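(* Let $H$ be a Hopf algebra over a field $\mathbb{K}$ of characteristic $0$, let $M$ be an $H$-Hopf bimodule, and let $(f,g)$ be a pair of multi-brace type on the cotensor coalgebra $T_H^c(M)$. Let $V=M^{coR}$ be the space of right coinvariants of $M$ with its Yetter-Drinfel'd braiding $\sigma$, and let $\mathbf{M}=\bigoplus_{p,q\ge0}\mathbf{M}_{pq}$, where $\mathbf{M}_{pq}:V^{\otimes p}\otimes V^{\otimes q}\to V$ is the restriction of $f_{pq}$. Then the triple $(V,\mathbf{M},\sigma)$ is a quantum multi-brace algebra.
   Context: Cotensor coalgebra: $T_H^c(M)=\bigoplus_{n\ge0}M^{\Box n}$, $M^{\Box0}=H$, $M^{\Box1}=M$, $M^{\Box n}$ the $n$-fold cotensor product over $H$ (the cotensor product $X\Box_HY$ is the equalizer of $\delta_R\otimes\mathrm{id}$ and $\mathrm{id}\otimes\delta_L$ on $X\otimes Y$), with deconcatenation coproduct (components with an index $0$ are given by the coactions, and by the coproduct of $H$ in degree $0$). $M^{\Box n}\subset M^{\otimes n}$ has the $H$-bimodule structure of the tensor product (via the iterated coproduct of $H$) and the $H$-bicomodule structure given by the two external factors. On $D=T_H^c(M)\otimes T_H^c(M)$ the $H$-bimodule structure comes from the two external factors and the bicomodule structure from the tensor product (coact on both factors and multiply in $H$). $\Delta^{(n)}$ is the iterated coproduct of the tensor product coalgebra $D$ with $n$ factors as target ($\Delta^{(1)}=\mathrm{id}$). Pair of multi-brace type: linear maps $f:D\to M$, $g:D\to H$ with restrictions $f_{pq},g_{pq}$ to $M^{\Box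 p}\otimes M^{\Box q}$ such that (1) $g_{00}=m_H$ (multiplication of $H$) and $g_{pq}=0$ for $(p,q)\ne(0,0)$; (2) $f_{01}=a_L$, $f_{10}=a_R$ (left and right module structure maps of $M$) and $f_{0n}=f_{n0}=0$ for $n\ne1$; (3) $(f,g)$ has property (MB): $g$ is a coalgebra morphism; $f$ is an $H$-Hopf bimodule morphism with $f_{00}=0$; and for all $i,j,k\ge0$, on $M^{\Box i}\otimes M^{\Box j}\otimes M^{\Box k}$, $$g_{0k}(g_{ij}\otimes\mathrm{id})+\sum_{n=1}^{i+j}g_{nk}(f^{\otimes n}\Delta^{(n)}\otimes\mathrm{id})=g_{i0}(\mathrm{id}\otimes g_{jk})+\sum_{m=1}^{j+k}g_{im}(\mathrm{id}\otimes f^{\otimes m}\Delta^{(m)}),$$ $$f_{0k}(g_{ij}\otimes\mathrm{id})+\sum_{n=1}^{i+j}f_{nk}(f^{\otimes n}\Delta^{(n)}\otimes\mathrm{id})=f_{i0}(\mathrm{id}\otimes g_{jk})+\sum_{m=1}^{j+k}f_{im}(\mathrm{id}\otimes f^{\otimes m}\Delta^{(m)}).$$ Coinvariants: $V=M^{coR}=\{m\in M:\delta_R(m)=m\otimes1\}$ is a left Yetter-Drinfel'd module over $H$ with adjoint action $h.v=\sum h_{(1)}vS(h_{(2)})$ and the induced left coaction $v\mapsto\sum v_{(-1)}\otimes v_{(0)}$; its braiding is $\sigma(v\otimes w)=\sum v_{(-1)}.w\otimes v_{(0)}$. The space $(M^{\Box p})^{coR}$ of right coinvariants is identified with $V^{\otimes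 p}$ (explicitly via $P^{\otimes p}$, where $P:M\to V$, $P(m)=\sum m_{(0)}S(m_{(1)})$; for $p=2$ the inverse is $v\otimes w\mapsto\sum v\,w_{(-1)}\otimes w_{(0)}$); for $p=0$ it is $\mathbb{K}1\subset H$. Since $f_{pq}$ is a right comodule map, its restriction to $V^{\otimes p}\otimes V^{\otimes q}\subset M^{\Box p}\otimes M^{\Box q}$ has image in $V$; this restriction is $\mathbf{M}_{pq}$. Quantum multi-brace algebra: a braided vector space $(V,\sigma)$ with linear maps $\mathbf{M}_{pq}:V^{\otimes p}\otimes V^{\otimes q}\to V$, $p,q\ge0$, such that (1) $\mathbf{M}_{00}=0$, $\mathbf{M}_{10}=\mathrm{id}_V=\mathbf{M}_{01}$, $\mathbf{M}_{n0}=0=\mathbf{M}_{0n}$ for $n\ge2$; (2) for all $i,j,k\ge1$, $\beta_{1k}(\mathbf{M}_{ij}\otimes\mathrm{id}_V^{\otimes k})=(\mathrm{id}_V^{\otimes k}\otimes\mathbf{M}_{ij})\beta_{i+j,k}$ and $\beta_{i1}(\mathrm{id}_V^{\otimes i}\otimes\mathbf{M}_{jk})=(\mathbf{M}_{jk}\otimes\mathrm{id}_V^{\otimes i})\beta_{i,j+k}$; (3) for all $i,j,k\ge1$, on $V^{\otimes i}\otimes V^{\otimes j}\otimes V^{\otimes k}$, $$\sum_{r=1}^{i+j}\mathbf{M}_{rk}\circ\big((\mathbf{M}^{\otimes r}\circ\Delta_\beta^{(r-1)})\otimes\mathrm{id}_V^{\otimes k}\big)=\sum_{l=1}^{j+k}\mathbf{M}_{il}\circ\big(\mathrm{id}_V^{\otimes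 i}\otimes(\mathbf{M}^{\otimes l}\circ\Delta_\beta^{(l-1)})\big).$$ Here $\beta_{ij}:V^{\otimes i}\otimes V^{\otimes j}\to V^{\otimes j}\otimes V^{\otimes i}$ is the braiding built from $\sigma$ by moving the first $i$ factors past the last $j$ factors, keeping orders (the Matsumoto-Tits lift of that permutation acting through $\sigma$; $\beta_{0j},\beta_{i0}$ are identities), and $\Delta_\beta=(\mathrm{id}\otimes\beta\otimes\mathrm{id})(\delta\otimes\delta)$ is the twisted coproduct on $T(V)\otimes T(V)$, with $\delta$ the deconcatenation coproduct of $T(V)$ and $\beta=\bigoplus\beta_{ij}$. $\Delta_\beta^{(r-1)}:T(V)\otimes T(V)\to(T(V)\otimes T(V))^{\otimes r}$ is its $(r-1)$-fold iterate. *)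

theory Defs
  imports Complex_Main "HOL-Library.Function_Algebras" "HOL-Library.Product_Plus"
begin

section \<open>Tensors over a vector space\<close>

text \<open>
  A vector space is a type with a scalar multiplication \<open>s\<close> (locale \<^locale>\<open>vector_space\<close>).
  All tensor powers of it live in one type: the pure tensor \<open>e1 \<otimes> ... \<otimes> en\<close> is the functional that
  evaluates a scalar function \<open>\<phi>\<close> on lists at \<open>[e1, ..., en]\<close> if \<open>\<phi>\<close> is linear in
  each entry (and is \<open>0\<close> on all other \<open>\<phi>\<close>). Over a field, multilinear forms separate tensors, so
  the span of the pure tensors is the tensor algebra, and equality of tensors is equality in HOL.
  Its product is concatenation; for subspaces \<open>X\<close>, \<open>Y\<close> that are homogeneous (in the number of
  entries), the span of the products is a copy of the abstract tensor product of \<open>X\<close> and \<open>Y\<close>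
  (see \<open>tensor_map_sum\<close> below). So tensor products are strictly associative here.
\<close>

type_synonym ('k, 'e) tensor = "('e list \<Rightarrow> 'k) \<Rightarrow> 'k"

definition multilinear :: "('k::field \<Rightarrow> 'e::ab_group_add \<Rightarrow> 'e) \<Rightarrow> ('e list \<Rightarrow> 'k) \<Rightarrow> bool" where
  "multilinear s \<phi> \<longleftrightarrow>
     (\<forall>u v a b. \<phi> (u @ (a + b) # v) = \<phi> (u @ a # v) + \<phi> (u @ b # v)) \<and>
     (\<forall>u v a c. \<phi> (u @ s c a # v) = c * \<phi> (u @ a # v))"

definition pure :: "('k::field \<Rightarrow> 'e::ab_group_add \<Rightarrow> 'e) \<Rightarrow> 'e list \<Rightarrow> ('k, 'e) tensor" where
  "pure s w = (\<lambda>\<phi>. if multilinear s \<phi> then \<phi> w else 0)"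

definition tscale :: "'k::field \<Rightarrow> ('k, 'e) tensor \<Rightarrow> ('k, 'e) tensor" where
  "tscale c t = (\<lambda>\<phi>. c * t \<phi>)"

global_interpretation tens: vector_space "tscale :: 'k::field \<Rightarrow> ('k, 'e) tensor \<Rightarrow> ('k, 'e) tensor"
  by unfold_locales (auto simp: tscale_def fun_eq_iff algebra_simps)

definition tmult :: "('k::field \<Rightarrow> 'e::ab_group_add \<Rightarrow> 'e)
    \<Rightarrow> ('k, 'e) tensor \<Rightarrow> ('k, 'e) tensor \<Rightarrow> ('k, 'e) tensor" where
  "tmult s x y = (\<lambda>\<phi>. if multilinear s \<phi> then x (\<lambda>u. y (\<lambda>v. \<phi> (u @ v))) else 0)"

text \<open>\<open>tpow s V n\<close> is the \<open>n\<close>-th tensor power of the subspace \<open>V\<close>,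
  \<open>tprod s X Y\<close> is the tensor product of \<open>X\<close> and \<open>Y\<close>.\<close>

definition tpow :: "('k::field \<Rightarrow> 'e::ab_group_add \<Rightarrow> 'e) \<Rightarrow> 'e set \<Rightarrow> nat \<Rightarrow> ('k, 'e) tensor set" where
  "tpow s V n = tens.span {pure s w |w. length w = n \<and> set w \<subseteq> V}"

definition tprod :: "('k::field \<Rightarrow> 'e::ab_group_add \<Rightarrow> 'e)
    \<Rightarrow> ('k, 'e) tensor set \<Rightarrow> ('k, 'e) tensor set \<Rightarrow> ('k, 'e) tensor set" where
  "tprod s X Y = tens.span {tmult s x y |x y. x \<in> X \<and> y \<in> Y}"

text \<open>\<open>tbind t F\<close> is the value at \<open>t\<close> of the linear map with \<open>pure w \<mapsto> F w\<close>, where \<open>F\<close> is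
  tensor-valued and linear in each entry of the list \<open>w\<close>. A map that is only meant for lists of one length
  (or shape) is extended by \<open>0\<close>. \<open>tlift\<close> is the same for vector-valued \<open>F\<close>.\<close>

definition tbind :: "('k, 'e) tensor \<Rightarrow> ('e list \<Rightarrow> ('k, 'd) tensor) \<Rightarrow> ('k, 'd) tensor" where
  "tbind t F = (\<lambda>\<psi>. t (\<lambda>w. F w \<psi>))"

definition tlift :: "('k::field \<Rightarrow> 'd::ab_group_add \<Rightarrow> 'd)
    \<Rightarrow> ('e list \<Rightarrow> 'd) \<Rightarrow> ('k, 'e) tensor \<Rightarrow> 'd" where
  "tlift s F t = (THE x. pure s [x] = tbind t (\<lambda>w. pure s [F w]))"

definition linear_on :: "('k::field \<Rightarrow> 'a::ab_group_add \<Rightarrow> 'a) \<Rightarrow> ('k \<Rightarrow> 'b::ab_group_add \<Rightarrow> 'b)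
    \<Rightarrow> 'a set \<Rightarrow> ('a \<Rightarrow> 'b) \<Rightarrow> bool" where
  "linear_on s1 s2 X F \<longleftrightarrow>
     (\<forall>x\<in>X. \<forall>y\<in>X. F (x + y) = F x + F y) \<and> (\<forall>c. \<forall>x\<in>X. F (s1 c x) = s2 c (F x))"

text \<open>The tensor product of linear maps \<open>F\<close> on \<open>X\<close> and \<open>G\<close> on \<open>Y\<close>; \<open>s\<close> and \<open>s'\<close> are the scalar
  multiplications on the source and on the target side.\<close>

definition tensor_map :: "('k::field \<Rightarrow> 'e::ab_group_add \<Rightarrow> 'e) \<Rightarrow> ('k \<Rightarrow> 'd::ab_group_add \<Rightarrow> 'd)
    \<Rightarrow> ('k, 'e) tensor set \<Rightarrow> (('k, 'e) tensor \<Rightarrow> ('k, 'd) tensor)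
    \<Rightarrow> ('k, 'e) tensor set \<Rightarrow> (('k, 'e) tensor \<Rightarrow> ('k, 'd) tensor)
    \<Rightarrow> ('k, 'e) tensor \<Rightarrow> ('k, 'd) tensor" where
  "tensor_map s s' X F Y G t = (THE r. \<exists>ps. set ps \<subseteq> X \<times> Y \<and>
      t = (\<Sum>(x, y)\<leftarrow>ps. tmult s x y) \<and> r = (\<Sum>(x, y)\<leftarrow>ps. tmult s' (F x) (G y)))"

text \<open>\<open>apply_at s i F\<close> is \<open>id \<otimes> F \<otimes> id\<close> with \<open>F\<close> acting on the entry with index \<open>i\<close> (counted from
  \<open>0\<close>); \<open>flip_blocks s a b c\<close> exchanges the second and the third of four blocks of \<open>a\<close>, \<open>b\<close>, \<open>c\<close> and
  arbitrarily many entries.\<close>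

definition apply_at :: "('k::field \<Rightarrow> 'e::ab_group_add \<Rightarrow> 'e)
    \<Rightarrow> nat \<Rightarrow> ('e \<Rightarrow> ('k, 'e) tensor) \<Rightarrow> ('k, 'e) tensor \<Rightarrow> ('k, 'e) tensor" where
  "apply_at s i F t = tbind t (\<lambda>w. if i < length w
      then tmult s (pure s (take i w)) (tmult s (F (w ! i)) (pure s (drop (Suc i) w))) else 0)"

definition flip_blocks :: "('k::field \<Rightarrow> 'e::ab_group_add \<Rightarrow> 'e)
    \<Rightarrow> nat \<Rightarrow> nat \<Rightarrow> nat \<Rightarrow> ('k, 'e) tensor \<Rightarrow> ('k, 'e) tensor" where
  "flip_blocks s a b c t = tbind t (\<lambda>w. if a + b + c \<le> length w
      then pure s (take a w @ take c (drop (a + b) w) @ take b (drop a w) @ drop (a + b + c) w)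
      else 0)"


subsection \<open>The tensor product of linear maps is well defined\<close>

lemma multilinear_zero: "multilinear s (\<lambda>_. 0)"
  by (simp add: multilinear_def)

lemma multilinear_append_left: "multilinear s \<phi> \<Longrightarrow> multilinear s (\<lambda>v. \<phi> (u @ v))"
  unfolding multilinear_def by (metis append_assoc)

lemma multilinear_append_right: "multilinear s \<phi> \<Longrightarrow> multilinear s (\<lambda>u. \<phi> (u @ v))"
  unfolding multilinear_def by simp

lemma multilinear_length:
  "multilinear s \<phi> \<Longrightarrow> multilinear s (\<lambda>w. if length w = n then \<phi> w else 0)"
  unfolding multilinear_def by auto

lemma multilinear_cmult: "multilinear s \<phi> \<Longrightarrow> multilinear s (\<lambda>w. c * \<phi> w)"
  unfolding multilinear_def by (auto simp: algebra_simps)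

lemma multilinear_mult:
  assumes "multilinear s \<phi>" "multilinear s \<chi>"
  shows "multilinear s (\<lambda>w. \<phi> (take n w) * \<chi> (drop n w))"
proof -
  have "take n (u @ a # v) = (if length u < n then u @ a # take (n - Suc (length u)) v else take n u)"
    "drop n (u @ a # v) = (if length u < n then drop (n - Suc (length u)) v else drop n u @ a # v)"
    for u v and a :: 'b
    by (auto simp: take_Cons' drop_Cons')
  then show ?thesis
    using assms unfolding multilinear_def by (auto simp: algebra_simps)
qed

lemma tmult_pure: "tmult s (pure s u) (pure s v) = pure s (u @ v)"
proof
  fix \<phi>
  show "tmult s (pure s u) (pure s v) \<phi> = pure s (u @ v) \<phi>"
    by (simp add: tmult_def pure_def multilinear_append_left multilinear_append_right)
qed

lemma tbind_pure:
  assumes "\<And>\<psi>. multilinear s (\<lambda>w. F w \<psi>)"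
  shows "tbind (pure s w) F = F w"
  using assms by (simp add: tbind_def pure_def fun_eq_iff)

text \<open>Necessary conditions for elements of the tensor algebra, and for those of degree \<open>n\<close>.\<close>

definition tensor_like :: "('k::field \<Rightarrow> 'e::ab_group_add \<Rightarrow> 'e) \<Rightarrow> ('k, 'e) tensor \<Rightarrow> bool" where
  "tensor_like s t \<longleftrightarrow>
     (\<forall>\<phi>. \<not> multilinear s \<phi> \<longrightarrow> t \<phi> = 0) \<and>
     (\<forall>\<phi> \<chi>. multilinear s \<phi> \<longrightarrow> multilinear s \<chi> \<longrightarrow> t (\<lambda>w. \<phi> w + \<chi> w) = t \<phi> + t \<chi>) \<and>
     (\<forall>\<phi> c. multilinear s \<phi> \<longrightarrow> t (\<lambda>w. c * \<phi> w) = c * t \<phi>)"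

definition homog :: "('k::field \<Rightarrow> 'e::ab_group_add \<Rightarrow> 'e) \<Rightarrow> nat \<Rightarrow> ('k, 'e) tensor \<Rightarrow> bool" where
  "homog s n t \<longleftrightarrow> tensor_like s t \<and>
     (\<forall>\<phi>. multilinear s \<phi> \<longrightarrow> t (\<lambda>w. if length w = n then \<phi> w else 0) = t \<phi>)"

lemma multilinear_add: "multilinear s \<phi> \<Longrightarrow> multilinear s \<chi> \<Longrightarrow> multilinear s (\<lambda>w. \<phi> w + \<chi> w)"
  unfolding multilinear_def by (auto simp: algebra_simps)

lemma homog_subspace: "tens.subspace {t. homog s n t}"
  unfolding tens.subspace_def homog_def tensor_like_def by (auto simp: tscale_def algebra_simps)

lemma homog_pure: "homog s (length w) (pure s w)"
  unfolding homog_def tensor_like_def pure_def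
  by (simp add: multilinear_length multilinear_cmult multilinear_add)

lemma tpow_homog: "tpow s V n \<subseteq> {t. homog s n t}"
  unfolding tpow_def
  by (rule tens.span_minimal) (use homog_pure homog_subspace in blast)+

lemma tmult_add_left: "tmult s (x + y) z = tmult s x z + tmult s y z"
  by (auto simp: tmult_def fun_eq_iff)

lemma tmult_tscale_left: "tmult s (tscale c x) z = tscale c (tmult s x z)"
  by (auto simp: tmult_def tscale_def fun_eq_iff)

lemma multilinear_slice:
  assumes "multilinear s \<phi>" "tensor_like s y"
  shows "multilinear s (\<lambda>u. y (\<lambda>v. \<phi> (u @ v)))"
  unfolding multilinear_def
proof (intro conjI allI)
  have ap: "multilinear s (\<lambda>v. \<phi> (u @ v))" for u
    by (rule multilinear_append_left[OF assms(1)])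
  fix u v a b c
  have "(\<lambda>w. \<phi> ((u @ (a + b) # v) @ w)) = (\<lambda>w. \<phi> ((u @ a # v) @ w) + \<phi> ((u @ b # v) @ w))"
    using assms(1) by (auto simp: multilinear_def)
  then show "y (\<lambda>w. \<phi> ((u @ (a + b) # v) @ w))
      = y (\<lambda>w. \<phi> ((u @ a # v) @ w)) + y (\<lambda>w. \<phi> ((u @ b # v) @ w))"
    using assms(2) ap unfolding tensor_like_def by metis
  have "(\<lambda>w. \<phi> ((u @ s c a # v) @ w)) = (\<lambda>w. c * \<phi> ((u @ a # v) @ w))"
    using assms(1) by (auto simp: multilinear_def)
  then show "y (\<lambda>w. \<phi> ((u @ s c a # v) @ w)) = c * y (\<lambda>w. \<phi> ((u @ a # v) @ w))"
    using assms(2) ap unfolding tensor_like_def by metis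
qed

lemma tmult_add_right:
  assumes "tensor_like s x" "tensor_like s y" "tensor_like s z"
  shows "tmult s x (y + z) = tmult s x y + tmult s x z"
proof
  fix \<phi>
  show "tmult s x (y + z) \<phi> = (tmult s x y + tmult s x z) \<phi>"
    using assms multilinear_slice[of s \<phi>]
    by (auto simp: tmult_def tensor_like_def[of s x])
qed

lemma tmult_tscale_right:
  assumes "tensor_like s x" "tensor_like s y"
  shows "tmult s x (tscale c y) = tscale c (tmult s x y)"
proof
  fix \<phi>
  show "tmult s x (tscale c y) \<phi> = tscale c (tmult s x y) \<phi>"
    using assms multilinear_slice[of s \<phi>]
    by (auto simp: tmult_def tscale_def tensor_like_def[of s x])
qed

lemma tensor_like_subspace: "tens.subspace {t. tensor_like s t}"
  unfolding tens.subspace_def tensor_like_def by (auto simp: tscale_def algebra_simps)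

lemma sum_fun_apply: "(\<Sum>i\<in>I. f i) a = (\<Sum>i\<in>I. f i a)"
  for f :: "'i \<Rightarrow> 'a \<Rightarrow> 'b::comm_monoid_add"
  by (induction I rule: infinite_finite_induct) simp_all

lemma tensor_like_tscale: "tensor_like s t \<Longrightarrow> tensor_like s (tscale c t)"
  using tens.subspace_scale[OF tensor_like_subspace, of t s c] by simp

lemma tmult_sum_left: "tmult s (\<Sum>i\<in>I. x i) z = (\<Sum>i\<in>I. tmult s (x i) z)"
proof (induction I rule: infinite_finite_induct)
  case (insert i I)
  then show ?case by (subst (1 2) sum.insert) (auto simp only: tmult_add_left)
qed (auto simp: tmult_def fun_eq_iff)

lemma tmult_zero_right: "tensor_like s x \<Longrightarrow> tmult s x 0 = 0"
proof -
  assume x: "tensor_like s x"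
  have "x (\<lambda>w. 0 * 0) = 0 * x (\<lambda>_. 0)"
    using x multilinear_zero[of s] unfolding tensor_like_def by blast
  then show ?thesis by (auto simp: tmult_def fun_eq_iff)
qed

lemma tmult_sum_right:
  assumes "tensor_like s x" "\<And>i. i \<in> I \<Longrightarrow> tensor_like s (z i)"
  shows "tmult s x (\<Sum>i\<in>I. z i) = (\<Sum>i\<in>I. tmult s x (z i))"
  using assms(2)
proof (induction I rule: infinite_finite_induct)
  case (insert i I)
  have "tensor_like s (\<Sum>i\<in>I. z i)"
    using insert.prems tens.subspace_sum[OF tensor_like_subspace, of I z s] by auto
  then show ?case
    using insert assms(1)
    by (subst (1 2) sum.insert) (auto simp only: tmult_add_right insertI1 insertI2)
qed (auto simp: tmult_zero_right assms(1))

lemma linear_on_zero: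
  assumes "linear_on tscale tscale X F" "tens.subspace X"
  shows "F 0 = 0"
proof -
  have "F (tscale 0 0) = tscale 0 (F 0)"
    using assms tens.subspace_0 unfolding linear_on_def by blast
  then show ?thesis by simp
qed

lemma linear_on_sum:
  assumes "linear_on tscale tscale X F" "tens.subspace X" "\<And>i. i \<in> I \<Longrightarrow> x i \<in> X"
  shows "F (\<Sum>i\<in>I. tscale (c i) (x i)) = (\<Sum>i\<in>I. tscale (c i) (F (x i)))"
  using assms(3)
proof (induction I rule: infinite_finite_induct)
  case (insert i I)
  have "(\<Sum>i\<in>I. tscale (c i) (x i)) \<in> X" "tscale (c i) (x i) \<in> X"
    using insert.prems assms(2) by (auto intro!: tens.subspace_sum tens.subspace_scale)
  then show ?case
    using insert assms(1) unfolding linear_on_def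
    by (subst (1 2) sum.insert) (auto simp only: insertI1 insertI2)
qed (use linear_on_zero[OF assms(1,2)] in auto)

lemma tmult_independent:
  fixes s :: "'k::field \<Rightarrow> 'e::ab_group_add \<Rightarrow> 'e"
  assumes "finite B" "\<not> tens.dependent B" "B \<subseteq> {t. homog s m t}"
    and z: "\<And>b. b \<in> B \<Longrightarrow> homog s n (z b)" and 0: "(\<Sum>b\<in>B. tmult s (z b) b) = 0"
  shows "\<forall>b\<in>B. z b = 0"
proof -
  have key: "z b \<phi> = 0" if \<phi>: "multilinear s \<phi>" and b: "b \<in> B" for \<phi> b
  proof -
    have "(\<Sum>b\<in>B. tscale (z b \<phi>) b) = 0"
    proof
      fix \<chi> :: "'e list \<Rightarrow> 'k"
      show "(\<Sum>b\<in>B. tscale (z b \<phi>) b) \<chi> = 0 \<chi>"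
      proof (cases "multilinear s \<chi>")
        case False
        then show ?thesis
          using assms(3) by (auto simp: sum_fun_apply tscale_def homog_def tensor_like_def intro!: sum.neutral)
      next
        case True
        define \<psi> where "\<psi> w = (if length w = n + m then \<phi> (take n w) * \<chi> (drop n w) else 0)" for w
        have \<psi>: "multilinear s \<psi>"
          unfolding \<psi>_def by (intro multilinear_length multilinear_mult \<phi> True)
        have "tmult s (z b) b \<psi> = z b \<phi> * b \<chi>" if b: "b \<in> B" for b
        proof -
          have zb: "homog s n (z b)" and hb: "homog s m b" using that z assms(3) by auto
          have "tmult s (z b) b \<psi> = z b (\<lambda>u. b (\<lambda>v. \<psi> (u @ v)))"
            by (simp add: tmult_def \<psi>)
          also have "\<dots> = z b (\<lambda>u. if length u = n then b (\<lambda>v. \<psi> (u @ v)) else 0)"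
            using zb multilinear_slice[OF \<psi>, of b] hb by (simp add: homog_def)
          also have "(\<lambda>u. if length u = n then b (\<lambda>v. \<psi> (u @ v)) else 0)
              = (\<lambda>u. if length u = n then b \<chi> * \<phi> u else 0)"
          proof
            fix u
            have "b (\<lambda>v. \<psi> (u @ v)) = b \<chi> * \<phi> u" if u: "length u = n"
            proof -
              have "(\<lambda>v. \<psi> (u @ v)) = (\<lambda>v. \<phi> u * (if length v = m then \<chi> v else 0))"
                by (auto simp: \<psi>_def u)
              then have "b (\<lambda>v. \<psi> (u @ v)) = \<phi> u * b (\<lambda>v. if length v = m then \<chi> v else 0)"
                using hb multilinear_length[OF True, of m] by (simp add: homog_def tensor_like_def)
              then show ?thesis using hb True by (simp add: homog_def)
            qed
            then show "(if length u = n then b (\<lambda>v. \<psi> (u @ v)) else 0)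
              = (if length u = n then b \<chi> * \<phi> u else 0)" by simp
          qed
          also have "z b \<dots> = z b (\<lambda>u. b \<chi> * \<phi> u)"
            using zb multilinear_cmult[OF \<phi>] by (simp add: homog_def)
          also have "\<dots> = b \<chi> * z b \<phi>"
            using zb \<phi> by (simp add: homog_def tensor_like_def)
          finally show ?thesis by simp
        qed
        then have "(\<Sum>b\<in>B. z b \<phi> * b \<chi>) = (\<Sum>b\<in>B. tmult s (z b) b) \<psi>"
          by (simp add: sum_fun_apply)
        then show ?thesis using 0 by (simp add: sum_fun_apply tscale_def)
      qed
    qed
    then show ?thesis
      using tens.independentD[OF assms(2,1) subset_refl, of "\<lambda>b. z b \<phi>" b] b by simp
  qed
  show ?thesis
  proof
    fix b assume b: "b \<in> B"
    show "z b = 0"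
      using key[OF _ b] z[OF b] by (force simp: homog_def tensor_like_def fun_eq_iff)
  qed
qed

lemma tensor_map_zero:
  fixes s :: "'k::field \<Rightarrow> 'e::ab_group_add \<Rightarrow> 'e" and s' :: "'k \<Rightarrow> 'd::ab_group_add \<Rightarrow> 'd"
  assumes X: "tens.subspace X" "X \<subseteq> {t. homog s n t}" and Y: "tens.subspace Y" "Y \<subseteq> {t. homog s m t}"
    and F: "linear_on tscale tscale X F" "\<And>x. x \<in> X \<Longrightarrow> tensor_like s' (F x)"
    and G: "linear_on tscale tscale Y G" "\<And>y. y \<in> Y \<Longrightarrow> tensor_like s' (G y)"
    and I: "finite I" "\<And>i. i \<in> I \<Longrightarrow> x i \<in> X" "\<And>i. i \<in> I \<Longrightarrow> y i \<in> Y"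
    and 0: "(\<Sum>i\<in>I. tmult s (x i) (y i)) = 0"
  shows "(\<Sum>i\<in>I. tmult s' (F (x i)) (G (y i))) = 0"
proof -
  obtain B where B: "B \<subseteq> Y" "\<not> tens.dependent B" "Y \<subseteq> tens.span B"
    using tens.basis_exists[of Y] by metis
  define r where "r i b = tens.representation B (y i) b" for i b
  define S where "S = (\<Union>i\<in>I. {b. r i b \<noteq> 0})"
  have S: "finite S" "S \<subseteq> B"
    using I(1) tens.finite_representation tens.representation_ne_zero unfolding S_def r_def by auto
  have y: "y i = (\<Sum>b\<in>S. tscale (r i b) b)" if "i \<in> I" for i
  proof -
    have "(\<Sum>b\<in>S. tscale (r i b) b) = (\<Sum>b | r i b \<noteq> 0. tscale (r i b) b)"
      by (rule sum.mono_neutral_right) (use S that in \<open>auto simp: S_def\<close>)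
    also have "\<dots> = y i"
      unfolding r_def by (rule tens.sum_nonzero_representation_eq) (use B I(3) that in auto)
    finally show ?thesis by simp
  qed
  define z where "z b = (\<Sum>i\<in>I. tscale (r i b) (x i))" for b
  have XT: "tensor_like s t" if "t \<in> X" for t using X(2) that by (auto simp: homog_def)
  have YT: "tensor_like s t" if "t \<in> Y" for t using Y(2) that by (auto simp: homog_def)
  have SY: "b \<in> Y" if "b \<in> S" for b using S B that by auto
  have zX: "z b \<in> X" for b
    unfolding z_def using X(1) I(2) by (auto intro!: tens.subspace_sum tens.subspace_scale)
  have "tmult s (x i) (y i) = (\<Sum>b\<in>S. tmult s (tscale (r i b) (x i)) b)" if i: "i \<in> I" for i
  proof -
    have "tmult s (x i) (y i) = (\<Sum>b\<in>S. tmult s (x i) (tscale (r i b) b))"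
      unfolding y[OF i] by (rule tmult_sum_right) (use I(2) i XT SY YT in \<open>auto intro!: tensor_like_tscale\<close>)
    then show ?thesis
      using I(2) i XT SY YT by (simp add: tmult_tscale_right tmult_tscale_left)
  qed
  then have "(\<Sum>i\<in>I. tmult s (x i) (y i)) = (\<Sum>i\<in>I. \<Sum>b\<in>S. tmult s (tscale (r i b) (x i)) b)"
    by (rule sum.cong[OF refl])
  also have "\<dots> = (\<Sum>b\<in>S. tmult s (z b) b)"
    unfolding z_def tmult_sum_left by (rule sum.swap)
  finally have "(\<Sum>b\<in>S. tmult s (z b) b) = 0" using 0 by simp
  then have z0: "z b = 0" if "b \<in> S" for b
    using tmult_independent[of S s m n z] S B(2) tens.dependent_mono[of S B] SY Y(2) zX X(2) that by blast
  have "tmult s' (F (x i)) (G (y i)) = (\<Sum>b\<in>S. tmult s' (tscale (r i b) (F (x i))) (G b))"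
    if i: "i \<in> I" for i
  proof -
    have Gy: "G (y i) = (\<Sum>b\<in>S. tscale (r i b) (G b))"
      unfolding y[OF i] by (rule linear_on_sum[OF G(1) Y(1)]) (rule SY)
    have "tmult s' (F (x i)) (G (y i)) = (\<Sum>b\<in>S. tmult s' (F (x i)) (tscale (r i b) (G b)))"
      unfolding Gy by (rule tmult_sum_right) (use I(2) i F(2) SY G(2) in \<open>auto intro!: tensor_like_tscale\<close>)
    then show ?thesis
      using I(2) i F(2) SY G(2) by (simp add: tmult_tscale_right tmult_tscale_left)
  qed
  then have "(\<Sum>i\<in>I. tmult s' (F (x i)) (G (y i)))
      = (\<Sum>i\<in>I. \<Sum>b\<in>S. tmult s' (tscale (r i b) (F (x i))) (G b))"
    by (rule sum.cong[OF refl])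
  also have "\<dots> = (\<Sum>b\<in>S. tmult s' (\<Sum>i\<in>I. tscale (r i b) (F (x i))) (G b))"
    unfolding tmult_sum_left by (rule sum.swap)
  also have "\<dots> = (\<Sum>b\<in>S. tmult s' (F (z b)) (G b))"
    unfolding z_def by (intro sum.cong refl) (simp add: linear_on_sum[OF F(1) X(1)] I(2))
  also have "\<dots> = 0"
    by (rule sum.neutral) (auto simp: z0 linear_on_zero[OF F(1) X(1)] tmult_def)
  finally show ?thesis .
qed

theorem tensor_map_sum:
  fixes s :: "'k::field \<Rightarrow> 'e::ab_group_add \<Rightarrow> 'e" and s' :: "'k \<Rightarrow> 'd::ab_group_add \<Rightarrow> 'd"
  assumes X: "tens.subspace X" "X \<subseteq> {t. homog s n t}" and Y: "tens.subspace Y" "Y \<subseteq> {t. homog s m t}"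
    and F: "linear_on tscale tscale X F" "\<And>x. x \<in> X \<Longrightarrow> tensor_like s' (F x)"
    and G: "linear_on tscale tscale Y G" "\<And>y. y \<in> Y \<Longrightarrow> tensor_like s' (G y)"
    and ps: "set ps \<subseteq> X \<times> Y"
  shows "tensor_map s s' X F Y G (\<Sum>(x, y)\<leftarrow>ps. tmult s x y) = (\<Sum>(x, y)\<leftarrow>ps. tmult s' (F x) (G y))"
  unfolding tensor_map_def
proof (rule the_equality)
  show "\<exists>qs. set qs \<subseteq> X \<times> Y \<and> (\<Sum>(x, y)\<leftarrow>ps. tmult s x y) = (\<Sum>(x, y)\<leftarrow>qs. tmult s x y) \<and>
      (\<Sum>(x, y)\<leftarrow>ps. tmult s' (F x) (G y)) = (\<Sum>(x, y)\<leftarrow>qs. tmult s' (F x) (G y))"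
    using ps by blast
next
  fix r
  assume "\<exists>qs. set qs \<subseteq> X \<times> Y \<and> (\<Sum>(x, y)\<leftarrow>ps. tmult s x y) = (\<Sum>(x, y)\<leftarrow>qs. tmult s x y) \<and>
      r = (\<Sum>(x, y)\<leftarrow>qs. tmult s' (F x) (G y))"
  then obtain qs where qs: "set qs \<subseteq> X \<times> Y"
    "(\<Sum>(x, y)\<leftarrow>ps. tmult s x y) = (\<Sum>(x, y)\<leftarrow>qs. tmult s x y)"
    "r = (\<Sum>(x, y)\<leftarrow>qs. tmult s' (F x) (G y))" by blast
  define l where "l = length ps"
  define ws where "ws = ps @ map (\<lambda>(x, y). (tscale (- 1) x, y)) qs"
  have ws: "set ws \<subseteq> X \<times> Y"
    using ps qs(1) X(1) by (auto simp: ws_def tens.subspace_neg)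
  have sl: "(\<Sum>(x, y)\<leftarrow>us. h x y) = (\<Sum>i<length us. h (fst (us ! i)) (snd (us ! i)))"
    for us :: "(('k, 'e) tensor \<times> ('k, 'e) tensor) list" and h :: "_ \<Rightarrow> _ \<Rightarrow> ('k, 'z) tensor"
    by (simp add: sum_list_sum_nth atLeast0LessThan case_prod_beta)
  have a: "(\<Sum>(x, y)\<leftarrow>ws. tmult s x y) = (\<Sum>(x, y)\<leftarrow>ps. tmult s x y) - (\<Sum>(x, y)\<leftarrow>qs. tmult s x y)"
    by (simp add: ws_def comp_def case_prod_beta tmult_tscale_left uminus_sum_list_map
        flip: diff_conv_add_uminus del: tens.scale_minus_left) (simp add: case_prod_beta comp_def uminus_sum_list_map)
  have lin: "F (tscale (- 1) x) = tscale (- 1) (F x)" if "x \<in> X" for x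
    using F(1) that by (simp add: linear_on_def del: tens.scale_minus_left)
  have "(\<Sum>(x, y)\<leftarrow>map (\<lambda>(x, y). (tscale (- 1) x, y)) qs. tmult s' (F x) (G y))
      = - (\<Sum>(x, y)\<leftarrow>qs. tmult s' (F x) (G y))"
    using qs(1) by (induction qs) (auto simp: lin tmult_tscale_left simp del: tens.scale_minus_left, simp)
  then have b: "(\<Sum>(x, y)\<leftarrow>ws. tmult s' (F x) (G y))
      = (\<Sum>(x, y)\<leftarrow>ps. tmult s' (F x) (G y)) - (\<Sum>(x, y)\<leftarrow>qs. tmult s' (F x) (G y))"
    by (simp add: ws_def)
  have m: "fst (ws ! i) \<in> X" "snd (ws ! i) \<in> Y" if "i < length ws" for i
    using subsetD[OF ws nth_mem[OF that]] by (simp_all add: mem_Times_iff)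
  have "(\<Sum>(x, y)\<leftarrow>ws. tmult s' (F x) (G y)) = 0"
    unfolding sl
    by (rule tensor_map_zero[OF X Y F G finite_lessThan]) (use m a qs(2) in \<open>auto simp: sl\<close>)
  then show "r = (\<Sum>(x, y)\<leftarrow>ps. tmult s' (F x) (G y))" using b qs(3) by simp
qed

lemma pure_single_inject:
  fixes s :: "'k::field \<Rightarrow> 'e::ab_group_add \<Rightarrow> 'e"
  assumes "vector_space s"
  shows "pure s [x] = pure s [y] \<longleftrightarrow> x = y"
proof
  interpret vector_space s by fact
  interpret vp: vector_space_pair s "(*) :: 'k \<Rightarrow> 'k \<Rightarrow> 'k"
    by unfold_locales (simp_all add: algebra_simps)
  assume eq: "pure s [x] = pure s [y]"
  show "x = y"
  proof (rule ccontr)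
    assume "x \<noteq> y"
    then have "independent {x - y}" by simp
    then obtain g where g: "Vector_Spaces.linear s (*) g" "g (x - y) = 1"
      using vp.linear_independent_extend[of "{x - y}" "\<lambda>_. 1"] by auto
    define \<phi> where "\<phi> w = (if length w = 1 then g (hd w) else 0)" for w
    interpret g: Vector_Spaces.linear s "(*)" g by fact
    have "multilinear s \<phi>"
      by (auto simp: multilinear_def \<phi>_def g.add g.scale)
    then have "\<phi> [x] = \<phi> [y]" using fun_cong[OF eq, of \<phi>] by (simp add: pure_def)
    then show False using g(2) by (simp add: \<phi>_def g.diff)
  qed
qed simp

lemma tlift_pure:
  assumes "vector_space s'" "\<And>\<psi>. multilinear s (\<lambda>w. pure s' [F w] \<psi>)"
  shows "tlift s' F (pure s w) = F w"
  using assms by (simp add: tlift_def tbind_pure pure_single_inject)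


section \<open>Convolution powers on bigraded coalgebras\<close>

text \<open>
  Here \<open>D p q\<close> is the component of bidegree \<open>(p, q)\<close> of a bigraded coalgebra whose coproduct has the
  components \<open>cop p q p' q' : D (p + p') (q + q') \<longrightarrow> D p q \<otimes> D p' q'\<close>. A linear map
  on the direct sum of the \<open>D p q\<close> is given by its family of restrictions. \<open>F p q\<close> is a map on \<open>D p q\<close> with
  values in the tensors of degree \<open>1\<close>.

  For \<open>ps = [(p1, q1), ..., (pn, qn)]\<close>, \<open>iter_coprod s D cop ps\<close> is the component of the iterated
  coproduct with \<open>n\<close> factors that has values in \<open>D p1 q1 \<otimes> ... \<otimes> D pn qn\<close>, and \<open>conv_power s D cop F n i j\<close> is
  \<open>F\<close> to the \<open>n\<close>-th tensor power after the iterated coproduct, on \<open>D i j\<close>.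
\<close>

type_synonym ('k, 'e) bigraded_space = "nat \<Rightarrow> nat \<Rightarrow> ('k, 'e) tensor set"
type_synonym ('k, 'e, 'b) bigraded_map = "nat \<Rightarrow> nat \<Rightarrow> ('k, 'e) tensor \<Rightarrow> 'b"
type_synonym ('k, 'e) bigraded_coprod =
  "nat \<Rightarrow> nat \<Rightarrow> nat \<Rightarrow> nat \<Rightarrow> ('k, 'e) tensor \<Rightarrow> ('k, 'e) tensor"

fun tensor_list :: "('k::field \<Rightarrow> 'e::ab_group_add \<Rightarrow> 'e) \<Rightarrow> ('k, 'e) bigraded_space
    \<Rightarrow> (nat \<times> nat) list \<Rightarrow> ('k, 'e) tensor set" where
  "tensor_list s D [] = tpow s UNIV 0"
| "tensor_list s D ((p, q) # ps) = tprod s (D p q) (tensor_list s D ps)"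

fun tensor_list_map :: "('k::field \<Rightarrow> 'e::ab_group_add \<Rightarrow> 'e) \<Rightarrow> ('k, 'e) bigraded_space
    \<Rightarrow> ('k, 'e, ('k, 'e) tensor) bigraded_map
    \<Rightarrow> (nat \<times> nat) list \<Rightarrow> ('k, 'e) tensor \<Rightarrow> ('k, 'e) tensor" where
  "tensor_list_map s D F [] = id"
| "tensor_list_map s D F ((p, q) # ps) =
     tensor_map s s (D p q) (F p q) (tensor_list s D ps) (tensor_list_map s D F ps)"

fun iter_coprod :: "('k::field \<Rightarrow> 'e::ab_group_add \<Rightarrow> 'e) \<Rightarrow> ('k, 'e) bigraded_space
    \<Rightarrow> ('k, 'e) bigraded_coprod \<Rightarrow> (nat \<times> nat) list \<Rightarrow> ('k, 'e) tensor \<Rightarrow> ('k, 'e) tensor" where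
  "iter_coprod s D cop [] = id"
| "iter_coprod s D cop [pq] = id"
| "iter_coprod s D cop ((p, q) # r # rs) =
     (let p' = sum_list (map fst (r # rs)); q' = sum_list (map snd (r # rs))
      in tensor_map s s (D p q) id (D p' q') (iter_coprod s D cop (r # rs)) \<circ> cop p q p' q')"

definition bidegree_splits :: "nat \<Rightarrow> nat \<Rightarrow> nat \<Rightarrow> (nat \<times> nat) list set" where
  "bidegree_splits n i j =
     {ps. length ps = n \<and> sum_list (map fst ps) = i \<and> sum_list (map snd ps) = j}"

lemma finite_bidegree_splits: "finite (bidegree_splits n i j)"
proof (rule finite_subset)
  show "bidegree_splits n i j \<subseteq> {ps. set ps \<subseteq> {..i} \<times> {..j} \<and> length ps = n}"
    unfolding bidegree_splits_def by (force intro: member_le_sum_list)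
qed (rule finite_lists_length_eq, simp)

definition conv_power :: "('k::field \<Rightarrow> 'e::ab_group_add \<Rightarrow> 'e) \<Rightarrow> ('k, 'e) bigraded_space
    \<Rightarrow> ('k, 'e) bigraded_coprod \<Rightarrow> ('k, 'e, ('k, 'e) tensor) bigraded_map
    \<Rightarrow> nat \<Rightarrow> nat \<Rightarrow> nat \<Rightarrow> ('k, 'e) tensor \<Rightarrow> ('k, 'e) tensor" where
  "conv_power s D cop F n i j t =
     (\<Sum>ps\<in>bidegree_splits n i j. tensor_list_map s D F ps (iter_coprod s D cop ps t))"


section \<open>Quantum multi-brace algebras\<close>

text \<open>\<open>V\<close> is a subspace of the ambient vector space with scalar multiplication \<open>s\<close>. Invertibility of
  the braiding is not part of the definition: the axioms of a quantum multi-brace algebra involve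
  positive braids only, and the braiding of a Yetter-Drinfel'd module need not be invertible if the
  antipode is not bijective.\<close>

definition braided_vector_space :: "('k::field \<Rightarrow> 'v::ab_group_add \<Rightarrow> 'v) \<Rightarrow> 'v set
    \<Rightarrow> (('k, 'v) tensor \<Rightarrow> ('k, 'v) tensor) \<Rightarrow> bool" where
  "braided_vector_space s V \<sigma> \<longleftrightarrow>
     vector_space s \<and> module.subspace s V \<and>
     linear_on tscale tscale (tpow s V 2) \<sigma> \<and> \<sigma> ` tpow s V 2 \<subseteq> tpow s V 2 \<and>
     (let \<sigma>1 = tensor_map s s (tpow s V 2) \<sigma> (tpow s V 1) id;
          \<sigma>2 = tensor_map s s (tpow s V 1) id (tpow s V 2) \<sigma>
      in \<forall>t\<in>tpow s V 3. \<sigma>1 (\<sigma>2 (\<sigma>1 t)) = \<sigma>2 (\<sigma>1 (\<sigma>2 t)))"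

text \<open>\<open>block_braiding s V \<sigma> i j\<close> moves the first \<open>i\<close> factors past the last \<open>j\<close> ones. It is the lift of that
  permutation along one of its reduced expressions (of length \<open>i * j\<close>).\<close>

fun one_past :: "('k::field \<Rightarrow> 'v::ab_group_add \<Rightarrow> 'v) \<Rightarrow> 'v set
    \<Rightarrow> (('k, 'v) tensor \<Rightarrow> ('k, 'v) tensor) \<Rightarrow> nat \<Rightarrow> ('k, 'v) tensor \<Rightarrow> ('k, 'v) tensor" where
  "one_past s V \<sigma> 0 = id"
| "one_past s V \<sigma> (Suc j) =
     tensor_map s s (tpow s V 1) id (tpow s V (Suc j)) (one_past s V \<sigma> j) \<circ>
     tensor_map s s (tpow s V 2) \<sigma> (tpow s V j) id"

fun block_braiding :: "('k::field \<Rightarrow> 'v::ab_group_add \<Rightarrow> 'v) \<Rightarrow> 'v set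
    \<Rightarrow> (('k, 'v) tensor \<Rightarrow> ('k, 'v) tensor) \<Rightarrow> nat \<Rightarrow> nat \<Rightarrow> ('k, 'v) tensor \<Rightarrow> ('k, 'v) tensor" where
  "block_braiding s V \<sigma> 0 j = id"
| "block_braiding s V \<sigma> (Suc i) j =
     tensor_map s s (tpow s V (Suc j)) (one_past s V \<sigma> j) (tpow s V i) id \<circ>
     tensor_map s s (tpow s V 1) id (tpow s V (i + j)) (block_braiding s V \<sigma> i j)"

definition twisted_coprod :: "('k::field \<Rightarrow> 'v::ab_group_add \<Rightarrow> 'v) \<Rightarrow> 'v set
    \<Rightarrow> (('k, 'v) tensor \<Rightarrow> ('k, 'v) tensor) \<Rightarrow> ('k, 'v) bigraded_coprod" where
  "twisted_coprod s V \<sigma> p q p' q' =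
     tensor_map s s (tpow s V p) id (tpow s V (p' + q + q'))
       (tensor_map s s (tpow s V (p' + q)) (block_braiding s V \<sigma> p' q) (tpow s V q') id)"

definition quantum_multi_brace_algebra :: "('k::field \<Rightarrow> 'v::ab_group_add \<Rightarrow> 'v) \<Rightarrow> 'v set
    \<Rightarrow> ('k, 'v, 'v) bigraded_map \<Rightarrow> (('k, 'v) tensor \<Rightarrow> ('k, 'v) tensor) \<Rightarrow> bool" where
  "quantum_multi_brace_algebra s V B \<sigma> \<longleftrightarrow>
    (let T = tpow s V;
         \<beta> = block_braiding s V \<sigma>;
         B1 = (\<lambda>p q t. pure s [B p q t]);
         BD = conv_power s (\<lambda>p q. tprod s (T p) (T q)) (twisted_coprod s V \<sigma>) B1
     in
     braided_vector_space s V \<sigma> \<and>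
     (\<forall>p q. linear_on tscale s (tprod s (T p) (T q)) (B p q) \<and> B p q ` tprod s (T p) (T q) \<subseteq> V) \<and>
     (\<forall>t\<in>T 0. B 0 0 t = 0) \<and>
     (\<forall>v\<in>V. B 1 0 (pure s [v]) = v \<and> B 0 1 (pure s [v]) = v) \<and>
     (\<forall>n\<ge>2. \<forall>t\<in>T n. B n 0 t = 0 \<and> B 0 n t = 0) \<and>
     (\<forall>i\<ge>1. \<forall>j\<ge>1. \<forall>k\<ge>1. \<forall>t\<in>T (i + j + k).
        \<beta> 1 k (tensor_map s s (T (i + j)) (B1 i j) (T k) id t) =
          tensor_map s s (T k) id (T (i + j)) (B1 i j) (\<beta> (i + j) k t) \<and>
        \<beta> i 1 (tensor_map s s (T i) id (T (j + k)) (B1 j k) t) =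
          tensor_map s s (T (j + k)) (B1 j k) (T i) id (\<beta> i (j + k) t)) \<and>
     (\<forall>i\<ge>1. \<forall>j\<ge>1. \<forall>k\<ge>1. \<forall>t\<in>T (i + j + k).
        (\<Sum>r=1..i + j. B r k (tensor_map s s (T (i + j)) (BD r i j) (T k) id t)) =
        (\<Sum>l=1..j + k. B i l (tensor_map s s (T i) id (T (j + k)) (BD l j k) t))))"


section \<open>Hopf algebras and Hopf bimodules\<close>

text \<open>The algebra structure of a Hopf algebra is given by the type class \<^class>\<open>ring_1\<close>.\<close>

record ('k, 'h) hopf_data =
  hscale :: "'k \<Rightarrow> 'h \<Rightarrow> 'h"
  comult :: "'h \<Rightarrow> ('k, 'h) tensor"
  counit :: "'h \<Rightarrow> 'k"
  antipode :: "'h \<Rightarrow> 'h"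

definition hopf_algebra :: "('k::field, 'h::ring_1) hopf_data \<Rightarrow> bool" where
  "hopf_algebra H \<longleftrightarrow>
    (let s = hscale H; \<Delta> = comult H; \<epsilon> = counit H; S = antipode H in
     vector_space s \<and>
     (\<forall>c x y. s c x * y = s c (x * y) \<and> x * s c y = s c (x * y)) \<and>
     Vector_Spaces.linear s tscale \<Delta> \<and> range \<Delta> \<subseteq> tpow s UNIV 2 \<and>
     Vector_Spaces.linear s (*) \<epsilon> \<and>
     (\<forall>x. apply_at s 0 \<Delta> (\<Delta> x) = apply_at s 1 \<Delta> (\<Delta> x)) \<and>
     (\<forall>x. tlift s (\<lambda>w. case w of [a, b] \<Rightarrow> s (\<epsilon> a) b | _ \<Rightarrow> 0) (\<Delta> x) = x) \<and>
     (\<forall>x. tlift s (\<lambda>w. case w of [a, b] \<Rightarrow> s (\<epsilon> b) a | _ \<Rightarrow> 0) (\<Delta> x) = x) \<and>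
     (\<forall>x y. \<Delta> (x * y) =
        tbind (\<Delta> x) (\<lambda>u. tbind (\<Delta> y) (\<lambda>v.
          case (u, v) of ([a, b], [c, d]) \<Rightarrow> pure s [a * c, b * d] | _ \<Rightarrow> 0))) \<and>
     \<Delta> 1 = pure s [1, 1] \<and>
     (\<forall>x y. \<epsilon> (x * y) = \<epsilon> x * \<epsilon> y) \<and> \<epsilon> 1 = 1 \<and>
     Vector_Spaces.linear s s S \<and>
     (\<forall>x. tlift s (\<lambda>w. case w of [a, b] \<Rightarrow> S a * b | _ \<Rightarrow> 0) (\<Delta> x) = s (\<epsilon> x) 1) \<and>
     (\<forall>x. tlift s (\<lambda>w. case w of [a, b] \<Rightarrow> a * S b | _ \<Rightarrow> 0) (\<Delta> x) = s (\<epsilon> x) 1))"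

text \<open>The iterated coproduct of \<open>H\<close> with \<open>n\<close> factors (the counit for \<open>n = 0\<close>).\<close>

fun iter_comult :: "('k::field, 'h::ring_1) hopf_data \<Rightarrow> nat \<Rightarrow> 'h \<Rightarrow> ('k, 'h) tensor" where
  "iter_comult H 0 x = tscale (counit H x) (pure (hscale H) [])"
| "iter_comult H (Suc n) x = tbind (comult H x) (\<lambda>w. case w of
     [a, b] \<Rightarrow> tmult (hscale H) (pure (hscale H) [a]) (iter_comult H n b) | _ \<Rightarrow> 0)"

text \<open>Tensors that mix elements of \<open>H\<close> and of \<open>M\<close> are tensors over the direct sum of \<open>H\<close> and \<open>M\<close>, which
  is the product type.\<close>

record ('k, 'h, 'm) bimodule_data =
  mscale :: "'k \<Rightarrow> 'm \<Rightarrow> 'm"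
  lact :: "'h \<Rightarrow> 'm \<Rightarrow> 'm"
  ract :: "'m \<Rightarrow> 'h \<Rightarrow> 'm"
  lcoact :: "'m \<Rightarrow> ('k, 'h \<times> 'm) tensor"
  rcoact :: "'m \<Rightarrow> ('k, 'h \<times> 'm) tensor"

definition sscale :: "('k::field, 'h::ring_1) hopf_data \<Rightarrow> ('k, 'h, 'm::ab_group_add) bimodule_data
    \<Rightarrow> 'k \<Rightarrow> 'h \<times> 'm \<Rightarrow> 'h \<times> 'm" where
  "sscale H M c e = (hscale H c (fst e), mscale M c (snd e))"

definition hpart :: "('k::field, 'h::ring_1) hopf_data \<Rightarrow> ('k, 'h, 'm::ab_group_add) bimodule_data
    \<Rightarrow> ('k, 'h \<times> 'm) tensor set" where
  "hpart H M = tpow (sscale H M) (range (\<lambda>x. (x, 0))) 1"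

definition mpart :: "('k::field, 'h::ring_1) hopf_data \<Rightarrow> ('k, 'h, 'm::ab_group_add) bimodule_data
    \<Rightarrow> ('k, 'h \<times> 'm) tensor set" where
  "mpart H M = tpow (sscale H M) (range (\<lambda>m. (0, m))) 1"

text \<open>The left and right coactions on the direct sum, where \<open>H\<close> coacts on itself by its coproduct.\<close>

definition comult_emb :: "('k::field, 'h::ring_1) hopf_data
    \<Rightarrow> ('k, 'h, 'm::ab_group_add) bimodule_data \<Rightarrow> 'h \<Rightarrow> ('k, 'h \<times> 'm) tensor" where
  "comult_emb H M x = tbind (comult H x) (\<lambda>w. pure (sscale H M) (map (\<lambda>a. (a, 0)) w))"

definition lco :: "('k::field, 'h::ring_1) hopf_data \<Rightarrow> ('k, 'h, 'm::ab_group_add) bimodule_data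
    \<Rightarrow> 'h \<times> 'm \<Rightarrow> ('k, 'h \<times> 'm) tensor" where
  "lco H M e = comult_emb H M (fst e) + lcoact M (snd e)"

definition rco :: "('k::field, 'h::ring_1) hopf_data \<Rightarrow> ('k, 'h, 'm::ab_group_add) bimodule_data
    \<Rightarrow> 'h \<times> 'm \<Rightarrow> ('k, 'h \<times> 'm) tensor" where
  "rco H M e = comult_emb H M (fst e) + rcoact M (snd e)"

text \<open>The actions of \<open>H\<close> on tensor products of copies of \<open>H\<close> and \<open>M\<close> via the iterated coproduct.\<close>

definition tlact :: "('k::field, 'h::ring_1) hopf_data \<Rightarrow> ('k, 'h, 'm::ab_group_add) bimodule_data
    \<Rightarrow> 'h \<Rightarrow> ('k, 'h \<times> 'm) tensor \<Rightarrow> ('k, 'h \<times> 'm) tensor" where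
  "tlact H M x t = tbind t (\<lambda>w. tbind (iter_comult H (length w) x) (\<lambda>xs.
     if length xs = length w
     then pure (sscale H M) (map2 (\<lambda>a (b, m). (a * b, lact M a m)) xs w) else 0))"

definition tract :: "('k::field, 'h::ring_1) hopf_data \<Rightarrow> ('k, 'h, 'm::ab_group_add) bimodule_data
    \<Rightarrow> ('k, 'h \<times> 'm) tensor \<Rightarrow> 'h \<Rightarrow> ('k, 'h \<times> 'm) tensor" where
  "tract H M t x = tbind t (\<lambda>w. tbind (iter_comult H (length w) x) (\<lambda>xs.
     if length xs = length w
     then pure (sscale H M) (map2 (\<lambda>a (b, m). (b * a, ract M m a)) xs w) else 0))"

definition hopf_bimodule :: "('k::field, 'h::ring_1) hopf_data
    \<Rightarrow> ('k, 'h, 'm::ab_group_add) bimodule_data \<Rightarrow> bool" where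
  "hopf_bimodule H M \<longleftrightarrow>
    (let sH = hscale H; sM = mscale M; \<delta>L = lcoact M; \<delta>R = rcoact M; s = sscale H M in
     vector_space sM \<and>
     (\<forall>m. Vector_Spaces.linear sH sM (\<lambda>x. lact M x m)) \<and>
     (\<forall>x. Vector_Spaces.linear sM sM (lact M x)) \<and>
     (\<forall>m. Vector_Spaces.linear sH sM (ract M m)) \<and>
     (\<forall>x. Vector_Spaces.linear sM sM (\<lambda>m. ract M m x)) \<and>
     (\<forall>x y m. lact M (x * y) m = lact M x (lact M y m)) \<and> (\<forall>m. lact M 1 m = m) \<and>
     (\<forall>x y m. ract M m (x * y) = ract M (ract M m x) y) \<and> (\<forall>m. ract M m 1 = m) \<and>
     (\<forall>x y m. ract M (lact M x m) y = lact M x (ract M m y)) \<and>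
     Vector_Spaces.linear sM tscale \<delta>L \<and> range \<delta>L \<subseteq> tprod s (hpart H M) (mpart H M) \<and>
     Vector_Spaces.linear sM tscale \<delta>R \<and> range \<delta>R \<subseteq> tprod s (mpart H M) (hpart H M) \<and>
     (\<forall>m. apply_at s 0 (lco H M) (\<delta>L m) = apply_at s 1 (lco H M) (\<delta>L m)) \<and>
     (\<forall>m. tlift sM (\<lambda>w. case w of [(x, _), (_, n)] \<Rightarrow> sM (counit H x) n | _ \<Rightarrow> 0) (\<delta>L m) = m) \<and>
     (\<forall>m. apply_at s 0 (rco H M) (\<delta>R m) = apply_at s 1 (rco H M) (\<delta>R m)) \<and>
     (\<forall>m. tlift sM (\<lambda>w. case w of [(_, n), (x, _)] \<Rightarrow> sM (counit H x) n | _ \<Rightarrow> 0) (\<delta>R m) = m) \<and>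
     (\<forall>m. apply_at s 0 (lco H M) (\<delta>R m) = apply_at s 1 (rco H M) (\<delta>L m)) \<and>
     (\<forall>x m. \<delta>L (lact M x m) = tlact H M x (\<delta>L m)) \<and>
     (\<forall>x m. \<delta>L (ract M m x) = tract H M (\<delta>L m) x) \<and>
     (\<forall>x m. \<delta>R (lact M x m) = tlact H M x (\<delta>R m)) \<and>
     (\<forall>x m. \<delta>R (ract M m x) = tract H M (\<delta>R m) x))"


section \<open>The cotensor coalgebra\<close>

text \<open>\<open>cotensor H M n\<close> is the \<open>n\<close>-fold cotensor product of \<open>M\<close>, a space of tensors of degree
  \<open>max 1 n\<close>; in the last equation the right coaction is applied to the last factor but one.\<close>

fun cotensor :: "('k::field, 'h::ring_1) hopf_data \<Rightarrow> ('k, 'h, 'm::ab_group_add) bimodule_data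
    \<Rightarrow> nat \<Rightarrow> ('k, 'h \<times> 'm) tensor set" where
  "cotensor H M 0 = hpart H M"
| "cotensor H M (Suc 0) = mpart H M"
| "cotensor H M (Suc (Suc n)) =
     {t \<in> tprod (sscale H M) (cotensor H M (Suc n)) (mpart H M).
        apply_at (sscale H M) n (rco H M) t = apply_at (sscale H M) (Suc n) (lco H M) t}"

text \<open>The left coaction is \<open>lco\<close> on the first factor, the right coaction is \<open>rco\<close> on the last one.\<close>

definition cotensor_lco :: "('k::field, 'h::ring_1) hopf_data
    \<Rightarrow> ('k, 'h, 'm::ab_group_add) bimodule_data \<Rightarrow> ('k, 'h \<times> 'm) tensor \<Rightarrow> ('k, 'h \<times> 'm) tensor" where
  "cotensor_lco H M = apply_at (sscale H M) 0 (lco H M)"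

definition cotensor_rco :: "('k::field, 'h::ring_1) hopf_data
    \<Rightarrow> ('k, 'h, 'm::ab_group_add) bimodule_data
    \<Rightarrow> nat \<Rightarrow> ('k, 'h \<times> 'm) tensor \<Rightarrow> ('k, 'h \<times> 'm) tensor" where
  "cotensor_rco H M n = apply_at (sscale H M) (n - 1) (rco H M)"

text \<open>The component of the coproduct from degree \<open>a + b\<close> to degrees \<open>a\<close> and \<open>b\<close>; for \<open>a, b > 0\<close> this
  is deconcatenation, which does nothing to a tensor.\<close>

definition deconc :: "('k::field, 'h::ring_1) hopf_data \<Rightarrow> ('k, 'h, 'm::ab_group_add) bimodule_data
    \<Rightarrow> nat \<Rightarrow> nat \<Rightarrow> ('k, 'h \<times> 'm) tensor \<Rightarrow> ('k, 'h \<times> 'm) tensor" where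
  "deconc H M a b = (if a = 0 then cotensor_lco H M else if b = 0 then cotensor_rco H M a else id)"

text \<open>The tensor square \<open>D\<close> of the cotensor coalgebra, with its coalgebra and Hopf bimodule structure.\<close>

definition dsq :: "('k::field, 'h::ring_1) hopf_data \<Rightarrow> ('k, 'h, 'm::ab_group_add) bimodule_data
    \<Rightarrow> ('k, 'h \<times> 'm) bigraded_space" where
  "dsq H M p q = tprod (sscale H M) (cotensor H M p) (cotensor H M q)"

definition dsq_coprod :: "('k::field, 'h::ring_1) hopf_data
    \<Rightarrow> ('k, 'h, 'm::ab_group_add) bimodule_data \<Rightarrow> ('k, 'h \<times> 'm) bigraded_coprod" where
  "dsq_coprod H M p q p' q' =
     flip_blocks (sscale H M) (max 1 p) (max 1 p') (max 1 q) \<circ>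
     tensor_map (sscale H M) (sscale H M)
       (cotensor H M (p + p')) (deconc H M p p') (cotensor H M (q + q')) (deconc H M q q')"

definition dsq_counit :: "('k::field, 'h::ring_1) hopf_data
    \<Rightarrow> nat \<Rightarrow> nat \<Rightarrow> ('k, 'h \<times> 'm::ab_group_add) tensor \<Rightarrow> 'k" where
  "dsq_counit H p q t = (if p = 0 \<and> q = 0
     then t (\<lambda>w. case w of [(x, _), (y, _)] \<Rightarrow> counit H x * counit H y | _ \<Rightarrow> 0) else 0)"

definition dsq_lact :: "('k::field, 'h::ring_1) hopf_data
    \<Rightarrow> ('k, 'h, 'm::ab_group_add) bimodule_data
    \<Rightarrow> nat \<Rightarrow> nat \<Rightarrow> 'h \<Rightarrow> ('k, 'h \<times> 'm) tensor \<Rightarrow> ('k, 'h \<times> 'm) tensor" where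
  "dsq_lact H M p q x = tensor_map (sscale H M) (sscale H M)
     (cotensor H M p) (tlact H M x) (cotensor H M q) id"

definition dsq_ract :: "('k::field, 'h::ring_1) hopf_data
    \<Rightarrow> ('k, 'h, 'm::ab_group_add) bimodule_data
    \<Rightarrow> nat \<Rightarrow> nat \<Rightarrow> ('k, 'h \<times> 'm) tensor \<Rightarrow> 'h \<Rightarrow> ('k, 'h \<times> 'm) tensor" where
  "dsq_ract H M p q t x = tensor_map (sscale H M) (sscale H M)
     (cotensor H M p) id (cotensor H M q) (\<lambda>u. tract H M u x) t"

definition dsq_lco :: "('k::field, 'h::ring_1) hopf_data
    \<Rightarrow> ('k, 'h, 'm::ab_group_add) bimodule_data
    \<Rightarrow> nat \<Rightarrow> nat \<Rightarrow> ('k, 'h \<times> 'm) tensor \<Rightarrow> ('k, 'h \<times> 'm) tensor" where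
  "dsq_lco H M p q t =
    (let a = max 1 p; b = max 1 q in
     tbind (tensor_map (sscale H M) (sscale H M)
         (cotensor H M p) (cotensor_lco H M) (cotensor H M q) (cotensor_lco H M) t)
       (\<lambda>w. if length w = a + b + 2
         then pure (sscale H M)
           ((fst (w ! 0) * fst (w ! (a + 1)), 0) # take a (drop 1 w) @ drop (a + 2) w)
         else 0))"

definition dsq_rco :: "('k::field, 'h::ring_1) hopf_data
    \<Rightarrow> ('k, 'h, 'm::ab_group_add) bimodule_data
    \<Rightarrow> nat \<Rightarrow> nat \<Rightarrow> ('k, 'h \<times> 'm) tensor \<Rightarrow> ('k, 'h \<times> 'm) tensor" where
  "dsq_rco H M p q t =
    (let a = max 1 p; b = max 1 q in
     tbind (tensor_map (sscale H M) (sscale H M)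
         (cotensor H M p) (cotensor_rco H M p) (cotensor H M q) (cotensor_rco H M q) t)
       (\<lambda>w. if length w = a + b + 2
         then pure (sscale H M)
           (take a w @ take b (drop (a + 1) w) @ [(fst (w ! a) * fst (w ! (a + b + 1)), 0)])
         else 0))"


section \<open>Pairs of multi-brace type\<close>

text \<open>Values of \<open>f\<close> and \<open>g\<close> are turned into tensors of degree \<open>1\<close>.\<close>

definition mval :: "('k::field, 'h::ring_1) hopf_data \<Rightarrow> ('k, 'h, 'm::ab_group_add) bimodule_data
    \<Rightarrow> ('k, 'h \<times> 'm, 'm) bigraded_map \<Rightarrow> ('k, 'h \<times> 'm, ('k, 'h \<times> 'm) tensor) bigraded_map" where
  "mval H M f p q t = pure (sscale H M) [(0, f p q t)]"

definition hval :: "('k::field, 'h::ring_1) hopf_data \<Rightarrow> ('k, 'h, 'm::ab_group_add) bimodule_data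
    \<Rightarrow> ('k, 'h \<times> 'm, 'h) bigraded_map \<Rightarrow> ('k, 'h \<times> 'm, ('k, 'h \<times> 'm) tensor) bigraded_map" where
  "hval H M g p q t = pure (sscale H M) [(g p q t, 0)]"

definition coalgebra_morphism :: "('k::field, 'h::ring_1) hopf_data
    \<Rightarrow> ('k, 'h, 'm::ab_group_add) bimodule_data \<Rightarrow> ('k, 'h \<times> 'm, 'h) bigraded_map \<Rightarrow> bool" where
  "coalgebra_morphism H M g \<longleftrightarrow>
     (\<forall>p q. linear_on tscale (hscale H) (dsq H M p q) (g p q)) \<and>
     (\<forall>p q. \<forall>t\<in>dsq H M p q.
        comult_emb H M (g p q t) =
          (\<Sum>a\<le>p. \<Sum>b\<le>q. tensor_map (sscale H M) (sscale H M)
             (dsq H M a b) (hval H M g a b) (dsq H M (p - a) (q - b)) (hval H M g (p - a) (q - b))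
             (dsq_coprod H M a b (p - a) (q - b) t)) \<and>
        counit H (g p q t) = dsq_counit H p q t)"

definition hopf_bimodule_morphism :: "('k::field, 'h::ring_1) hopf_data
    \<Rightarrow> ('k, 'h, 'm::ab_group_add) bimodule_data \<Rightarrow> ('k, 'h \<times> 'm, 'm) bigraded_map \<Rightarrow> bool" where
  "hopf_bimodule_morphism H M f \<longleftrightarrow>
     (\<forall>p q. linear_on tscale (mscale M) (dsq H M p q) (f p q)) \<and>
     (\<forall>p q. \<forall>t\<in>dsq H M p q.
        (\<forall>x. f p q (dsq_lact H M p q x t) = lact M x (f p q t)) \<and>
        (\<forall>x. f p q (dsq_ract H M p q t x) = ract M (f p q t) x) \<and>
        lcoact M (f p q t) = tensor_map (sscale H M) (sscale H M)
          (hpart H M) id (dsq H M p q) (mval H M f p q) (dsq_lco H M p q t) \<and>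
        rcoact M (f p q t) = tensor_map (sscale H M) (sscale H M)
          (dsq H M p q) (mval H M f p q) (hpart H M) id (dsq_rco H M p q t))"

definition property_MB :: "('k::field, 'h::ring_1) hopf_data
    \<Rightarrow> ('k, 'h, 'm::ab_group_add) bimodule_data
    \<Rightarrow> ('k, 'h \<times> 'm, 'm) bigraded_map \<Rightarrow> ('k, 'h \<times> 'm, 'h) bigraded_map \<Rightarrow> bool" where
  "property_MB H M f g \<longleftrightarrow>
    (let s = sscale H M; C = cotensor H M; D = dsq H M;
         f1 = mval H M f; g1 = hval H M g;
         fD = conv_power s D (dsq_coprod H M) f1
     in
     coalgebra_morphism H M g \<and>
     hopf_bimodule_morphism H M f \<and> (\<forall>t\<in>D 0 0. f 0 0 t = 0) \<and>
     (\<forall>i j k. \<forall>t\<in>tprod s (D i j) (C k).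
        g 0 k (tensor_map s s (D i j) (g1 i j) (C k) id t)
          + (\<Sum>n=1..i + j. g n k (tensor_map s s (D i j) (fD n i j) (C k) id t)) =
        g i 0 (tensor_map s s (C i) id (D j k) (g1 j k) t)
          + (\<Sum>n=1..j + k. g i n (tensor_map s s (C i) id (D j k) (fD n j k) t)) \<and>
        f 0 k (tensor_map s s (D i j) (g1 i j) (C k) id t)
          + (\<Sum>n=1..i + j. f n k (tensor_map s s (D i j) (fD n i j) (C k) id t)) =
        f i 0 (tensor_map s s (C i) id (D j k) (g1 j k) t)
          + (\<Sum>n=1..j + k. f i n (tensor_map s s (C i) id (D j k) (fD n j k) t))))"

definition multi_brace_pair :: "('k::field, 'h::ring_1) hopf_data
    \<Rightarrow> ('k, 'h, 'm::ab_group_add) bimodule_data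
    \<Rightarrow> ('k, 'h \<times> 'm, 'm) bigraded_map \<Rightarrow> ('k, 'h \<times> 'm, 'h) bigraded_map \<Rightarrow> bool" where
  "multi_brace_pair H M f g \<longleftrightarrow>
     (\<forall>x y. g 0 0 (pure (sscale H M) [(x, 0), (y, 0)]) = x * y) \<and>
     (\<forall>p q. (p, q) \<noteq> (0, 0) \<longrightarrow> (\<forall>t\<in>dsq H M p q. g p q t = 0)) \<and>
     (\<forall>x m. f 0 1 (pure (sscale H M) [(x, 0), (0, m)]) = lact M x m) \<and>
     (\<forall>x m. f 1 0 (pure (sscale H M) [(0, m), (x, 0)]) = ract M m x) \<and>
     (\<forall>n. n \<noteq> 1 \<longrightarrow> (\<forall>t\<in>dsq H M 0 n. f 0 n t = 0) \<and> (\<forall>t\<in>dsq H M n 0. f n 0 t = 0)) \<and>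
     property_MB H M f g"


section \<open>Right coinvariants\<close>

definition coinvariants :: "('k::field, 'h::ring_1) hopf_data
    \<Rightarrow> ('k, 'h, 'm::ab_group_add) bimodule_data \<Rightarrow> 'm set" where
  "coinvariants H M = {m. rcoact M m = pure (sscale H M) [(0, m), (1, 0)]}"

definition adjoint_act :: "('k::field, 'h::ring_1) hopf_data
    \<Rightarrow> ('k, 'h, 'm::ab_group_add) bimodule_data \<Rightarrow> 'h \<Rightarrow> 'm \<Rightarrow> 'm" where
  "adjoint_act H M x v = tlift (mscale M)
     (\<lambda>w. case w of [a, b] \<Rightarrow> ract M (lact M a v) (antipode H b) | _ \<Rightarrow> 0) (comult H x)"

definition yd_braiding :: "('k::field, 'h::ring_1) hopf_data
    \<Rightarrow> ('k, 'h, 'm::ab_group_add) bimodule_data \<Rightarrow> ('k, 'm) tensor \<Rightarrow> ('k, 'm) tensor" where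
  "yd_braiding H M t = tbind t (\<lambda>u. case u of
       [v, w] \<Rightarrow> tbind (lcoact M v) (\<lambda>z. case z of
           [(x, _), (_, v')] \<Rightarrow> pure (mscale M) [adjoint_act H M x w, v'] | _ \<Rightarrow> 0)
     | _ \<Rightarrow> 0)"

definition coinv_proj :: "('k::field, 'h::ring_1) hopf_data
    \<Rightarrow> ('k, 'h, 'm::ab_group_add) bimodule_data \<Rightarrow> 'm \<Rightarrow> 'm" where
  "coinv_proj H M m = tlift (mscale M)
     (\<lambda>w. case w of [(_, n), (x, _)] \<Rightarrow> ract M n (antipode H x) | _ \<Rightarrow> 0) (rcoact M m)"

definition cotensor_coinv :: "('k::field, 'h::ring_1) hopf_data
    \<Rightarrow> ('k, 'h, 'm::ab_group_add) bimodule_data \<Rightarrow> nat \<Rightarrow> ('k, 'h \<times> 'm) tensor set" where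
  "cotensor_coinv H M p = {t \<in> cotensor H M p.
     cotensor_rco H M p t = tmult (sscale H M) t (pure (sscale H M) [(1, 0)])}"

definition coinv_proj_power :: "('k::field, 'h::ring_1) hopf_data
    \<Rightarrow> ('k, 'h, 'm::ab_group_add) bimodule_data
    \<Rightarrow> nat \<Rightarrow> ('k, 'h \<times> 'm) tensor \<Rightarrow> ('k, 'm) tensor" where
  "coinv_proj_power H M p t = tbind t (\<lambda>w. if length w = p
     then pure (mscale M) (map (\<lambda>e. coinv_proj H M (snd e)) w) else 0)"

text \<open>The identification of the \<open>p\<close>-th tensor power of the coinvariants of \<open>M\<close> with the coinvariants of the
  \<open>p\<close>-fold cotensor product; for \<open>p = 0\<close> the scalar \<open>c\<close> goes to \<open>c 1\<close> in \<open>H\<close>.\<close>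

definition coinv_embed :: "('k::field, 'h::ring_1) hopf_data
    \<Rightarrow> ('k, 'h, 'm::ab_group_add) bimodule_data
    \<Rightarrow> nat \<Rightarrow> ('k, 'm) tensor \<Rightarrow> ('k, 'h \<times> 'm) tensor" where
  "coinv_embed H M p t = (if p = 0
     then tbind t (\<lambda>w. if w = [] then pure (sscale H M) [(1, 0)] else 0)
     else the_inv_into (cotensor_coinv H M p) (coinv_proj_power H M p) t)"

definition restricted_brace :: "('k::field, 'h::ring_1) hopf_data
    \<Rightarrow> ('k, 'h, 'm::ab_group_add) bimodule_data
    \<Rightarrow> ('k, 'h \<times> 'm, 'm) bigraded_map \<Rightarrow> ('k, 'm, 'm) bigraded_map" where
  "restricted_brace H M f p q t = f p q (tensor_map (mscale M) (sscale H M)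
     (tpow (mscale M) (coinvariants H M) p) (coinv_embed H M p)
     (tpow (mscale M) (coinvariants H M) q) (coinv_embed H M q) t)"

end

theory Submission
  imports Defs
begin

text \<open>Property (MB) on \<open>C i \<otimes> H \<otimes> C k\<close>, where \<open>C n\<close> is the \<open>n\<close>-fold cotensor power, says that
  \<open>f(y h \<otimes> z) = f(y \<otimes> h z)\<close>. Let \<open>\<kappa>\<close> embed words in the coinvariants into the cotensor powers. Since
  \<open>h \<kappa>(t) = \<Sum> \<kappa>(h1 . t) h2\<close> and the deconcatenation of \<open>\<kappa>(s1 s2)\<close> is \<open>\<Sum> \<kappa>(s1) s2(-1) \<otimes> \<kappa>(s2(0))\<close>, balancedness
  moves \<open>s2(-1)\<close> onto the second tensor factor, where it acts by the adjoint action on the part of \<open>t\<close> that it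
  passes. This is exactly the braiding in the twisted coproduct, so \<open>\<kappa>\<close> carries the convolution powers of the
  restriction of \<open>f\<close> to those of \<open>f\<close>, and the associativity condition is (MB) on embedded words. The
  compatibility with the braiding expresses that the restriction is left colinear and, by the same argument,
  linear for the adjoint action.\<close>

text \<open>The cotensor powers are defined by equations, while the argument runs on words.
  \<open>gen_cotensor\<close> bridges this: embedded words generate each cotensor power under the
  right action. Hence the left action and deconcatenation preserve the cotensor powers, and \<kappa>
  is the identification of the coinvariants, which in positive degree is given only as an inverse
  function. The obstacle in transporting convolution powers is that \<kappa> is not multiplicative:
  prepending m to w multiplies m by the coaction of w. The induction on the number of factors
  therefore also needs the left colinearity of the convolution powers of \<open>f\<close>, which is
  \<open>F_coaction\<close>. Sweedler sums run over chosen lists of pairs. Such lists are neither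
  unique nor additive in their argument, so a rewriting of a sum is justified by linearity of its
  summand in each slot; \<open>lin_intros\<close> collects the rules for this. Maps that are linear
  only on a subspace are first extended along a linear projection.\<close>

text \<open>Pointwise unfolding of sums of tensors is unwanted: tensors are functions only by encoding.\<close>

declare plus_fun_apply [simp del] zero_fun_apply [simp del]

section \<open>Linear and multilinear maps\<close>

abbreviation lin :: "('k::field \<Rightarrow> 'a::ab_group_add \<Rightarrow> 'a) \<Rightarrow> ('k \<Rightarrow> 'b::ab_group_add \<Rightarrow> 'b)
    \<Rightarrow> ('a \<Rightarrow> 'b) \<Rightarrow> bool" where
  "lin s1 s2 F \<equiv> linear_on s1 s2 UNIV F"

lemma lin_iff: "lin s1 s2 F \<longleftrightarrow> (\<forall>x y. F (x + y) = F x + F y) \<and> (\<forall>c x. F (s1 c x) = s2 c (F x))"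
  by (simp add: linear_on_def)

lemma lin_add: "lin s1 s2 F \<Longrightarrow> F (x + y) = F x + F y"
  and lin_scale: "lin s1 s2 F \<Longrightarrow> F (s1 c x) = s2 c (F x)"
  by (auto simp: lin_iff)

lemma lin_zero: "lin s1 s2 F \<Longrightarrow> F 0 = 0"
  using lin_add[of s1 s2 F 0 0] by simp

lemma lin_sum_list: "lin s1 s2 F \<Longrightarrow> F (\<Sum>p\<leftarrow>xs. G p) = (\<Sum>p\<leftarrow>xs. F (G p))"
  by (induction xs) (auto simp: lin_zero lin_add)

lemma lin_sum_list2: "lin s1 s2 F \<Longrightarrow> F (\<Sum>(a, b)\<leftarrow>xs. G a b) = (\<Sum>(a, b)\<leftarrow>xs. F (G a b))"
  by (induction xs) (auto simp: lin_zero lin_add)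

lemma sum_list_sum_list_swap:
  fixes F :: "'a \<Rightarrow> 'b \<Rightarrow> 'c::comm_monoid_add"
  shows "(\<Sum>x\<leftarrow>xs. \<Sum>y\<leftarrow>ys. F x y) = (\<Sum>y\<leftarrow>ys. \<Sum>x\<leftarrow>xs. F x y)"
  by (induction xs) (auto simp: sum_list_addf)

lemma sum_list_swap:
  fixes F :: "'a \<Rightarrow> 'b \<Rightarrow> 'c \<Rightarrow> 'd \<Rightarrow> 'e::comm_monoid_add"
  shows "(\<Sum>(a, b)\<leftarrow>xs. \<Sum>(c, d)\<leftarrow>ys. F a b c d) = (\<Sum>(c, d)\<leftarrow>ys. \<Sum>(a, b)\<leftarrow>xs. F a b c d)"
  using sum_list_sum_list_swap[of "\<lambda>(a, b) (c, d). F a b c d" ys xs]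
  by (simp add: case_prod_beta')

lemma sum_list_cong2:
  assumes "\<And>a b. (a, b) \<in> set xs \<Longrightarrow> F a b = G a b"
  shows "(\<Sum>(a, b)\<leftarrow>xs. F a b) = (\<Sum>(a, b)\<leftarrow>xs. G a b)"
  using assms by (induction xs) auto

lemma sum_list_sum_swap:
  fixes F :: "'a \<Rightarrow> 'b \<Rightarrow> 'c \<Rightarrow> 'e::comm_monoid_add"
  shows "(\<Sum>(a, b)\<leftarrow>xs. \<Sum>i\<in>I. F a b i) = (\<Sum>i\<in>I. \<Sum>(a, b)\<leftarrow>xs. F a b i)"
  by (induction xs) (auto simp: sum.distrib)

named_theorems lin_intros

lemma lin_id [lin_intros]: "linear_on s s X (\<lambda>x. x)"
  by (simp add: linear_on_def)

lemma lin_comp: "lin s2 s3 G \<Longrightarrow> linear_on s1 s2 X F \<Longrightarrow> linear_on s1 s3 X (\<lambda>x. G (F x))"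
  by (simp add: linear_on_def)

lemma lin_tscale_add: "linear_on s1 tscale X F \<Longrightarrow> linear_on s1 tscale X G \<Longrightarrow> linear_on s1 tscale X (\<lambda>x. F x + G x)"
  by (simp add: linear_on_def tens.scale_right_distrib)

lemma lin_tscale_sum_list [lin_intros]:
  "(\<And>p. p \<in> set ps \<Longrightarrow> linear_on s1 tscale X (\<lambda>x. F x p)) \<Longrightarrow> linear_on s1 tscale X (\<lambda>x. \<Sum>p\<leftarrow>ps. F x p)"
  by (induction ps) (auto simp: linear_on_def tens.scale_right_distrib)

lemma lin_tscale_sum_list2 [lin_intros]:
  "(\<And>a b. (a, b) \<in> set ps \<Longrightarrow> linear_on s1 tscale X (\<lambda>x. F x a b))
    \<Longrightarrow> linear_on s1 tscale X (\<lambda>x. \<Sum>(a, b)\<leftarrow>ps. F x a b)"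
  by (induction ps) (auto simp: linear_on_def tens.scale_right_distrib)

lemma linear_on_mono: "linear_on s1 s2 X F \<Longrightarrow> Y \<subseteq> X \<Longrightarrow> linear_on s1 s2 Y F"
  unfolding linear_on_def by blast

text \<open>The tensor-valued form of \<open>multilinear\<close>: under this condition
  \<open>tbind\<close> sends \<open>pure s w\<close> to \<open>F w\<close>, as
  \<open>tbind_pure_mlin\<close> records.\<close>

definition mlin :: "('k::field \<Rightarrow> 'e::ab_group_add \<Rightarrow> 'e) \<Rightarrow> ('e list \<Rightarrow> ('k, 'd) tensor) \<Rightarrow> bool" where
  "mlin s F \<longleftrightarrow> (\<forall>u v. lin s tscale (\<lambda>x. F (u @ x # v)))"

lemma mlin_multilinear: "mlin s F \<Longrightarrow> multilinear s (\<lambda>w. F w \<psi>)"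
  by (auto simp: mlin_def multilinear_def linear_on_def tscale_def plus_fun_apply)

lemma mlinD: "mlin s F \<Longrightarrow> lin s tscale (\<lambda>x. F (u @ x # v))"
  by (simp add: mlin_def)

lemma mlin_pure: "mlin s (pure s)"
proof -
  have "pure s (u @ (a + b) # v) = pure s (u @ a # v) + pure s (u @ b # v)"
    "pure s (u @ s c a # v) = tscale c (pure s (u @ a # v))" for u a b c v
    by (auto simp: pure_def fun_eq_iff tscale_def multilinear_def plus_fun_apply)
  then show ?thesis by (simp add: mlin_def linear_on_def)
qed

lemma lin_pure: "linear_on s1 s X A \<Longrightarrow> linear_on s1 tscale X (\<lambda>x. pure s (u @ A x # v))"
  by (rule lin_comp[OF mlinD[OF mlin_pure]])

lemmas lin_pure1 [lin_intros] = lin_pure[where u = "[]" and v = "[]", unfolded append.simps]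

lemmas lin_pure2 [lin_intros] =
  lin_pure[where u = "[]" and v = "[b]" for b, unfolded append.simps]
  lin_pure[where u = "[b]" and v = "[]" for b, unfolded append.simps]

lemmas lin_pure3 [lin_intros] =
  lin_pure[where u = "[]" and v = "[b, c]" for b c, unfolded append.simps]
  lin_pure[where u = "[b]" and v = "[c]" for b c, unfolded append.simps]
  lin_pure[where u = "[b, c]" and v = "[]" for b c, unfolded append.simps]

section \<open>Genuine tensors\<close>

text \<open>The type of tensors contains every functional on scalar functions. Right linearity and
  associativity of \<open>tmult\<close> hold for functionals that respect sums and multiples of
  multilinear forms; elements of this span do so by \<open>TT_tensor_like\<close>.\<close>

definition TT :: "('k::field \<Rightarrow> 'e::ab_group_add \<Rightarrow> 'e) \<Rightarrow> ('k, 'e) tensor set" where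
  "TT s = tens.span (range (pure s))"

named_theorems TT_intros

lemma TT_subspace: "tens.subspace (TT s)"
  unfolding TT_def by (rule tens.subspace_span)

lemma TT_pure [TT_intros, simp]: "pure s w \<in> TT s"
  unfolding TT_def by (intro tens.span_base) auto

lemma TT_0 [simp]: "0 \<in> TT s"
  and TT_add [TT_intros]: "x \<in> TT s \<Longrightarrow> y \<in> TT s \<Longrightarrow> x + y \<in> TT s"
  and TT_tscale [TT_intros]: "x \<in> TT s \<Longrightarrow> tscale c x \<in> TT s"
  using TT_subspace[of s] by (auto simp: tens.subspace_def)

lemma subspace_sum_list:
  "tens.subspace X \<Longrightarrow> (\<And>p. p \<in> set ps \<Longrightarrow> F p \<in> X) \<Longrightarrow> (\<Sum>p\<leftarrow>ps. F p) \<in> X"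
  by (induction ps) (auto simp: tens.subspace_def)

lemma subspace_sum_list2:
  "tens.subspace X \<Longrightarrow> (\<And>a b. (a, b) \<in> set ps \<Longrightarrow> F a b \<in> X) \<Longrightarrow> (\<Sum>(a, b)\<leftarrow>ps. F a b) \<in> X"
  by (induction ps) (auto simp: tens.subspace_def)

lemmas TT_sum_list [TT_intros] = subspace_sum_list[OF TT_subspace]
lemmas TT_sum_list2 [TT_intros] = subspace_sum_list2[OF TT_subspace]
lemmas TT_sum [TT_intros] = tens.subspace_sum[OF TT_subspace]

lemma TT_tensor_like: "x \<in> TT s \<Longrightarrow> tensor_like s x"
proof -
  have "tens.span (range (pure s)) \<subseteq> {t. tensor_like s t}"
    by (rule tens.span_minimal[OF _ tensor_like_subspace]) (auto intro: homog_pure[unfolded homog_def, THEN conjunct1])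
  then show "x \<in> TT s \<Longrightarrow> tensor_like s x" unfolding TT_def by blast
qed

lemma linear_on_eq_span:
  assumes F: "linear_on tscale s2 (tens.span B) F" and G: "linear_on tscale s2 (tens.span B) G"
    and eq: "\<And>b. b \<in> B \<Longrightarrow> F b = G b" and t: "t \<in> tens.span B" and s2: "vector_space s2"
  shows "F t = G t"
proof -
  interpret s2: vector_space s2 by (rule s2)
  have z: "F 0 = 0" "G 0 = 0"
    using F G tens.span_zero[of B] unfolding linear_on_def
    by (metis s2.scale_zero_left tens.scale_zero_left)+
  have "t \<in> tens.span B \<and> F t = G t"
    using t
  proof (induction rule: tens.span_induct_alt)
    case base then show ?case using z tens.span_zero by simp
  next
    case (step c x y)
    have "x \<in> tens.span B" using step by (simp add: tens.span_base)
    moreover from this have "tscale c x \<in> tens.span B" by (rule tens.span_scale)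
    moreover have "y \<in> tens.span B" using step by simp
    ultimately show ?case using step eq F G unfolding linear_on_def by (simp add: tens.span_add)
  qed
  then show ?thesis ..
qed

lemma vector_space_tscale: "vector_space tscale"
  by (rule tens.vector_space_axioms)

lemma TT_eqI:
  assumes "t \<in> TT s" "\<And>w. F (pure s w) = G (pure s w)"
    "linear_on tscale tscale (TT s) F" "linear_on tscale tscale (TT s) G"
  shows "F t = G t"
  using assms unfolding TT_def
  by (intro linear_on_eq_span[of tscale "range (pure s)" F G t])
     (auto intro: linear_on_mono tens.vector_space_axioms)

subsection \<open>Binding\<close>

lemma lin_tbind [lin_intros]: "linear_on s1 tscale X A \<Longrightarrow> linear_on s1 tscale X (\<lambda>x. tbind (A x) F)"
  by (simp add: linear_on_def tbind_def tscale_def fun_eq_iff plus_fun_apply)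

lemma tbind_simps:
  "tbind (x + y) F = tbind x F + tbind y F" "tbind (tscale c x) F = tscale c (tbind x F)"
  "tbind 0 F = 0"
  by (simp_all add: tbind_def tscale_def fun_eq_iff plus_fun_apply zero_fun_apply)

lemmas tbind_sum_list = lin_sum_list[OF lin_tbind[OF lin_id]]
lemmas tbind_sum_list2 = lin_sum_list2[OF lin_tbind[OF lin_id]]

lemma tbind_pure_mlin: "mlin s F \<Longrightarrow> tbind (pure s w) F = F w"
  by (intro tbind_pure mlin_multilinear)

lemma TT_tbind [TT_intros]:
  assumes t: "t \<in> TT s" and F: "mlin s F" "\<And>w. F w \<in> TT s'" shows "tbind t F \<in> TT s'"
proof -
  have "TT s \<subseteq> {t. tbind t F \<in> TT s'}"
    unfolding TT_def[of s]
    by (rule tens.span_minimal)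
      (auto simp: tens.subspace_def tbind_pure_mlin F tbind_simps intro: TT_intros)
  then show ?thesis using t by auto
qed

subsection \<open>Products\<close>

lemma tmult_TT_add_right:
  "x \<in> TT s \<Longrightarrow> y \<in> TT s \<Longrightarrow> z \<in> TT s \<Longrightarrow> tmult s x (y + z) = tmult s x y + tmult s x z"
  by (intro tmult_add_right TT_tensor_like)

lemma tmult_TT_tscale_right:
  "x \<in> TT s \<Longrightarrow> y \<in> TT s \<Longrightarrow> tmult s x (tscale c y) = tscale c (tmult s x y)"
  by (intro tmult_tscale_right TT_tensor_like)

lemma lin_tmult_left [lin_intros]: "linear_on s1 tscale X A \<Longrightarrow> linear_on s1 tscale X (\<lambda>x. tmult s (A x) y)"
  by (auto simp: linear_on_def tmult_add_left tmult_tscale_left)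

lemma lin_tmult_right [lin_intros]:
  "linear_on s1 tscale X A \<Longrightarrow> y \<in> TT s \<Longrightarrow> (\<And>x. x \<in> X \<Longrightarrow> A x \<in> TT s) \<Longrightarrow> linear_on s1 tscale X (\<lambda>x. tmult s y (A x))"
  by (auto simp: linear_on_def tmult_TT_add_right tmult_TT_tscale_right)

lemma TT_tmult [TT_intros]:
  assumes "x \<in> TT s" "y \<in> TT s" shows "tmult s x y \<in> TT s"
proof -
  have "TT s \<subseteq> {y. y \<in> TT s \<and> tmult s (pure s w) y \<in> TT s}" for w
    unfolding TT_def[of s]
    by (rule tens.span_minimal)
      (auto simp: tens.subspace_def TT_def[symmetric] tmult_pure tmult_TT_add_right tmult_TT_tscale_right
        tmult_zero_right TT_tensor_like intro: TT_intros)
  then have "TT s \<subseteq> {x. tmult s x y \<in> TT s}"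
    using assms(2) unfolding TT_def[of s]
    by (intro tens.span_minimal)
      (auto simp: tens.subspace_def tmult_add_left tmult_tscale_left
        tens.span_add tens.span_scale tens.span_zero lin_zero[OF lin_tmult_left[OF lin_id]])
  then show ?thesis using assms(1) by auto
qed

lemma tmult_assoc:
  "z \<in> TT s \<Longrightarrow> tmult s (tmult s x y) z = tmult s x (tmult s y z)"
  using multilinear_slice[OF _ TT_tensor_like[of z s]]
  by (auto simp: tmult_def fun_eq_iff multilinear_append_left)

lemma tmult_Nil_left [simp]: "y \<in> TT s \<Longrightarrow> tmult s (pure s []) y = y"
  using TT_tensor_like[of y s] multilinear_slice[OF _ TT_tensor_like[of y s]]
  by (auto simp: tmult_def fun_eq_iff pure_def tensor_like_def)

lemma tmult_Nil_right [simp]: "x \<in> TT s \<Longrightarrow> tmult s x (pure s []) = x"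
  using TT_tensor_like[of x s]
  by (auto simp: tmult_def fun_eq_iff pure_def tensor_like_def multilinear_append_left)

lemma tmult_zero_left [simp]: "tmult s 0 y = 0"
  by (auto simp: tmult_def fun_eq_iff zero_fun_apply)

lemma tmult_TT_zero_right [simp]: "x \<in> TT s \<Longrightarrow> tmult s x 0 = 0"
  by (intro tmult_zero_right TT_tensor_like)

lemmas tmult_sum_list_left = lin_sum_list[OF lin_tmult_left[OF lin_id]]
lemmas tmult_sum_list2_left = lin_sum_list2[OF lin_tmult_left[OF lin_id]]

lemma tmult_sum_list_right:
  "x \<in> TT s \<Longrightarrow> (\<And>p. p \<in> set ps \<Longrightarrow> F p \<in> TT s)
    \<Longrightarrow> tmult s x (\<Sum>p\<leftarrow>ps. F p) = (\<Sum>p\<leftarrow>ps. tmult s x (F p))"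
proof (induction ps)
  case (Cons p ps)
  have "(\<Sum>p\<leftarrow>ps. F p) \<in> TT s" using Cons.prems by (intro TT_sum_list) auto
  then show ?case using Cons by (simp add: tmult_TT_add_right)
next
  case Nil
  then show ?case using tmult_zero_right[OF TT_tensor_like] by simp
qed

lemma tmult_sum_list2_right:
  "x \<in> TT s \<Longrightarrow> (\<And>a b. (a, b) \<in> set ps \<Longrightarrow> F a b \<in> TT s)
    \<Longrightarrow> tmult s x (\<Sum>(a, b)\<leftarrow>ps. F a b) = (\<Sum>(a, b)\<leftarrow>ps. tmult s x (F a b))"
  using tmult_sum_list_right[of x s ps "\<lambda>p. F (fst p) (snd p)"] by (auto simp: case_prod_beta')

subsection \<open>Tensor powers\<close>

lemma tpow_subspace: "tens.subspace (tpow s V n)"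
  unfolding tpow_def by (rule tens.subspace_span)

lemma tpow_pure: "length w = n \<Longrightarrow> set w \<subseteq> V \<Longrightarrow> pure s w \<in> tpow s V n"
  unfolding tpow_def by (intro tens.span_base) auto

lemma tpow_mono: "V \<subseteq> W \<Longrightarrow> tpow s V n \<subseteq> tpow s W n"
  unfolding tpow_def by (rule tens.span_mono) auto

lemma tpow_TT: "tpow s V n \<subseteq> TT s"
  unfolding tpow_def TT_def by (rule tens.span_mono) auto

lemma tpow_minimal:
  "(\<And>w. length w = n \<Longrightarrow> set w \<subseteq> V \<Longrightarrow> pure s w \<in> X) \<Longrightarrow> tens.subspace X \<Longrightarrow> tpow s V n \<subseteq> X"
  unfolding tpow_def by (rule tens.span_minimal) auto

lemma tpow_eqI:
  assumes "t \<in> tpow s V n" "vector_space s2" "linear_on tscale s2 (tpow s V n) F" "linear_on tscale s2 (tpow s V n) G"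
    "\<And>w. length w = n \<Longrightarrow> set w \<subseteq> V \<Longrightarrow> F (pure s w) = G (pure s w)"
  shows "F t = G t"
  by (rule linear_on_eq_span[OF assms(3,4)[unfolded tpow_def] _ assms(1)[unfolded tpow_def] assms(2)]) (use assms(5) in auto)

lemma tpow_tbind:
  assumes "mlin s F" "\<And>w. length w = n \<Longrightarrow> set w \<subseteq> V \<Longrightarrow> F w \<in> X" "tens.subspace X" "t \<in> tpow s V n"
  shows "tbind t F \<in> X"
proof -
  have "tpow s V n \<subseteq> {t. tbind t F \<in> X}"
    by (rule tpow_minimal)
      (use assms in \<open>auto simp: tens.subspace_def tbind_simps tbind_pure_mlin\<close>)
  then show ?thesis using assms(4) by auto
qed

lemma tpow_tmult:
  assumes "x \<in> tpow s V n" "y \<in> tpow s V m" shows "tmult s x y \<in> tpow s V (n + m)"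
proof -
  have TT: "t \<in> tpow s V k \<Longrightarrow> t \<in> TT s" for t k using tpow_TT by auto
  have "tpow s V m \<subseteq> {y. y \<in> tpow s V m \<and> tmult s (pure s w) y \<in> tpow s V (n + m)}"
    if "length w = n" "set w \<subseteq> V" for w
    by (rule tpow_minimal)
      (use that tpow_subspace[of s V] in \<open>auto simp: tens.subspace_def tmult_pure tmult_TT_add_right
        tmult_TT_tscale_right TT tpow_pure\<close>)
  then have "tpow s V n \<subseteq> {x. tmult s x y \<in> tpow s V (n + m)}"
    using assms(2) tpow_subspace[of s V "n + m"]
    by (intro tpow_minimal)
      (auto simp: tens.subspace_def tmult_add_left tmult_tscale_left)
  then show ?thesis using assms(1) by auto
qed

text \<open>The scalar in front of each summand is absorbed into its first letter. This takes a
  letter to begin with, hence the positive degree.\<close>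

lemma tpow_list:
  assumes t: "t \<in> tpow s V n" and n: "n \<ge> 1" and V: "\<And>c v. v \<in> V \<Longrightarrow> s c v \<in> V"
  obtains ws where "\<And>w. w \<in> set ws \<Longrightarrow> length w = n \<and> set w \<subseteq> V" "t = (\<Sum>w\<leftarrow>ws. pure s w)"
proof -
  have "\<exists>ws. (\<forall>w\<in>set ws. length w = n \<and> set w \<subseteq> V) \<and> t = (\<Sum>w\<leftarrow>ws. pure s w)"
    using t unfolding tpow_def
  proof (induction rule: tens.span_induct_alt)
    case base then show ?case by (intro exI[of _ "[]"]) auto
  next
    case (step c x y)
    then obtain w ws where w: "x = pure s w" "length w = n" "set w \<subseteq> V"
      "\<forall>w\<in>set ws. length w = n \<and> set w \<subseteq> V" "y = (\<Sum>w\<leftarrow>ws. pure s w)" by auto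
    then obtain a v where av: "w = a # v" using n by (cases w) auto
    have "tscale c x = pure s (s c a # v)"
      using lin_scale[OF mlinD[OF mlin_pure, of s "[]" v], of c a] by (simp add: w av)
    then show ?case
      using w V by (intro exI[of _ "(s c a # v) # ws"]) (auto simp: av)
  qed
  then show ?thesis using that by blast
qed

subsection \<open>Homogeneous subspaces and their linear maps\<close>

text \<open>Lying in a single degree is what makes the span of the products of two subspaces a copy
  of their tensor product, so that \<open>tensor_map\<close> is well defined on it.\<close>

definition hsub :: "('k::field \<Rightarrow> 'e::ab_group_add \<Rightarrow> 'e) \<Rightarrow> nat \<Rightarrow> ('k, 'e) tensor set \<Rightarrow> bool" where
  "hsub s n X \<longleftrightarrow> tens.subspace X \<and> X \<subseteq> tpow s UNIV n"

lemma hsub_subspace: "hsub s n X \<Longrightarrow> tens.subspace X"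
  and hsub_tpow_UNIV: "hsub s n X \<Longrightarrow> x \<in> X \<Longrightarrow> x \<in> tpow s UNIV n"
  by (auto simp: hsub_def)

lemma hsub_TT: "hsub s n X \<Longrightarrow> x \<in> X \<Longrightarrow> x \<in> TT s"
  using tpow_TT[of s UNIV n] by (auto simp: hsub_def)

lemma hsub_homog: "hsub s n X \<Longrightarrow> X \<subseteq> {t. homog s n t}"
  using tpow_homog[of s UNIV n] by (auto simp: hsub_def)

lemma hsub_tpow: "hsub s n (tpow s V n)"
  unfolding hsub_def using tpow_mono[of V UNIV] tpow_subspace by auto

lemma tprod_subspace: "tens.subspace (tprod s X Y)"
  unfolding tprod_def by (rule tens.subspace_span)

lemma tprod_tmult: "x \<in> X \<Longrightarrow> y \<in> Y \<Longrightarrow> tmult s x y \<in> tprod s X Y"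
  unfolding tprod_def by (intro tens.span_base) auto

lemma tprod_minimal:
  "(\<And>x y. x \<in> X \<Longrightarrow> y \<in> Y \<Longrightarrow> tmult s x y \<in> Z) \<Longrightarrow> tens.subspace Z \<Longrightarrow> tprod s X Y \<subseteq> Z"
  unfolding tprod_def by (rule tens.span_minimal) auto

lemma hsub_tprod: "hsub s n X \<Longrightarrow> hsub s m Y \<Longrightarrow> hsub s (n + m) (tprod s X Y)"
  unfolding hsub_def by (intro conjI tprod_subspace tprod_minimal tpow_subspace tpow_tmult) auto

lemma tprod_eqI:
  assumes "t \<in> tprod s X Y" "vector_space s2" "linear_on tscale s2 (tprod s X Y) F" "linear_on tscale s2 (tprod s X Y) G"
    "\<And>x y. x \<in> X \<Longrightarrow> y \<in> Y \<Longrightarrow> F (tmult s x y) = G (tmult s x y)"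
  shows "F t = G t"
  by (rule linear_on_eq_span[OF assms(3,4)[unfolded tprod_def] _ assms(1)[unfolded tprod_def] assms(2)]) (use assms(5) in auto)

lemma tprod_list:
  assumes t: "t \<in> tprod s X Y" and X: "tens.subspace X"
  obtains ps where "set ps \<subseteq> X \<times> Y" "t = (\<Sum>(x, y)\<leftarrow>ps. tmult s x y)"
proof -
  have "\<exists>ps. set ps \<subseteq> X \<times> Y \<and> t = (\<Sum>(x, y)\<leftarrow>ps. tmult s x y)"
    using t unfolding tprod_def
  proof (induction rule: tens.span_induct_alt)
    case base then show ?case by (intro exI[of _ "[]"]) auto
  next
    case (step c x y)
    then obtain a b ps where "x = tmult s a b" "a \<in> X" "b \<in> Y"
      "set ps \<subseteq> X \<times> Y" "y = (\<Sum>(x, y)\<leftarrow>ps. tmult s x y)" by auto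
    then show ?case using X
      by (intro exI[of _ "(tscale c a, b) # ps"]) (auto simp: tmult_tscale_left tens.subspace_scale)
  qed
  then show ?thesis using that by blast
qed

lemma tprod_tpow: "tprod s (tpow s V n) (tpow s V m) = tpow s V (n + m)"
proof
  show "tprod s (tpow s V n) (tpow s V m) \<subseteq> tpow s V (n + m)"
    by (intro tprod_minimal tpow_tmult tpow_subspace)
  show "tpow s V (n + m) \<subseteq> tprod s (tpow s V n) (tpow s V m)"
  proof (rule tpow_minimal[OF _ tprod_subspace])
    fix w assume w: "length w = n + m" "set w \<subseteq> V"
    have "pure s w = tmult s (pure s (take n w)) (pure s (drop n w))" by (simp add: tmult_pure)
    also have "\<dots> \<in> tprod s (tpow s V n) (tpow s V m)"
      using w by (intro tprod_tmult tpow_pure) (auto dest: in_set_takeD in_set_dropD)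
    finally show "pure s w \<in> tprod s (tpow s V n) (tpow s V m)" .
  qed
qed

lemma tprod_unit_right:
  assumes "hsub s n X" shows "tprod s X (tpow s V 0) = X"
proof
  have "tpow s V 0 \<subseteq> {y. y \<in> TT s \<and> tmult s x y \<in> X}" if "x \<in> X" for x
    using hsub_TT[OF assms that] that hsub_subspace[OF assms]
    by (intro tpow_minimal) (auto simp: tens.subspace_def tmult_TT_add_right tmult_TT_tscale_right intro: TT_intros)
  then show "tprod s X (tpow s V 0) \<subseteq> X"
    by (intro tprod_minimal hsub_subspace[OF assms]) auto
  show "X \<subseteq> tprod s X (tpow s V 0)"
  proof
    fix x assume x: "x \<in> X"
    then have "tmult s x (pure s []) \<in> tprod s X (tpow s V 0)" by (intro tprod_tmult tpow_pure) auto
    then show "x \<in> tprod s X (tpow s V 0)" using hsub_TT[OF assms x] by simp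
  qed
qed

text \<open>The functions are total, but maps built by \<open>tensor_map\<close> are unspecified
  outside \<open>X\<close>; only their restriction to \<open>X\<close> is meant.\<close>

definition LM :: "('k::field, 'e) tensor set \<Rightarrow> ('k, 'd) tensor set
    \<Rightarrow> (('k, 'e) tensor \<Rightarrow> ('k, 'd) tensor) \<Rightarrow> bool" where
  "LM X Y F \<longleftrightarrow> linear_on tscale tscale X F \<and> (\<forall>x\<in>X. F x \<in> Y)"

lemma LM_linear: "LM X Y F \<Longrightarrow> linear_on tscale tscale X F"
  and LM_mem: "LM X Y F \<Longrightarrow> x \<in> X \<Longrightarrow> F x \<in> Y"
  by (auto simp: LM_def)

lemma LM_id: "LM X X id" "LM X X (\<lambda>x. x)"
  by (auto simp: LM_def linear_on_def)

lemma LM_comp: "LM Y Z G \<Longrightarrow> LM X Y F \<Longrightarrow> LM X Z (G \<circ> F)"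
  by (auto simp: LM_def linear_on_def)

lemma LM_sum: "tens.subspace Y \<Longrightarrow> (\<And>i. i \<in> I \<Longrightarrow> LM X Y (F i)) \<Longrightarrow> LM X Y (\<lambda>x. \<Sum>i\<in>I. F i x)"
  by (auto simp: LM_def linear_on_def sum.distrib tens.scale_sum_right intro!: tens.subspace_sum)

lemma LM_cong: "LM X Y F \<Longrightarrow> tens.subspace X \<Longrightarrow> (\<And>x. x \<in> X \<Longrightarrow> F x = G x) \<Longrightarrow> LM X Y G"
  by (auto simp: LM_def linear_on_def tens.subspace_def)

lemma lin_LM: "lin tscale tscale F \<Longrightarrow> (\<And>x. x \<in> X \<Longrightarrow> F x \<in> Y) \<Longrightarrow> LM X Y F"
  by (auto simp: LM_def intro: linear_on_mono)

lemma linear_on_sum_list: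
  assumes "linear_on tscale s2 X F" "tens.subspace X" "vector_space s2" "\<And>p. p \<in> set ps \<Longrightarrow> G p \<in> X"
  shows "F (\<Sum>p\<leftarrow>ps. G p) = (\<Sum>p\<leftarrow>ps. F (G p))"
proof -
  interpret s2: vector_space s2 by fact
  have "F (tscale 0 0) = s2 0 (F 0)" using assms(1,2) unfolding linear_on_def tens.subspace_def by blast
  then have z: "F 0 = 0" by simp
  show ?thesis using assms(4)
  proof (induction ps)
    case (Cons p ps)
    have "(\<Sum>p\<leftarrow>ps. G p) \<in> X" using Cons.prems assms(2) by (intro subspace_sum_list) auto
    then show ?case using Cons assms(1) by (simp add: linear_on_def)
  qed (use z in simp)
qed

lemma linear_on_sum_list2:
  assumes "linear_on tscale s2 X F" "tens.subspace X" "vector_space s2" "\<And>a b. (a, b) \<in> set ps \<Longrightarrow> G a b \<in> X"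
  shows "F (\<Sum>(a, b)\<leftarrow>ps. G a b) = (\<Sum>(a, b)\<leftarrow>ps. F (G a b))"
  using linear_on_sum_list[OF assms(1-3), of ps "\<lambda>p. G (fst p) (snd p)"] assms(4) by (auto simp: case_prod_beta')

lemmas LM_sum_list2 = linear_on_sum_list2[OF LM_linear _ vector_space_tscale]
text \<open>By \<open>tensor_map_sum\<close> the value can be computed from any list of products
  that represents the tensor: appending lists gives additivity, scaling the left entries gives
  homogeneity.\<close>

lemma tensor_map_LM:
  fixes s :: "'k::field \<Rightarrow> 'e::ab_group_add \<Rightarrow> 'e" and s' :: "'k \<Rightarrow> 'd::ab_group_add \<Rightarrow> 'd"
  assumes X: "hsub s n X" and Y: "hsub s m Y" and F: "LM X X' F" and G: "LM Y Y' G"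
    and X': "X' \<subseteq> TT s'" and Y': "Y' \<subseteq> TT s'"
  shows "LM (tprod s X Y) (tprod s' X' Y') (tensor_map s s' X F Y G)"
    and "\<And>x y. x \<in> X \<Longrightarrow> y \<in> Y \<Longrightarrow> tensor_map s s' X F Y G (tmult s x y) = tmult s' (F x) (G y)"
proof -
  let ?T = "tensor_map s s' X F Y G"
  have sum: "?T (\<Sum>(x, y)\<leftarrow>ps. tmult s x y) = (\<Sum>(x, y)\<leftarrow>ps. tmult s' (F x) (G y))"
    if "set ps \<subseteq> X \<times> Y" for ps
    by (rule tensor_map_sum[OF hsub_subspace[OF X] hsub_homog[OF X] hsub_subspace[OF Y] hsub_homog[OF Y]
      LM_linear[OF F] _ LM_linear[OF G] _ that]) (use F G X' Y' in \<open>auto simp: LM_def intro!: TT_tensor_like\<close>)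
  show "?T (tmult s x y) = tmult s' (F x) (G y)" if "x \<in> X" "y \<in> Y" for x y
    using sum[of "[(x, y)]"] that by simp
  show "LM (tprod s X Y) (tprod s' X' Y') ?T"
    unfolding LM_def linear_on_def
  proof (intro conjI ballI allI)
    fix t u c assume t: "t \<in> tprod s X Y" and u: "u \<in> tprod s X Y"
    obtain ps where ps: "set ps \<subseteq> X \<times> Y" "t = (\<Sum>(x, y)\<leftarrow>ps. tmult s x y)"
      using tprod_list[OF t hsub_subspace[OF X]] by blast
    obtain qs where qs: "set qs \<subseteq> X \<times> Y" "u = (\<Sum>(x, y)\<leftarrow>qs. tmult s x y)"
      using tprod_list[OF u hsub_subspace[OF X]] by blast
    show "?T (t + u) = ?T t + ?T u"
      using sum[of "ps @ qs"] sum[of ps] sum[of qs] ps qs by simp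
  next
    fix t c assume t: "t \<in> tprod s X Y"
    obtain ps where ps: "set ps \<subseteq> X \<times> Y" "t = (\<Sum>(x, y)\<leftarrow>ps. tmult s x y)"
      using tprod_list[OF t hsub_subspace[OF X]] by blast
    let ?qs = "map (\<lambda>(x, y). (tscale c x, y)) ps"
    have qs: "set ?qs \<subseteq> X \<times> Y" using ps(1) hsub_subspace[OF X] by (auto intro: tens.subspace_scale)
    have "tscale c t = (\<Sum>(x, y)\<leftarrow>?qs. tmult s x y)" unfolding ps(2)
      by (induction ps) (auto simp: tens.scale_right_distrib tmult_tscale_left)
    moreover have "tscale c (\<Sum>(x, y)\<leftarrow>ps. tmult s' (F x) (G y)) = (\<Sum>(x, y)\<leftarrow>?qs. tmult s' (F x) (G y))"
      using ps(1) LM_linear[OF F]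
      by (induction ps) (auto simp: tens.scale_right_distrib tmult_tscale_left linear_on_def)
    ultimately show "?T (tscale c t) = tscale c (?T t)" using sum[OF qs] sum[OF ps(1)] ps(2) by simp
  next
    fix t assume t: "t \<in> tprod s X Y"
    obtain ps where ps: "set ps \<subseteq> X \<times> Y" "t = (\<Sum>(x, y)\<leftarrow>ps. tmult s x y)"
      using tprod_list[OF t hsub_subspace[OF X]] by blast
    show "?T t \<in> tprod s' X' Y'"
      unfolding ps(2) sum[OF ps(1)]
      by (rule subspace_sum_list2[OF tprod_subspace]) (use ps(1) F G in \<open>auto simp: LM_def intro!: tprod_tmult\<close>)
  qed
qed

lemmas tensor_map_tmult = tensor_map_LM(2)

text \<open>Replaces a map that is linear on a subspace by one that is linear everywhere and agrees
  with it there; \<open>F_extension\<close> does this for convolution powers.\<close>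

lemma subspace_projection:
  assumes "tens.subspace X"
  obtains \<pi> where "lin tscale tscale \<pi>" "\<And>t. \<pi> t \<in> X" "\<And>t. t \<in> X \<Longrightarrow> \<pi> t = t"
proof -
  interpret tp: vector_space_pair "tscale :: 'a \<Rightarrow> ('a, 'b) tensor \<Rightarrow> _" "tscale :: 'a \<Rightarrow> ('a, 'b) tensor \<Rightarrow> _" ..
  obtain g where g: "g ` UNIV \<subseteq> X" "Vector_Spaces.linear tscale tscale g" "\<forall>v\<in>X. g v = v"
    using tp.linear_exists_left_inverse_on[OF tens.linear_id assms] by auto
  interpret g: Vector_Spaces.linear tscale tscale g by fact
  show ?thesis
  proof (rule that)
    show "lin tscale tscale g" by (simp add: lin_iff g.add g.scale)
  qed (use g in auto)
qed

section \<open>Convolution powers\<close>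

lemma tensor_map_sum_right:
  assumes X: "hsub s n X" and Y: "hsub s m Y" and F: "LM X X' F" and G: "\<And>i. i \<in> I \<Longrightarrow> LM Y Y' (G i)"
    and X': "X' \<subseteq> TT s'" and Y': "tens.subspace Y'" "Y' \<subseteq> TT s'" and u: "u \<in> tprod s X Y"
  shows "tensor_map s s' X F Y (\<lambda>t. \<Sum>i\<in>I. G i t) u = (\<Sum>i\<in>I. tensor_map s s' X F Y (G i) u)"
proof -
  have GI: "LM Y Y' (\<lambda>t. \<Sum>i\<in>I. G i t)" using Y' G by (intro LM_sum)
  note T = tensor_map_LM[OF X Y F GI X' Y'(2)]
  note Ti = tensor_map_LM[OF X Y F G X' Y'(2)]
  show ?thesis
  proof (rule tprod_eqI[OF u vector_space_tscale LM_linear[OF T(1)] LM_linear[OF LM_sum[OF tprod_subspace Ti(1)]]])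
    fix x y assume x: "x \<in> X" and y: "y \<in> Y"
    have "tmult s' (F x) (\<Sum>i\<in>I. G i y) = (\<Sum>i\<in>I. tmult s' (F x) (G i y))"
      using x y LM_mem[OF F] LM_mem[OF G] X' Y' by (intro tmult_sum_right TT_tensor_like) auto
    then show "tensor_map s s' X F Y (\<lambda>t. \<Sum>i\<in>I. G i t) (tmult s x y)
        = (\<Sum>i\<in>I. tensor_map s s' X F Y (G i) (tmult s x y))"
      using T(2) Ti(2) x y by simp
  qed auto
qed

lemma tensor_map_comp:
  assumes X: "hsub s n X" and Y: "hsub s m Y" and F: "LM X X' F" and G: "LM Y Y' G"
    and X': "hsub s' n' X'" and Y': "hsub s' m' Y'"
    and F': "LM X' X'' F'" "X'' \<subseteq> TT s''" and G': "LM Y' Y'' G'" "Y'' \<subseteq> TT s''" and u: "u \<in> tprod s X Y"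
  shows "tensor_map s' s'' X' F' Y' G' (tensor_map s s' X F Y G u)
    = tensor_map s s'' X (F' \<circ> F) Y (G' \<circ> G) u"
proof -
  have TT: "X' \<subseteq> TT s'" "Y' \<subseteq> TT s'" using hsub_TT[OF X'] hsub_TT[OF Y'] by auto
  note 1 = tensor_map_LM[OF X Y F G TT]
  note 2 = tensor_map_LM[OF X' Y' F'(1) G'(1) F'(2) G'(2)]
  note 3 = tensor_map_LM[OF X Y LM_comp[OF F'(1) F] LM_comp[OF G'(1) G] F'(2) G'(2)]
  have "(tensor_map s' s'' X' F' Y' G' \<circ> tensor_map s s' X F Y G) u = tensor_map s s'' X (F' \<circ> F) Y (G' \<circ> G) u"
    by (rule tprod_eqI[OF u vector_space_tscale LM_linear[OF LM_comp[OF 2(1) 1(1)]] LM_linear[OF 3(1)]])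
      (simp add: 1(2) 2(2) 3(2) LM_mem[OF F] LM_mem[OF G])
  then show ?thesis by simp
qed

lemma bidegree_splits_Suc_sum:
  "(\<Sum>ps\<in>bidegree_splits (Suc n) i j. F ps)
    = (\<Sum>p\<le>i. \<Sum>q\<le>j. \<Sum>ps\<in>bidegree_splits n (i - p) (j - q). F ((p, q) # ps))"
proof -
  let ?S = "SIGMA pq:{..i} \<times> {..j}. bidegree_splits n (i - fst pq) (j - snd pq)"
  have "bij_betw (\<lambda>(pq, ps). pq # ps) ?S (bidegree_splits (Suc n) i j)"
    by (rule bij_betw_byWitness[where f' = "\<lambda>ps. (hd ps, tl ps)"])
      (auto simp: bidegree_splits_def length_Suc_conv)
  then have "(\<Sum>ps\<in>bidegree_splits (Suc n) i j. F ps) = (\<Sum>x\<in>?S. F (case x of (pq, ps) \<Rightarrow> pq # ps))"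
    by (rule sum.reindex_bij_betw[symmetric])
  also have "\<dots> = (\<Sum>pq\<in>{..i} \<times> {..j}. \<Sum>ps\<in>bidegree_splits n (i - fst pq) (j - snd pq). F (pq # ps))"
    by (subst sum.Sigma) (auto simp: finite_bidegree_splits intro!: sum.cong)
  also have "\<dots> = (\<Sum>p\<le>i. \<Sum>q\<le>j. \<Sum>ps\<in>bidegree_splits n (i - p) (j - q). F ((p, q) # ps))"
    by (simp add: sum.cartesian_product case_prod_beta')
  finally show ?thesis .
qed

lemma bidegree_splits_1: "bidegree_splits (Suc 0) i j = {[(i, j)]}"
  by (auto simp: bidegree_splits_def length_Suc_conv)

text \<open>Its two instances are the tensor square of the cotensor coalgebra and the twisted tensor
  square of the tensor algebra of the coinvariants. The parameter \<open>d\<close> gives the tensor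
  degree of each component. It differs between the two, since degree zero of the cotensor coalgebra
  is \<open>H\<close>, a space of tensors of degree one.\<close>

locale bigraded_coalgebra =
  fixes s :: "'k::field \<Rightarrow> 'e::ab_group_add \<Rightarrow> 'e" and D :: "('k, 'e) bigraded_space"
    and cop :: "('k, 'e) bigraded_coprod" and F :: "('k, 'e, ('k, 'e) tensor) bigraded_map"
    and d :: "nat \<Rightarrow> nat \<Rightarrow> nat"
  assumes D: "\<And>p q. hsub s (d p q) (D p q)"
    and cop: "\<And>p q p' q'. LM (D (p + p') (q + q')) (tprod s (D p q) (D p' q')) (cop p q p' q')"
    and F: "\<And>p q. LM (D p q) (tpow s UNIV 1) (F p q)"
begin

lemma hsub_tensor_list: "\<exists>n. hsub s n (tensor_list s D ps)"
proof (induction ps)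
  case Nil
  show ?case using hsub_tpow[of s 0 UNIV] by auto
next
  case (Cons pq ps)
  then obtain n where "hsub s n (tensor_list s D ps)" ..
  then have "hsub s (d (fst pq) (snd pq) + n) (tprod s (D (fst pq) (snd pq)) (tensor_list s D ps))"
    by (intro hsub_tprod D)
  then show ?case by (cases pq) auto
qed

lemma tensor_list_map_LM:
  "LM (tensor_list s D ps) (tpow s UNIV (length ps)) (tensor_list_map s D F ps)"
proof (induction ps)
  case Nil
  show ?case by (simp add: LM_id)
next
  case (Cons pq ps)
  obtain n where n: "hsub s n (tensor_list s D ps)" using hsub_tensor_list ..
  show ?case
    using tensor_map_LM(1)[OF D n F Cons tpow_TT tpow_TT] by (cases pq) (simp add: tprod_tpow)
qed

lemma iter_coprod_LM:
  "ps \<noteq> [] \<Longrightarrow> LM (D (sum_list (map fst ps)) (sum_list (map snd ps))) (tensor_list s D ps) (iter_coprod s D cop ps)"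
proof (induction ps)
  case (Cons pq ps)
  obtain p q where pq: "pq = (p, q)" by (cases pq)
  show ?case
  proof (cases ps)
    case Nil
    then show ?thesis by (simp add: pq tprod_unit_right[OF D] LM_id)
  next
    case (Cons r rs)
    obtain n where n: "hsub s n (tensor_list s D ps)" using hsub_tensor_list ..
    have TT: "D p q \<subseteq> TT s" "tensor_list s D ps \<subseteq> TT s" using hsub_TT[OF D] hsub_TT[OF n] by auto
    have "LM (tprod s (D p q) (D (sum_list (map fst ps)) (sum_list (map snd ps))))
        (tprod s (D p q) (tensor_list s D ps))
        (tensor_map s s (D p q) id (D (sum_list (map fst ps)) (sum_list (map snd ps))) (iter_coprod s D cop ps))"
      using Cons by (intro tensor_map_LM(1)[OF D D LM_id(1) _ TT] Cons.IH) simp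
    then show ?thesis
      using LM_comp[OF _ cop] by (auto simp: pq Cons Let_def comp_def)
  qed
qed simp

lemma map_iter_coprod_LM:
  "ps \<noteq> [] \<Longrightarrow> LM (D (sum_list (map fst ps)) (sum_list (map snd ps))) (tpow s UNIV (length ps))
     (\<lambda>t. tensor_list_map s D F ps (iter_coprod s D cop ps t))"
  using LM_comp[OF tensor_list_map_LM iter_coprod_LM, of ps] by (simp add: comp_def)

lemma map_iter_coprod_Cons:
  assumes "ps \<noteq> []" and t: "t \<in> D (p + sum_list (map fst ps)) (q + sum_list (map snd ps))"
  shows "tensor_list_map s D F ((p, q) # ps) (iter_coprod s D cop ((p, q) # ps) t)
    = tensor_map s s (D p q) (F p q) (D (sum_list (map fst ps)) (sum_list (map snd ps)))
        (\<lambda>t. tensor_list_map s D F ps (iter_coprod s D cop ps t))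
        (cop p q (sum_list (map fst ps)) (sum_list (map snd ps)) t)"
proof -
  obtain r rs where ps: "ps = r # rs" using assms(1) by (cases ps) auto
  obtain n where n: "hsub s n (tensor_list s D ps)" using hsub_tensor_list ..
  show ?thesis
    using tensor_map_comp[OF D D LM_id(1) iter_coprod_LM[OF assms(1)] D n F tpow_TT tensor_list_map_LM tpow_TT
      LM_mem[OF cop t]]
    by (simp add: ps Let_def comp_def)
qed

lemma conv_power_LM: "n \<ge> 1 \<Longrightarrow> LM (D i j) (tpow s UNIV n) (conv_power s D cop F n i j)"
  unfolding conv_power_def
proof (rule LM_sum[OF tpow_subspace])
  fix ps assume "n \<ge> 1" "ps \<in> bidegree_splits n i j"
  then show "LM (D i j) (tpow s UNIV n) (\<lambda>t. tensor_list_map s D F ps (iter_coprod s D cop ps t))"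
    using map_iter_coprod_LM[of ps] by (cases ps) (auto simp: bidegree_splits_def)
qed

lemma conv_power_1: "t \<in> D i j \<Longrightarrow> conv_power s D cop F (Suc 0) i j t = F i j t"
  using tensor_map_tmult[OF D hsub_tpow F LM_id(1) tpow_TT tpow_TT, of t i j "pure s []" UNIV 0]
    hsub_TT[OF D, of t i j] LM_mem[OF F, of t i j] tpow_TT[of s UNIV 1]
  by (auto simp: conv_power_def bidegree_splits_1 tpow_pure subset_iff)

text \<open>\<open>iter_coprod\<close> is nested to the right, so the first factor can be split off
  and the others summed to the next lower power. The later inductions on the number of factors rest
  on this recursion.\<close>

lemma conv_power_Suc:
  assumes n: "n \<ge> 1" and t: "t \<in> D i j"
  shows "conv_power s D cop F (Suc n) i j t = (\<Sum>p\<le>i. \<Sum>q\<le>j.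
    tensor_map s s (D p q) (F p q) (D (i - p) (j - q)) (conv_power s D cop F n (i - p) (j - q))
      (cop p q (i - p) (j - q) t))"
  unfolding conv_power_def[of s D cop F "Suc n"] bidegree_splits_Suc_sum
proof (intro sum.cong refl)
  fix p q assume pq: "p \<in> {..i}" "q \<in> {..j}"
  let ?G = "\<lambda>ps t. tensor_list_map s D F ps (iter_coprod s D cop ps t)"
  have G: "LM (D (i - p) (j - q)) (tpow s UNIV n) (?G ps)" if "ps \<in> bidegree_splits n (i - p) (j - q)" for ps
    using map_iter_coprod_LM[of ps] that n by (cases ps) (auto simp: bidegree_splits_def)
  have c: "cop p q (i - p) (j - q) t \<in> tprod s (D p q) (D (i - p) (j - q))"
    using LM_mem[OF cop, of t p "i - p" q "j - q"] t pq by simp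
  have "(\<Sum>ps\<in>bidegree_splits n (i - p) (j - q). ?G ((p, q) # ps) t)
    = (\<Sum>ps\<in>bidegree_splits n (i - p) (j - q).
        tensor_map s s (D p q) (F p q) (D (i - p) (j - q)) (?G ps) (cop p q (i - p) (j - q) t))"
  proof (intro sum.cong refl)
    fix ps assume "ps \<in> bidegree_splits n (i - p) (j - q)"
    then show "?G ((p, q) # ps) t
      = tensor_map s s (D p q) (F p q) (D (i - p) (j - q)) (?G ps) (cop p q (i - p) (j - q) t)"
      using map_iter_coprod_Cons[of ps t p q] t pq n by (cases ps) (auto simp: bidegree_splits_def)
  qed
  also have "\<dots> = tensor_map s s (D p q) (F p q) (D (i - p) (j - q))
      (\<lambda>t. \<Sum>ps\<in>bidegree_splits n (i - p) (j - q). ?G ps t) (cop p q (i - p) (j - q) t)"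
    by (rule tensor_map_sum_right[OF D D F G tpow_TT tpow_subspace tpow_TT c, symmetric])
  finally show "(\<Sum>ps\<in>bidegree_splits n (i - p) (j - q). ?G ((p, q) # ps) t)
    = tensor_map s s (D p q) (F p q) (D (i - p) (j - q)) (conv_power s D cop F n (i - p) (j - q))
      (cop p q (i - p) (j - q) t)"
    unfolding conv_power_def .
qed

end

section \<open>Sums over words\<close>

lemma lin_0 [lin_intros]: "linear_on s tscale X (\<lambda>x. 0)"
  by (simp add: linear_on_def)

lemma mlin_case2:
  fixes s :: "'k::field \<Rightarrow> 'e::ab_group_add \<Rightarrow> 'e"
  assumes "\<And>b. lin s tscale (\<lambda>a. F a b)" "\<And>a. lin s tscale (\<lambda>b. F a b)"
  shows "mlin s (\<lambda>w. case w of [a, b] \<Rightarrow> F a b | _ \<Rightarrow> 0)"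
proof -
  have *: "(case w of [a, b] \<Rightarrow> F a b | _ \<Rightarrow> 0) = (if length w = 2 then F (w ! 0) (w ! 1) else 0)" for w
    by (auto split: list.split)
  have "length u + length v = 1 \<Longrightarrow> u = [] \<and> (\<exists>b. v = [b]) \<or> (\<exists>a. u = [a]) \<and> v = []" for u v :: "'e list"
    by (cases u; cases v) auto
  note c = this
  show ?thesis unfolding mlin_def
  proof (intro allI)
    fix u v
    show "lin s tscale (\<lambda>x. case u @ x # v of [a, b] \<Rightarrow> F a b | _ \<Rightarrow> 0)"
      using c[of u v] assms unfolding * by (cases "length u + length v = 1") (auto intro: lin_0)
  qed
qed

lemma mlin_case3:
  fixes s :: "'k::field \<Rightarrow> 'e::ab_group_add \<Rightarrow> 'e"
  assumes "\<And>b c. lin s tscale (\<lambda>a. F a b c)" "\<And>a c. lin s tscale (\<lambda>b. F a b c)"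
    "\<And>a b. lin s tscale (\<lambda>c. F a b c)"
  shows "mlin s (\<lambda>w. case w of [a, b, c] \<Rightarrow> F a b c | _ \<Rightarrow> 0)"
proof -
  have *: "(case w of [a, b, c] \<Rightarrow> F a b c | _ \<Rightarrow> 0) = (if length w = 3 then F (w ! 0) (w ! 1) (w ! 2) else 0)" for w
    by (auto split: list.split)
  have "length u + length v = 2 \<Longrightarrow> u = [] \<and> (\<exists>b c. v = [b, c]) \<or> (\<exists>a. u = [a]) \<and> (\<exists>c. v = [c])
      \<or> (\<exists>a b. u = [a, b]) \<and> v = []" for u v :: "'e list"
    by (auto simp: neq_Nil_conv length_Suc_conv numeral_2_eq_2 add_eq_if split: if_splits)
  note c = this
  show ?thesis unfolding mlin_def
  proof (intro allI)
    fix u v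
    show "lin s tscale (\<lambda>x. case u @ x # v of [a, b, c] \<Rightarrow> F a b c | _ \<Rightarrow> 0)"
      using c[of u v] assms unfolding *
      by (cases "length u + length v = 2") (auto simp: eval_nat_numeral intro: lin_0)
  qed
qed

lemma tlift_sum_list:
  assumes "vector_space s'" "mlin s (\<lambda>w. pure s' [F w])"
  shows "tlift s' F (\<Sum>w\<leftarrow>ws. pure s w) = (\<Sum>w\<leftarrow>ws. F w)"
proof -
  have "tbind (\<Sum>w\<leftarrow>ws. pure s w) (\<lambda>w. pure s' [F w]) = pure s' [\<Sum>w\<leftarrow>ws. F w]"
    by (simp add: tbind_sum_list tbind_pure_mlin[OF assms(2)] lin_sum_list[OF lin_pure1[OF lin_id]])
  then show ?thesis
    unfolding tlift_def by (intro the_equality) (auto simp: pure_single_inject[OF assms(1)])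
qed

lemma lin_module: "Vector_Spaces.linear s1 s2 F \<longleftrightarrow> vector_space s1 \<and> vector_space s2 \<and> lin s1 s2 F"
  by (auto simp: Vector_Spaces.linear_def linear_on_def module_hom_def module_hom_axioms_def module_iff_vector_space)

section \<open>Sweedler sums over a Hopf algebra\<close>

lemma tbind_0_right: "t \<in> TT s \<Longrightarrow> tbind t (\<lambda>_. 0) = 0"
  by (rule TT_eqI[of t s "\<lambda>t. tbind t (\<lambda>_. 0)" "\<lambda>_. 0"])
    (auto simp: tbind_pure_mlin mlin_def lin_0 intro!: lin_intros)

lemma mlin_tmult_slot:
  fixes s :: "'k::field \<Rightarrow> 'e::ab_group_add \<Rightarrow> 'e"
  assumes F: "lin s tscale F" "\<And>x. F x \<in> TT s"
  shows "mlin s (\<lambda>w. if i < length w then tmult s (pure s (take i w)) (tmult s (F (w ! i)) (pure s (drop (Suc i) w))) else 0)"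
proof -
  show ?thesis unfolding mlin_def
  proof (intro allI)
    fix u v :: "'e list"
    \<comment> \<open>The varying letter lies in the slot, to the left of it, or to the right of
      it.\<close>
    consider "length u = i" | "length u < i" | "i < length u" by linarith
    then show "lin s tscale (\<lambda>x. if i < length (u @ x # v) then tmult s (pure s (take i (u @ x # v)))
      (tmult s (F ((u @ x # v) ! i)) (pure s (drop (Suc i) (u @ x # v)))) else 0)"
    proof cases
      case 1
      then show ?thesis
        by (auto intro!: lin_tmult_right lin_tmult_left F TT_intros)
    next
      case 2
      then obtain k where k: "i = length u + Suc k" using less_iff_Suc_add by auto
      have "lin s tscale (\<lambda>x. tmult s (pure s (u @ x # take k v)) (tmult s (F (v ! k)) (pure s (drop (Suc k) v))))"
        by (intro lin_tmult_left mlinD[OF mlin_pure])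
      then show ?thesis unfolding k by (cases "k < length v") (simp_all add: nth_append lin_0)
    next
      case 3
      then obtain k where k: "length u = i + Suc k" using less_iff_Suc_add by auto
      have "lin s tscale (\<lambda>x. tmult s (pure s (take i u)) (tmult s (F (u ! i)) (pure s (drop (Suc i) u @ x # v))))"
        by (intro lin_tmult_right mlinD[OF mlin_pure] TT_intros F)
      then show ?thesis using 3 by (auto simp: nth_append)
    qed
  qed
qed

lemma apply_at_pure:
  assumes "lin s tscale F" "\<And>x. F x \<in> TT s"
  shows "apply_at s i F (pure s w) = (if i < length w
      then tmult s (pure s (take i w)) (tmult s (F (w ! i)) (pure s (drop (Suc i) w))) else 0)"
  unfolding apply_at_def by (rule tbind_pure_mlin[OF mlin_tmult_slot[OF assms]])

lemma lin_apply_at [lin_intros]: "linear_on s1 tscale X A \<Longrightarrow> linear_on s1 tscale X (\<lambda>x. apply_at s i F (A x))"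
  unfolding apply_at_def by (rule lin_tbind)

lemma TT_apply_at [TT_intros]:
  "lin s tscale F \<Longrightarrow> (\<And>x. F x \<in> TT s) \<Longrightarrow> t \<in> TT s \<Longrightarrow> apply_at s i F t \<in> TT s"
  unfolding apply_at_def by (rule TT_tbind[OF _ mlin_tmult_slot]) (auto intro: TT_intros)

text \<open>Sweedler notation: an arbitrary list of pairs representing the coproduct. Sums over it
  are independent of the choice when the summand is bilinear, because they then equal a
  \<open>tbind\<close> of the coproduct.\<close>

definition cop :: "('k::field, 'h::ring_1) hopf_data \<Rightarrow> 'h \<Rightarrow> ('h \<times> 'h) list" where
  "cop H x = (SOME ps. comult H x = (\<Sum>(a, b)\<leftarrow>ps. pure (hscale H) [a, b]))"

locale hopf =
  fixes H :: "('k::field, 'h::ring_1) hopf_data"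
  assumes hopf: "hopf_algebra H"
begin

abbreviation hs where "hs \<equiv> hscale H"
abbreviation \<epsilon> where "\<epsilon> \<equiv> counit H"
abbreviation S where "S \<equiv> antipode H"

lemma vs_h: "vector_space hs"
  and h_scale_mult: "hs c x * y = hs c (x * y)" "x * hs c y = hs c (x * y)"
  and lin_comult: "lin hs tscale (comult H)"
  and comult_tpow: "comult H x \<in> tpow hs UNIV 2"
  and lin_counit: "lin hs (*) \<epsilon>"
  and coassoc: "apply_at hs 0 (comult H) (comult H x) = apply_at hs 1 (comult H) (comult H x)"
  and counit_l: "tlift hs (\<lambda>w. case w of [a, b] \<Rightarrow> hs (\<epsilon> a) b | _ \<Rightarrow> 0) (comult H x) = x"
  and counit_r: "tlift hs (\<lambda>w. case w of [a, b] \<Rightarrow> hs (\<epsilon> b) a | _ \<Rightarrow> 0) (comult H x) = x"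
  and comult_mult: "comult H (x * y) = tbind (comult H x) (\<lambda>u. tbind (comult H y) (\<lambda>v.
          case (u, v) of ([a, b], [c, d]) \<Rightarrow> pure hs [a * c, b * d] | _ \<Rightarrow> 0))"
  and comult_1: "comult H 1 = pure hs [1, 1]"
  and counit_mult: "\<epsilon> (x * y) = \<epsilon> x * \<epsilon> y" and counit_1: "\<epsilon> 1 = 1"
  and lin_S: "lin hs hs S"
  and antipode_l: "tlift hs (\<lambda>w. case w of [a, b] \<Rightarrow> S a * b | _ \<Rightarrow> 0) (comult H x) = hs (\<epsilon> x) 1"
  and antipode_r: "tlift hs (\<lambda>w. case w of [a, b] \<Rightarrow> a * S b | _ \<Rightarrow> 0) (comult H x) = hs (\<epsilon> x) 1"
  using hopf unfolding hopf_algebra_def Let_def lin_module by blast+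

lemma lin_h_mult [lin_intros]:
  "linear_on s1 hs X A \<Longrightarrow> linear_on s1 hs X (\<lambda>x. A x * b)" "linear_on s1 hs X A \<Longrightarrow> linear_on s1 hs X (\<lambda>x. b * A x)"
  by (auto simp: linear_on_def algebra_simps h_scale_mult)

lemma lin_S_comp [lin_intros]: "linear_on s1 hs X A \<Longrightarrow> linear_on s1 hs X (\<lambda>x. S (A x))"
  by (rule lin_comp[OF lin_S])

lemma lin_counit_comp [lin_intros]: "linear_on s1 hs X A \<Longrightarrow> linear_on s1 tscale X (\<lambda>x. tscale (\<epsilon> (A x)) t)"
  using lin_counit by (auto simp: linear_on_def tens.scale_left_distrib)

lemma lin_tscale_const [lin_intros]: "linear_on s1 tscale X A \<Longrightarrow> linear_on s1 tscale X (\<lambda>x. tscale c (A x))"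
  by (auto simp: linear_on_def tens.scale_right_distrib mult.commute)

lemma cop: "comult H x = (\<Sum>(a, b)\<leftarrow>cop H x. pure hs [a, b])"
proof -
  obtain ws where ws: "\<And>w. w \<in> set ws \<Longrightarrow> length w = 2" "comult H x = (\<Sum>w\<leftarrow>ws. pure hs w)"
    using tpow_list[OF comult_tpow[of x]] by auto
  have *: "pure hs w = pure hs [w ! 0, w ! 1]" if "w \<in> set ws" for w
    using ws(1)[OF that] by (intro arg_cong[where f = "pure hs"]) (auto simp: length_Suc_conv numeral_2_eq_2)
  have "(\<Sum>w\<leftarrow>ws. pure hs w) = (\<Sum>w\<leftarrow>ws. pure hs [w ! 0, w ! 1])"
    by (rule arg_cong[where f = sum_list], rule map_cong[OF refl], rule *)
  then have "(\<Sum>w\<leftarrow>ws. pure hs w) = (\<Sum>(a, b)\<leftarrow>map (\<lambda>w. (w ! 0, w ! 1)) ws. pure hs [a, b])"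
    by (simp add: comp_def)
  then show ?thesis unfolding cop_def ws(2) by (rule someI)
qed

lemma tbind_comult:
  assumes "\<And>b. lin hs tscale (\<lambda>a. F a b)" "\<And>a. lin hs tscale (\<lambda>b. F a b)"
  shows "tbind (comult H x) (\<lambda>w. case w of [a, b] \<Rightarrow> F a b | _ \<Rightarrow> 0) = (\<Sum>(a, b)\<leftarrow>cop H x. F a b)"
  by (simp add: cop[of x] tbind_sum_list2 tbind_pure_mlin[OF mlin_case2[OF assms]])

text \<open>The list \<open>cop H x\<close> itself does not depend linearly on \<open>x\<close>.
  Linearity of the sum comes from writing it as a \<open>tbind\<close> of the coproduct.\<close>

lemma lin_cop [lin_intros]:
  assumes "linear_on s1 hs X A" "\<And>b. lin hs tscale (\<lambda>a. F a b)" "\<And>a. lin hs tscale (\<lambda>b. F a b)"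
  shows "linear_on s1 tscale X (\<lambda>x. \<Sum>(a, b)\<leftarrow>cop H (A x). F a b)"
  unfolding tbind_comult[OF assms(2,3), symmetric] by (intro lin_tbind lin_comp[OF lin_comult] assms(1))

text \<open>The two sums are the values of one trilinear function on the two sides of
  coassociativity, read as tensors of degree three.\<close>

lemma cop_coassoc:
  assumes F: "\<And>b c. lin hs tscale (\<lambda>a. F a b c)" "\<And>a c. lin hs tscale (\<lambda>b. F a b c)"
    "\<And>a b. lin hs tscale (\<lambda>c. F a b c)"
  shows "(\<Sum>(a, b)\<leftarrow>cop H x. \<Sum>(c, d)\<leftarrow>cop H a. F c d b) = (\<Sum>(a, b)\<leftarrow>cop H x. \<Sum>(c, d)\<leftarrow>cop H b. F a c d)"
proof -
  let ?F = "\<lambda>w. case w of [a, b, c] \<Rightarrow> F a b c | _ \<Rightarrow> 0"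
  have TT: "comult H x \<in> TT hs" for x using comult_tpow tpow_TT[of hs UNIV 2] by auto
  note ap = apply_at_pure[OF lin_comult TT]
  have ml: "mlin hs ?F" by (rule mlin_case3[OF F])
  have "tbind (apply_at hs 0 (comult H) (comult H x)) ?F = (\<Sum>(a, b)\<leftarrow>cop H x. \<Sum>(c, d)\<leftarrow>cop H a. F c d b)"
    unfolding cop[of x] lin_sum_list2[OF lin_apply_at[OF lin_id]] tbind_sum_list2 ap
    by (simp add: cop TT_sum_list2 case_prod_beta' tmult_sum_list_left tmult_pure TT_sum_list tbind_sum_list tbind_sum_list2 tbind_pure_mlin[OF ml])
  moreover have "tbind (apply_at hs 1 (comult H) (comult H x)) ?F = (\<Sum>(a, b)\<leftarrow>cop H x. \<Sum>(c, d)\<leftarrow>cop H b. F a c d)"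
    unfolding cop[of x] lin_sum_list2[OF lin_apply_at[OF lin_id]] tbind_sum_list2 ap
    by (simp add: cop TT_sum_list2 case_prod_beta' tmult_sum_list_left tmult_sum_list_right tmult_pure TT_sum_list tbind_sum_list tbind_sum_list2 tbind_pure_mlin[OF ml])
  ultimately show ?thesis using coassoc by simp
qed

lemma tlift_comult:
  assumes "vector_space s2" "\<And>b. lin hs s2 (\<lambda>a. F a b)" "\<And>a. lin hs s2 (\<lambda>b. F a b)"
  shows "tlift s2 (\<lambda>w. case w of [a, b] \<Rightarrow> F a b | _ \<Rightarrow> 0) (comult H x) = (\<Sum>(a, b)\<leftarrow>cop H x. F a b)"
proof -
  have z: "pure s2 [0] = 0" using lin_zero[OF lin_pure1[OF lin_id]] .
  have *: "(\<lambda>w. pure s2 [case w of [a, b] \<Rightarrow> F a b | _ \<Rightarrow> 0]) = (\<lambda>w. case w of [a, b] \<Rightarrow> pure s2 [F a b] | _ \<Rightarrow> 0)"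
    by (auto simp: z fun_eq_iff split: list.split)
  have "mlin hs (\<lambda>w. pure s2 [case w of [a, b] \<Rightarrow> F a b | _ \<Rightarrow> 0])"
    unfolding * by (intro mlin_case2 lin_pure1 assms)
  note t = tlift_sum_list[OF assms(1) this, of "map (\<lambda>(a, b). [a, b]) (cop H x)"]
  show ?thesis
    unfolding cop[of x] using t by (simp add: comp_def case_prod_beta')
qed

lemma lin_hs_left: "lin hs hs (\<lambda>x. hs (\<epsilon> x) b)"
  and lin_hs_right: "lin hs hs (hs c)"
proof -
  interpret vector_space hs by (rule vs_h)
  show "lin hs hs (\<lambda>x. hs (\<epsilon> x) b)" "lin hs hs (hs c)"
    using lin_counit by (auto simp: linear_on_def scale_left_distrib scale_right_distrib mult.commute)
qed

lemma cop_counit_l: "lin hs tscale F \<Longrightarrow> (\<Sum>(a, b)\<leftarrow>cop H x. tscale (\<epsilon> a) (F b)) = F x"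
  using tlift_comult[OF vs_h lin_hs_left lin_hs_right, of x]
  lin_sum_list2[of hs tscale F "\<lambda>a b. hs (\<epsilon> a) b" "cop H x"]
  by (simp add: counit_l lin_scale)

lemma cop_counit_r: "lin hs tscale F \<Longrightarrow> (\<Sum>(a, b)\<leftarrow>cop H x. tscale (\<epsilon> b) (F a)) = F x"
  using tlift_comult[OF vs_h lin_hs_right lin_hs_left, of x]
  lin_sum_list2[of hs tscale F "\<lambda>a b. hs (\<epsilon> b) a" "cop H x"]
  by (simp add: counit_r lin_scale)

lemma cop_antipode_l: "lin hs tscale F \<Longrightarrow> (\<Sum>(a, b)\<leftarrow>cop H x. F (S a * b)) = tscale (\<epsilon> x) (F 1)"
proof -
  assume F: "lin hs tscale F"
  have "(\<Sum>(a, b)\<leftarrow>cop H x. S a * b) = hs (\<epsilon> x) 1"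
    using tlift_comult[OF vs_h lin_h_mult(1)[OF lin_S] lin_h_mult(2)[OF lin_id], of x] antipode_l by simp
  then show ?thesis
    using lin_sum_list2[OF F, of "\<lambda>a b. S a * b" "cop H x"] lin_scale[OF F] by simp
qed

lemma cop_antipode_r: "lin hs tscale F \<Longrightarrow> (\<Sum>(a, b)\<leftarrow>cop H x. F (a * S b)) = tscale (\<epsilon> x) (F 1)"
proof -
  assume F: "lin hs tscale F"
  have "(\<Sum>(a, b)\<leftarrow>cop H x. a * S b) = hs (\<epsilon> x) 1"
    using tlift_comult[OF vs_h lin_h_mult(1)[OF lin_id] lin_h_mult(2)[OF lin_S], of x] antipode_r by simp
  then show ?thesis
    using lin_sum_list2[OF F, of "\<lambda>a b. a * S b" "cop H x"] lin_scale[OF F] by simp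
qed

lemma cop_mult:
  assumes F: "\<And>b. lin hs tscale (\<lambda>a. F a b)" "\<And>a. lin hs tscale (\<lambda>b. F a b)"
  shows "(\<Sum>(a, b)\<leftarrow>cop H (x * y). F a b) = (\<Sum>(a, b)\<leftarrow>cop H x. \<Sum>(c, d)\<leftarrow>cop H y. F (a * c) (b * d))"
proof -
  let ?F = "\<lambda>w. case w of [a, b] \<Rightarrow> F a b | _ \<Rightarrow> 0"
  have ml: "mlin hs ?F" by (rule mlin_case2[OF F])
  have "(\<Sum>(a, b)\<leftarrow>cop H (x * y). F a b) = tbind (comult H (x * y)) ?F"
    by (rule tbind_comult[OF F, symmetric])
  also have "comult H (x * y) = tbind (comult H x) (\<lambda>u. case u of [a, b] \<Rightarrow>
      tbind (comult H y) (\<lambda>v. case v of [c, d] \<Rightarrow> pure hs [a * c, b * d] | _ \<Rightarrow> 0) | _ \<Rightarrow> 0)"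
    unfolding comult_mult
  proof (rule arg_cong[where f = "tbind (comult H x)"], rule ext)
    fix u
    have TT: "comult H y \<in> TT hs" using comult_tpow tpow_TT[of hs UNIV 2] by auto
    show "tbind (comult H y) (\<lambda>v. case (u, v) of ([a, b], [c, d]) \<Rightarrow> pure hs [a * c, b * d] | _ \<Rightarrow> 0)
      = (case u of [a, b] \<Rightarrow> tbind (comult H y) (\<lambda>v. case v of [c, d] \<Rightarrow> pure hs [a * c, b * d] | _ \<Rightarrow> 0) | _ \<Rightarrow> 0)"
      by (auto split: list.split simp: tbind_0_right[OF TT])
  qed
  also have "\<dots> = (\<Sum>(a, b)\<leftarrow>cop H x. \<Sum>(c, d)\<leftarrow>cop H y. pure hs [a * c, b * d])"
  proof -
    have *: "tbind (comult H y) (\<lambda>v. case v of [c, d] \<Rightarrow> pure hs [a * c, b * d] | _ \<Rightarrow> 0)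
      = (\<Sum>(c, d)\<leftarrow>cop H y. pure hs [a * c, b * d])" for a b
      by (rule tbind_comult) (intro lin_intros)+
    show ?thesis unfolding * by (rule tbind_comult) (intro lin_intros)+
  qed
  also have "tbind \<dots> ?F = (\<Sum>(a, b)\<leftarrow>cop H x. \<Sum>(c, d)\<leftarrow>cop H y. F (a * c) (b * d))"
    by (simp add: tbind_sum_list2 tbind_pure_mlin[OF ml])
  finally show ?thesis .
qed

lemma cop_1:
  assumes "\<And>b. lin hs tscale (\<lambda>a. F a b)" "\<And>a. lin hs tscale (\<lambda>b. F a b)"
  shows "(\<Sum>(a, b)\<leftarrow>cop H 1. F a b) = F 1 1"
  unfolding tbind_comult[OF assms, symmetric] comult_1 by (simp add: tbind_pure_mlin[OF mlin_case2[OF assms]])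

end

section \<open>Operators on a single tensor factor\<close>

lemma tpow_TT_eqI:
  assumes t: "t \<in> tpow s V n" and u: "u \<in> TT s'"
    and eq: "\<And>w v. length w = n \<Longrightarrow> set w \<subseteq> V \<Longrightarrow> F (pure s w) (pure s' v) = G (pure s w) (pure s' v)"
    and l1: "linear_on tscale tscale (tpow s V n) (\<lambda>t. F t u)" "linear_on tscale tscale (tpow s V n) (\<lambda>t. G t u)"
    and l2: "\<And>t. t \<in> tpow s V n \<Longrightarrow> linear_on tscale tscale (TT s') (F t)"
      "\<And>t. t \<in> tpow s V n \<Longrightarrow> linear_on tscale tscale (TT s') (G t)"
  shows "F t u = G t u"
proof (rule tpow_eqI[OF t vector_space_tscale l1])
  fix w assume w: "length w = n" "set w \<subseteq> V"
  show "F (pure s w) u = G (pure s w) u"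
    by (rule TT_eqI[OF u eq[OF w] l2(1)[OF tpow_pure[OF w]] l2(2)[OF tpow_pure[OF w]]])
qed

lemma TT_TT_eqI:
  assumes t: "t \<in> TT s" and u: "u \<in> TT s'"
    and eq: "\<And>w v. F (pure s w) (pure s' v) = G (pure s w) (pure s' v)"
    and l1: "linear_on tscale tscale (TT s) (\<lambda>t. F t u)" "linear_on tscale tscale (TT s) (\<lambda>t. G t u)"
    and l2: "\<And>w. linear_on tscale tscale (TT s') (F (pure s w))" "\<And>w. linear_on tscale tscale (TT s') (G (pure s w))"
  shows "F t u = G t u"
proof (rule TT_eqI[OF t _ l1])
  fix w show "F (pure s w) u = G (pure s w) u"
    by (rule TT_eqI[OF u]) (use eq l2 in auto)
qed

lemma tpow_TTD: "t \<in> tpow s V n \<Longrightarrow> t \<in> TT s"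
  using tpow_TT by (rule subsetD)

locale slot_map =
  fixes s :: "'k::field \<Rightarrow> 'e::ab_group_add \<Rightarrow> 'e" and F :: "'e \<Rightarrow> ('k, 'e) tensor"
  assumes F: "lin s tscale F" and F_TT [TT_intros]: "\<And>x. F x \<in> TT s"
begin

lemma apply_at_mid:
  assumes "t \<in> tpow s UNIV i" "u \<in> TT s"
  shows "apply_at s i F (tmult s t (tmult s (pure s [e]) u)) = tmult s t (tmult s (F e) u)"
  by (rule tpow_TT_eqI[OF assms, where F = "\<lambda>t u. apply_at s i F (tmult s t (tmult s (pure s [e]) u))"
        and G = "\<lambda>t u. tmult s t (tmult s (F e) u)"])
    (auto simp: tmult_pure apply_at_pure F F_TT tpow_TTD intro!: lin_intros TT_intros assms)

lemma apply_at_left: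
  assumes "t \<in> tpow s UNIV n" "u \<in> TT s" "i < n"
  shows "apply_at s i F (tmult s t u) = tmult s (apply_at s i F t) u"
  by (rule tpow_TT_eqI[OF assms(1,2), where F = "\<lambda>t u. apply_at s i F (tmult s t u)"
        and G = "\<lambda>t u. tmult s (apply_at s i F t) u"])
    (use assms(3) in \<open>auto simp: tmult_pure apply_at_pure F F_TT nth_append tmult_assoc
      tpow_TTD intro!: lin_intros TT_intros assms F\<close>)

lemma apply_at_right:
  assumes "t \<in> tpow s UNIV n" "u \<in> TT s"
  shows "apply_at s (n + i) F (tmult s t u) = tmult s t (apply_at s i F u)"
proof (rule tpow_TT_eqI[OF assms, where F = "\<lambda>t u. apply_at s (n + i) F (tmult s t u)"
        and G = "\<lambda>t u. tmult s t (apply_at s i F u)"])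
  fix w v :: "'e list" assume w: "length w = n"
  show "apply_at s (n + i) F (tmult s (pure s w) (pure s v)) = tmult s (pure s w) (apply_at s i F (pure s v))"
  proof (cases "i < length v")
    case True
    have "tmult s (pure s (w @ take i v)) y = tmult s (pure s w) (tmult s (pure s (take i v)) y)" if "y \<in> TT s" for y
      unfolding tmult_pure[symmetric] by (rule tmult_assoc[OF that])
    then show ?thesis
      using w True by (simp add: tmult_pure apply_at_pure F F_TT nth_append TT_tmult)
  qed (use w in \<open>simp add: tmult_pure apply_at_pure F F_TT\<close>)
qed (auto simp: tpow_TTD intro!: lin_intros TT_intros assms F)

lemma apply_at_short: "t \<in> tpow s UNIV n \<Longrightarrow> n \<le> i \<Longrightarrow> apply_at s i F t = 0"
  by (rule tpow_eqI[of t s UNIV n tscale "apply_at s i F" "\<lambda>_. 0"])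
    (auto simp: apply_at_pure F F_TT vector_space_tscale intro!: lin_intros)

lemma apply_at_single: "apply_at s 0 F (pure s [e]) = F e"
  by (simp add: apply_at_pure F F_TT TT_intros)

end

section \<open>Antipode\<close>

context hopf
begin

lemma S_1: "S 1 = 1"
proof -
  have "pure hs [1 * S 1] = (\<Sum>(a, b)\<leftarrow>cop H 1. pure hs [a * S b])"
    by (rule cop_1[symmetric]) (intro lin_intros)+
  also have "\<dots> = pure hs [1]"
    using cop_antipode_r[OF lin_pure1[OF lin_id], of 1] by (simp add: counit_1)
  finally show ?thesis by (simp add: pure_single_inject[OF vs_h])
qed

text \<open>On H \<otimes> H both S(x y) and S(y) S(x) are convolution inverses of the
  multiplication. \<open>T\<close> is the triple product S(x1 y1) x2 y2 S(y3) S(x3), evaluated once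
  by cancelling the left pair and once by cancelling the right pair.\<close>

lemma S_mult: "S (x * y) = S y * S x"
proof -
  define T where "T = (\<Sum>(a, b)\<leftarrow>cop H x. \<Sum>(a1, a2)\<leftarrow>cop H a. \<Sum>(c, d)\<leftarrow>cop H y. \<Sum>(c1, c2)\<leftarrow>cop H c.
    pure hs [S (a1 * c1) * (a2 * c2) * (S d * S b)])"
  have "T = (\<Sum>(a, b)\<leftarrow>cop H x. \<Sum>(c, d)\<leftarrow>cop H y. \<Sum>(a1, a2)\<leftarrow>cop H a. \<Sum>(c1, c2)\<leftarrow>cop H c.
    pure hs [S (a1 * c1) * (a2 * c2) * (S d * S b)])"
    unfolding T_def by (intro sum_list_cong2 sum_list_swap)
  also have "\<dots> = (\<Sum>(a, b)\<leftarrow>cop H x. \<Sum>(c, d)\<leftarrow>cop H y. tscale (\<epsilon> a) (tscale (\<epsilon> c) (pure hs [S d * S b])))"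
  proof (intro sum_list_cong2)
    fix a b c d
    have "(\<Sum>(a1, a2)\<leftarrow>cop H a. \<Sum>(c1, c2)\<leftarrow>cop H c. pure hs [S (a1 * c1) * (a2 * c2) * (S d * S b)])
      = (\<Sum>(u, v)\<leftarrow>cop H (a * c). pure hs [S u * v * (S d * S b)])"
      by (rule cop_mult[symmetric]) (intro lin_intros)+
    also have "\<dots> = tscale (\<epsilon> (a * c)) (pure hs [1 * (S d * S b)])"
      by (rule cop_antipode_l) (intro lin_intros)
    finally show "(\<Sum>(a1, a2)\<leftarrow>cop H a. \<Sum>(c1, c2)\<leftarrow>cop H c. pure hs [S (a1 * c1) * (a2 * c2) * (S d * S b)])
      = tscale (\<epsilon> a) (tscale (\<epsilon> c) (pure hs [S d * S b]))" by (simp add: counit_mult)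
  qed
  also have "\<dots> = (\<Sum>(a, b)\<leftarrow>cop H x. tscale (\<epsilon> a) (\<Sum>(c, d)\<leftarrow>cop H y. tscale (\<epsilon> c) (pure hs [S d * S b])))"
    by (intro sum_list_cong2) (rule lin_sum_list2[OF lin_tscale_const[OF lin_id], symmetric])
  also have "\<dots> = (\<Sum>(a, b)\<leftarrow>cop H x. tscale (\<epsilon> a) (pure hs [S y * S b]))"
    by (intro sum_list_cong2 arg_cong[where f = "tscale _"] cop_counit_l lin_intros)
  also have "\<dots> = pure hs [S y * S x]"
    by (rule cop_counit_l) (intro lin_intros)
  finally have 1: "T = pure hs [S y * S x]" .
  have "T = (\<Sum>(a, b)\<leftarrow>cop H x. \<Sum>(a1, a2)\<leftarrow>cop H b. \<Sum>(c, d)\<leftarrow>cop H y. \<Sum>(c1, c2)\<leftarrow>cop H c.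
    pure hs [S (a * c1) * (a1 * c2) * (S d * S a2)])"
    unfolding T_def by (rule cop_coassoc) (intro lin_intros)+
  also have "\<dots> = (\<Sum>(a, b)\<leftarrow>cop H x. \<Sum>(a1, a2)\<leftarrow>cop H b. \<Sum>(c, d)\<leftarrow>cop H y. \<Sum>(c1, c2)\<leftarrow>cop H d.
    pure hs [S (a * c) * (a1 * c1) * (S c2 * S a2)])"
    by (intro sum_list_cong2 cop_coassoc lin_intros)
  also have "\<dots> = (\<Sum>(a, b)\<leftarrow>cop H x. \<Sum>(a1, a2)\<leftarrow>cop H b. \<Sum>(c, d)\<leftarrow>cop H y.
    tscale (\<epsilon> d) (pure hs [S (a * c) * a1 * S a2]))"
  proof (intro sum_list_cong2)
    fix a b a1 a2 c d
    have "(\<Sum>(c1, c2)\<leftarrow>cop H d. pure hs [S (a * c) * a1 * (c1 * S c2) * S a2])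
      = tscale (\<epsilon> d) (pure hs [S (a * c) * a1 * 1 * S a2])"
      by (rule cop_antipode_r) (intro lin_intros)
    then show "(\<Sum>(c1, c2)\<leftarrow>cop H d. pure hs [S (a * c) * (a1 * c1) * (S c2 * S a2)])
      = tscale (\<epsilon> d) (pure hs [S (a * c) * a1 * S a2])" by (simp add: mult.assoc)
  qed
  also have "\<dots> = (\<Sum>(a, b)\<leftarrow>cop H x. \<Sum>(a1, a2)\<leftarrow>cop H b. pure hs [S (a * y) * (a1 * S a2)])"
    unfolding mult.assoc by (intro sum_list_cong2 cop_counit_r lin_intros)
  also have "\<dots> = (\<Sum>(a, b)\<leftarrow>cop H x. tscale (\<epsilon> b) (pure hs [S (a * y) * 1]))"
    by (intro sum_list_cong2 cop_antipode_r lin_intros)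
  also have "\<dots> = pure hs [S (x * y) * 1]"
    by (rule cop_counit_r) (intro lin_intros)
  finally show ?thesis using 1 by (simp add: pure_single_inject[OF vs_h])
qed

end

section \<open>Diagonal actions on tensor powers\<close>

text \<open>Serves three letter actions: left and right multiplication on the direct sum of
  \<open>H\<close> and \<open>M\<close>, and the adjoint action on \<open>M\<close>. The acting
  element is written first for right actions too. The empty word carries the counit, in accordance
  with \<open>iter_comult H 0\<close>.\<close>

primrec dact :: "('k::field, 'h::ring_1) hopf_data \<Rightarrow> ('k \<Rightarrow> 'e::ab_group_add \<Rightarrow> 'e) \<Rightarrow> ('h \<Rightarrow> 'e \<Rightarrow> 'e)
    \<Rightarrow> 'e list \<Rightarrow> 'h \<Rightarrow> ('k, 'e) tensor" where
  "dact H s \<alpha> [] = (\<lambda>x. tscale (counit H x) (pure s []))"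
| "dact H s \<alpha> (e # w) = (\<lambda>x. \<Sum>(a, b)\<leftarrow>cop H x. tmult s (pure s [\<alpha> a e]) (dact H s \<alpha> w b))"

definition dactT :: "('k::field, 'h::ring_1) hopf_data \<Rightarrow> ('k \<Rightarrow> 'e::ab_group_add \<Rightarrow> 'e) \<Rightarrow> ('h \<Rightarrow> 'e \<Rightarrow> 'e)
    \<Rightarrow> 'h \<Rightarrow> ('k, 'e) tensor \<Rightarrow> ('k, 'e) tensor" where
  "dactT H s \<alpha> x t = tbind t (\<lambda>w. dact H s \<alpha> w x)"

lemma lin_dactT [lin_intros]: "linear_on s1 tscale X A \<Longrightarrow> linear_on s1 tscale X (\<lambda>y. dactT H s \<alpha> x (A y))"
  unfolding dactT_def by (rule lin_tbind)

lemmas dactT_sum_list2 = lin_sum_list2[OF lin_dactT[OF lin_id]]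

locale letter_action = hopf H for H :: "('k::field, 'h::ring_1) hopf_data" +
  fixes s :: "'k \<Rightarrow> 'e::ab_group_add \<Rightarrow> 'e" and \<alpha> :: "'h \<Rightarrow> 'e \<Rightarrow> 'e"
  assumes lin_act1: "\<And>e. lin hs s (\<lambda>x. \<alpha> x e)" and lin_act2: "\<And>x. lin s s (\<alpha> x)"
begin

abbreviation da where "da \<equiv> dact H s \<alpha>"
abbreviation dT where "dT \<equiv> dactT H s \<alpha>"

lemma lin_act_comp [lin_intros]:
  "linear_on s1 hs X A \<Longrightarrow> linear_on s1 s X (\<lambda>x. \<alpha> (A x) e)"
  "linear_on s1 s X B \<Longrightarrow> linear_on s1 s X (\<lambda>x. \<alpha> h (B x))"
  by (rule lin_comp[OF lin_act1] lin_comp[OF lin_act2], assumption)+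

lemma da_TT [TT_intros, simp]: "da w x \<in> TT s"
  by (induction w arbitrary: x) (auto intro!: TT_intros)

lemma da_tpow:
  "set w \<subseteq> V \<Longrightarrow> (\<And>a e. e \<in> V \<Longrightarrow> \<alpha> a e \<in> V) \<Longrightarrow> da w x \<in> tpow s V (length w)"
proof (induction w arbitrary: x)
  case Nil
  then show ?case using tens.subspace_scale[OF tpow_subspace tpow_pure[of "[]" 0 V s]] by simp
next
  case (Cons e w)
  have "tmult s (pure s [\<alpha> a e]) (da w b) \<in> tpow s V (1 + length w)" for a b
    using Cons by (intro tpow_tmult tpow_pure) auto
  then show ?case by (auto intro!: subspace_sum_list2[OF tpow_subspace])
qed

lemma lin_da: "lin hs tscale (da w)"
proof (induction w)
  case Nil
  show ?case by simp (intro lin_intros)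
next
  case (Cons e w)
  show ?case by simp (intro lin_intros lin_comp[OF Cons] da_TT TT_pure)+
qed

lemma lin_da_comp [lin_intros]: "linear_on s1 hs X A \<Longrightarrow> linear_on s1 tscale X (\<lambda>x. da w (A x))"
  by (rule lin_comp[OF lin_da])

lemma mlin_da: "mlin s (\<lambda>w. da w x)"
proof -
  have "lin s tscale (\<lambda>e. da (u @ e # v) x)" for u v
    by (induction u arbitrary: x) (simp, intro lin_intros, auto intro!: lin_intros)
  then show ?thesis by (simp add: mlin_def)
qed

lemma dT_TT [TT_intros]: "t \<in> TT s \<Longrightarrow> dT x t \<in> TT s"
  unfolding dactT_def by (rule TT_tbind[OF _ mlin_da da_TT])

lemma dT_pure [simp]: "dT x (pure s w) = da w x"
  unfolding dactT_def by (rule tbind_pure_mlin[OF mlin_da])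

lemma dT_tpow:
  "t \<in> tpow s V n \<Longrightarrow> (\<And>a e. e \<in> V \<Longrightarrow> \<alpha> a e \<in> V) \<Longrightarrow> dT x t \<in> tpow s V n"
  unfolding dactT_def by (rule tpow_tbind[OF mlin_da _ tpow_subspace]) (auto intro: da_tpow)

lemma lin_dT_comp [lin_intros]:
  assumes A: "linear_on s1 hs X A" and t: "t \<in> TT s"
  shows "linear_on s1 tscale X (\<lambda>x. dT (A x) t)"
proof -
  have "dT (a + b) t = dT a t + dT b t" for a b
    by (rule TT_eqI[OF t, of "dT (a + b)" "\<lambda>t. dT a t + dT b t"])
      (auto intro!: lin_intros lin_tscale_add simp: lin_add[OF lin_da])
  moreover have "dT (hs c a) t = tscale c (dT a t)" for a c
    by (rule TT_eqI[OF t, of "dT (hs c a)" "\<lambda>t. tscale c (dT a t)"])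
      (auto intro!: lin_intros simp: lin_scale[OF lin_da])
  ultimately show ?thesis using A by (simp add: linear_on_def)
qed

lemma da_single: "da [e] x = pure s [\<alpha> x e]"
proof -
  have "da [e] x = (\<Sum>(a, b)\<leftarrow>cop H x. tscale (\<epsilon> b) (pure s [\<alpha> a e]))"
    by (auto intro!: sum_list_cong2 simp: tmult_TT_tscale_right tmult_pure)
  also have "\<dots> = pure s [\<alpha> x e]" by (rule cop_counit_r) (intro lin_intros)
  finally show ?thesis .
qed

text \<open>Induction on \<open>u\<close>: coassociativity regroups the three legs that go to the
  first letter, to the rest of \<open>u\<close> and to \<open>v\<close>.\<close>

lemma da_append: "da (u @ v) x = (\<Sum>(a, b)\<leftarrow>cop H x. tmult s (da u a) (da v b))"
proof (induction u arbitrary: x)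
  case Nil
  have "(\<Sum>(a, b)\<leftarrow>cop H x. tmult s (da [] a) (da v b)) = (\<Sum>(a, b)\<leftarrow>cop H x. tscale (\<epsilon> a) (da v b))"
    by (auto intro!: sum_list_cong2 simp: tmult_tscale_left)
  also have "\<dots> = da v x" by (rule cop_counit_l[OF lin_da])
  finally show ?case by simp
next
  case (Cons e u)
  have "da ((e # u) @ v) x = (\<Sum>(a, b)\<leftarrow>cop H x. \<Sum>(c, d)\<leftarrow>cop H b.
      tmult s (pure s [\<alpha> a e]) (tmult s (da u c) (da v d)))"
    by (auto simp: Cons intro!: sum_list_cong2 tmult_sum_list2_right TT_intros)
  also have "\<dots> = (\<Sum>(a, b)\<leftarrow>cop H x. \<Sum>(c, d)\<leftarrow>cop H a.
      tmult s (pure s [\<alpha> c e]) (tmult s (da u d) (da v b)))"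
    by (rule cop_coassoc[symmetric]) (intro lin_intros TT_intros)+
  also have "\<dots> = (\<Sum>(a, b)\<leftarrow>cop H x. tmult s (da (e # u) a) (da v b))"
    by (auto simp: tmult_sum_list2_left tmult_assoc intro!: sum_list_cong2)
  finally show ?case .
qed

lemma dT_tmult:
  assumes "t \<in> TT s" "u \<in> TT s"
  shows "dT x (tmult s t u) = (\<Sum>(a, b)\<leftarrow>cop H x. tmult s (dT a t) (dT b u))"
  by (rule TT_TT_eqI[OF assms, where F = "\<lambda>t u. dT x (tmult s t u)"
        and G = "\<lambda>t u. \<Sum>(a, b)\<leftarrow>cop H x. tmult s (dT a t) (dT b u)"])
    (auto simp: tmult_pure da_append intro!: lin_intros TT_intros assms)

lemma dT_one:
  assumes "t \<in> TT s" "\<And>e. \<alpha> 1 e = e" shows "dT 1 t = t"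
proof -
  have "da w 1 = pure s w" for w
  proof (induction w)
    case (Cons e w)
    have "da (e # w) 1 = tmult s (pure s [\<alpha> 1 e]) (da w 1)"
      by simp (rule cop_1; intro lin_intros TT_intros)
    then show ?case using Cons assms(2) by (simp add: tmult_pure)
  qed (simp add: counit_1)
  then show ?thesis by (intro TT_eqI[OF assms(1), of "dT 1" "\<lambda>t. t"]) (auto intro!: lin_intros)
qed

text \<open>\<open>da_append\<close> cuts the word around the slot, which gives the letter there a
  leg of its own. On that leg the hypothesis moves the action through \<open>F\<close>, and
  \<open>dT_tmult\<close> reassembles the legs.\<close>

lemma apply_at_dT:
  assumes "slot_map s F" and eq: "\<And>x e. F (\<alpha> x e) = dT x (F e)" and t: "t \<in> TT s"
  shows "apply_at s i F (dT x t) = dT x (apply_at s i F t)"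
proof -
  interpret slot_map s F by fact
  have "apply_at s i F (da w x) = dT x (apply_at s i F (pure s w))" for w
  proof (cases "i < length w")
    case False
    then have "apply_at s i F (da w x) = 0"
      by (intro apply_at_short[of _ "length w"] da_tpow) auto
    then show ?thesis using False by (simp add: apply_at_pure F F_TT lin_zero[OF lin_dactT[OF lin_id]])
  next
    case True
    define u e v where "u = take i w" "e = w ! i" "v = drop (Suc i) w"
    have w: "w = u @ e # v" "length u = i" using True by (simp_all add: u_e_v_def id_take_nth_drop)
    have T: "da u a \<in> tpow s UNIV i" for a using da_tpow[of u UNIV a] w by simp
    have "apply_at s i F (da w x) = (\<Sum>(a, b)\<leftarrow>cop H x. \<Sum>(c, d)\<leftarrow>cop H b.
        apply_at s i F (tmult s (da u a) (tmult s (pure s [\<alpha> c e]) (da v d))))"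
      unfolding w da_append
      by (simp add: lin_sum_list2[OF lin_apply_at[OF lin_id]] tmult_sum_list2_right TT_intros)
    also have "\<dots> = (\<Sum>(a, b)\<leftarrow>cop H x. \<Sum>(c, d)\<leftarrow>cop H b.
        tmult s (da u a) (tmult s (dT c (F e)) (da v d)))"
      by (simp add: apply_at_mid T eq)
    also have "\<dots> = dT x (tmult s (pure s u) (tmult s (F e) (pure s v)))"
      by (simp add: dT_tmult TT_intros F_TT tmult_sum_list2_right)
    finally show ?thesis using w by (simp add: apply_at_pure F F_TT nth_append)
  qed
  then show ?thesis by (intro TT_eqI[OF t, of "\<lambda>t. apply_at s i F (dT x t)" "\<lambda>t. dT x (apply_at s i F t)"]) (auto intro!: lin_intros)
qed

end

lemma dactT_comp_Cons:
  assumes "letter_action H s \<alpha>" "letter_action H s \<alpha>'"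
  shows "dactT H s \<alpha> x (dact H s \<alpha>' (e # w) y) = (\<Sum>(c, d)\<leftarrow>cop H y. \<Sum>(a, b)\<leftarrow>cop H x.
    tmult s (pure s [\<alpha> a (\<alpha>' c e)]) (dactT H s \<alpha> b (dact H s \<alpha>' w d)))"
proof -
  interpret A: letter_action H s \<alpha> by fact
  interpret B: letter_action H s \<alpha>' by fact
  show ?thesis
    unfolding dact.simps(2)[of H s \<alpha>']
    by (simp add: dactT_sum_list2 A.dT_tmult A.da_single del: dact.simps)
qed

lemma dactT_commute:
  assumes "letter_action H s \<alpha>" "letter_action H s \<alpha>'" and eq: "\<And>x y e. \<alpha> x (\<alpha>' y e) = \<alpha>' y (\<alpha> x e)"
    and t: "t \<in> TT s"
  shows "dactT H s \<alpha> x (dactT H s \<alpha>' y t) = dactT H s \<alpha>' y (dactT H s \<alpha> x t)"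
proof -
  interpret A: letter_action H s \<alpha> by fact
  interpret B: letter_action H s \<alpha>' by fact
  have "dactT H s \<alpha> x (dact H s \<alpha>' w y) = dactT H s \<alpha>' y (dact H s \<alpha> w x)" for w
  proof (induction w arbitrary: x y)
    case Nil
    then show ?case by (simp add: lin_scale[OF lin_dactT[OF lin_id]] mult.commute)
  next
    case (Cons e w)
    show ?case
      unfolding dactT_comp_Cons[OF assms(1,2)] dactT_comp_Cons[OF assms(2,1)]
      by (subst sum_list_swap) (simp add: Cons eq)
  qed
  then show ?thesis by (intro TT_eqI[OF t, of "\<lambda>t. dactT H s \<alpha> x (dactT H s \<alpha>' y t)" "\<lambda>t. dactT H s \<alpha>' y (dactT H s \<alpha> x t)"]) (auto intro!: lin_intros)
qed

lemma (in letter_action) dT_mult_left: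
  assumes eq: "\<And>x y e. \<alpha> (x * y) e = \<alpha> x (\<alpha> y e)" and t: "t \<in> TT s"
  shows "dT (x * y) t = dT x (dT y t)"
proof -
  have la: "letter_action H s \<alpha>" ..
  have "da w (x * y) = dT x (da w y)" for w
  proof (induction w arbitrary: x y)
    case Nil
    then show ?case by (simp add: lin_scale[OF lin_dactT[OF lin_id]] mult.commute counit_mult)
  next
    case (Cons e w)
    have "da (e # w) (x * y) = (\<Sum>(a, b)\<leftarrow>cop H x. \<Sum>(c, d)\<leftarrow>cop H y. tmult s (pure s [\<alpha> (a * c) e]) (da w (b * d)))"
      by simp (rule cop_mult; intro lin_intros TT_intros)
    then show ?case unfolding dactT_comp_Cons[OF la la] by (subst sum_list_swap) (simp add: Cons eq)
  qed
  then show ?thesis by (intro TT_eqI[OF t, of "dT (x * y)" "\<lambda>t. dT x (dT y t)"]) (auto intro!: lin_intros)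
qed

text \<open>The version for right actions: with the acting element written first, a product acts by
  its left factor first.\<close>

lemma (in letter_action) dT_mult_right:
  assumes eq: "\<And>x y e. \<alpha> (x * y) e = \<alpha> y (\<alpha> x e)" and t: "t \<in> TT s"
  shows "dT (x * y) t = dT y (dT x t)"
proof -
  have la: "letter_action H s \<alpha>" ..
  have "da w (x * y) = dT y (da w x)" for w
  proof (induction w arbitrary: x y)
    case Nil
    then show ?case by (simp add: lin_scale[OF lin_dactT[OF lin_id]] mult.commute counit_mult)
  next
    case (Cons e w)
    have "da (e # w) (x * y) = (\<Sum>(a, b)\<leftarrow>cop H x. \<Sum>(c, d)\<leftarrow>cop H y. tmult s (pure s [\<alpha> (a * c) e]) (da w (b * d)))"
      by simp (rule cop_mult; intro lin_intros TT_intros)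
    then show ?case unfolding dactT_comp_Cons[OF la la] by (simp add: Cons eq)
  qed
  then show ?thesis by (intro TT_eqI[OF t, of "dT (x * y)" "\<lambda>t. dT y (dT x t)"]) (auto intro!: lin_intros)
qed

section \<open>Hopf bimodules\<close>

context letter_action
begin

lemma iter_comult_lin_TT: "lin hs tscale (iter_comult H n) \<and> (\<forall>x. iter_comult H n x \<in> TT hs)"
proof (induction n)
  case 0
  show ?case by (auto intro!: lin_intros TT_intros)
next
  case (Suc n)
  then have l: "lin hs tscale (iter_comult H n)" and t: "\<And>x. iter_comult H n x \<in> TT hs" by auto
  have "iter_comult H (Suc n) x = (\<Sum>(a, b)\<leftarrow>cop H x. tmult hs (pure hs [a]) (iter_comult H n b))" for x
    by simp (rule tbind_comult; intro lin_intros lin_comp[OF l] t TT_pure)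
  moreover have "lin hs tscale (\<lambda>x. \<Sum>(a, b)\<leftarrow>cop H x. tmult hs (pure hs [a]) (iter_comult H n b))"
    by (intro lin_intros lin_comp[OF l] t TT_pure)
  ultimately show ?case using t by (auto intro!: TT_intros)
qed

lemma iter_comult_Suc:
  "iter_comult H (Suc n) x = (\<Sum>(a, b)\<leftarrow>cop H x. tmult hs (pure hs [a]) (iter_comult H n b))"
  using iter_comult_lin_TT[of n]
  by simp (rule tbind_comult; auto intro!: lin_intros lin_comp[of _ _ "iter_comult H n"])

lemma mlin_map2: "mlin hs (\<lambda>xs. if length xs = length w then pure s (map2 \<alpha> xs w) else 0)"
  unfolding mlin_def
proof (intro allI)
  fix u v :: "'h list"
  show "lin hs tscale (\<lambda>x. if length (u @ x # v) = length w then pure s (map2 \<alpha> (u @ x # v) w) else 0)"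
  proof (cases "length u + Suc (length v) = length w")
    case True
    define w1 e w2 where "w1 = take (length u) w" "e = w ! length u" "w2 = drop (Suc (length u)) w"
    have w: "w = w1 @ e # w2" "length w1 = length u" using True by (simp_all add: w1_e_w2_def id_take_nth_drop)
    have "lin hs tscale (\<lambda>x. pure s (map2 \<alpha> u w1 @ \<alpha> x e # map2 \<alpha> v w2))"
      by (intro lin_pure lin_intros)
    then show ?thesis using True w by simp
  qed (simp add: lin_0)
qed

text \<open>Identifies the recursive diagonal action with the one by iterated coproducts, so that
  \<open>tlact\<close> and \<open>tract\<close> are instances of \<open>dactT\<close>.\<close>

lemma tbind_iter_comult:
  "tbind (iter_comult H (length w) x) (\<lambda>xs. if length xs = length w then pure s (map2 \<alpha> xs w) else 0) = da w x"
proof (induction w arbitrary: x)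
  case Nil
  show ?case using tbind_pure_mlin[OF mlin_map2[of "[]"], of "[]"] by (simp add: tbind_simps)
next
  case (Cons e w)
  let ?G = "\<lambda>w xs. if length xs = length w then pure s (map2 \<alpha> xs w) else 0"
  have T: "iter_comult H n b \<in> TT hs" for n b using iter_comult_lin_TT by blast
  have "tbind (tmult hs (pure hs [a]) t) (?G (e # w)) = tmult s (pure s [\<alpha> a e]) (tbind t (?G w))"
    if t: "t \<in> TT hs" for a t
  proof (rule TT_eqI[OF t, of "\<lambda>t. tbind (tmult hs (pure hs [a]) t) (?G (e # w))"
        "\<lambda>t. tmult s (pure s [\<alpha> a e]) (tbind t (?G w))"])
    show "tbind (tmult hs (pure hs [a]) (pure hs v)) (?G (e # w))
        = tmult s (pure s [\<alpha> a e]) (tbind (pure hs v) (?G w))" for v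
      unfolding tmult_pure tbind_pure_mlin[OF mlin_map2] by (simp add: tmult_pure)
    show "linear_on tscale tscale (TT hs) (\<lambda>t. tmult s (pure s [\<alpha> a e]) (tbind t (?G w)))"
      by (intro lin_intros TT_pure) (auto intro!: TT_tbind[OF _ mlin_map2])
  qed (intro lin_intros TT_pure; simp)
  note * = this[OF T]
  show ?case
    unfolding length_Cons iter_comult_Suc tbind_sum_list2 using * by (simp add: Cons)
qed

end

definition eL :: "('k::field, 'h::ring_1) hopf_data \<Rightarrow> ('k, 'h, 'm::ab_group_add) bimodule_data \<Rightarrow> 'h \<Rightarrow> 'h \<times> 'm \<Rightarrow> 'h \<times> 'm" where
  "eL H M x e = (x * fst e, lact M x (snd e))"

definition eR :: "('k::field, 'h::ring_1) hopf_data \<Rightarrow> ('k, 'h, 'm::ab_group_add) bimodule_data \<Rightarrow> 'h \<Rightarrow> 'h \<times> 'm \<Rightarrow> 'h \<times> 'm" where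
  "eR H M x e = (fst e * x, ract M (snd e) x)"

text \<open>A chosen Sweedler list for the left coaction. The tensor does not determine the entries
  of a list, so the choice prefers one whose \<open>M\<close>-entries are coinvariant whenever such
  a list exists. For coinvariant \<open>m\<close> one exists by \<open>lc_coinvariant\<close>, and
  words over the coinvariants then stay such under the coaction.\<close>

definition lc :: "('k::field, 'h::ring_1) hopf_data \<Rightarrow> ('k, 'h, 'm::ab_group_add) bimodule_data \<Rightarrow> 'm \<Rightarrow> ('h \<times> 'm) list" where
  "lc H M m = (let R = (\<lambda>ps. lcoact M m = (\<Sum>(x, n)\<leftarrow>ps. pure (sscale H M) [(x, 0), (0, n)]));
      V = (\<lambda>ps. snd ` set ps \<subseteq> coinvariants H M)
    in SOME ps. R ps \<and> ((\<exists>qs. R qs \<and> V qs) \<longrightarrow> V ps))"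

definition rc :: "('k::field, 'h::ring_1) hopf_data \<Rightarrow> ('k, 'h, 'm::ab_group_add) bimodule_data \<Rightarrow> 'm \<Rightarrow> ('m \<times> 'h) list" where
  "rc H M m = (SOME ps. rcoact M m = (\<Sum>(n, x)\<leftarrow>ps. pure (sscale H M) [(0, n), (x, 0)]))"

locale hopf_bimod = hopf H for H :: "('k::field, 'h::ring_1) hopf_data" +
  fixes M :: "('k, 'h, 'm::ab_group_add) bimodule_data"
  assumes hbm: "hopf_bimodule H M"
begin

abbreviation ms where "ms \<equiv> mscale M"
abbreviation es where "es \<equiv> sscale H M"
abbreviation V where "V \<equiv> coinvariants H M"
abbreviation la where "la \<equiv> lact M"
abbreviation ra where "ra \<equiv> ract M"

lemma vs_m: "vector_space ms"
  and lin_la1: "lin hs ms (\<lambda>x. la x m)" and lin_la2: "lin ms ms (la x)"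
  and lin_ra1: "lin hs ms (ra m)" and lin_ra2: "lin ms ms (\<lambda>m. ra m x)"
  and la_mult: "la (x * y) m = la x (la y m)" and la_1 [simp]: "la 1 m = m"
  and ra_mult: "ra m (x * y) = ra (ra m x) y" and ra_1 [simp]: "ra m 1 = m"
  and la_ra: "ra (la x m) y = la x (ra m y)"
  and lin_lcoact: "lin ms tscale (lcoact M)" and lcoact_mem: "lcoact M m \<in> tprod es (hpart H M) (mpart H M)"
  and lin_rcoact: "lin ms tscale (rcoact M)" and rcoact_mem: "rcoact M m \<in> tprod es (mpart H M) (hpart H M)"
  and lcoact_coassoc: "apply_at es 0 (lco H M) (lcoact M m) = apply_at es 1 (lco H M) (lcoact M m)"
  and lcoact_counit: "tlift ms (\<lambda>w. case w of [(x, _), (_, n)] \<Rightarrow> ms (\<epsilon> x) n | _ \<Rightarrow> 0) (lcoact M m) = m"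
  and rcoact_coassoc: "apply_at es 0 (rco H M) (rcoact M m) = apply_at es 1 (rco H M) (rcoact M m)"
  and rcoact_counit: "tlift ms (\<lambda>w. case w of [(_, n), (x, _)] \<Rightarrow> ms (\<epsilon> x) n | _ \<Rightarrow> 0) (rcoact M m) = m"
  and coact_commute: "apply_at es 0 (lco H M) (rcoact M m) = apply_at es 1 (rco H M) (lcoact M m)"
  and lcoact_la: "lcoact M (la x m) = tlact H M x (lcoact M m)"
  and lcoact_ra: "lcoact M (ra m x) = tract H M (lcoact M m) x"
  and rcoact_la: "rcoact M (la x m) = tlact H M x (rcoact M m)"
  and rcoact_ra: "rcoact M (ra m x) = tract H M (rcoact M m) x"
  using hbm unfolding hopf_bimodule_def Let_def lin_module image_subset_iff by simp_all

lemma hs_0 [simp]: "hs c 0 = 0" and ms_0 [simp]: "ms c 0 = 0" and ms_0_left [simp]: "ms 0 m = 0"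
proof -
  interpret h: vector_space hs by (rule vs_h)
  interpret m: vector_space ms by (rule vs_m)
  show "hs c 0 = 0" "ms c 0 = 0" "ms 0 m = 0" by simp_all
qed

lemma lin_la [lin_intros]:
  "linear_on s1 hs X A \<Longrightarrow> linear_on s1 ms X (\<lambda>x. la (A x) m)"
  "linear_on s1 ms X B \<Longrightarrow> linear_on s1 ms X (\<lambda>x. la h (B x))"
  by (rule lin_comp[OF lin_la1] lin_comp[OF lin_la2], assumption)+

lemma lin_ra [lin_intros]:
  "linear_on s1 hs X A \<Longrightarrow> linear_on s1 ms X (\<lambda>x. ra m (A x))"
  "linear_on s1 ms X B \<Longrightarrow> linear_on s1 ms X (\<lambda>x. ra (B x) h)"
  by (rule lin_comp[OF lin_ra1] lin_comp[OF lin_ra2], assumption)+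

lemma lin_inj [lin_intros]:
  "linear_on s1 hs X A \<Longrightarrow> linear_on s1 es X (\<lambda>x. (A x, 0))"
  "linear_on s1 ms X B \<Longrightarrow> linear_on s1 es X (\<lambda>x. (0, B x))"
  by (auto simp: linear_on_def sscale_def)

lemma lin_fst [lin_intros]: "linear_on s1 es X A \<Longrightarrow> linear_on s1 hs X (\<lambda>x. fst (A x))"
  and lin_snd [lin_intros]: "linear_on s1 es X A \<Longrightarrow> linear_on s1 ms X (\<lambda>x. snd (A x))"
  by (auto simp: linear_on_def sscale_def)

sublocale EL: letter_action H es "eL H M"
  by unfold_locales (auto simp: linear_on_def eL_def sscale_def algebra_simps h_scale_mult
      lin_add[OF lin_la1] lin_scale[OF lin_la1] lin_add[OF lin_la2] lin_scale[OF lin_la2])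

sublocale ER: letter_action H es "eR H M"
  by unfold_locales (auto simp: linear_on_def eR_def sscale_def algebra_simps h_scale_mult
      lin_add[OF lin_ra1] lin_scale[OF lin_ra1] lin_add[OF lin_ra2] lin_scale[OF lin_ra2])

abbreviation L where "L \<equiv> dactT H es (eL H M)"
abbreviation R where "R \<equiv> dactT H es (eR H M)"

lemma tlact_L: "tlact H M x t = L x t"
proof -
  have "map2 (\<lambda>a (b, m). (a * b, la a m)) xs w = map2 (eL H M) xs w" for xs w
    by (rule map_cong) (auto simp: eL_def)
  then show ?thesis unfolding tlact_def dactT_def EL.tbind_iter_comult[symmetric] by (simp only:)
qed

lemma tract_R: "tract H M t x = R x t"
proof -
  have "map2 (\<lambda>a (b, m). (b * a, ra m a)) xs w = map2 (eR H M) xs w" for xs w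
    by (rule map_cong) (auto simp: eR_def)
  then show ?thesis unfolding tract_def dactT_def ER.tbind_iter_comult[symmetric] by (simp only:)
qed

lemma hpart_iff: "t \<in> hpart H M \<longleftrightarrow> (\<exists>x. t = pure es [(x, 0)])"
proof
  assume t: "t \<in> hpart H M"
  obtain ws where ws: "\<And>w. w \<in> set ws \<Longrightarrow> length w = 1 \<and> set w \<subseteq> range (\<lambda>x. (x, 0))" "t = (\<Sum>w\<leftarrow>ws. pure es w)"
    by (rule tpow_list[OF t[unfolded hpart_def] order_refl]) (auto simp: sscale_def intro: that)
  have "\<exists>x. (\<Sum>w\<leftarrow>ws. pure es w) = pure es [(x, 0)]" using ws(1)
  proof (induction ws)
    case Nil
    have "pure es [(0, 0)] = 0" using lin_zero[OF lin_pure1[OF lin_id], of es] by (simp add: zero_prod_def)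
    then show ?case by (intro exI[of _ 0]) simp
  next
    case (Cons w ws)
    then obtain x where "(\<Sum>w\<leftarrow>ws. pure es w) = pure es [(x, 0)]" by fastforce
    moreover obtain y where "w = [(y, 0)]" using Cons.prems[of w] by (auto simp: length_Suc_conv)
    ultimately show ?case
      using lin_add[OF lin_pure1[OF lin_inj(1)[OF lin_id]], of y x] by (intro exI[of _ "y + x"]) simp
  qed
  then show "\<exists>x. t = pure es [(x, 0)]" using ws(2) by simp
qed (auto simp: hpart_def intro: tpow_pure)

lemma mpart_iff: "t \<in> mpart H M \<longleftrightarrow> (\<exists>m. t = pure es [(0, m)])"
proof
  assume t: "t \<in> mpart H M"
  obtain ws where ws: "\<And>w. w \<in> set ws \<Longrightarrow> length w = 1 \<and> set w \<subseteq> range (\<lambda>x. (0, x))" "t = (\<Sum>w\<leftarrow>ws. pure es w)"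
    by (rule tpow_list[OF t[unfolded mpart_def] order_refl]) (auto simp: sscale_def intro: that)
  have "\<exists>x. (\<Sum>w\<leftarrow>ws. pure es w) = pure es [(0, x)]" using ws(1)
  proof (induction ws)
    case Nil
    have "pure es [(0, 0)] = 0" using lin_zero[OF lin_pure1[OF lin_id], of es] by (simp add: zero_prod_def)
    then show ?case by (intro exI[of _ 0]) simp
  next
    case (Cons w ws)
    then obtain x where "(\<Sum>w\<leftarrow>ws. pure es w) = pure es [(0, x)]" by fastforce
    moreover obtain y where "w = [(0, y)]" using Cons.prems[of w] by (auto simp: length_Suc_conv)
    ultimately show ?case
      using lin_add[OF lin_pure1[OF lin_inj(2)[OF lin_id]], of y x] by (intro exI[of _ "y + x"]) simp
  qed
  then show "\<exists>x. t = pure es [(0, x)]" using ws(2) by simp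
qed (auto simp: mpart_def intro: tpow_pure)

lemma hsub_hpart: "hsub es 1 (hpart H M)" and hsub_mpart: "hsub es 1 (mpart H M)"
  unfolding hpart_def mpart_def by (rule hsub_tpow)+

lemma lcoact_ex: "\<exists>ps. lcoact M m = (\<Sum>(x, n)\<leftarrow>ps. pure es [(x, 0), (0, n)])"
proof -
  obtain qs where qs: "set qs \<subseteq> hpart H M \<times> mpart H M" "lcoact M m = (\<Sum>(x, y)\<leftarrow>qs. tmult es x y)"
    using tprod_list[OF lcoact_mem hsub_subspace[OF hsub_hpart]] by blast
  have "\<exists>ps. (\<Sum>(x, y)\<leftarrow>qs. tmult es x y) = (\<Sum>(x, n)\<leftarrow>ps. pure es [(x, 0), (0, n)])" using qs(1)
  proof (induction qs)
    case Nil then show ?case by (intro exI[of _ "[]"]) simp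
  next
    case (Cons q qs)
    then obtain ps where "(\<Sum>(x, y)\<leftarrow>qs. tmult es x y) = (\<Sum>(x, n)\<leftarrow>ps. pure es [(x, 0), (0, n)])" by auto
    moreover obtain x n where "q = (pure es [(x, 0)], pure es [(0, n)])"
      using Cons.prems by (cases q) (auto simp: hpart_iff mpart_iff)
    ultimately show ?case by (intro exI[of _ "(x, n) # ps"]) (simp add: tmult_pure)
  qed
  then show ?thesis using qs(2) by simp
qed

lemma rcoact_ex: "\<exists>ps. rcoact M m = (\<Sum>(n, x)\<leftarrow>ps. pure es [(0, n), (x, 0)])"
proof -
  obtain qs where qs: "set qs \<subseteq> mpart H M \<times> hpart H M" "rcoact M m = (\<Sum>(x, y)\<leftarrow>qs. tmult es x y)"
    using tprod_list[OF rcoact_mem hsub_subspace[OF hsub_mpart]] by blast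
  have "\<exists>ps. (\<Sum>(x, y)\<leftarrow>qs. tmult es x y) = (\<Sum>(n, x)\<leftarrow>ps. pure es [(0, n), (x, 0)])" using qs(1)
  proof (induction qs)
    case Nil then show ?case by (intro exI[of _ "[]"]) simp
  next
    case (Cons q qs)
    then obtain ps where "(\<Sum>(x, y)\<leftarrow>qs. tmult es x y) = (\<Sum>(n, x)\<leftarrow>ps. pure es [(0, n), (x, 0)])" by auto
    moreover obtain x n where "q = (pure es [(0, n)], pure es [(x, 0)])"
      using Cons.prems by (cases q) (auto simp: hpart_iff mpart_iff)
    ultimately show ?case by (intro exI[of _ "(n, x) # ps"]) (simp add: tmult_pure)
  qed
  then show ?thesis using qs(2) by simp
qed

lemma lc_spec: "lcoact M m = (\<Sum>(x, n)\<leftarrow>lc H M m. pure es [(x, 0), (0, n)]) \<and>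
   ((\<exists>ps. lcoact M m = (\<Sum>(x, n)\<leftarrow>ps. pure es [(x, 0), (0, n)]) \<and> snd ` set ps \<subseteq> V) \<longrightarrow> snd ` set (lc H M m) \<subseteq> V)"
proof -
  obtain ps where "lcoact M m = (\<Sum>(x, n)\<leftarrow>ps. pure es [(x, 0), (0, n)])" using lcoact_ex by blast
  then show ?thesis
    unfolding lc_def Let_def
    by (intro someI_ex[where P = "\<lambda>qs. lcoact M m = (\<Sum>(x, n)\<leftarrow>qs. pure es [(x, 0), (0, n)]) \<and>
   ((\<exists>ps. lcoact M m = (\<Sum>(x, n)\<leftarrow>ps. pure es [(x, 0), (0, n)]) \<and> snd ` set ps \<subseteq> V) \<longrightarrow> snd ` set qs \<subseteq> V)"])
      blast
qed

lemma lc: "lcoact M m = (\<Sum>(x, n)\<leftarrow>lc H M m. pure es [(x, 0), (0, n)])"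
  using lc_spec by blast

lemma rc: "rcoact M m = (\<Sum>(n, x)\<leftarrow>rc H M m. pure es [(0, n), (x, 0)])"
  unfolding rc_def by (rule someI_ex[OF rcoact_ex])

subsection \<open>Sweedler sums for the coactions\<close>

lemma tbind_pure2:
  assumes "\<And>n. lin s1 tscale (\<lambda>x. F x n)" "\<And>x. lin s2 tscale (\<lambda>n. F x n)"
    and p: "lin es s1 p" and q: "lin es s2 q"
  shows "tbind (pure es [e1, e2]) (\<lambda>w. case w of [e1, e2] \<Rightarrow> F (p e1) (q e2) | _ \<Rightarrow> 0) = F (p e1) (q e2)"
  by (subst tbind_pure_mlin[OF mlin_case2]) (auto intro: lin_comp[OF assms(1) p] lin_comp[OF assms(2) q])

lemma tbind_lcoact:
  assumes "\<And>n. lin hs tscale (\<lambda>x. F x n)" "\<And>x. lin ms tscale (\<lambda>n. F x n)"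
  shows "tbind (lcoact M m) (\<lambda>w. case w of [e1, e2] \<Rightarrow> F (fst e1) (snd e2) | _ \<Rightarrow> 0) = (\<Sum>(x, n)\<leftarrow>lc H M m. F x n)"
  using tbind_pure2[OF assms lin_fst[OF lin_id] lin_snd[OF lin_id]] by (simp add: lc[of m] tbind_sum_list2)

lemma tbind_rcoact:
  assumes "\<And>x. lin ms tscale (\<lambda>n. F n x)" "\<And>n. lin hs tscale (\<lambda>x. F n x)"
  shows "tbind (rcoact M m) (\<lambda>w. case w of [e1, e2] \<Rightarrow> F (snd e1) (fst e2) | _ \<Rightarrow> 0) = (\<Sum>(n, x)\<leftarrow>rc H M m. F n x)"
  using tbind_pure2[OF assms lin_snd[OF lin_id] lin_fst[OF lin_id]] by (simp add: rc[of m] tbind_sum_list2)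

lemma lin_lc [lin_intros]:
  assumes "linear_on s1 ms X A" "\<And>n. lin hs tscale (\<lambda>x. F x n)" "\<And>x. lin ms tscale (\<lambda>n. F x n)"
  shows "linear_on s1 tscale X (\<lambda>x. \<Sum>(x, n)\<leftarrow>lc H M (A x). F x n)"
  unfolding tbind_lcoact[OF assms(2,3), symmetric] by (intro lin_tbind lin_comp[OF lin_lcoact] assms(1))

lemma lin_rc [lin_intros]:
  assumes "linear_on s1 ms X A" "\<And>x. lin ms tscale (\<lambda>n. F n x)" "\<And>n. lin hs tscale (\<lambda>x. F n x)"
  shows "linear_on s1 tscale X (\<lambda>x. \<Sum>(n, x)\<leftarrow>rc H M (A x). F n x)"
  unfolding tbind_rcoact[OF assms(2,3), symmetric] by (intro lin_tbind lin_comp[OF lin_rcoact] assms(1))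

lemma lin_comult_emb: "lin hs tscale (comult_emb H M)"
  unfolding comult_emb_def by (intro lin_tbind lin_comult)

lemma comult_emb: "comult_emb H M x = (\<Sum>(a, b)\<leftarrow>cop H x. pure es [(a, 0), (b, 0)])"
proof -
  have "mlin hs (\<lambda>w. pure es (map (\<lambda>a. (a, 0)) w))"
    unfolding mlin_def by (auto intro!: lin_pure lin_intros)
  then show ?thesis unfolding comult_emb_def cop[of x] tbind_sum_list2 by (simp add: tbind_pure_mlin)
qed

lemma lco_h: "lco H M (x, 0) = (\<Sum>(a, b)\<leftarrow>cop H x. pure es [(a, 0), (b, 0)])"
  and lco_m: "lco H M (0, m) = (\<Sum>(x, n)\<leftarrow>lc H M m. pure es [(x, 0), (0, n)])"
  and rco_h: "rco H M (x, 0) = (\<Sum>(a, b)\<leftarrow>cop H x. pure es [(a, 0), (b, 0)])"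
  and rco_m: "rco H M (0, m) = (\<Sum>(n, x)\<leftarrow>rc H M m. pure es [(0, n), (x, 0)])"
  by (simp_all add: lco_def rco_def lin_zero[OF lin_comult_emb] lin_zero[OF lin_lcoact] lin_zero[OF lin_rcoact] flip: comult_emb lc rc)

sublocale LC: slot_map es "lco H M"
proof
  show "lin es tscale (lco H M)" unfolding lco_def
    by (intro lin_tscale_add lin_comp[OF lin_comult_emb] lin_comp[OF lin_lcoact] lin_intros)
  show "lco H M e \<in> TT es" for e
    unfolding lco_def comult_emb lc by (intro TT_intros)
qed

sublocale RC: slot_map es "rco H M"
proof
  show "lin es tscale (rco H M)" unfolding rco_def
    by (intro lin_tscale_add lin_comp[OF lin_comult_emb] lin_comp[OF lin_rcoact] lin_intros)
  show "rco H M e \<in> TT es" for e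
    unfolding rco_def comult_emb rc by (intro TT_intros)
qed

lemma lin_pure3': 
  assumes "\<And>b c. lin s1 tscale (\<lambda>a. F a b c)" "\<And>a c. lin s2 tscale (\<lambda>b. F a b c)" "\<And>a b. lin s3 tscale (\<lambda>c. F a b c)"
    and "lin es s1 p" "lin es s2 q" "lin es s3 r"
  shows "mlin es (\<lambda>w. case w of [e1, e2, e3] \<Rightarrow> F (p e1) (q e2) (r e3) | _ \<Rightarrow> 0)"
  by (rule mlin_case3) (auto intro: lin_comp[OF assms(1,4)] lin_comp[OF assms(2,5)] lin_comp[OF assms(3,6)])

lemmas ap_simps = lin_sum_list2[OF lin_apply_at[OF lin_id]] apply_at_pure[OF LC.F LC.F_TT] apply_at_pure[OF RC.F RC.F_TT]

lemma lc_coassoc: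
  assumes F: "\<And>b c. lin hs tscale (\<lambda>a. F a b c)" "\<And>a c. lin hs tscale (\<lambda>b. F a b c)" "\<And>a b. lin ms tscale (\<lambda>c. F a b c)"
  shows "(\<Sum>(x, n)\<leftarrow>lc H M m. \<Sum>(a, b)\<leftarrow>cop H x. F a b n) = (\<Sum>(x, n)\<leftarrow>lc H M m. \<Sum>(y, k)\<leftarrow>lc H M n. F x y k)"
proof -
  note ml = lin_pure3'[OF F lin_fst[OF lin_id] lin_fst[OF lin_id] lin_snd[OF lin_id]]
  have "(\<Sum>(x, n)\<leftarrow>lc H M m. \<Sum>(a, b)\<leftarrow>cop H x. pure es [(a, 0), (b, 0), (0, n)])
    = (\<Sum>(x, n)\<leftarrow>lc H M m. \<Sum>(y, k)\<leftarrow>lc H M n. pure es [(x, 0), (y, 0), (0, k)])"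
    using lcoact_coassoc[of m] unfolding lc[of m] ap_simps
    by (simp add: lco_h lco_m TT_sum_list2 tmult_sum_list2_left tmult_sum_list2_right tmult_pure)
  from arg_cong[OF this, of "\<lambda>t. tbind t (\<lambda>w. case w of [e1, e2, e3] \<Rightarrow> F (fst e1) (fst e2) (snd e3) | _ \<Rightarrow> 0)"]
  show ?thesis by (simp add: tbind_sum_list2 tbind_pure_mlin[OF ml])
qed

lemma rc_coassoc:
  assumes F: "\<And>b c. lin ms tscale (\<lambda>a. F a b c)" "\<And>a c. lin hs tscale (\<lambda>b. F a b c)" "\<And>a b. lin hs tscale (\<lambda>c. F a b c)"
  shows "(\<Sum>(n, x)\<leftarrow>rc H M m. \<Sum>(k, y)\<leftarrow>rc H M n. F k y x) = (\<Sum>(n, x)\<leftarrow>rc H M m. \<Sum>(a, b)\<leftarrow>cop H x. F n a b)"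
proof -
  note ml = lin_pure3'[OF F lin_snd[OF lin_id] lin_fst[OF lin_id] lin_fst[OF lin_id]]
  have "(\<Sum>(n, x)\<leftarrow>rc H M m. \<Sum>(k, y)\<leftarrow>rc H M n. pure es [(0, k), (y, 0), (x, 0)])
    = (\<Sum>(n, x)\<leftarrow>rc H M m. \<Sum>(a, b)\<leftarrow>cop H x. pure es [(0, n), (a, 0), (b, 0)])"
    using rcoact_coassoc[of m] unfolding rc[of m] ap_simps
    by (simp add: rco_h rco_m TT_sum_list2 tmult_sum_list2_left tmult_sum_list2_right tmult_pure)
  from arg_cong[OF this, of "\<lambda>t. tbind t (\<lambda>w. case w of [e1, e2, e3] \<Rightarrow> F (snd e1) (fst e2) (fst e3) | _ \<Rightarrow> 0)"]
  show ?thesis by (simp add: tbind_sum_list2 tbind_pure_mlin[OF ml])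
qed

lemma lc_rc_commute:
  assumes F: "\<And>b c. lin hs tscale (\<lambda>a. F a b c)" "\<And>a c. lin ms tscale (\<lambda>b. F a b c)" "\<And>a b. lin hs tscale (\<lambda>c. F a b c)"
  shows "(\<Sum>(n, x)\<leftarrow>rc H M m. \<Sum>(y, k)\<leftarrow>lc H M n. F y k x) = (\<Sum>(x, n)\<leftarrow>lc H M m. \<Sum>(k, y)\<leftarrow>rc H M n. F x k y)"
proof -
  note ml = lin_pure3'[OF F lin_fst[OF lin_id] lin_snd[OF lin_id] lin_fst[OF lin_id]]
  have "(\<Sum>(n, x)\<leftarrow>rc H M m. \<Sum>(y, k)\<leftarrow>lc H M n. pure es [(y, 0), (0, k), (x, 0)])
    = (\<Sum>(x, n)\<leftarrow>lc H M m. \<Sum>(k, y)\<leftarrow>rc H M n. pure es [(x, 0), (0, k), (y, 0)])"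
    using coact_commute[of m] unfolding rc[of m] lc[of m] ap_simps
    by (simp add: lco_m rco_m TT_sum_list2 tmult_sum_list2_left tmult_sum_list2_right tmult_pure)
  from arg_cong[OF this, of "\<lambda>t. tbind t (\<lambda>w. case w of [e1, e2, e3] \<Rightarrow> F (fst e1) (snd e2) (fst e3) | _ \<Rightarrow> 0)"]
  show ?thesis by (simp add: tbind_sum_list2 tbind_pure_mlin[OF ml])
qed

end

section \<open>Cancelling the antipode across several Sweedler legs\<close>

context hopf
begin

text \<open>In Sweedler notation, S(x3) \<otimes> x1 S(x2) equals S(x) \<otimes> 1: coassociativity
  groups x1 with x2, the antipode cancels there, and the counit law absorbs the scalar.\<close>

lemma cop_antipode3:
  assumes G: "\<And>b. lin hs tscale (\<lambda>a. G a b)" "\<And>a. lin hs tscale (\<lambda>b. G a b)"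
  shows "(\<Sum>(y, r)\<leftarrow>cop H x. \<Sum>(a, b)\<leftarrow>cop H r. G (S b) (y * S a)) = G (S x) 1"
proof -
  note l [lin_intros] = lin_comp[OF G(1)] lin_comp[OF G(2)]
  have "(\<Sum>(y, r)\<leftarrow>cop H x. \<Sum>(a, b)\<leftarrow>cop H r. G (S b) (y * S a))
    = (\<Sum>(u, b)\<leftarrow>cop H x. \<Sum>(y, a)\<leftarrow>cop H u. G (S b) (y * S a))"
    by (rule cop_coassoc[symmetric]) (intro lin_intros)+
  also have "\<dots> = (\<Sum>(u, b)\<leftarrow>cop H x. tscale (\<epsilon> u) (G (S b) 1))"
    by (intro sum_list_cong2 cop_antipode_r G)
  also have "\<dots> = G (S x) 1" by (rule cop_counit_l) (intro lin_intros)
  finally show ?thesis .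
qed

text \<open>Of the four legs, the inner pair x2 S(x3) cancels first, by
  \<open>cop_antipode3\<close>, and then the outer pair x1 S(x4).\<close>

lemma cop_antipode4:
  assumes G: "\<And>b. lin hs tscale (\<lambda>a. G a b)" "\<And>a. lin hs tscale (\<lambda>b. G a b)"
  shows "(\<Sum>(a, b)\<leftarrow>cop H x. \<Sum>(c, d)\<leftarrow>cop H a. \<Sum>(b1, b2)\<leftarrow>cop H b. G (c * S b2) (d * S b1)) = tscale (\<epsilon> x) (G 1 1)"
proof -
  note l [lin_intros] = lin_comp[OF G(1)] lin_comp[OF G(2)]
  have "(\<Sum>(a, b)\<leftarrow>cop H x. \<Sum>(c, d)\<leftarrow>cop H a. \<Sum>(b1, b2)\<leftarrow>cop H b. G (c * S b2) (d * S b1))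
    = (\<Sum>(c, r)\<leftarrow>cop H x. \<Sum>(d, b)\<leftarrow>cop H r. \<Sum>(b1, b2)\<leftarrow>cop H b. G (c * S b2) (d * S b1))"
    by (rule cop_coassoc) (intro lin_intros)+
  also have "\<dots> = (\<Sum>(c, r)\<leftarrow>cop H x. G (c * S r) 1)"
    by (intro sum_list_cong2 cop_antipode3[where G = "\<lambda>a b. G (c * a) b" for c] lin_intros)
  also have "\<dots> = tscale (\<epsilon> x) (G 1 1)" by (rule cop_antipode_r) (rule G)
  finally show ?thesis .
qed

end

context hopf_bimod
begin

lemma tlift_words:
  assumes "\<And>n. lin s1 ms (\<lambda>x. F x n)" "\<And>x. lin s2 ms (\<lambda>n. F x n)" "lin es s1 p" "lin es s2 q"
  shows "tlift ms (\<lambda>w. case w of [e1, e2] \<Rightarrow> F (p e1) (q e2) | _ \<Rightarrow> 0) (\<Sum>w\<leftarrow>map (\<lambda>(e1, e2). [e1, e2]) ps. pure es w)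
    = (\<Sum>(e1, e2)\<leftarrow>ps. F (p e1) (q e2))"
proof -
  have z: "pure ms [0] = 0" using lin_zero[OF lin_pure1[OF lin_id]] .
  have *: "(\<lambda>w. pure ms [case w of [a, b] \<Rightarrow> F (p a) (q b) | _ \<Rightarrow> 0]) = (\<lambda>w. case w of [a, b] \<Rightarrow> pure ms [F (p a) (q b)] | _ \<Rightarrow> 0)"
    by (auto simp: z fun_eq_iff split: list.split)
  have "mlin es (\<lambda>w. pure ms [case w of [a, b] \<Rightarrow> F (p a) (q b) | _ \<Rightarrow> 0])"
    unfolding * by (intro mlin_case2 lin_pure1 lin_comp[OF assms(1,3)] lin_comp[OF assms(2,4)])
  then show ?thesis
    by (subst tlift_sum_list[OF vs_m]) (auto simp: comp_def case_prod_beta')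
qed

lemma lin_ms_left: "lin hs ms (\<lambda>x. ms (\<epsilon> x) n)" and lin_ms_right: "lin ms ms (ms c)"
proof -
  interpret vector_space ms by (rule vs_m)
  show "lin hs ms (\<lambda>x. ms (\<epsilon> x) n)" "lin ms ms (ms c)"
    using lin_counit by (auto simp: linear_on_def scale_left_distrib scale_right_distrib mult.commute)
qed

lemma lc_words: "lcoact M m = (\<Sum>w\<leftarrow>map (\<lambda>(e1, e2). [e1, e2]) (map (\<lambda>(x, n). ((x, 0), (0, n))) (lc H M m)). pure es w)"
  and rc_words: "rcoact M m = (\<Sum>w\<leftarrow>map (\<lambda>(e1, e2). [e1, e2]) (map (\<lambda>(n, x). ((0, n), (x, 0))) (rc H M m)). pure es w)"
  by (simp_all add: lc[of m] rc[of m] comp_def case_prod_beta')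

lemma lc_counit: "lin ms tscale F \<Longrightarrow> (\<Sum>(x, n)\<leftarrow>lc H M m. tscale (\<epsilon> x) (F n)) = F m"
proof -
  assume F: "lin ms tscale F"
  have c: "(\<lambda>w. case w of [(x, _), (_, n)] \<Rightarrow> ms (\<epsilon> x) n | _ \<Rightarrow> 0)
      = (\<lambda>w. case w of [e1, e2] \<Rightarrow> ms (\<epsilon> (fst e1)) (snd e2) | _ \<Rightarrow> 0)"
    by (auto simp: fun_eq_iff split: list.split)
  have "(\<Sum>(x, n)\<leftarrow>lc H M m. ms (\<epsilon> x) n) = m"
    using lcoact_counit[of m] tlift_words[OF lin_ms_left lin_ms_right lin_fst[OF lin_id] lin_snd[OF lin_id], of "map (\<lambda>(x, n). ((x, 0), (0, n))) (lc H M m)"]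
    unfolding c lc_words by (simp add: comp_def case_prod_beta')
  then show ?thesis using lin_sum_list2[OF F, of "\<lambda>x n. ms (\<epsilon> x) n" "lc H M m"] by (simp add: lin_scale[OF F])
qed

lemma rc_counit: "lin ms tscale F \<Longrightarrow> (\<Sum>(n, x)\<leftarrow>rc H M m. tscale (\<epsilon> x) (F n)) = F m"
proof -
  assume F: "lin ms tscale F"
  have c: "(\<lambda>w. case w of [(_, n), (x, _)] \<Rightarrow> ms (\<epsilon> x) n | _ \<Rightarrow> 0)
      = (\<lambda>w. case w of [e1, e2] \<Rightarrow> ms (\<epsilon> (fst e2)) (snd e1) | _ \<Rightarrow> 0)"
    by (auto simp: fun_eq_iff split: list.split)
  have "(\<Sum>(n, x)\<leftarrow>rc H M m. ms (\<epsilon> x) n) = m"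
    using rcoact_counit[of m] tlift_words[where F = "\<lambda>n x. ms (\<epsilon> x) n", OF lin_ms_right lin_ms_left lin_snd[OF lin_id] lin_fst[OF lin_id], of "map (\<lambda>(n, x). ((0, n), (x, 0))) (rc H M m)"]
    unfolding c rc_words by (simp add: comp_def case_prod_beta')
  then show ?thesis using lin_sum_list2[OF F, of "\<lambda>n x. ms (\<epsilon> x) n" "rc H M m"] by (simp add: lin_scale[OF F])
qed

subsection \<open>Compatibility of actions and coactions\<close>

lemma EL_da2: "EL.da [e1, e2] x = (\<Sum>(a, b)\<leftarrow>cop H x. pure es [eL H M a e1, eL H M b e2])"
  by (subst dact.simps(2), subst EL.da_single) (simp add: tmult_pure)

lemma ER_da2: "ER.da [e1, e2] x = (\<Sum>(a, b)\<leftarrow>cop H x. pure es [eR H M a e1, eR H M b e2])"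
  by (subst dact.simps(2), subst ER.da_single) (simp add: tmult_pure)

lemma eL_simps [simp]: "eL H M x (y, 0) = (x * y, 0)" "eL H M x (0, m) = (0, la x m)"
  and eR_simps [simp]: "eR H M x (y, 0) = (y * x, 0)" "eR H M x (0, m) = (0, ra m x)"
  by (simp_all add: eL_def eR_def lin_zero[OF lin_la2] lin_zero[OF lin_ra2])

lemma lc_la:
  assumes F: "\<And>n. lin hs tscale (\<lambda>x. F x n)" "\<And>x. lin ms tscale (\<lambda>n. F x n)"
  shows "(\<Sum>(x, n)\<leftarrow>lc H M (la h m). F x n) = (\<Sum>(x, n)\<leftarrow>lc H M m. \<Sum>(a, b)\<leftarrow>cop H h. F (a * x) (la b n))"
proof -
  note t = tbind_pure2[OF F lin_fst[OF lin_id] lin_snd[OF lin_id]]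
  show ?thesis
    unfolding tbind_lcoact[OF F, symmetric] lcoact_la tlact_L lc[of m]
    by (simp add: dactT_sum_list2 EL_da2 tbind_sum_list2 t del: dact.simps)
qed

lemma lc_ra:
  assumes F: "\<And>n. lin hs tscale (\<lambda>x. F x n)" "\<And>x. lin ms tscale (\<lambda>n. F x n)"
  shows "(\<Sum>(x, n)\<leftarrow>lc H M (ra m h). F x n) = (\<Sum>(x, n)\<leftarrow>lc H M m. \<Sum>(a, b)\<leftarrow>cop H h. F (x * a) (ra n b))"
proof -
  note t = tbind_pure2[OF F lin_fst[OF lin_id] lin_snd[OF lin_id]]
  show ?thesis
    unfolding tbind_lcoact[OF F, symmetric] lcoact_ra tract_R lc[of m]
    by (simp add: dactT_sum_list2 ER_da2 tbind_sum_list2 t del: dact.simps)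
qed

lemma rc_la:
  assumes F: "\<And>x. lin ms tscale (\<lambda>n. F n x)" "\<And>n. lin hs tscale (\<lambda>x. F n x)"
  shows "(\<Sum>(n, x)\<leftarrow>rc H M (la h m). F n x) = (\<Sum>(n, x)\<leftarrow>rc H M m. \<Sum>(a, b)\<leftarrow>cop H h. F (la a n) (b * x))"
proof -
  note t = tbind_pure2[OF F lin_snd[OF lin_id] lin_fst[OF lin_id]]
  show ?thesis
    unfolding tbind_rcoact[OF F, symmetric] rcoact_la tlact_L rc[of m]
    by (simp add: dactT_sum_list2 EL_da2 tbind_sum_list2 t del: dact.simps)
qed

lemma rc_ra:
  assumes F: "\<And>x. lin ms tscale (\<lambda>n. F n x)" "\<And>n. lin hs tscale (\<lambda>x. F n x)"
  shows "(\<Sum>(n, x)\<leftarrow>rc H M (ra m h). F n x) = (\<Sum>(n, x)\<leftarrow>rc H M m. \<Sum>(a, b)\<leftarrow>cop H h. F (ra n a) (x * b))"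
proof -
  note t = tbind_pure2[OF F lin_snd[OF lin_id] lin_fst[OF lin_id]]
  show ?thesis
    unfolding tbind_rcoact[OF F, symmetric] rcoact_ra tract_R rc[of m]
    by (simp add: dactT_sum_list2 ER_da2 tbind_sum_list2 t del: dact.simps)
qed

lemma lin_es_split: "lin es tscale F \<Longrightarrow> F (x, m) = F (x, 0) + F (0, m)"
  using lin_add[of es tscale F "(x, 0)" "(0, m)"] by simp

lemma es_eqI:
  assumes "lin es tscale F" "lin es tscale G" "\<And>x. F (x, 0) = G (x, 0)" "\<And>m. F (0, m) = G (0, m)"
  shows "F e = G e"
  using assms lin_es_split[OF assms(1)] lin_es_split[OF assms(2)] by (cases e) metis

lemma lco_eR: "lco H M (eR H M h e) = R h (lco H M e)"
proof (rule es_eqI[of "\<lambda>e. lco H M (eR H M h e)" "\<lambda>e. R h (lco H M e)"])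
  fix x
  have "lco H M (x * h, 0) = (\<Sum>(a, b)\<leftarrow>cop H x. \<Sum>(c, d)\<leftarrow>cop H h. pure es [(a * c, 0), (b * d, 0)])"
    unfolding lco_h by (rule cop_mult; intro lin_intros)
  then show "lco H M (eR H M h (x, 0)) = R h (lco H M (x, 0))"
    by (simp add: lco_h dactT_sum_list2 ER_da2 del: dact.simps)
next
  fix m
  show "lco H M (eR H M h (0, m)) = R h (lco H M (0, m))"
    by (simp add: lco_def lin_zero[OF lin_comult_emb] lcoact_ra tract_R)
qed (intro lin_intros lin_comp[OF LC.F])+

lemma rco_eR: "rco H M (eR H M h e) = R h (rco H M e)"
proof (rule es_eqI[of "\<lambda>e. rco H M (eR H M h e)" "\<lambda>e. R h (rco H M e)"])
  fix x
  have "rco H M (x * h, 0) = (\<Sum>(a, b)\<leftarrow>cop H x. \<Sum>(c, d)\<leftarrow>cop H h. pure es [(a * c, 0), (b * d, 0)])"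
    unfolding rco_h by (rule cop_mult; intro lin_intros)
  then show "rco H M (eR H M h (x, 0)) = R h (rco H M (x, 0))"
    by (simp add: rco_h dactT_sum_list2 ER_da2 del: dact.simps)
next
  fix m
  show "rco H M (eR H M h (0, m)) = R h (rco H M (0, m))"
    by (simp add: rco_def lin_zero[OF lin_comult_emb] rcoact_ra tract_R)
qed (intro lin_intros lin_comp[OF RC.F])+

lemmas apply_lco_R = ER.apply_at_dT[OF LC.slot_map_axioms lco_eR]
  and apply_rco_R = ER.apply_at_dT[OF RC.slot_map_axioms rco_eR]

lemma R_mult: "t \<in> TT es \<Longrightarrow> R (x * y) t = R y (R x t)"
  by (rule ER.dT_mult_right) (simp_all add: eR_def ra_mult mult.assoc)

lemma R_1: "t \<in> TT es \<Longrightarrow> R 1 t = t"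
  by (rule ER.dT_one) (simp_all add: eR_def)

lemma L_R: "t \<in> TT es \<Longrightarrow> L x (R y t) = R y (L x t)"
  by (rule dactT_commute[OF EL.letter_action_axioms ER.letter_action_axioms]) (simp_all add: eL_def eR_def la_ra mult.assoc)

subsection \<open>Coinvariants and the adjoint action\<close>

abbreviation ad where "ad \<equiv> adjoint_act H M"
abbreviation P where "P \<equiv> coinv_proj H M"

lemma ad: "ad x m = (\<Sum>(a, b)\<leftarrow>cop H x. ra (la a m) (S b))"
  unfolding adjoint_act_def by (rule tlift_comult[OF vs_m]; intro lin_intros)

lemma P: "P m = (\<Sum>(n, x)\<leftarrow>rc H M m. ra n (S x))"
proof -
  have c: "(\<lambda>w. case w of [(_, n), (x, _)] \<Rightarrow> ra n (S x) | _ \<Rightarrow> 0)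
      = (\<lambda>w. case w of [e1, e2] \<Rightarrow> ra (snd e1) (S (fst e2)) | _ \<Rightarrow> 0)"
    by (auto simp: fun_eq_iff split: list.split)
  have l: "lin ms ms (\<lambda>n. ra n (S x))" "lin hs ms (\<lambda>x. ra n (S x))" for n x by (intro lin_intros)+
  show ?thesis
    unfolding coinv_proj_def c rc_words
    by (subst tlift_words[where F = "\<lambda>n x. ra n (S x)", OF l lin_snd[OF lin_id] lin_fst[OF lin_id]]) (simp add: comp_def case_prod_beta')
qed

lemma ad_F: "lin ms tscale F \<Longrightarrow> F (ad x m) = (\<Sum>(a, b)\<leftarrow>cop H x. F (ra (la a m) (S b)))"
  unfolding ad by (rule lin_sum_list2)

lemma P_F: "lin ms tscale F \<Longrightarrow> F (P m) = (\<Sum>(n, x)\<leftarrow>rc H M m. F (ra n (S x)))"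
  unfolding P by (rule lin_sum_list2)

text \<open>The calculus of Sweedler sums is set up for tensor values. Elements of \<open>M\<close>
  are therefore handled through their tensors of degree one, which determine them by
  \<open>pure_single_inject\<close>.\<close>

lemma lin_if_pure:
  assumes "lin s1 tscale (\<lambda>x. pure ms [A x])" shows "lin s1 ms A"
proof -
  note l = lin_pure1[OF lin_id, of ms UNIV]
  have "pure ms [A (x + y)] = pure ms [A x + A y]" for x y
    using lin_add[OF assms, of x y] lin_add[OF l, of "A x" "A y"] by simp
  moreover have "pure ms [A (s1 c x)] = pure ms [ms c (A x)]" for c x
    using lin_scale[OF assms, of c x] lin_scale[OF l, of c "A x"] by simp
  ultimately show ?thesis by (simp add: linear_on_def pure_single_inject[OF vs_m])
qed

lemma lin_ad1: "lin hs ms (\<lambda>x. ad x m)" and lin_ad2: "lin ms ms (ad x)" and lin_P: "lin ms ms P"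
proof -
  have a: "pure ms [ad x m] = (\<Sum>(a, b)\<leftarrow>cop H x. pure ms [ra (la a m) (S b)])" for x m
    by (rule ad_F) (intro lin_intros)
  have p: "pure ms [P m] = (\<Sum>(n, x)\<leftarrow>rc H M m. pure ms [ra n (S x)])" for m
    by (rule P_F) (intro lin_intros)
  have "lin hs tscale (\<lambda>x. pure ms [ad x m])" "lin ms tscale (\<lambda>m. pure ms [ad x m])" "lin ms tscale (\<lambda>m. pure ms [P m])"
    unfolding a p by (intro lin_intros)+
  then show "lin hs ms (\<lambda>x. ad x m)" "lin ms ms (ad x)" "lin ms ms P"
    by - (rule lin_if_pure; assumption)+
qed

sublocale AD: letter_action H ms ad
  by unfold_locales (rule lin_ad1 lin_ad2)+

lemma lin_P_comp [lin_intros]: "linear_on s1 ms X A \<Longrightarrow> linear_on s1 ms X (\<lambda>x. P (A x))"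
  by (rule lin_comp[OF lin_P])

lemma ad_mult: "ad (x * y) m = ad x (ad y m)"
proof -
  have "pure ms [ad (x * y) m] = (\<Sum>(a, b)\<leftarrow>cop H (x * y). pure ms [ra (la a m) (S b)])"
    by (rule ad_F) (intro lin_intros)
  also have "\<dots> = (\<Sum>(a, b)\<leftarrow>cop H x. \<Sum>(c, d)\<leftarrow>cop H y. pure ms [ra (la (a * c) m) (S (b * d))])"
    by (rule cop_mult; intro lin_intros)
  also have "\<dots> = (\<Sum>(a, b)\<leftarrow>cop H x. pure ms [ra (la a (ad y m)) (S b)])"
  proof (intro sum_list_cong2)
    fix a b
    have "pure ms [ra (la a (ad y m)) (S b)] = (\<Sum>(c, d)\<leftarrow>cop H y. pure ms [ra (la a (ra (la c m) (S d))) (S b)])"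
      by (rule ad_F) (intro lin_intros)
    then show "(\<Sum>(c, d)\<leftarrow>cop H y. pure ms [ra (la (a * c) m) (S (b * d))]) = pure ms [ra (la a (ad y m)) (S b)]"
      by (simp add: la_mult ra_mult S_mult la_ra)
  qed
  also have "\<dots> = pure ms [ad x (ad y m)]"
    by (rule ad_F[symmetric]) (intro lin_intros)
  finally show ?thesis by (simp add: pure_single_inject[OF vs_m])
qed

lemma ad_1: "ad 1 m = m"
proof -
  have "pure ms [ad 1 m] = (\<Sum>(a, b)\<leftarrow>cop H 1. pure ms [ra (la a m) (S b)])"
    by (rule ad_F) (intro lin_intros)
  also have "\<dots> = pure ms [ra (la 1 m) (S 1)]" by (rule cop_1; intro lin_intros)
  finally show ?thesis by (simp add: S_1 pure_single_inject[OF vs_m])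
qed

text \<open>In Sweedler notation, (h1 m S(h2)) h3 = h m. This replaces a left multiplication by the
  adjoint action followed by a right multiplication.\<close>

lemma ad_ra:
  assumes F: "lin ms tscale F"
  shows "(\<Sum>(a, b)\<leftarrow>cop H h. F (ra (ad a m) b)) = F (la h m)"
proof -
  note l [lin_intros] = lin_comp[OF F]
  have "(\<Sum>(a, b)\<leftarrow>cop H h. F (ra (ad a m) b)) = (\<Sum>(a, b)\<leftarrow>cop H h. \<Sum>(c, d)\<leftarrow>cop H a. F (ra (ra (la c m) (S d)) b))"
    by (intro sum_list_cong2 ad_F lin_intros)
  also have "\<dots> = (\<Sum>(a, b)\<leftarrow>cop H h. \<Sum>(c, d)\<leftarrow>cop H b. F (ra (la a m) (S c * d)))"
    unfolding ra_mult[symmetric] by (rule cop_coassoc; intro lin_intros)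
  also have "\<dots> = (\<Sum>(a, b)\<leftarrow>cop H h. tscale (\<epsilon> b) (F (ra (la a m) 1)))"
    by (intro sum_list_cong2 cop_antipode_l lin_intros)
  also have "\<dots> = F (ra (la h m) 1)" by (rule cop_counit_r) (intro lin_intros)
  finally show ?thesis by simp
qed

text \<open>The Yetter-Drinfel'd condition in a form without antipode; it holds on all of \<open>M\<close>.\<close>

lemma yetter_drinfeld:
  assumes F: "\<And>n. lin hs tscale (\<lambda>x. F x n)" "\<And>x. lin ms tscale (\<lambda>n. F x n)"
  shows "(\<Sum>(a, b)\<leftarrow>cop H h. \<Sum>(x, n)\<leftarrow>lc H M (ad a m). F (x * b) n)
    = (\<Sum>(a, b)\<leftarrow>cop H h. \<Sum>(x, n)\<leftarrow>lc H M m. F (a * x) (ad b n))"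
proof -
  note l [lin_intros] = lin_comp[OF F(1)] lin_comp[OF F(2)]
  have "(\<Sum>(a, b)\<leftarrow>cop H h. \<Sum>(x, n)\<leftarrow>lc H M m. F (a * x) (ad b n))
    = (\<Sum>(a, b)\<leftarrow>cop H h. \<Sum>(x, n)\<leftarrow>lc H M m. \<Sum>(c, d)\<leftarrow>cop H b. F (a * x) (ra (la c n) (S d)))"
    by (intro sum_list_cong2 ad_F F)
  also have "\<dots> = (\<Sum>(a, b)\<leftarrow>cop H h. \<Sum>(c, d)\<leftarrow>cop H b. \<Sum>(x, n)\<leftarrow>lc H M m. F (a * x) (ra (la c n) (S d)))"
    by (intro sum_list_cong2 sum_list_swap)
  also have "\<dots> = (\<Sum>(a, b)\<leftarrow>cop H h. \<Sum>(c, d)\<leftarrow>cop H a. \<Sum>(x, n)\<leftarrow>lc H M m. F (c * x) (ra (la d n) (S b)))"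
    by (rule cop_coassoc[symmetric]; intro lin_intros)
  also have "\<dots> = (\<Sum>(a, b)\<leftarrow>cop H h. \<Sum>(x, n)\<leftarrow>lc H M m. \<Sum>(c, d)\<leftarrow>cop H a. F (c * x) (ra (la d n) (S b)))"
    by (intro sum_list_cong2 sum_list_swap)
  also have "\<dots> = (\<Sum>(a, b)\<leftarrow>cop H h. \<Sum>(x, n)\<leftarrow>lc H M (la a m). F x (ra n (S b)))"
    by (intro sum_list_cong2 lc_la[symmetric] lin_intros)
  \<comment> \<open>The left action of a is split into an adjoint action and a right multiplication
    by d. The legs of d then meet S(b): one of them cancels, the other remains in the
    \<open>H\<close>-part.\<close>
  also have "\<dots> = (\<Sum>(a, b)\<leftarrow>cop H h. \<Sum>(c, d)\<leftarrow>cop H a. \<Sum>(x, n)\<leftarrow>lc H M (ra (ad c m) d). F x (ra n (S b)))"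
    by (intro sum_list_cong2 ad_ra[symmetric] lin_intros)
  also have "\<dots> = (\<Sum>(a, b)\<leftarrow>cop H h. \<Sum>(c, d)\<leftarrow>cop H a. \<Sum>(x, n)\<leftarrow>lc H M (ad c m). \<Sum>(u, v)\<leftarrow>cop H d. F (x * u) (ra (ra n v) (S b)))"
    by (intro sum_list_cong2 lc_ra lin_intros)
  also have "\<dots> = (\<Sum>(a, b)\<leftarrow>cop H h. \<Sum>(c, d)\<leftarrow>cop H b. \<Sum>(x, n)\<leftarrow>lc H M (ad a m). \<Sum>(u, v)\<leftarrow>cop H c. F (x * u) (ra n (v * S d)))"
    unfolding ra_mult[symmetric] by (rule cop_coassoc; intro lin_intros)
  also have "\<dots> = (\<Sum>(a, b)\<leftarrow>cop H h. \<Sum>(x, n)\<leftarrow>lc H M (ad a m). \<Sum>(c, d)\<leftarrow>cop H b. \<Sum>(u, v)\<leftarrow>cop H c. F (x * u) (ra n (v * S d)))"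
    by (intro sum_list_cong2 sum_list_swap)
  also have "\<dots> = (\<Sum>(a, b)\<leftarrow>cop H h. \<Sum>(x, n)\<leftarrow>lc H M (ad a m). \<Sum>(c, d)\<leftarrow>cop H b. \<Sum>(u, v)\<leftarrow>cop H d. F (x * c) (ra n (u * S v)))"
    by (intro sum_list_cong2 cop_coassoc lin_intros)
  also have "\<dots> = (\<Sum>(a, b)\<leftarrow>cop H h. \<Sum>(x, n)\<leftarrow>lc H M (ad a m). \<Sum>(c, d)\<leftarrow>cop H b. tscale (\<epsilon> d) (F (x * c) (ra n 1)))"
    by (intro sum_list_cong2 cop_antipode_r lin_intros)
  also have "\<dots> = (\<Sum>(a, b)\<leftarrow>cop H h. \<Sum>(x, n)\<leftarrow>lc H M (ad a m). F (x * b) (ra n 1))"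
    by (intro sum_list_cong2 cop_counit_r lin_intros)
  finally show ?thesis by simp
qed

lemma coinvariantsD:
  assumes "v \<in> V" and F: "\<And>x. lin ms tscale (\<lambda>n. F n x)" "\<And>n. lin hs tscale (\<lambda>x. F n x)"
  shows "(\<Sum>(n, x)\<leftarrow>rc H M v. F n x) = F v 1"
proof -
  have "rcoact M v = pure es [(0, v), (1, 0)]" using assms(1) by (simp add: coinvariants_def)
  then show ?thesis
    unfolding tbind_rcoact[OF F, symmetric]
    using tbind_pure2[OF F lin_snd[OF lin_id] lin_fst[OF lin_id]] by simp
qed

text \<open>P(m0) m1 = m0 S(m1) m2 = m. Together with \<open>P_coinvariant\<close> this writes each
  element of \<open>M\<close> as a sum of coinvariants times elements of \<open>H\<close>.\<close>

lemma rc_P: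
  assumes F: "lin ms tscale F"
  shows "(\<Sum>(n, x)\<leftarrow>rc H M m. F (ra (P n) x)) = F m"
proof -
  note l [lin_intros] = lin_comp[OF F]
  have "(\<Sum>(n, x)\<leftarrow>rc H M m. F (ra (P n) x)) = (\<Sum>(n, x)\<leftarrow>rc H M m. \<Sum>(k, y)\<leftarrow>rc H M n. F (ra (ra k (S y)) x))"
    by (intro sum_list_cong2 P_F lin_intros)
  also have "\<dots> = (\<Sum>(n, x)\<leftarrow>rc H M m. \<Sum>(a, b)\<leftarrow>cop H x. F (ra n (S a * b)))"
    unfolding ra_mult[symmetric] by (rule rc_coassoc; intro lin_intros)
  also have "\<dots> = (\<Sum>(n, x)\<leftarrow>rc H M m. tscale (\<epsilon> x) (F (ra n 1)))"
    by (intro sum_list_cong2 cop_antipode_l lin_intros)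
  also have "\<dots> = F (ra m 1)" by (rule rc_counit) (intro lin_intros)
  finally show ?thesis by simp
qed

text \<open>Both sides are obtained by letting \<open>S x2 \<otimes> S x1\<close> act on the coaction of \<open>n = P(n0) n1\<close>;
  this avoids the coproduct of the antipode.\<close>

lemma rc_P_coinvariant:
  assumes F: "\<And>x. lin ms tscale (\<lambda>n. F n x)" "\<And>n. lin hs tscale (\<lambda>x. F n x)"
  shows "(\<Sum>(n, x)\<leftarrow>rc H M (P m). F n x) = F (P m) 1"
proof -
  note l [lin_intros] = lin_comp[OF F(1)] lin_comp[OF F(2)]
  define X where "X = (\<Sum>(n, x)\<leftarrow>rc H M m. \<Sum>(x1, x2)\<leftarrow>cop H x. \<Sum>(k, y)\<leftarrow>rc H M n. F (ra k (S x2)) (y * S x1))"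
  have "X = (\<Sum>(n, x)\<leftarrow>rc H M m. \<Sum>(k, y)\<leftarrow>rc H M n. \<Sum>(x1, x2)\<leftarrow>cop H x. F (ra k (S x2)) (y * S x1))"
    unfolding X_def by (intro sum_list_cong2 sum_list_swap)
  also have "\<dots> = (\<Sum>(n, x)\<leftarrow>rc H M m. \<Sum>(y, r)\<leftarrow>cop H x. \<Sum>(x1, x2)\<leftarrow>cop H r. F (ra n (S x2)) (y * S x1))"
    by (rule rc_coassoc; intro lin_intros)
  also have "\<dots> = (\<Sum>(n, x)\<leftarrow>rc H M m. F (ra n (S x)) 1)"
    by (intro sum_list_cong2 cop_antipode3[where G = "\<lambda>a b. F (ra n a) b" for n] lin_intros)
  also have "\<dots> = F (P m) 1"
    by (rule P_F[symmetric]) (rule F)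
  finally have 1: "X = F (P m) 1" .
  have "X = (\<Sum>(n, x)\<leftarrow>rc H M m. \<Sum>(x1, x2)\<leftarrow>cop H x. \<Sum>(n0, n1)\<leftarrow>rc H M n. \<Sum>(k, y)\<leftarrow>rc H M (ra (P n0) n1). F (ra k (S x2)) (y * S x1))"
    unfolding X_def by (intro sum_list_cong2 rc_P[symmetric] lin_intros)
  also have "\<dots> = (\<Sum>(n, x)\<leftarrow>rc H M m. \<Sum>(x1, x2)\<leftarrow>cop H x. \<Sum>(n0, n1)\<leftarrow>rc H M n. \<Sum>(k, y)\<leftarrow>rc H M (P n0). \<Sum>(c, d)\<leftarrow>cop H n1.
      F (ra (ra k c) (S x2)) (y * d * S x1))"
    by (intro sum_list_cong2 rc_ra lin_intros)
  also have "\<dots> = (\<Sum>(n, x)\<leftarrow>rc H M m. \<Sum>(n0, n1)\<leftarrow>rc H M n. \<Sum>(x1, x2)\<leftarrow>cop H x. \<Sum>(k, y)\<leftarrow>rc H M (P n0). \<Sum>(c, d)\<leftarrow>cop H n1.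
      F (ra k (c * S x2)) (y * (d * S x1)))"
    unfolding ra_mult[symmetric] mult.assoc by (intro sum_list_cong2 sum_list_swap)
  also have "\<dots> = (\<Sum>(n, x)\<leftarrow>rc H M m. \<Sum>(a, b)\<leftarrow>cop H x. \<Sum>(x1, x2)\<leftarrow>cop H b. \<Sum>(k, y)\<leftarrow>rc H M (P n). \<Sum>(c, d)\<leftarrow>cop H a.
      F (ra k (c * S x2)) (y * (d * S x1)))"
    by (rule rc_coassoc; intro lin_intros)
  also have "\<dots> = (\<Sum>(n, x)\<leftarrow>rc H M m. \<Sum>(a, b)\<leftarrow>cop H x. \<Sum>(k, y)\<leftarrow>rc H M (P n). \<Sum>(x1, x2)\<leftarrow>cop H b. \<Sum>(c, d)\<leftarrow>cop H a.
      F (ra k (c * S x2)) (y * (d * S x1)))"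
    by (intro sum_list_cong2 sum_list_swap)
  also have "\<dots> = (\<Sum>(n, x)\<leftarrow>rc H M m. \<Sum>(k, y)\<leftarrow>rc H M (P n). \<Sum>(a, b)\<leftarrow>cop H x. \<Sum>(x1, x2)\<leftarrow>cop H b. \<Sum>(c, d)\<leftarrow>cop H a.
      F (ra k (c * S x2)) (y * (d * S x1)))"
    by (intro sum_list_cong2 sum_list_swap)
  also have "\<dots> = (\<Sum>(n, x)\<leftarrow>rc H M m. \<Sum>(k, y)\<leftarrow>rc H M (P n). \<Sum>(a, b)\<leftarrow>cop H x. \<Sum>(c, d)\<leftarrow>cop H a. \<Sum>(x1, x2)\<leftarrow>cop H b.
      F (ra k (c * S x2)) (y * (d * S x1)))"
    by (intro sum_list_cong2 sum_list_swap)
  also have "\<dots> = (\<Sum>(n, x)\<leftarrow>rc H M m. \<Sum>(k, y)\<leftarrow>rc H M (P n). tscale (\<epsilon> x) (F (ra k 1) (y * 1)))"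
    by (intro sum_list_cong2 cop_antipode4[where G = "\<lambda>a b. F (ra k a) (y * b)" for k y] lin_intros)
  also have "\<dots> = (\<Sum>(n, x)\<leftarrow>rc H M m. tscale (\<epsilon> x) (\<Sum>(k, y)\<leftarrow>rc H M (P n). F k y))"
    by (intro sum_list_cong2) (simp add: lin_sum_list2[OF lin_tscale_const[OF lin_id]])
  also have "\<dots> = (\<Sum>(k, y)\<leftarrow>rc H M (P m). F k y)"
    by (rule rc_counit) (intro lin_intros F)
  finally show ?thesis using 1 by simp
qed

lemma P_coinvariant: "P m \<in> V"
proof -
  have "(\<Sum>(n, x)\<leftarrow>rc H M (P m). pure es [(0, n), (x, 0)]) = pure es [(0, P m), (1, 0)]"
    by (rule rc_P_coinvariant; intro lin_intros)
  then show ?thesis by (simp add: coinvariants_def rc[of "P m"])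
qed

lemma P_id: "v \<in> V \<Longrightarrow> P v = v"
proof -
  assume v: "v \<in> V"
  have "pure ms [P v] = (\<Sum>(n, x)\<leftarrow>rc H M v. pure ms [ra n (S x)])" by (rule P_F) (intro lin_intros)
  also have "\<dots> = pure ms [ra v (S 1)]" by (rule coinvariantsD[OF v]; intro lin_intros)
  finally show ?thesis by (simp add: S_1 pure_single_inject[OF vs_m])
qed

text \<open>For coinvariant v the right coaction of h v is h1 v \<otimes> h2, so that P(h v) = h1 v
  S(h2). Since the values of \<open>P\<close> are coinvariant, the adjoint action preserves the
  coinvariants.\<close>

lemma ad_P: "v \<in> V \<Longrightarrow> ad h v = P (la h v)"
proof -
  assume v: "v \<in> V"
  have "pure ms [P (la h v)] = (\<Sum>(n, x)\<leftarrow>rc H M (la h v). pure ms [ra n (S x)])" by (rule P_F) (intro lin_intros)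
  also have "\<dots> = (\<Sum>(n, x)\<leftarrow>rc H M v. \<Sum>(a, b)\<leftarrow>cop H h. pure ms [ra (la a n) (S (b * x))])"
    by (rule rc_la; intro lin_intros)
  also have "\<dots> = (\<Sum>(a, b)\<leftarrow>cop H h. pure ms [ra (la a v) (S (b * 1))])"
    by (rule coinvariantsD[OF v]; intro lin_intros)
  also have "\<dots> = pure ms [ad h v]"
    unfolding mult_1_right by (rule ad_F[symmetric]) (intro lin_intros)
  finally show ?thesis by (simp add: pure_single_inject[OF vs_m])
qed

lemma ad_coinvariant: "v \<in> V \<Longrightarrow> ad h v \<in> V"
  by (simp add: ad_P P_coinvariant)

text \<open>The left and right coactions commute, so for coinvariant v applying \<open>P\<close> to
  the second leg of the left coaction does not change it. The list with projected entries is then a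
  representative over the coinvariants, and the choice made in \<open>lc\<close> yields one of this
  kind.\<close>

lemma lc_coinvariant:
  assumes v: "v \<in> V" shows "snd ` set (lc H M v) \<subseteq> V"
proof -
  have "lcoact M v = (\<Sum>(x, n)\<leftarrow>lc H M v. pure es [(x, 0), (0, n)])" by (rule lc)
  also have "\<dots> = (\<Sum>(x, n)\<leftarrow>lc H M v. pure es [(x, 0), (0, ra n (S 1))])" by (simp add: S_1)
  also have "\<dots> = (\<Sum>(n, x)\<leftarrow>rc H M v. \<Sum>(y, k)\<leftarrow>lc H M n. pure es [(y, 0), (0, ra k (S x))])"
    by (rule coinvariantsD[OF v, symmetric]; intro lin_intros)
  also have "\<dots> = (\<Sum>(x, n)\<leftarrow>lc H M v. \<Sum>(k, y)\<leftarrow>rc H M n. pure es [(x, 0), (0, ra k (S y))])"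
    by (rule lc_rc_commute; intro lin_intros)
  also have "\<dots> = (\<Sum>(x, n)\<leftarrow>lc H M v. pure es [(x, 0), (0, P n)])"
    by (intro sum_list_cong2 P_F[symmetric] lin_intros)
  also have "\<dots> = (\<Sum>(x, n)\<leftarrow>map (\<lambda>(x, n). (x, P n)) (lc H M v). pure es [(x, 0), (0, n)])"
    by (simp add: comp_def case_prod_beta')
  finally have "\<exists>ps. lcoact M v = (\<Sum>(x, n)\<leftarrow>ps. pure es [(x, 0), (0, n)]) \<and> snd ` set ps \<subseteq> V"
    using P_coinvariant by (intro exI[of _ "map (\<lambda>(x, n). (x, P n)) (lc H M v)"]) auto
  then show ?thesis using lc_spec by blast
qed

lemma lc_coinvariantD: "v \<in> V \<Longrightarrow> (x, n) \<in> set (lc H M v) \<Longrightarrow> n \<in> V"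
  using lc_coinvariant by force

lemma V_zero: "0 \<in> V" and V_add: "u \<in> V \<Longrightarrow> v \<in> V \<Longrightarrow> u + v \<in> V" and V_scale: "v \<in> V \<Longrightarrow> ms c v \<in> V"
proof -
  have *: "v \<in> V \<longleftrightarrow> P v = v" for v using P_id P_coinvariant[of v] by force
  show "0 \<in> V" "u \<in> V \<Longrightarrow> v \<in> V \<Longrightarrow> u + v \<in> V" "v \<in> V \<Longrightarrow> ms c v \<in> V"
    unfolding * by (simp_all add: lin_zero[OF lin_P] lin_add[OF lin_P] lin_scale[OF lin_P])
qed

lemma V_subspace: "module.subspace ms V"
proof -
  interpret vector_space ms by (rule vs_m)
  show ?thesis by (simp add: subspace_def V_zero V_add V_scale)
qed

end

section \<open>The diagonal coaction on words and the embedding into the cotensor powers\<close>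

lemma sum_list_concat: "sum_list (concat xss) = (\<Sum>xs\<leftarrow>xss. sum_list xs)"
  by (induction xss) auto

text \<open>A Sweedler list for the tensor product coaction of a word; the \<open>H\<close>-parts
  are multiplied in the order of the letters.\<close>

primrec dco :: "('k::field, 'h::ring_1) hopf_data \<Rightarrow> ('k, 'h, 'm::ab_group_add) bimodule_data \<Rightarrow> 'm list \<Rightarrow> ('h \<times> 'm list) list" where
  "dco H M [] = [(1, [])]"
| "dco H M (m # w) = concat (map (\<lambda>(x, n). map (\<lambda>(y, v). (x * y, n # v)) (dco H M w)) (lc H M m))"

text \<open>The word is given in reverse because each step of \<kappa> removes the last
  letter.\<close>

primrec kkr :: "('k::field, 'h::ring_1) hopf_data \<Rightarrow> ('k, 'h, 'm::ab_group_add) bimodule_data \<Rightarrow> 'm list \<Rightarrow> ('k, 'h \<times> 'm) tensor" where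
  "kkr H M [] = pure (sscale H M) []"
| "kkr H M (m # r) = (\<Sum>(x, n)\<leftarrow>lc H M m.
     tmult (sscale H M) (dactT H (sscale H M) (eR H M) x (kkr H M r)) (pure (sscale H M) [(0, n)]))"

text \<open>The empty word goes to the empty tensor, the unit of concatenation, from which the
  recursion starts. \<open>kap\<close> replaces this value by 1 in \<open>H\<close>, the degree-zero
  part of the cotensor coalgebra.\<close>

definition kk :: "('k::field, 'h::ring_1) hopf_data \<Rightarrow> ('k, 'h, 'm::ab_group_add) bimodule_data \<Rightarrow> 'm list \<Rightarrow> ('k, 'h \<times> 'm) tensor" where
  "kk H M w = kkr H M (rev w)"

text \<open>The embedding \<open>\<kappa>\<close> of tensor powers of the coinvariants into cotensor powers,
  with \<open>\<kappa>(v1 \<dots> vn w) = \<kappa>(v1 \<dots> vn) w(-1) \<otimes> w(0)\<close>.\<close>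

definition kap :: "('k::field, 'h::ring_1) hopf_data \<Rightarrow> ('k, 'h, 'm::ab_group_add) bimodule_data \<Rightarrow> 'm list \<Rightarrow> ('k, 'h \<times> 'm) tensor" where
  "kap H M w = (if w = [] then pure (sscale H M) [(1, 0)] else kk H M w)"

context hopf_bimod
begin

abbreviation dc where "dc \<equiv> dco H M"
abbreviation \<kappa> where "\<kappa> \<equiv> kap H M"
abbreviation kw where "kw \<equiv> kk H M"

lemma dco_Cons:
  fixes F :: "'h \<Rightarrow> 'm list \<Rightarrow> 'z::comm_monoid_add"
  shows "(\<Sum>(x, u)\<leftarrow>dc (m # w). F x u) = (\<Sum>(x, n)\<leftarrow>lc H M m. \<Sum>(y, v)\<leftarrow>dc w. F (x * y) (n # v))"
  by (simp add: map_concat sum_list_concat comp_def case_prod_beta')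

lemma dco_append:
  fixes F :: "'h \<Rightarrow> 'm list \<Rightarrow> 'z::comm_monoid_add"
  shows "(\<Sum>(x, u)\<leftarrow>dc (w @ v). F x u) = (\<Sum>(x, w')\<leftarrow>dc w. \<Sum>(y, v')\<leftarrow>dc v. F (x * y) (w' @ v'))"
proof (induction w arbitrary: F)
  case (Cons m w)
  show ?case unfolding append_Cons dco_Cons Cons by (simp add: mult.assoc)
qed simp

lemma dco_single:
  fixes F :: "'h \<Rightarrow> 'm list \<Rightarrow> 'z::comm_monoid_add"
  shows "(\<Sum>(x, u)\<leftarrow>dc [m]. F x u) = (\<Sum>(x, n)\<leftarrow>lc H M m. F x [n])"
  unfolding dco_Cons by simp

lemma dco_length: "(x, u) \<in> set (dc w) \<Longrightarrow> length u = length w"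
  by (induction w arbitrary: x u) auto

lemma dco_V: "(x, u) \<in> set (dc w) \<Longrightarrow> set w \<subseteq> V \<Longrightarrow> set u \<subseteq> V"
proof (induction w arbitrary: x u)
  case (Cons m w)
  then obtain y n z v where "(y, n) \<in> set (lc H M m)" "(z, v) \<in> set (dc w)" "u = n # v" by auto
  then show ?case using lc_coinvariantD[of m y n] Cons by auto
qed simp

declare dco.simps(2) [simp del]

lemma mlin_Cons:
  assumes "mlin s F" shows "mlin s (\<lambda>w. F (e # w))"
proof -
  have "lin s tscale (\<lambda>x. F (e # u @ x # v))" for u v using mlinD[OF assms, of "e # u" v] by simp
  then show ?thesis by (simp add: mlin_def)
qed

lemma mlin_hd: "mlin s F \<Longrightarrow> lin s tscale (\<lambda>e. F (e # w))"
  using mlinD[of s F "[]" w] by simp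

text \<open>Induction on the word: the coproduct is multiplicative on the product of the
  \<open>H\<close>-parts, \<open>lc_coassoc\<close> treats the first letter and the hypothesis the
  others.\<close>

lemma dco_coassoc:
  assumes "\<And>b u. lin hs tscale (\<lambda>a. F a b u)" "\<And>a u. lin hs tscale (\<lambda>b. F a b u)" "\<And>a b. mlin ms (F a b)"
  shows "(\<Sum>(x, u)\<leftarrow>dc w. \<Sum>(a, b)\<leftarrow>cop H x. F a b u) = (\<Sum>(x, u)\<leftarrow>dc w. \<Sum>(y, v)\<leftarrow>dc u. F x y v)"
  using assms
proof (induction w arbitrary: F)
  case Nil
  show ?case by simp (rule cop_1; rule Nil)
next
  case (Cons m w)
  note l [lin_intros] = lin_comp[OF Cons.prems(1)] lin_comp[OF Cons.prems(2)] mlin_hd[OF Cons.prems(3)]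
    mlin_Cons[OF Cons.prems(3)]
  have IH: "(\<Sum>(y, v)\<leftarrow>dc w. \<Sum>(c, d)\<leftarrow>cop H y. F (a * c) (b * d) (n # v))
      = (\<Sum>(y, v)\<leftarrow>dc w. \<Sum>(z, u)\<leftarrow>dc v. F (a * y) (b * z) (n # u))" for a b n
    by (rule Cons.IH; intro lin_intros)
  have "(\<Sum>(x, u)\<leftarrow>dc (m # w). \<Sum>(a, b)\<leftarrow>cop H x. F a b u)
    = (\<Sum>(x, n)\<leftarrow>lc H M m. \<Sum>(y, v)\<leftarrow>dc w. \<Sum>(a, b)\<leftarrow>cop H x. \<Sum>(c, d)\<leftarrow>cop H y. F (a * c) (b * d) (n # v))"
    unfolding dco_Cons by (intro sum_list_cong2 cop_mult lin_intros)
  also have "\<dots> = (\<Sum>(x, n)\<leftarrow>lc H M m. \<Sum>(a, b)\<leftarrow>cop H x. \<Sum>(y, v)\<leftarrow>dc w. \<Sum>(c, d)\<leftarrow>cop H y. F (a * c) (b * d) (n # v))"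
    by (intro sum_list_cong2 sum_list_swap)
  also have "\<dots> = (\<Sum>(x, n)\<leftarrow>lc H M m. \<Sum>(k, p)\<leftarrow>lc H M n. \<Sum>(y, v)\<leftarrow>dc w. \<Sum>(z, u)\<leftarrow>dc v. F (x * y) (k * z) (p # u))"
    unfolding IH by (rule lc_coassoc; intro lin_intros)
  also have "\<dots> = (\<Sum>(x, u)\<leftarrow>dc (m # w). \<Sum>(y, v)\<leftarrow>dc u. F x y v)"
    unfolding dco_Cons by (intro sum_list_cong2 sum_list_swap)
  finally show ?case .
qed

lemma dco_counit: "mlin ms F \<Longrightarrow> (\<Sum>(x, u)\<leftarrow>dc w. tscale (\<epsilon> x) (F u)) = F w"
proof (induction w arbitrary: F)
  case Nil then show ?case by (simp add: counit_1)
next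
  case (Cons m w)
  have "(\<Sum>(x, u)\<leftarrow>dc (m # w). tscale (\<epsilon> x) (F u))
    = (\<Sum>(x, n)\<leftarrow>lc H M m. tscale (\<epsilon> x) (\<Sum>(y, v)\<leftarrow>dc w. tscale (\<epsilon> y) (F (n # v))))"
    unfolding dco_Cons by (intro sum_list_cong2) (simp add: counit_mult lin_sum_list2[OF lin_tscale_const[OF lin_id]])
  also have "\<dots> = (\<Sum>(x, n)\<leftarrow>lc H M m. tscale (\<epsilon> x) (F (n # w)))"
    by (simp add: Cons.IH[OF mlin_Cons[OF Cons.prems]])
  also have "\<dots> = F (m # w)" by (rule lc_counit) (rule mlin_hd[OF Cons.prems])
  finally show ?case .
qed

subsection \<open>The embedding\<close>

lemma kk_Nil [simp]: "kw [] = pure es []"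
  by (simp add: kk_def)

lemma kk_snoc: "kw (w @ [m]) = (\<Sum>(x, n)\<leftarrow>lc H M m. tmult es (R x (kw w)) (pure es [(0, n)]))"
  by (simp add: kk_def)

lemma kk_TT [TT_intros, simp]: "kw w \<in> TT es"
  by (induction w rule: rev_induct) (auto simp: kk_snoc intro!: TT_intros)

lemma kk_tpow: "kw w \<in> tpow es (range (Pair 0)) (length w)"
proof (induction w rule: rev_induct)
  case Nil show ?case by (auto intro: tpow_pure)
next
  case (snoc m w)
  have "R x (kw w) \<in> tpow es (range (Pair 0)) (length w)" for x
    by (rule ER.dT_tpow[OF snoc]) auto
  then have "tmult es (R x (kw w)) (pure es [(0, n)]) \<in> tpow es (range (Pair 0)) (length w + 1)" for x n
    by (intro tpow_tmult tpow_pure) auto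
  then show ?case by (auto simp: kk_snoc intro!: subspace_sum_list2[OF tpow_subspace])
qed

lemma mlin_kk: "mlin ms kw"
proof -
  have "lin ms tscale (\<lambda>m. kw (u @ m # v))" for u v
  proof (induction v rule: rev_induct)
    case Nil show ?case unfolding kk_snoc by (intro lin_intros TT_intros)
  next
    case (snoc e v)
    have "kw (u @ m # v @ [e]) = (\<Sum>(x, n)\<leftarrow>lc H M e. tmult es (R x (kw (u @ m # v))) (pure es [(0, n)]))" for m
      using kk_snoc[of "u @ m # v" e] by simp
    then show ?case by simp (intro lin_intros snoc)
  qed
  then show ?thesis by (simp add: mlin_def)
qed

lemma R_single: "R x (pure es [e]) = pure es [eR H M x e]"
  and L_single: "L x (pure es [e]) = pure es [eL H M x e]"
  by (simp_all add: ER.da_single EL.da_single del: dact.simps)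

lemma kk_single: "kw [m] = pure es [(0, m)]"
proof -
  have "kw [m] = (\<Sum>(x, n)\<leftarrow>lc H M m. tscale (\<epsilon> x) (pure es [(0, n)]))"
    using kk_snoc[of "[]" m] by (simp add: tmult_tscale_left)
  also have "\<dots> = pure es [(0, m)]" by (rule lc_counit) (intro lin_intros)
  finally show ?thesis .
qed

text \<open>Induction on the last letter of \<open>w\<close>. Its coaction acts on everything before
  it; multiplicativity of the diagonal action splits this between \<open>u\<close> and
  \<open>w\<close>, and coassociativity turns the two legs into an iterated coaction.\<close>

lemma kk_append: "kw (u @ w) = (\<Sum>(x, v)\<leftarrow>dc w. tmult es (R x (kw u)) (kw v))"
proof (induction w rule: rev_induct)
  case Nil then show ?case by (simp add: R_1)
next
  case (snoc e w)
  have "kw (u @ w @ [e]) = (\<Sum>(a, n)\<leftarrow>lc H M e. \<Sum>(x, v)\<leftarrow>dc w. \<Sum>(c, d)\<leftarrow>cop H a.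
      tmult es (R (x * c) (kw u)) (tmult es (R d (kw v)) (pure es [(0, n)])))"
    using kk_snoc[of "u @ w" e]
    by (simp add: snoc dactT_sum_list2 ER.dT_tmult TT_intros tmult_sum_list2_left tmult_assoc R_mult del: dact.simps)
  also have "\<dots> = (\<Sum>(a, n)\<leftarrow>lc H M e. \<Sum>(c, d)\<leftarrow>cop H a. \<Sum>(x, v)\<leftarrow>dc w.
      tmult es (R (x * c) (kw u)) (tmult es (R d (kw v)) (pure es [(0, n)])))"
    by (intro sum_list_cong2 sum_list_swap)
  also have "\<dots> = (\<Sum>(a, n)\<leftarrow>lc H M e. \<Sum>(b, k)\<leftarrow>lc H M n. \<Sum>(x, v)\<leftarrow>dc w.
      tmult es (R (x * a) (kw u)) (tmult es (R b (kw v)) (pure es [(0, k)])))"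
    by (rule lc_coassoc; intro lin_intros TT_intros)
  also have "\<dots> = (\<Sum>(a, n)\<leftarrow>lc H M e. \<Sum>(x, v)\<leftarrow>dc w. \<Sum>(b, k)\<leftarrow>lc H M n.
      tmult es (R (x * a) (kw u)) (tmult es (R b (kw v)) (pure es [(0, k)])))"
    by (intro sum_list_cong2 sum_list_swap)
  also have "\<dots> = (\<Sum>(x, v)\<leftarrow>dc w. \<Sum>(a, n)\<leftarrow>lc H M e. \<Sum>(b, k)\<leftarrow>lc H M n.
      tmult es (R (x * a) (kw u)) (tmult es (R b (kw v)) (pure es [(0, k)])))"
    by (rule sum_list_swap)
  also have "\<dots> = (\<Sum>(x, v)\<leftarrow>dc (w @ [e]). tmult es (R x (kw u)) (kw v))"
    unfolding dco_append dco_single by (simp add: kk_snoc tmult_sum_list2_right TT_intros)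
  finally show ?case .
qed

lemma kk_Cons: "kw (m # w) = (\<Sum>(x, v)\<leftarrow>dc w. tmult es (pure es [(0, ra m x)]) (kw v))"
  using kk_append[of "[m]" w] by (simp add: kk_single R_single del: ER.dT_pure)

abbreviation KK where "KK t \<equiv> tbind t kw"

lemma KK_TT [TT_intros]: "t \<in> TT ms \<Longrightarrow> KK t \<in> TT es"
  by (rule TT_tbind[OF _ mlin_kk kk_TT])

lemma KK_snoc:
  assumes "t \<in> TT ms"
  shows "KK (tmult ms t (pure ms [e])) = (\<Sum>(x, n)\<leftarrow>lc H M e. tmult es (R x (KK t)) (pure es [(0, n)]))"
  by (rule TT_eqI[OF assms, of "\<lambda>t. KK (tmult ms t (pure ms [e]))"
        "\<lambda>t. \<Sum>(x, n)\<leftarrow>lc H M e. tmult es (R x (KK t)) (pure es [(0, n)])"])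
    (simp_all add: tmult_pure tbind_pure_mlin[OF mlin_kk] kk_snoc lin_intros)

text \<open>Induction on the last letter. There \<open>ad_ra\<close> writes the left action as an
  adjoint action followed by a right multiplication, and \<open>yetter_drinfeld\<close> takes the
  coaction past the adjoint action. The right factors produced in this way combine to the diagonal
  right action on the whole word.\<close>

lemma L_kk: "L h (kw w) = (\<Sum>(a, b)\<leftarrow>cop H h. R b (KK (AD.da w a)))"
proof (induction w arbitrary: h rule: rev_induct)
  case Nil
  have "(\<Sum>(a, b)\<leftarrow>cop H h. R b (KK (AD.da [] a))) = (\<Sum>(a, b)\<leftarrow>cop H h. tscale (\<epsilon> a) (tscale (\<epsilon> b) (pure es [])))"
    by (simp add: tbind_simps tbind_pure_mlin[OF mlin_kk] lin_scale[OF lin_dactT[OF lin_id]] del: tens.scale_scale)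
  also have "\<dots> = tscale (\<epsilon> h) (pure es [])" by (rule cop_counit_l) (intro lin_intros)
  finally show ?case by simp
next
  case (snoc m w)
  define T where "T c y k = tmult es (R y (KK (AD.da w c))) (pure es [(0, k)])" for c y k
  have [lin_intros]: "linear_on s1 hs X A \<Longrightarrow> linear_on s1 tscale X (\<lambda>c. T (A c) y k)"
    "linear_on s1 hs X A \<Longrightarrow> linear_on s1 tscale X (\<lambda>y. T c (A y) k)"
    "linear_on s1 ms X B \<Longrightarrow> linear_on s1 tscale X (\<lambda>k. T c y (B k))" for s1 X A B c y k
    unfolding T_def by (intro lin_intros TT_intros; assumption)+
  have "L h (kw (w @ [m])) = (\<Sum>(x, n)\<leftarrow>lc H M m. \<Sum>(a, b)\<leftarrow>cop H h. \<Sum>(c, d)\<leftarrow>cop H a. T c (d * x) (la b n))"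
    unfolding kk_snoc T_def
    by (simp add: dactT_sum_list2 EL.dT_tmult TT_intros L_single L_R snoc R_mult tmult_sum_list2_left del: dact.simps EL.dT_pure)
  also have "\<dots> = (\<Sum>(a, b)\<leftarrow>cop H h. \<Sum>(x, n)\<leftarrow>lc H M m. \<Sum>(c, d)\<leftarrow>cop H a. T c (d * x) (la b n))"
    by (rule sum_list_swap)
  also have "\<dots> = (\<Sum>(a, b)\<leftarrow>cop H h. \<Sum>(c, d)\<leftarrow>cop H a. \<Sum>(x, n)\<leftarrow>lc H M m. T c (d * x) (la b n))"
    by (intro sum_list_cong2 sum_list_swap)
  \<comment> \<open>Isolates the leg c that acts on \<open>w\<close>, so that the remaining
    computation concerns only the last letter.\<close>
  also have "\<dots> = (\<Sum>(c, r)\<leftarrow>cop H h. \<Sum>(p, v)\<leftarrow>cop H r. \<Sum>(x, n)\<leftarrow>lc H M m. T c (p * x) (la v n))"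
    by (rule cop_coassoc; intro lin_intros)
  also have "\<dots> = (\<Sum>(c, r)\<leftarrow>cop H h. \<Sum>(d, b)\<leftarrow>cop H r. \<Sum>(b1, b2)\<leftarrow>cop H b. \<Sum>(x, n)\<leftarrow>lc H M (ad d m). T c (x * b1) (ra n b2))"
  proof (rule sum_list_cong2)
    fix c r
    have "(\<Sum>(p, v)\<leftarrow>cop H r. \<Sum>(x, n)\<leftarrow>lc H M m. T c (p * x) (la v n))
      = (\<Sum>(p, v)\<leftarrow>cop H r. \<Sum>(x, n)\<leftarrow>lc H M m. \<Sum>(q, b)\<leftarrow>cop H v. T c (p * x) (ra (ad q n) b))"
      by (intro sum_list_cong2 ad_ra[symmetric] lin_intros)
    also have "\<dots> = (\<Sum>(p, v)\<leftarrow>cop H r. \<Sum>(q, b)\<leftarrow>cop H v. \<Sum>(x, n)\<leftarrow>lc H M m. T c (p * x) (ra (ad q n) b))"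
      by (intro sum_list_cong2 sum_list_swap)
    also have "\<dots> = (\<Sum>(u, b)\<leftarrow>cop H r. \<Sum>(p, q)\<leftarrow>cop H u. \<Sum>(x, n)\<leftarrow>lc H M m. T c (p * x) (ra (ad q n) b))"
      by (rule cop_coassoc[symmetric]; intro lin_intros)
    also have "\<dots> = (\<Sum>(u, b)\<leftarrow>cop H r. \<Sum>(d, b1)\<leftarrow>cop H u. \<Sum>(x, n)\<leftarrow>lc H M (ad d m). T c (x * b1) (ra n b))"
      by (intro sum_list_cong2 yetter_drinfeld[symmetric] lin_intros)
    also have "\<dots> = (\<Sum>(d, b)\<leftarrow>cop H r. \<Sum>(b1, b2)\<leftarrow>cop H b. \<Sum>(x, n)\<leftarrow>lc H M (ad d m). T c (x * b1) (ra n b2))"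
      by (rule cop_coassoc; intro lin_intros)
    finally show "(\<Sum>(p, v)\<leftarrow>cop H r. \<Sum>(x, n)\<leftarrow>lc H M m. T c (p * x) (la v n))
      = (\<Sum>(d, b)\<leftarrow>cop H r. \<Sum>(b1, b2)\<leftarrow>cop H b. \<Sum>(x, n)\<leftarrow>lc H M (ad d m). T c (x * b1) (ra n b2))" .
  qed
  also have "\<dots> = (\<Sum>(a, b)\<leftarrow>cop H h. \<Sum>(c, d)\<leftarrow>cop H a. \<Sum>(b1, b2)\<leftarrow>cop H b. \<Sum>(x, n)\<leftarrow>lc H M (ad d m). T c (x * b1) (ra n b2))"
    by (rule cop_coassoc[symmetric]; intro lin_intros)
  also have "\<dots> = (\<Sum>(a, b)\<leftarrow>cop H h. \<Sum>(c, d)\<leftarrow>cop H a. \<Sum>(x, n)\<leftarrow>lc H M (ad d m). \<Sum>(b1, b2)\<leftarrow>cop H b. T c (x * b1) (ra n b2))"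
    by (intro sum_list_cong2 sum_list_swap)
  also have "\<dots> = (\<Sum>(a, b)\<leftarrow>cop H h. R b (KK (AD.da (w @ [m]) a)))"
    unfolding AD.da_append AD.da_single T_def
    by (simp add: tbind_sum_list2 KK_snoc dactT_sum_list2 ER.dT_tmult TT_intros R_single R_mult del: dact.simps ER.dT_pure)
  finally show ?case .
qed

lemma kap_Nil: "\<kappa> [] = pure es [(1, 0)]" and kap_kk: "w \<noteq> [] \<Longrightarrow> \<kappa> w = kw w"
  by (simp_all add: kap_def)

lemma kap_TT [TT_intros, simp]: "\<kappa> w \<in> TT es"
  by (simp add: kap_def)

lemma mlin_kap: "mlin ms \<kappa>"
  using mlin_kk by (simp add: mlin_def kap_def)

abbreviation K where "K t \<equiv> tbind t \<kappa>"

lemma K_pure: "K (pure ms w) = \<kappa> w"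
  by (rule tbind_pure_mlin[OF mlin_kap])

lemma K_KK: "t \<in> tpow ms UNIV n \<Longrightarrow> n \<ge> 1 \<Longrightarrow> K t = KK t"
  by (rule tpow_eqI[of t ms UNIV n tscale "\<lambda>t. K t" "\<lambda>t. KK t"])
    (auto simp: vector_space_tscale tbind_pure_mlin[OF mlin_kap] tbind_pure_mlin[OF mlin_kk] intro!: lin_intros kap_kk)

lemma L_kap: "L h (\<kappa> w) = (\<Sum>(a, b)\<leftarrow>cop H h. R b (K (AD.da w a)))"
proof (cases "w = []")
  case True
  have "(\<Sum>(a, b)\<leftarrow>cop H h. R b (K (AD.da w a))) = (\<Sum>(a, b)\<leftarrow>cop H h. tscale (\<epsilon> a) (pure es [(b, 0)]))"
    using True by (simp add: tbind_simps K_pure kap_Nil lin_scale[OF lin_dactT[OF lin_id]] ER.da_single dact.simps(1) del: dact.simps(2))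
  also have "\<dots> = pure es [(h, 0)]" by (rule cop_counit_l) (intro lin_intros)
  finally show ?thesis using True by (simp add: kap_Nil EL.da_single del: dact.simps)
next
  case False
  then have "AD.da w a \<in> tpow ms UNIV (length w)" for a by (intro AD.da_tpow) auto
  then have "K (AD.da w a) = KK (AD.da w a)" for a using False by (intro K_KK) (auto simp: Suc_le_eq)
  then show ?thesis using L_kk[of h w] False by (simp add: kap_kk)
qed

subsection \<open>Coactions on the embedding\<close>

text \<open>The left coaction acts on the first entry, which \<open>kk_Cons\<close> shows to be m
  v(-1). By \<open>lc_ra\<close> the factor v(-1) contributes to both legs, and
  \<open>dco_coassoc\<close> recognises the result as a diagonal coaction.\<close>

lemma lco_kap: "apply_at es 0 (lco H M) (\<kappa> w) = (\<Sum>(x, u)\<leftarrow>dc w. tmult es (pure es [(x, 0)]) (\<kappa> u))"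
proof (cases w)
  case Nil
  have "(\<Sum>(a, b)\<leftarrow>cop H 1. pure es [(a, 0), (b, 0)]) = pure es [(1, 0), (1, 0)]"
    by (rule cop_1; intro lin_intros)
  then show ?thesis using Nil by (simp add: kap_Nil LC.apply_at_single lco_h tmult_pure)
next
  case (Cons m v)
  note l [lin_intros] = mlinD[OF mlin_kk]
  have ml: "mlin ms (\<lambda>u. tmult es y (kw u))" if "y \<in> TT es" for y
    unfolding mlin_def using that by (auto intro!: lin_intros TT_intros)
  have "apply_at es 0 (lco H M) (tmult es (pure es [e]) t) = tmult es (lco H M e) t" if "t \<in> TT es" for e t
    using LC.apply_at_mid[of "pure es []" 0 t e] that by (simp add: tpow_pure TT_intros LC.F_TT)
  then have "apply_at es 0 (lco H M) (kw (m # v)) = (\<Sum>(x, u)\<leftarrow>dc v. \<Sum>(y, n)\<leftarrow>lc H M (ra m x). tmult es (pure es [(y, 0), (0, n)]) (kw u))"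
    unfolding kk_Cons by (simp add: lin_sum_list2[OF lin_apply_at[OF lin_id]] lco_m tmult_sum_list2_left)
  also have "\<dots> = (\<Sum>(x, u)\<leftarrow>dc v. \<Sum>(y, n)\<leftarrow>lc H M m. \<Sum>(a, b)\<leftarrow>cop H x. tmult es (pure es [(y * a, 0), (0, ra n b)]) (kw u))"
    by (intro sum_list_cong2 lc_ra lin_intros)
  also have "\<dots> = (\<Sum>(y, n)\<leftarrow>lc H M m. \<Sum>(x, u)\<leftarrow>dc v. \<Sum>(a, b)\<leftarrow>cop H x. tmult es (pure es [(y * a, 0), (0, ra n b)]) (kw u))"
    by (rule sum_list_swap)
  also have "\<dots> = (\<Sum>(y, n)\<leftarrow>lc H M m. \<Sum>(x, u)\<leftarrow>dc v. \<Sum>(z, u')\<leftarrow>dc u. tmult es (pure es [(y * x, 0), (0, ra n z)]) (kw u'))"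
    by (intro sum_list_cong2 dco_coassoc lin_intros ml TT_pure)
  also have "\<dots> = (\<Sum>(x, u)\<leftarrow>dc (m # v). tmult es (pure es [(x, 0)]) (kw u))"
    unfolding dco_Cons kk_Cons
    by (simp add: tmult_sum_list2_right TT_intros tmult_assoc[symmetric] tmult_pure)
  also have "\<dots> = (\<Sum>(x, u)\<leftarrow>dc (m # v). tmult es (pure es [(x, 0)]) (\<kappa> u))"
    by (intro sum_list_cong2) (auto dest!: dco_length simp: kap_def)
  finally show ?thesis using Cons by (simp add: kap_def)
qed

text \<open>The right coaction acts on the last entry, which is coinvariant by
  \<open>lc_coinvariantD\<close>. For the empty word the truncated index \<open>length w - 1\<close>
  is 0, the position of the single entry 1.\<close>

lemma rco_kap:
  assumes "set w \<subseteq> V"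
  shows "apply_at es (length w - 1) (rco H M) (\<kappa> w) = tmult es (\<kappa> w) (pure es [(1, 0)])"
proof (cases w rule: rev_cases)
  case Nil
  have "(\<Sum>(a, b)\<leftarrow>cop H 1. pure es [(a, 0), (b, 0)]) = pure es [(1, 0), (1, 0)]"
    by (rule cop_1; intro lin_intros)
  then show ?thesis using Nil by (simp add: kap_Nil RC.apply_at_single rco_h tmult_pure)
next
  case (snoc u v)
  have T: "R x (kw u) \<in> tpow es UNIV (length u)" for x
    by (rule subsetD[OF tpow_mono[of "range (Pair 0)"] ER.dT_tpow[OF kk_tpow]]) auto
  have r: "rco H M (0, n) = pure es [(0, n), (1, 0)]" if "n \<in> V" for n
    using that by (simp add: rco_m rc[symmetric] coinvariants_def)
  have "apply_at es (length u) (rco H M) (tmult es (R x (kw u)) (pure es [(0, n)]))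
      = tmult es (tmult es (R x (kw u)) (pure es [(0, n)])) (pure es [(1, 0)])" if "(x, n) \<in> set (lc H M v)" for x n
    using RC.apply_at_mid[OF T, of "pure es []" x "(0, n)"] assms snoc lc_coinvariantD[OF _ that]
    by (simp add: tmult_pure r tmult_assoc)
  then have "apply_at es (length u) (rco H M) (kw (u @ [v])) = tmult es (kw (u @ [v])) (pure es [(1, 0)])"
    unfolding kk_snoc lin_sum_list2[OF lin_apply_at[OF lin_id]] tmult_sum_list2_left
    by (intro sum_list_cong2)
  then show ?thesis using snoc by (simp add: kap_def)
qed

text \<open>By \<open>lc_ra\<close> the legs of \<open>h\<close> are shared between the coaction
  leg, which acts on the preceding letters, and the last letter itself. This is the diagonal right
  action.\<close>

lemma kk_ra: "kw (w @ [ra m h]) = R h (kw (w @ [m]))"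
proof -
  have "kw (w @ [ra m h]) = (\<Sum>(x, n)\<leftarrow>lc H M m. \<Sum>(a, b)\<leftarrow>cop H h. tmult es (R (x * a) (kw w)) (pure es [(0, ra n b)]))"
    unfolding kk_snoc by (rule lc_ra; intro lin_intros TT_intros)
  then show ?thesis
    unfolding kk_snoc by (simp add: dactT_sum_list2 ER.dT_tmult TT_intros R_mult R_single del: dact.simps ER.dT_pure)
qed

end

section \<open>The structure of the cotensor powers\<close>

lemma mlin_split:
  fixes s :: "'k::field \<Rightarrow> 'e::ab_group_add \<Rightarrow> 'e"
  assumes B: "\<And>v. mlin s (\<lambda>u. B u v)" "\<And>u. mlin s (B u)"
  shows "mlin s (\<lambda>w. if n \<le> length w then B (take n w) (drop n w) else 0)"
  unfolding mlin_def
proof (intro allI)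
  fix u v :: "'e list"
  show "lin s tscale (\<lambda>x. if n \<le> length (u @ x # v) then B (take n (u @ x # v)) (drop n (u @ x # v)) else 0)"
  proof (cases "length u < n")
    case True
    then obtain k where k: "n = length u + Suc k" using less_iff_Suc_add by auto
    show ?thesis using mlinD[OF B(1), of u "take k v" "drop k v"] unfolding k
      by (cases "k \<le> length v") (simp_all add: lin_0)
  next
    case False
    then show ?thesis using mlinD[OF B(2), of "take n u" "drop n u" v] by (simp add: trans_le_add1)
  qed
qed

lemma tbind_split:
  assumes B: "\<And>v. mlin s (\<lambda>u. B u v)" "\<And>u. mlin s (B u)" and t: "t \<in> tpow s UNIV n"
  shows "tbind (tmult s t (pure s v)) (\<lambda>w. if n \<le> length w then B (take n w) (drop n w) else 0) = tbind t (\<lambda>u. B u v)"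
  by (rule tpow_eqI[OF t vector_space_tscale, where
        F = "\<lambda>t. tbind (tmult s t (pure s v)) (\<lambda>w. if n \<le> length w then B (take n w) (drop n w) else 0)"
        and G = "\<lambda>t. tbind t (\<lambda>u. B u v)"])
    (simp_all add: lin_intros tmult_pure tbind_pure_mlin[OF mlin_split[OF B]] tbind_pure_mlin[OF B(1)])

lemma mlin_case1:
  fixes s :: "'k::field \<Rightarrow> 'e::ab_group_add \<Rightarrow> 'e"
  assumes "lin s tscale F"
  shows "mlin s (\<lambda>w. case w of [a] \<Rightarrow> F a | _ \<Rightarrow> 0)"
  unfolding mlin_def
proof (intro allI)
  fix u v :: "'e list"
  show "lin s tscale (\<lambda>x. case u @ x # v of [a] \<Rightarrow> F a | _ \<Rightarrow> 0)"
    using assms by (cases u; cases v; cases "tl u") (auto intro: lin_0)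
qed

lemma mlin_0: "mlin s (\<lambda>_. 0)"
  by (simp add: mlin_def lin_0)

context hopf_bimod
begin

abbreviation C where "C \<equiv> cotensor H M"

lemma hsub_cotensor: "hsub es (max 1 n) (C n)"
proof (induction n rule: cotensor.induct)
  case (3 H M n)
  have h: "hsub (sscale H M) (max 1 (Suc n) + 1) (tprod (sscale H M) (cotensor H M (Suc n)) (mpart H M))"
    by (rule hsub_tprod[OF 3]) (simp add: mpart_def hsub_tpow)
  have "tens.subspace (cotensor H M (Suc (Suc n)))"
    using hsub_subspace[OF h]
    by (auto simp: tens.subspace_def apply_at_def tbind_simps)
  then show ?case using h by (auto simp: hsub_def)
qed (simp_all add: hpart_def mpart_def hsub_tpow)

lemma C_TT: "t \<in> C n \<Longrightarrow> t \<in> TT es"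
  by (rule hsub_TT[OF hsub_cotensor])

lemma C_subspace: "tens.subspace (C n)"
  by (rule hsub_subspace[OF hsub_cotensor])

lemma C_tpow: "t \<in> C n \<Longrightarrow> t \<in> tpow es UNIV (max 1 n)"
  by (rule hsub_tpow_UNIV[OF hsub_cotensor])

lemma R_mpart: "t \<in> mpart H M \<Longrightarrow> R h t \<in> mpart H M"
  by (auto simp: mpart_iff R_single simp del: ER.dT_pure)

lemma R_cotensor: "t \<in> C n \<Longrightarrow> R h t \<in> C n"
proof (induction n arbitrary: t h rule: nat_less_induct)
  case (1 n)
  consider "n = 0" | "n = 1" | k where "n = Suc (Suc k)" by (metis One_nat_def nat.exhaust)
  then show ?case
  proof cases
    case 1
    then show ?thesis using \<open>t \<in> C n\<close> by (auto simp: hpart_iff R_single simp del: ER.dT_pure)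
  next
    case 2
    then show ?thesis using \<open>t \<in> C n\<close> by (simp add: R_mpart)
  next
    case 3
    have t: "t \<in> tprod es (C (Suc k)) (mpart H M)" and eq: "apply_at es k (rco H M) t = apply_at es (Suc k) (lco H M) t"
      using \<open>t \<in> C n\<close> 3 by auto
    have TT: "t \<in> TT es" by (rule C_TT) fact
    obtain ps where ps: "set ps \<subseteq> C (Suc k) \<times> mpart H M" "t = (\<Sum>(x, y)\<leftarrow>ps. tmult es x y)"
      using tprod_list[OF t C_subspace] by blast
    have "R h (tmult es x y) \<in> tprod es (C (Suc k)) (mpart H M)" if "(x, y) \<in> set ps" for x y
    proof -
      have xy: "x \<in> C (Suc k)" "y \<in> mpart H M" using that ps(1) by auto
      then have "x \<in> TT es" "y \<in> TT es" using C_TT[of x] C_TT[of y 1] by auto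
      then show ?thesis
        using xy 1 3 by (auto simp: ER.dT_tmult intro!: subspace_sum_list2[OF tprod_subspace] tprod_tmult R_mpart)
    qed
    then have "R h t \<in> tprod es (C (Suc k)) (mpart H M)"
      unfolding ps(2) dactT_sum_list2 by (intro subspace_sum_list2[OF tprod_subspace])
    then show ?thesis using 3 by (simp add: apply_rco_R[OF TT] apply_lco_R[OF TT] eq)
  qed
qed

lemma rco_R_kap:
  assumes "set w \<subseteq> V"
  shows "apply_at es (length w - 1) (rco H M) (R h (\<kappa> w)) = (\<Sum>(c, d)\<leftarrow>cop H h. tmult es (R c (\<kappa> w)) (pure es [(d, 0)]))"
  unfolding apply_rco_R[OF kap_TT] rco_kap[OF assms] by (simp add: ER.dT_tmult R_single del: ER.dT_pure)

text \<open>Both coactions in the cotensor equation at the last two factors give \<kappa>(w) v(-2)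
  \<otimes> v(-1) \<otimes> v(0). On the right-coaction side this uses that \<kappa>(w) is
  coinvariant, so that the coaction of \<kappa>(w) x is \<kappa>(w) x1 \<otimes> x2.\<close>

lemma kap_cotensor: "set w \<subseteq> V \<Longrightarrow> \<kappa> w \<in> C (length w)"
proof (induction w rule: rev_induct)
  case Nil show ?case by (auto simp: kap_Nil hpart_iff)
next
  case (snoc v w)
  show ?case
  proof (cases w rule: rev_cases)
    case Nil then show ?thesis by (auto simp: kap_kk kk_single mpart_iff)
  next
    case w: (snoc w' e)
    define k where "k = length w'"
    have len: "length w = Suc k" and ne: "w \<noteq> []" using w k_def by auto
    have \<kappa>w: "\<kappa> w \<in> C (Suc k)" using snoc len by simp
    have T: "R x (\<kappa> w) \<in> tpow es UNIV (Suc k)" for x using C_tpow[OF R_cotensor[OF \<kappa>w]] by simp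
    have kv: "\<kappa> (w @ [v]) = (\<Sum>(x, n)\<leftarrow>lc H M v. tmult es (R x (\<kappa> w)) (pure es [(0, n)]))"
      using ne by (simp add: kap_kk kk_snoc)
    have "\<kappa> (w @ [v]) \<in> tprod es (C (Suc k)) (mpart H M)"
      unfolding kv by (intro subspace_sum_list2[OF tprod_subspace] tprod_tmult R_cotensor \<kappa>w) (auto simp: mpart_iff)
    moreover have "apply_at es k (rco H M) (\<kappa> (w @ [v])) = apply_at es (Suc k) (lco H M) (\<kappa> (w @ [v]))"
    proof -
      have "apply_at es k (rco H M) (\<kappa> (w @ [v])) = (\<Sum>(x, n)\<leftarrow>lc H M v. \<Sum>(a, b)\<leftarrow>cop H x. tmult es (R a (\<kappa> w)) (pure es [(b, 0), (0, n)]))"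
        unfolding kv lin_sum_list2[OF lin_apply_at[OF lin_id]]
        using rco_R_kap[of w] snoc.prems len
        by (simp add: RC.apply_at_left[OF T] tmult_sum_list2_left tmult_assoc tmult_pure)
      also have "\<dots> = (\<Sum>(x, n)\<leftarrow>lc H M v. \<Sum>(y, k)\<leftarrow>lc H M n. tmult es (R x (\<kappa> w)) (pure es [(y, 0), (0, k)]))"
        by (rule lc_coassoc; intro lin_intros TT_intros)
      also have "\<dots> = apply_at es (Suc k) (lco H M) (\<kappa> (w @ [v]))"
      proof -
        have "apply_at es (Suc k) (lco H M) (tmult es (R x (\<kappa> w)) (pure es [(0, n)])) = tmult es (R x (\<kappa> w)) (lco H M (0, n))" for x n
          using LC.apply_at_right[OF T, of "pure es [(0, n)]" 0 x] by (simp add: LC.apply_at_single)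
        then show ?thesis unfolding kv lin_sum_list2[OF lin_apply_at[OF lin_id]]
          by (simp add: lco_m tmult_sum_list2_right TT_intros tmult_pure tmult_assoc)
      qed
      finally show ?thesis .
    qed
    ultimately show ?thesis by (simp add: len)
  qed
qed

text \<open>\<open>omega\<close> is the map \<open>y \<otimes> z \<otimes> a \<otimes> m \<mapsto> y S(z) a \<otimes> m\<close>. Applied to the defining equation of the cotensor
  product, after coacting on \<open>y\<close>, it exhibits an element as a combination of \<open>y h\<close> with \<open>y\<close> coinvariant.\<close>

definition omega :: "('h \<times> 'm) list \<Rightarrow> ('h \<times> 'm) list \<Rightarrow> ('k, 'h \<times> 'm) tensor" where
  "omega u v = (case v of [z, a, m] \<Rightarrow> tmult es (R (S (fst z) * fst a) (pure es u)) (pure es [m]) | _ \<Rightarrow> 0)"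

lemma mlin_omega: "mlin es (\<lambda>u. omega u v)" "mlin es (omega u)"
proof -
  have "mlin es (\<lambda>u. tmult es (R h (pure es u)) y)" for h y
    unfolding mlin_def by (intro allI lin_tmult_left lin_dactT mlinD[OF mlin_pure])
  moreover have "(\<exists>z a m. v = [z, a, m]) \<or> (\<lambda>u. omega u v) = (\<lambda>_. 0)"
    unfolding omega_def by (auto split: list.split)
  ultimately show "mlin es (\<lambda>u. omega u v)"
    by (auto simp: omega_def mlin_0 simp del: ER.dT_pure)
  show "mlin es (omega u)"
    unfolding omega_def by (rule mlin_case3; intro lin_intros TT_intros)
qed

lemma tbind_omega:
  assumes t: "t \<in> tpow es UNIV n"
  shows "tbind (tmult es t (pure es [(d, 0), (a, 0), (0, m)])) (\<lambda>w. if n \<le> length w then omega (take n w) (drop n w) else 0)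
    = tmult es (R (S d * a) t) (pure es [(0, m)])"
  unfolding tbind_split[OF mlin_omega t]
  by (rule tpow_eqI[OF t vector_space_tscale, of "\<lambda>t. tbind t (\<lambda>u. omega u [(d, 0), (a, 0), (0, m)])"
        "\<lambda>t. tmult es (R (S d * a) t) (pure es [(0, m)])"])
    (simp_all add: lin_intros tbind_pure_mlin[OF mlin_omega(1)], simp add: omega_def)

text \<open>The map y \<otimes> z \<mapsto> y S(z), zero unless the second block is a single letter.
  On the right coaction of \<kappa>(w) h it has the value \<epsilon>(h) \<kappa>(w).\<close>

definition xi :: "('h \<times> 'm) list \<Rightarrow> ('h \<times> 'm) list \<Rightarrow> ('k, 'h \<times> 'm) tensor" where
  "xi u v = (case v of [z] \<Rightarrow> R (S (fst z)) (pure es u) | _ \<Rightarrow> 0)"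

lemma mlin_xi: "mlin es (\<lambda>u. xi u v)" "mlin es (xi u)"
proof -
  have "mlin es (\<lambda>u. R h (pure es u))" for h
    unfolding mlin_def by (intro allI lin_dactT mlinD[OF mlin_pure])
  moreover have "(\<exists>z. v = [z]) \<or> (\<lambda>u. xi u v) = (\<lambda>_. 0)"
    unfolding xi_def by (auto split: list.split)
  ultimately show "mlin es (\<lambda>u. xi u v)"
    by (auto simp: xi_def mlin_0 simp del: ER.dT_pure)
  show "mlin es (xi u)"
    unfolding xi_def by (rule mlin_case1; intro lin_intros TT_intros)
qed

lemma tbind_xi:
  assumes t: "t \<in> tpow es UNIV n"
  shows "tbind (tmult es t (pure es [(d, 0)])) (\<lambda>w. if n \<le> length w then xi (take n w) (drop n w) else 0) = R (S d) t"
  unfolding tbind_split[OF mlin_xi t]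
  by (rule tpow_eqI[OF t vector_space_tscale, of "\<lambda>t. tbind t (\<lambda>u. xi u [(d, 0)])" "R (S d)"])
    (simp_all add: lin_intros tbind_pure_mlin[OF mlin_xi(1)], simp add: xi_def)

text \<open>The right \<open>H\<close>-span of the embedded words of length \<open>n\<close>. That
  it contains all of \<open>C n\<close> is the surjectivity half of the structure theorem of Hopf
  modules, applied to \<open>C n\<close>.\<close>

definition gen :: "nat \<Rightarrow> ('k, 'h \<times> 'm) tensor \<Rightarrow> bool" where
  "gen n t \<longleftrightarrow> (\<exists>ps. (\<forall>(h, w)\<in>set ps. length w = n \<and> set w \<subseteq> V) \<and> t = (\<Sum>(h, w)\<leftarrow>ps. R h (\<kappa> w)))"

lemma gen_0: "gen n 0"
  unfolding gen_def by (rule exI[of _ "[]"]) simp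

lemma gen_add: "gen n t \<Longrightarrow> gen n u \<Longrightarrow> gen n (t + u)"
  unfolding gen_def
proof (elim exE conjE)
  fix ps qs assume "\<forall>(h, w)\<in>set ps. length w = n \<and> set w \<subseteq> V" "t = (\<Sum>(h, w)\<leftarrow>ps. R h (\<kappa> w))"
    "\<forall>(h, w)\<in>set qs. length w = n \<and> set w \<subseteq> V" "u = (\<Sum>(h, w)\<leftarrow>qs. R h (\<kappa> w))"
  then show "\<exists>ps. (\<forall>(h, w)\<in>set ps. length w = n \<and> set w \<subseteq> V) \<and> t + u = (\<Sum>(h, w)\<leftarrow>ps. R h (\<kappa> w))"
    by (intro exI[of _ "ps @ qs"]) auto
qed

lemma gen_sum_list: "(\<And>p. p \<in> set ps \<Longrightarrow> gen n (F p)) \<Longrightarrow> gen n (\<Sum>p\<leftarrow>ps. F p)"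
  by (induction ps) (auto intro: gen_0 gen_add)

lemma gen_R_kap: "length w = n \<Longrightarrow> set w \<subseteq> V \<Longrightarrow> gen n (R h (\<kappa> w))"
  unfolding gen_def by (rule exI[of _ "[(h, w)]"]) simp

lemma gen_tscale: "gen n t \<Longrightarrow> gen n (tscale c t)"
  unfolding gen_def
proof (elim exE conjE)
  fix ps assume ps: "\<forall>(h, w)\<in>set ps. length w = n \<and> set w \<subseteq> V" "t = (\<Sum>(h, w)\<leftarrow>ps. R h (\<kappa> w))"
  have "tscale c (R h (\<kappa> w)) = R (hs c h) (\<kappa> w)" for h w
    using lin_scale[OF ER.lin_dT_comp[OF lin_id kap_TT], of c h w] by simp
  then have "tscale c t = (\<Sum>(h, w)\<leftarrow>map (\<lambda>(h, w). (hs c h, w)) ps. R h (\<kappa> w))"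
    unfolding ps(2) by (simp add: lin_sum_list[OF lin_tscale_const[OF lin_id]] comp_def case_prod_beta')
  then show "\<exists>ps. (\<forall>(h, w)\<in>set ps. length w = n \<and> set w \<subseteq> V) \<and> tscale c t = (\<Sum>(h, w)\<leftarrow>ps. R h (\<kappa> w))"
    using ps(1) by (intro exI[of _ "map (\<lambda>(h, w). (hs c h, w)) ps"]) auto
qed

text \<open>By induction an element t of the cotensor power is a sum of terms \<kappa>(w) h
  \<otimes> m. Let \<Omega> be the right coaction on the last factor but one followed by
  \<open>omega\<close>. Preceded by the same right coaction, it sends such a term to \<kappa>(w) h1
  S(h2) h3 \<otimes> m, hence t to t. Preceded by the left coaction of m, it sends the term to
  \<epsilon>(h) \<kappa>(w) m(-1) \<otimes> m(0), which is \<epsilon>(h) \<kappa>(w m). The cotensor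
  equation equates the two results.\<close>

lemma gen_cotensor: "t \<in> C n \<Longrightarrow> gen n t"
proof (induction n arbitrary: t rule: nat_less_induct)
  case (1 n)
  consider "n = 0" | "n = 1" | k where "n = Suc (Suc k)" by (metis One_nat_def nat.exhaust)
  then show ?case
  proof cases
    case n: 1
    then obtain x where "t = pure es [(x, 0)]" using \<open>t \<in> C n\<close> by (auto simp: hpart_iff)
    then have "t = R x (\<kappa> [])" by (simp add: kap_Nil R_single del: ER.dT_pure)
    then show ?thesis using n by (simp add: gen_R_kap)
  next
    case n: 2
    then obtain m where m: "t = pure es [(0, m)]" using \<open>t \<in> C n\<close> by (auto simp: mpart_iff)
    have "pure es [(0, m)] = (\<Sum>(k, x)\<leftarrow>rc H M m. pure es [(0, ra (P k) x)])"
      by (rule rc_P[symmetric]) (intro lin_intros)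
    also have "\<dots> = (\<Sum>(k, x)\<leftarrow>rc H M m. R x (\<kappa> [P k]))"
      by (simp add: kap_kk kk_single R_single del: ER.dT_pure)
    finally show ?thesis
      unfolding m using n by (auto intro!: gen_sum_list gen_R_kap P_coinvariant)
  next
    case n: (3 k)
    have t: "t \<in> tprod es (C (Suc k)) (mpart H M)" and eq: "apply_at es k (rco H M) t = apply_at es (Suc k) (lco H M) t"
      using \<open>t \<in> C n\<close> n by auto
    obtain qs where qs: "set qs \<subseteq> C (Suc k) \<times> mpart H M" "t = (\<Sum>(x, y)\<leftarrow>qs. tmult es x y)"
      using tprod_list[OF t C_subspace] by blast
    have "\<exists>ts. (\<forall>(h, w, m)\<in>set ts. length w = Suc k \<and> set w \<subseteq> V) \<and>
      (\<Sum>(x, y)\<leftarrow>qs. tmult es x y) = (\<Sum>(h, w, m)\<leftarrow>ts. tmult es (R h (\<kappa> w)) (pure es [(0, m)]))"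
      using qs(1)
    proof (induction qs)
      case Nil then show ?case by (intro exI[of _ "[]"]) simp
    next
      case (Cons q qs)
      then obtain ts where ts: "\<forall>(h, w, m)\<in>set ts. length w = Suc k \<and> set w \<subseteq> V"
        "(\<Sum>(x, y)\<leftarrow>qs. tmult es x y) = (\<Sum>(h, w, m)\<leftarrow>ts. tmult es (R h (\<kappa> w)) (pure es [(0, m)]))" by auto
      obtain x m where q: "q = (x, pure es [(0, m)])" "x \<in> C (Suc k)"
        using Cons.prems by (cases q) (auto simp: mpart_iff)
      have "gen (Suc k) x" using "1.IH" q(2) n by simp
      then obtain ps where ps: "\<forall>(h, w)\<in>set ps. length w = Suc k \<and> set w \<subseteq> V" "x = (\<Sum>(h, w)\<leftarrow>ps. R h (\<kappa> w))"
        unfolding gen_def by blast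
      show ?case
      proof (intro exI[of _ "map (\<lambda>(h, w). (h, w, m)) ps @ ts"] conjI)
        show "\<forall>(h, w, m)\<in>set (map (\<lambda>(h, w). (h, w, m)) ps @ ts). length w = Suc k \<and> set w \<subseteq> V"
          using ts(1) ps(1) by fastforce
        show "(\<Sum>(x, y)\<leftarrow>q # qs. tmult es x y)
          = (\<Sum>(h, w, m)\<leftarrow>map (\<lambda>(h, w). (h, w, m)) ps @ ts. tmult es (R h (\<kappa> w)) (pure es [(0, m)]))"
          using ts(2) by (simp add: q(1) ps(2) tmult_sum_list_left comp_def case_prod_beta')
      qed
    qed
    then obtain ts where ts: "\<forall>(h, w, m)\<in>set ts. length w = Suc k \<and> set w \<subseteq> V"
      "t = (\<Sum>(h, w, m)\<leftarrow>ts. tmult es (R h (\<kappa> w)) (pure es [(0, m)]))" using qs(2) by auto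
    let ?\<Omega> = "\<lambda>t. tbind (apply_at es k (rco H M) t) (\<lambda>w. if Suc k \<le> length w then omega (take (Suc k) w) (drop (Suc k) w) else 0)"
    have lo: "lin tscale tscale ?\<Omega>" by (intro lin_intros)
    have T: "R h (\<kappa> w) \<in> tpow es UNIV (Suc k)" if "length w = Suc k" "set w \<subseteq> V" for h w
      using C_tpow[OF R_cotensor[OF kap_cotensor[OF that(2)]]] that(1) by simp
    have om: "?\<Omega> (tmult es (R h (\<kappa> w)) (pure es [(a, 0), (0, m)])) = tscale (\<epsilon> h) (tmult es (R a (\<kappa> w)) (pure es [(0, m)]))"
      if w: "length w = Suc k" "set w \<subseteq> V" for h w a m
    proof -
      have "apply_at es k (rco H M) (tmult es (R h (\<kappa> w)) (pure es [(a, 0), (0, m)]))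
        = (\<Sum>(c, d)\<leftarrow>cop H h. tmult es (R c (\<kappa> w)) (pure es [(d, 0), (a, 0), (0, m)]))"
        using rco_R_kap[OF w(2), of h] w
        by (simp add: RC.apply_at_left[OF T] tmult_sum_list2_left tmult_assoc tmult_pure)
      then have "?\<Omega> (tmult es (R h (\<kappa> w)) (pure es [(a, 0), (0, m)]))
        = (\<Sum>(c, d)\<leftarrow>cop H h. tmult es (R (c * S d * a) (\<kappa> w)) (pure es [(0, m)]))"
        by (simp only: tbind_sum_list2 tbind_omega[OF T[OF w]] R_mult[OF kap_TT] mult.assoc)
      also have "\<dots> = tscale (\<epsilon> h) (tmult es (R (1 * a) (\<kappa> w)) (pure es [(0, m)]))"
        by (rule cop_antipode_r) (intro lin_intros TT_intros)
      finally show ?thesis by simp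
    qed
    define \<Phi> where "\<Phi> F = (\<Sum>p\<leftarrow>ts. F (fst p) (fst (snd p)) (snd (snd p)))" for F :: "'h \<Rightarrow> 'm list \<Rightarrow> 'm \<Rightarrow> ('k, 'h \<times> 'm) tensor"
    have \<Phi>cong: "\<Phi> F = \<Phi> G" if "\<And>h w m. length w = Suc k \<Longrightarrow> set w \<subseteq> V \<Longrightarrow> F h w m = G h w m" for F G
      unfolding \<Phi>_def using ts(1) that by (intro arg_cong[where f = sum_list] map_cong) auto
    have tF: "t = \<Phi> (\<lambda>h w m. tmult es (R h (\<kappa> w)) (pure es [(0, m)]))"
      unfolding ts(2) \<Phi>_def by (simp add: case_prod_beta')
    have lin\<Phi>: "F (\<Phi> G) = \<Phi> (\<lambda>h w m. F (G h w m))" if "lin tscale tscale F" for F G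
      unfolding \<Phi>_def by (rule lin_sum_list[OF that])
    have "?\<Omega> (apply_at es k (rco H M) t) = \<Phi> (\<lambda>h w m. ?\<Omega> (apply_at es k (rco H M) (tmult es (R h (\<kappa> w)) (pure es [(0, m)]))))"
      unfolding tF by (rule lin\<Phi>) (intro lin_intros)
    also have "\<dots> = \<Phi> (\<lambda>h w m. tmult es (R h (\<kappa> w)) (pure es [(0, m)]))"
    proof (rule \<Phi>cong)
      fix h w m assume w: "length w = Suc k" "set w \<subseteq> V"
      have "apply_at es k (rco H M) (tmult es (R h (\<kappa> w)) (pure es [(0, m)]))
        = (\<Sum>(c, d)\<leftarrow>cop H h. tmult es (R c (\<kappa> w)) (pure es [(d, 0), (0, m)]))"
        using rco_R_kap[OF w(2), of h] w
        by (simp add: RC.apply_at_left[OF T] tmult_sum_list2_left tmult_assoc tmult_pure)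
      then have "?\<Omega> (apply_at es k (rco H M) (tmult es (R h (\<kappa> w)) (pure es [(0, m)])))
        = (\<Sum>(c, d)\<leftarrow>cop H h. ?\<Omega> (tmult es (R c (\<kappa> w)) (pure es [(d, 0), (0, m)])))"
        using lin_sum_list2[OF lo] by (simp only:)
      also have "\<dots> = (\<Sum>(c, d)\<leftarrow>cop H h. tscale (\<epsilon> c) (tmult es (R d (\<kappa> w)) (pure es [(0, m)])))"
        by (simp only: om[OF w])
      also have "\<dots> = tmult es (R h (\<kappa> w)) (pure es [(0, m)])"
        by (rule cop_counit_l) (intro lin_intros TT_intros)
      finally show "?\<Omega> (apply_at es k (rco H M) (tmult es (R h (\<kappa> w)) (pure es [(0, m)])))
        = tmult es (R h (\<kappa> w)) (pure es [(0, m)])" .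
    qed
    \<comment> \<open>The defining equation of the cotensor product enters here: the inner right
      coaction is traded for the left coaction on the last factor.\<close>
    finally have "t = ?\<Omega> (apply_at es (Suc k) (lco H M) t)" using tF eq by simp
    also have "\<dots> = \<Phi> (\<lambda>h w m. ?\<Omega> (apply_at es (Suc k) (lco H M) (tmult es (R h (\<kappa> w)) (pure es [(0, m)]))))"
      unfolding tF by (rule lin\<Phi>) (intro lin_intros)
    also have "\<dots> = \<Phi> (\<lambda>h w m. tscale (\<epsilon> h) (\<kappa> (w @ [m])))"
    proof (rule \<Phi>cong)
      fix h w m assume w: "length w = Suc k" "set w \<subseteq> V"
      have "apply_at es (Suc k) (lco H M) (tmult es (R h (\<kappa> w)) (pure es [(0, m)]))
        = (\<Sum>(x, n)\<leftarrow>lc H M m. tmult es (R h (\<kappa> w)) (pure es [(x, 0), (0, n)]))"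
        using LC.apply_at_right[OF T[OF w], of "pure es [(0, m)]" 0 h]
        by (simp add: LC.apply_at_single lco_m tmult_sum_list2_right TT_intros)
      then have "?\<Omega> (apply_at es (Suc k) (lco H M) (tmult es (R h (\<kappa> w)) (pure es [(0, m)])))
        = (\<Sum>(x, n)\<leftarrow>lc H M m. ?\<Omega> (tmult es (R h (\<kappa> w)) (pure es [(x, 0), (0, n)])))"
        using lin_sum_list2[OF lo] by (simp only:)
      also have "\<dots> = (\<Sum>(x, n)\<leftarrow>lc H M m. tscale (\<epsilon> h) (tmult es (R x (\<kappa> w)) (pure es [(0, n)])))"
        by (simp only: om[OF w])
      also have "\<dots> = tscale (\<epsilon> h) (\<kappa> (w @ [m]))"
      proof -
        have "w \<noteq> []" using w(1) by auto
        then show ?thesis by (simp add: kap_kk kk_snoc lin_sum_list2[OF lin_tscale_const[OF lin_id]])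
      qed
      finally show "?\<Omega> (apply_at es (Suc k) (lco H M) (tmult es (R h (\<kappa> w)) (pure es [(0, m)])))
        = tscale (\<epsilon> h) (\<kappa> (w @ [m]))" .
    qed
    finally have t: "t = \<Phi> (\<lambda>h w m. tscale (\<epsilon> h) (\<kappa> (w @ [m])))" .
    \<comment> \<open>The last letter m is still an arbitrary element of \<open>M\<close>. The
      decomposition m = P(m0) m1 makes it coinvariant at the price of a right factor, which
      \<open>kk_ra\<close> moves to the outside.\<close>
    have "gen n (\<kappa> (w @ [m]))" if w: "length w = Suc k" "set w \<subseteq> V" for w m
    proof -
      have "\<kappa> (w @ [m]) = (\<Sum>(j, x)\<leftarrow>rc H M m. kw (w @ [ra (P j) x]))"
        using mlinD[OF mlin_kk, of w "[]"] by (simp add: kap_kk rc_P[of "\<lambda>m. kw (w @ [m])"])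
      then show ?thesis
        using w n by (auto simp: kk_ra kap_kk[symmetric] intro!: gen_sum_list gen_R_kap P_coinvariant)
    qed
    then show ?thesis
      unfolding t \<Phi>_def using ts(1) by (auto intro!: gen_sum_list gen_tscale)
  qed
qed

lemma cotensor_list:
  assumes "t \<in> C n"
  obtains ps where "\<And>h w. (h, w) \<in> set ps \<Longrightarrow> length w = n \<and> set w \<subseteq> V" "t = (\<Sum>(h, w)\<leftarrow>ps. R h (\<kappa> w))"
proof -
  obtain ps where "\<forall>(h, w)\<in>set ps. length w = n \<and> set w \<subseteq> V" "t = (\<Sum>(h, w)\<leftarrow>ps. R h (\<kappa> w))"
    using gen_cotensor[OF assms] unfolding gen_def by blast
  then show ?thesis by (intro that) auto
qed

lemma R_kap_cotensor: "length w = n \<Longrightarrow> set w \<subseteq> V \<Longrightarrow> R h (\<kappa> w) \<in> C n"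
  using R_cotensor[OF kap_cotensor] by auto

lemma K_cotensor: "t \<in> tpow ms V n \<Longrightarrow> K t \<in> C n"
  by (rule tpow_tbind[OF mlin_kap _ C_subspace]) (auto dest: kap_cotensor)

text \<open>Checked on the generators: \<open>L_R\<close> moves the right action outside, and
  \<open>L_kap\<close> rewrites the left action on an embedded word by the adjoint action, which
  preserves the coinvariants.\<close>

lemma L_cotensor:
  assumes "t \<in> C n" shows "L h t \<in> C n"
proof -
  have "L h (\<kappa> w) \<in> C n" if "length w = n" "set w \<subseteq> V" for h w
    unfolding L_kap using AD.da_tpow[OF that(2) ad_coinvariant] that
    by (intro subspace_sum_list2[OF C_subspace] R_cotensor K_cotensor) auto
  then have *: "L h (R x (\<kappa> w)) \<in> C n" if "length w = n" "set w \<subseteq> V" for x h w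
    unfolding L_R[OF kap_TT] using that by (intro R_cotensor)
  obtain ps where ps: "\<And>h w. (h, w) \<in> set ps \<Longrightarrow> length w = n \<and> set w \<subseteq> V" "t = (\<Sum>(h, w)\<leftarrow>ps. R h (\<kappa> w))"
    using cotensor_list[OF assms] by blast
  show ?thesis
    unfolding ps(2) dactT_sum_list2 by (rule subspace_sum_list2[OF C_subspace]) (use ps(1) * in blast)
qed

subsection \<open>Coinvariants of the cotensor powers\<close>

text \<open>Apply y \<otimes> z \<mapsto> y S(z) to both sides of the coinvariance equation. A sum
  of terms \<kappa>(w) h turns into the sum of the \<epsilon>(h) \<kappa>(w), while t \<otimes> 1
  turns into t.\<close>

lemma cotensor_coinv_K:
  assumes "t \<in> cotensor_coinv H M n"
  obtains u where "u \<in> tpow ms V n" "t = K u"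
proof -
  have t: "t \<in> C n" and co: "apply_at es (n - 1) (rco H M) t = tmult es t (pure es [(1, 0)])"
    using assms by (auto simp: cotensor_coinv_def cotensor_rco_def)
  obtain ps where ps: "\<And>h w. (h, w) \<in> set ps \<Longrightarrow> length w = n \<and> set w \<subseteq> V" "t = (\<Sum>(h, w)\<leftarrow>ps. R h (\<kappa> w))"
    using cotensor_list[OF t] by blast
  let ?\<Xi> = "\<lambda>t. tbind t (\<lambda>w. if max 1 n \<le> length w then xi (take (max 1 n) w) (drop (max 1 n) w) else 0)"
  have lx: "lin tscale tscale ?\<Xi>" by (intro lin_intros)
  have T: "R h (\<kappa> w) \<in> tpow es UNIV (max 1 n)" if "(h', w) \<in> set ps" for h h' w
    using ps(1)[OF that] C_tpow[OF R_kap_cotensor] by auto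
  have "?\<Xi> (apply_at es (n - 1) (rco H M) (R h (\<kappa> w))) = tscale (\<epsilon> h) (\<kappa> w)" if p: "(h, w) \<in> set ps" for h w
  proof -
    have "?\<Xi> (apply_at es (n - 1) (rco H M) (R h (\<kappa> w))) = (\<Sum>(c, d)\<leftarrow>cop H h. R (c * S d) (\<kappa> w))"
      using rco_R_kap[of w h] ps(1)[OF p] by (simp only: tbind_sum_list2 tbind_xi[OF T[OF p]] R_mult[OF kap_TT])
    also have "\<dots> = tscale (\<epsilon> h) (R 1 (\<kappa> w))" by (rule cop_antipode_r) (intro lin_intros TT_intros)
    finally show ?thesis by (simp add: R_1)
  qed
  then have "?\<Xi> (apply_at es (n - 1) (rco H M) t) = (\<Sum>(h, w)\<leftarrow>ps. tscale (\<epsilon> h) (\<kappa> w))"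
    unfolding ps(2) lin_sum_list2[OF lin_apply_at[OF lin_id]] lin_sum_list2[OF lx] by (intro sum_list_cong2)
  moreover have "?\<Xi> (tmult es t (pure es [(1, 0)])) = t"
    by (simp only: tbind_xi[OF C_tpow[OF t]] S_1 R_1[OF C_TT[OF t]])
  ultimately have "t = (\<Sum>(h, w)\<leftarrow>ps. tscale (\<epsilon> h) (\<kappa> w))" using co by simp
  also have "\<dots> = K (\<Sum>(h, w)\<leftarrow>ps. tscale (\<epsilon> h) (pure ms w))"
    by (simp add: tbind_sum_list2 tbind_simps K_pure)
  finally have "t = K (\<Sum>(h, w)\<leftarrow>ps. tscale (\<epsilon> h) (pure ms w))" .
  then show ?thesis
  proof (rule that[rotated])
    have "tscale (\<epsilon> h) (pure ms w) \<in> tpow ms V n" if "(h, w) \<in> set ps" for h w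
      using ps(1)[OF that] by (intro tens.subspace_scale[OF tpow_subspace] tpow_pure) auto
    then show "(\<Sum>(h, w)\<leftarrow>ps. tscale (\<epsilon> h) (pure ms w)) \<in> tpow ms V n"
      by (rule subspace_sum_list2[OF tpow_subspace])
  qed
qed

lemma kap_coinv: "set w \<subseteq> V \<Longrightarrow> \<kappa> w \<in> cotensor_coinv H M (length w)"
  using rco_kap[of w] kap_cotensor[of w] by (simp add: cotensor_coinv_def cotensor_rco_def)

lemma cotensor_coinv_subspace: "tens.subspace (cotensor_coinv H M n)"
  using C_subspace[of n]
  by (auto simp: tens.subspace_def cotensor_coinv_def cotensor_rco_def apply_at_def tbind_simps tmult_add_left tmult_tscale_left)

lemma K_coinv: "t \<in> tpow ms V n \<Longrightarrow> K t \<in> cotensor_coinv H M n"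
  by (rule tpow_tbind[OF mlin_kap _ cotensor_coinv_subspace]) (auto dest: kap_coinv)

lemma P_ra:
  assumes "v \<in> V" shows "pure ms [P (ra v x)] = tscale (\<epsilon> x) (pure ms [v])"
proof -
  have "pure ms [P (ra v x)] = (\<Sum>(n, y)\<leftarrow>rc H M (ra v x). pure ms [ra n (S y)])" by (rule P_F) (intro lin_intros)
  also have "\<dots> = (\<Sum>(n, y)\<leftarrow>rc H M v. \<Sum>(a, b)\<leftarrow>cop H x. pure ms [ra (ra n a) (S (y * b))])"
    by (rule rc_ra; intro lin_intros)
  also have "\<dots> = (\<Sum>(a, b)\<leftarrow>cop H x. pure ms [ra (ra v a) (S (1 * b))])"
    by (rule coinvariantsD[OF assms]; intro lin_intros)
  also have "\<dots> = (\<Sum>(a, b)\<leftarrow>cop H x. pure ms [ra v (a * S b)])" by (simp add: ra_mult)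
  also have "\<dots> = tscale (\<epsilon> x) (pure ms [ra v 1])" by (rule cop_antipode_r) (intro lin_intros)
  finally show ?thesis by simp
qed

abbreviation PP where "PP n \<equiv> coinv_proj_power H M n"

lemma mlin_PP: "mlin es (\<lambda>w. if length w = n then pure ms (map (\<lambda>e. P (snd e)) w) else 0)"
  unfolding mlin_def
proof (intro allI)
  fix u v :: "('h \<times> 'm) list"
  have "lin es tscale (\<lambda>x. pure ms (map (\<lambda>e. P (snd e)) u @ P (snd x) # map (\<lambda>e. P (snd e)) v))"
    by (intro lin_pure lin_intros)
  then show "lin es tscale (\<lambda>x. if length (u @ x # v) = n then pure ms (map (\<lambda>e. P (snd e)) (u @ x # v)) else 0)"
    by (cases "Suc (length u + length v) = n") (auto intro: lin_0)
qed

lemma PP_pure: "PP n (pure es w) = (if length w = n then pure ms (map (\<lambda>e. P (snd e)) w) else 0)"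
  unfolding coinv_proj_power_def by (rule tbind_pure_mlin[OF mlin_PP])

lemma lin_PP [lin_intros]: "linear_on s1 tscale X A \<Longrightarrow> linear_on s1 tscale X (\<lambda>x. PP n (A x))"
  unfolding coinv_proj_power_def by (rule lin_tbind)

lemma TT_PP [TT_intros]: "t \<in> TT es \<Longrightarrow> PP n t \<in> TT ms"
  unfolding coinv_proj_power_def by (rule TT_tbind[OF _ mlin_PP]) auto

lemma PP_Cons:
  assumes "t \<in> TT es"
  shows "PP (Suc n) (tmult es (pure es [e]) t) = tmult ms (pure ms [P (snd e)]) (PP n t)"
  by (rule TT_eqI[OF assms, of "\<lambda>t. PP (Suc n) (tmult es (pure es [e]) t)" "\<lambda>t. tmult ms (pure ms [P (snd e)]) (PP n t)"])
    (auto simp: tmult_pure PP_pure intro!: lin_intros TT_intros)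

text \<open>In \<open>kk_Cons\<close> the first letter v carries a right factor x.
  \<open>P_ra\<close> turns it into the scalar \<epsilon>(x), after which the counit law of the
  diagonal coaction restores the word.\<close>

lemma PP_kk: "length w = n \<Longrightarrow> set w \<subseteq> V \<Longrightarrow> PP n (kw w) = pure ms w"
proof (induction n arbitrary: w)
  case 0 then show ?case by (simp add: PP_pure)
next
  case (Suc n)
  then obtain v u where w: "w = v # u" "length u = n" "v \<in> V" "set u \<subseteq> V" by (cases w) auto
  have "PP (Suc n) (kw w) = (\<Sum>(x, u')\<leftarrow>dc u. PP (Suc n) (tmult es (pure es [(0, ra v x)]) (kw u')))"
    unfolding w(1) kk_Cons by (rule lin_sum_list2[OF lin_PP[OF lin_id]])
  also have "\<dots> = (\<Sum>(x, u')\<leftarrow>dc u. tscale (\<epsilon> x) (pure ms (v # u')))"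
  proof (rule sum_list_cong2)
    fix x u' assume "(x, u') \<in> set (dc u)"
    then have "PP n (kw u') = pure ms u'" using w dco_length dco_V by (intro Suc.IH) fastforce+
    then show "PP (Suc n) (tmult es (pure es [(0, ra v x)]) (kw u')) = tscale (\<epsilon> x) (pure ms (v # u'))"
      by (simp add: PP_Cons P_ra[OF w(3)] tmult_tscale_left tmult_pure)
  qed
  also have "\<dots> = pure ms w" unfolding w(1) by (rule dco_counit[OF mlin_Cons[OF mlin_pure]])
  finally show ?case .
qed

lemma PP_K: "t \<in> tpow ms V n \<Longrightarrow> n \<ge> 1 \<Longrightarrow> PP n (K t) = t"
  by (rule tpow_eqI[of t ms V n tscale "\<lambda>t. PP n (K t)" "\<lambda>t. t"])
    (auto simp: vector_space_tscale K_pure kap_kk PP_kk Suc_le_eq intro!: lin_intros)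

text \<open>In positive degree \<open>coinv_embed\<close> is the inverse of \<open>PP n\<close> on
  the coinvariants. Each coinvariant is some \<open>K u\<close>, and \<open>PP n\<close> recovers u
  from it, so \<open>PP n\<close> is injective there with inverse \<open>K\<close>.\<close>

lemma coinv_embed_K:
  assumes t: "t \<in> tpow ms V n" shows "coinv_embed H M n t = K t"
proof (cases "n = 0")
  case True
  have ml: "mlin ms (\<lambda>w. if w = [] then pure es [(1, 0)] else 0)"
    by (simp add: mlin_def lin_0)
  have "tbind t (\<lambda>w. if w = [] then pure es [(1, 0)] else 0) = K t"
    by (rule tpow_eqI[OF t vector_space_tscale, of "\<lambda>t. tbind t (\<lambda>w. if w = [] then pure es [(1, 0)] else 0)" "\<lambda>t. K t"])
      (use True in \<open>simp_all add: K_pure kap_Nil tbind_pure_mlin[OF ml] lin_intros\<close>)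
  then show ?thesis unfolding coinv_embed_def if_P[OF True] .
next
  case False
  have inj: "inj_on (PP n) (cotensor_coinv H M n)"
  proof (rule inj_onI)
    fix a b assume a: "a \<in> cotensor_coinv H M n" and b: "b \<in> cotensor_coinv H M n" and eq: "PP n a = PP n b"
    obtain u where u: "u \<in> tpow ms V n" "a = K u" using cotensor_coinv_K[OF a] .
    obtain v where v: "v \<in> tpow ms V n" "b = K v" using cotensor_coinv_K[OF b] .
    have "u = v" using eq PP_K[OF u(1)] PP_K[OF v(1)] False u(2) v(2) by simp
    then show "a = b" using u v by simp
  qed
  have "the_inv_into (cotensor_coinv H M n) (PP n) (PP n (K t)) = K t"
    by (rule the_inv_into_f_f[OF inj K_coinv[OF t]])
  moreover have "PP n (K t) = t" using False by (intro PP_K[OF t]) simp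
  ultimately show ?thesis unfolding coinv_embed_def if_not_P[OF False] by (simp only:)
qed

end

section \<open>The braiding of the coinvariants\<close>

context hopf_bimod
begin

abbreviation T where "T \<equiv> tpow ms V"
abbreviation \<sigma> where "\<sigma> \<equiv> yd_braiding H M"

lemma T_TT: "t \<in> T n \<Longrightarrow> t \<in> TT ms"
  by (rule tpow_TTD)

lemma da_T: "set w \<subseteq> V \<Longrightarrow> length w = n \<Longrightarrow> AD.da w x \<in> T n"
  using AD.da_tpow[OF _ ad_coinvariant, of w x] by auto

lemma lin_ad [lin_intros]:
  "linear_on s1 hs X A \<Longrightarrow> linear_on s1 ms X (\<lambda>x. ad (A x) m)"
  "linear_on s1 ms X B \<Longrightarrow> linear_on s1 ms X (\<lambda>x. ad h (B x))"
  by (rule AD.lin_act_comp; assumption)+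

lemma mlin_sig: "mlin ms (\<lambda>u. case u of [v, w] \<Rightarrow> \<Sum>(x, n)\<leftarrow>lc H M v. pure ms [ad x w, n] | _ \<Rightarrow> 0)"
  by (rule mlin_case2; intro lin_intros)

lemma sig_tbind: "\<sigma> t = tbind t (\<lambda>u. case u of [v, w] \<Rightarrow> \<Sum>(x, n)\<leftarrow>lc H M v. pure ms [ad x w, n] | _ \<Rightarrow> 0)"
proof -
  have "(\<lambda>z. case z of [(x, _), (_, v')] \<Rightarrow> pure ms [ad x w, v'] | _ \<Rightarrow> 0)
      = (\<lambda>z. case z of [e1, e2] \<Rightarrow> pure ms [ad (fst e1) w, snd e2] | _ \<Rightarrow> 0)" for w
    by (auto simp: fun_eq_iff split: list.split)
  then have "tbind (lcoact M v) (\<lambda>z. case z of [(x, _), (_, v')] \<Rightarrow> pure ms [ad x w, v'] | _ \<Rightarrow> 0)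
      = (\<Sum>(x, n)\<leftarrow>lc H M v. pure ms [ad x w, n])" for v w
    by (simp only:) (rule tbind_lcoact; intro lin_intros)
  then show ?thesis unfolding yd_braiding_def by (simp only:)
qed

lemma sig_pure: "\<sigma> (pure ms [v, w]) = (\<Sum>(x, n)\<leftarrow>lc H M v. pure ms [ad x w, n])"
  unfolding sig_tbind tbind_pure_mlin[OF mlin_sig] by simp

lemma LM_sig: "LM (T 2) (T 2) \<sigma>"
proof (rule lin_LM)
  show "lin tscale tscale \<sigma>" unfolding sig_tbind by (intro lin_intros)
  fix t assume t: "t \<in> T 2"
  show "\<sigma> t \<in> T 2" unfolding sig_tbind
  proof (rule tpow_tbind[OF mlin_sig _ tpow_subspace t])
    fix w assume "length w = 2" "set w \<subseteq> V"
    then obtain u v where w: "w = [u, v]" "u \<in> V" "v \<in> V" by (auto simp: length_Suc_conv numeral_2_eq_2)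
    have "pure ms [ad x v, n] \<in> T 2" if "(x, n) \<in> set (lc H M u)" for x n
      using w ad_coinvariant lc_coinvariantD[OF w(2) that] by (intro tpow_pure) auto
    then show "(case w of [v, w] \<Rightarrow> \<Sum>(x, n)\<leftarrow>lc H M v. pure ms [ad x w, n] | _ \<Rightarrow> 0) \<in> T 2"
      unfolding w(1) by (simp add: subspace_sum_list2[OF tpow_subspace])
  qed
qed

lemma T_map:
  assumes F: "LM (T a) (T a') F" and G: "LM (T b) (T b') G"
  shows "LM (T (a + b)) (T (a' + b')) (tensor_map ms ms (T a) F (T b) G)"
    and "\<And>x y. x \<in> T a \<Longrightarrow> y \<in> T b \<Longrightarrow> tensor_map ms ms (T a) F (T b) G (tmult ms x y) = tmult ms (F x) (G y)"
  using tensor_map_LM[OF hsub_tpow hsub_tpow F G tpow_TT tpow_TT] by (simp_all add: tprod_tpow)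

lemma one_past_LM: "LM (T (Suc j)) (T (Suc j)) (one_past ms V \<sigma> j)"
proof (induction j)
  case 0
  show ?case by (simp add: LM_id)
next
  case (Suc j)
  have "LM (T (1 + Suc j)) (T (1 + Suc j)) (tensor_map ms ms (T 1) id (T (Suc j)) (one_past ms V \<sigma> j))"
    by (rule T_map(1)[OF LM_id(1) Suc])
  moreover have "LM (T (2 + j)) (T (2 + j)) (tensor_map ms ms (T 2) \<sigma> (T j) id)"
    by (rule T_map(1)[OF LM_sig LM_id(1)])
  ultimately show ?case unfolding one_past.simps by (intro LM_comp[of "T (Suc (Suc j))"]) simp_all
qed

text \<open>Each crossing lets the current coaction leg of v act on one letter and coacts anew on
  what remains of v. Coassociativity collects these legs into the diagonal action of a single
  one.\<close>

lemma one_past_pure: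
  "v \<in> V \<Longrightarrow> set w \<subseteq> V \<Longrightarrow> length w = j \<Longrightarrow>
   one_past ms V \<sigma> j (pure ms (v # w)) = (\<Sum>(x, n)\<leftarrow>lc H M v. tmult ms (AD.da w x) (pure ms [n]))"
proof (induction j arbitrary: v w)
  case 0
  have "(\<Sum>(x, n)\<leftarrow>lc H M v. tscale (\<epsilon> x) (pure ms [n])) = pure ms [v]" by (rule lc_counit) (intro lin_intros)
  then show ?case using 0 by (simp add: tmult_tscale_left)
next
  case (Suc j)
  then obtain m u where w: "w = m # u" "length u = j" "m \<in> V" "set u \<subseteq> V" by (cases w) auto
  note v = \<open>v \<in> V\<close>
  have vm: "pure ms [v, m] \<in> T 2" and u: "pure ms u \<in> T j" using w v by (auto intro!: tpow_pure)
  have n: "n \<in> V" if "(x, n) \<in> set (lc H M v)" for x n by (rule lc_coinvariantD[OF v that])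
  have "one_past ms V \<sigma> (Suc j) (pure ms (v # w)) = tensor_map ms ms (T 1) id (T (Suc j)) (one_past ms V \<sigma> j)
      (tensor_map ms ms (T 2) \<sigma> (T j) id (tmult ms (pure ms [v, m]) (pure ms u)))"
    by (simp add: w tmult_pure)
  also have "\<dots> = tensor_map ms ms (T 1) id (T (Suc j)) (one_past ms V \<sigma> j)
      (\<Sum>(x, n)\<leftarrow>lc H M v. tmult ms (pure ms [ad x m]) (pure ms (n # u)))"
    unfolding T_map(2)[OF LM_sig LM_id(1) vm u] sig_pure by (simp add: tmult_sum_list2_left tmult_pure)
  also have "\<dots> = (\<Sum>(x, n)\<leftarrow>lc H M v. tensor_map ms ms (T 1) id (T (Suc j)) (one_past ms V \<sigma> j)
      (tmult ms (pure ms [ad x m]) (pure ms (n # u))))"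
  proof (rule LM_sum_list2[OF T_map(1)[OF LM_id(1) one_past_LM] tpow_subspace])
    fix x n assume "(x, n) \<in> set (lc H M v)"
    then show "tmult ms (pure ms [ad x m]) (pure ms (n # u)) \<in> T (1 + Suc j)"
      using n w ad_coinvariant by (intro tpow_tmult tpow_pure) auto
  qed
  also have "\<dots> = (\<Sum>(x, n)\<leftarrow>lc H M v. \<Sum>(y, k)\<leftarrow>lc H M n. tmult ms (pure ms [ad x m]) (tmult ms (AD.da u y) (pure ms [k])))"
  proof (rule sum_list_cong2)
    fix x n assume xn: "(x, n) \<in> set (lc H M v)"
    have "pure ms [ad x m] \<in> T 1" "pure ms (n # u) \<in> T (Suc j)"
      using n[OF xn] w ad_coinvariant by (auto intro!: tpow_pure)
    then show "tensor_map ms ms (T 1) id (T (Suc j)) (one_past ms V \<sigma> j) (tmult ms (pure ms [ad x m]) (pure ms (n # u)))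
      = (\<Sum>(y, k)\<leftarrow>lc H M n. tmult ms (pure ms [ad x m]) (tmult ms (AD.da u y) (pure ms [k])))"
      using Suc.IH[OF n[OF xn] w(4,2)]
      by (simp add: T_map(2)[OF LM_id(1) one_past_LM] tmult_sum_list2_right TT_intros)
  qed
  also have "\<dots> = (\<Sum>(x, n)\<leftarrow>lc H M v. \<Sum>(a, b)\<leftarrow>cop H x. tmult ms (pure ms [ad a m]) (tmult ms (AD.da u b) (pure ms [n])))"
    by (rule lc_coassoc[symmetric]; intro lin_intros TT_intros)
  also have "\<dots> = (\<Sum>(x, n)\<leftarrow>lc H M v. tmult ms (AD.da w x) (pure ms [n]))"
    unfolding w(1) by (simp add: tmult_sum_list2_left tmult_assoc)
  finally show ?case .
qed

lemma one_past_tensor: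
  assumes "v \<in> V" "t \<in> T j"
  shows "one_past ms V \<sigma> j (tmult ms (pure ms [v]) t) = (\<Sum>(x, n)\<leftarrow>lc H M v. tmult ms (AD.dT x t) (pure ms [n]))"
proof (rule tpow_eqI[OF assms(2) vector_space_tscale, of "\<lambda>t. one_past ms V \<sigma> j (tmult ms (pure ms [v]) t)"
    "\<lambda>t. \<Sum>(x, n)\<leftarrow>lc H M v. tmult ms (AD.dT x t) (pure ms [n])"])
  have "tmult ms (pure ms [v]) t \<in> T (Suc j)" if "t \<in> T j" for t
    using tpow_tmult[OF tpow_pure[of "[v]" 1 V ms] that] assms(1) by simp
  then have "LM (T j) (T (Suc j)) (\<lambda>t. tmult ms (pure ms [v]) t)"
    by (auto simp: LM_def T_TT intro!: lin_intros)
  from LM_linear[OF LM_comp[OF one_past_LM this]]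
  show "linear_on tscale tscale (T j) (\<lambda>t. one_past ms V \<sigma> j (tmult ms (pure ms [v]) t))" by (simp add: comp_def)
  show "linear_on tscale tscale (T j) (\<lambda>t. \<Sum>(x, n)\<leftarrow>lc H M v. tmult ms (AD.dT x t) (pure ms [n]))"
    by (intro lin_intros)
qed (simp add: tmult_pure one_past_pure assms(1))

abbreviation \<beta> where "\<beta> \<equiv> block_braiding ms V \<sigma>"

lemma block_LM: "LM (T (i + j)) (T (i + j)) (\<beta> i j)"
proof (induction i)
  case 0
  show ?case by (simp add: LM_id)
next
  case (Suc i)
  have "LM (T (Suc j + i)) (T (Suc j + i)) (tensor_map ms ms (T (Suc j)) (one_past ms V \<sigma> j) (T i) id)"
    by (rule T_map(1)[OF one_past_LM LM_id(1)])
  moreover have "LM (T (1 + (i + j))) (T (1 + (i + j))) (tensor_map ms ms (T 1) id (T (i + j)) (\<beta> i j))"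
    by (rule T_map(1)[OF LM_id(1) Suc])
  ultimately show ?case unfolding block_braiding.simps
    by (intro LM_comp[of "T (Suc (i + j))"]) (simp_all add: add.commute)
qed

text \<open>The last letters of \<open>u\<close> cross \<open>w\<close> first, so the leg y of the
  first letter acts after the leg x of the others. By \<open>ad_mult\<close> the total action is
  that of y x, the product formed in the diagonal coaction.\<close>

lemma block_pure:
  "set u \<subseteq> V \<Longrightarrow> set w \<subseteq> V \<Longrightarrow> length u = i \<Longrightarrow> length w = j \<Longrightarrow>
   \<beta> i j (pure ms (u @ w)) = (\<Sum>(x, u')\<leftarrow>dc u. tmult ms (AD.da w x) (pure ms u'))"
proof (induction i arbitrary: u)
  case 0
  then show ?case using AD.dT_one[of "pure ms w"] by (simp add: ad_1)
next
  case (Suc i)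
  then obtain v u1 where u: "u = v # u1" "length u1 = i" "v \<in> V" "set u1 \<subseteq> V" by (cases u) auto
  note w = \<open>set w \<subseteq> V\<close> \<open>length w = j\<close>
  have vT: "pure ms [v] \<in> T 1" and uw: "pure ms (u1 @ w) \<in> T (i + j)" using u w by (auto intro!: tpow_pure)
  have V': "set u' \<subseteq> V" "length u' = i" if "(x, u') \<in> set (dc u1)" for x u'
    using dco_V[OF that u(4)] dco_length[OF that] u(2) by auto
  let ?O = "tensor_map ms ms (T (Suc j)) (one_past ms V \<sigma> j) (T i) id"
  have "\<beta> (Suc i) j (pure ms (u @ w)) = ?O (tensor_map ms ms (T 1) id (T (i + j)) (\<beta> i j) (tmult ms (pure ms [v]) (pure ms (u1 @ w))))"
    by (simp add: u tmult_pure)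
  also have "\<dots> = ?O (\<Sum>(x, u')\<leftarrow>dc u1. tmult ms (tmult ms (pure ms [v]) (AD.da w x)) (pure ms u'))"
    unfolding T_map(2)[OF LM_id(1) block_LM vT uw] Suc.IH[OF u(4) w(1) u(2) w(2)]
    by (simp add: tmult_sum_list2_right TT_intros tmult_assoc)
  also have "\<dots> = (\<Sum>(x, u')\<leftarrow>dc u1. ?O (tmult ms (tmult ms (pure ms [v]) (AD.da w x)) (pure ms u')))"
  proof (rule LM_sum_list2[OF T_map(1)[OF one_past_LM LM_id(1)] tpow_subspace])
    fix x u' assume "(x, u') \<in> set (dc u1)"
    then have "tmult ms (tmult ms (pure ms [v]) (AD.da w x)) (pure ms u') \<in> T (1 + j + i)"
      using V' w u(3) by (intro tpow_tmult da_T tpow_pure) auto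
    then show "tmult ms (tmult ms (pure ms [v]) (AD.da w x)) (pure ms u') \<in> T (Suc j + i)" by simp
  qed
  also have "\<dots> = (\<Sum>(x, u')\<leftarrow>dc u1. \<Sum>(y, n)\<leftarrow>lc H M v. tmult ms (AD.da w (y * x)) (pure ms (n # u')))"
  proof (rule sum_list_cong2)
    fix x u' assume x: "(x, u') \<in> set (dc u1)"
    have "tmult ms (pure ms [v]) (AD.da w x) \<in> T (1 + j)"
      using w u(3) by (intro tpow_tmult da_T tpow_pure) auto
    then have A: "tmult ms (pure ms [v]) (AD.da w x) \<in> T (Suc j)" by simp
    have B: "pure ms u' \<in> T i" using V'[OF x] by (intro tpow_pure)
    show "?O (tmult ms (tmult ms (pure ms [v]) (AD.da w x)) (pure ms u'))
      = (\<Sum>(y, n)\<leftarrow>lc H M v. tmult ms (AD.da w (y * x)) (pure ms (n # u')))"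
      unfolding T_map(2)[OF one_past_LM LM_id(1) A B] one_past_tensor[OF u(3) da_T[OF w]]
      using AD.dT_mult_left[OF ad_mult, of "pure ms w"]
      by (simp add: tmult_sum_list2_left tmult_assoc tmult_pure)
  qed
  also have "\<dots> = (\<Sum>(x, u')\<leftarrow>dc u. tmult ms (AD.da w x) (pure ms u'))"
    unfolding u(1) dco_Cons by (rule sum_list_swap)
  finally show ?case .
qed

text \<open>On a word u v w both composites come to u(-2) v(-1) . w \<otimes> u(-1) . v(0) \<otimes>
  u(0). The side that first braids u with v reaches this form through the Yetter-Drinfel'd
  condition.\<close>

lemma braided: "braided_vector_space ms V \<sigma>"
proof -
  let ?\<sigma>1 = "tensor_map ms ms (T 2) \<sigma> (T 1) id" and ?\<sigma>2 = "tensor_map ms ms (T 1) id (T 2) \<sigma>"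
  have L1: "LM (T 3) (T 3) ?\<sigma>1" and L2: "LM (T 3) (T 3) ?\<sigma>2"
    using T_map(1)[OF LM_sig LM_id(1), of 1] T_map(1)[OF LM_id(1) LM_sig, of 1] by (simp_all add: numeral_3_eq_3)
  have s1: "?\<sigma>1 (pure ms [u, v, w]) = (\<Sum>(x, n)\<leftarrow>lc H M u. pure ms [ad x v, n, w])"
    if "u \<in> V" "v \<in> V" "w \<in> V" for u v w
  proof -
    have "pure ms [u, v] \<in> T 2" "pure ms [w] \<in> T 1" using that by (auto intro!: tpow_pure)
    from T_map(2)[OF LM_sig LM_id(1) this] show ?thesis by (simp add: tmult_pure sig_pure tmult_sum_list2_left)
  qed
  have s2: "?\<sigma>2 (pure ms [u, v, w]) = (\<Sum>(x, n)\<leftarrow>lc H M v. pure ms [u, ad x w, n])"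
    if "u \<in> V" "v \<in> V" "w \<in> V" for u v w
  proof -
    have "pure ms [u] \<in> T 1" "pure ms [v, w] \<in> T 2" using that by (auto intro!: tpow_pure)
    from T_map(2)[OF LM_id(1) LM_sig this] show ?thesis by (simp add: tmult_pure sig_pure tmult_sum_list2_right)
  qed
  have T3: "pure ms [u, v, w] \<in> T 3" if "u \<in> V" "v \<in> V" "w \<in> V" for u v w
    using that by (intro tpow_pure) auto
  note lcV = lc_coinvariantD and adV = ad_coinvariant
  have S1: "?\<sigma>1 (\<Sum>(a, b)\<leftarrow>ps. G a b) = (\<Sum>(a, b)\<leftarrow>ps. ?\<sigma>1 (G a b))" if "\<And>a b. (a, b) \<in> set ps \<Longrightarrow> G a b \<in> T 3"
    for ps and G :: "'h \<Rightarrow> 'm \<Rightarrow> _" by (rule LM_sum_list2[OF L1 tpow_subspace that])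
  have S2: "?\<sigma>2 (\<Sum>(a, b)\<leftarrow>ps. G a b) = (\<Sum>(a, b)\<leftarrow>ps. ?\<sigma>2 (G a b))" if "\<And>a b. (a, b) \<in> set ps \<Longrightarrow> G a b \<in> T 3"
    for ps and G :: "'h \<Rightarrow> 'm \<Rightarrow> _" by (rule LM_sum_list2[OF L2 tpow_subspace that])
  have word: "?\<sigma>1 (?\<sigma>2 (?\<sigma>1 (pure ms [u, v, w]))) = ?\<sigma>2 (?\<sigma>1 (?\<sigma>2 (pure ms [u, v, w])))"
    if uvw: "u \<in> V" "v \<in> V" "w \<in> V" for u v w
  proof -
    have "?\<sigma>2 (?\<sigma>1 (pure ms [u, v, w])) = (\<Sum>(x, n)\<leftarrow>lc H M u. ?\<sigma>2 (pure ms [ad x v, n, w]))"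
      unfolding s1[OF uvw] by (rule S2) (intro T3 adV uvw lcV[OF uvw(1)])
    also have "\<dots> = (\<Sum>(x, n)\<leftarrow>lc H M u. \<Sum>(y, k)\<leftarrow>lc H M n. pure ms [ad x v, ad y w, k])"
      by (intro sum_list_cong2 s2 adV uvw lcV[OF uvw(1)])
    finally have "?\<sigma>1 (?\<sigma>2 (?\<sigma>1 (pure ms [u, v, w]))) = (\<Sum>(x, n)\<leftarrow>lc H M u. ?\<sigma>1 (\<Sum>(y, k)\<leftarrow>lc H M n. pure ms [ad x v, ad y w, k]))"
      by (simp only:) (rule S1, rule subspace_sum_list2[OF tpow_subspace], intro T3 adV uvw, erule lcV[OF lcV[OF uvw(1)]])
    also have "\<dots> = (\<Sum>(x, n)\<leftarrow>lc H M u. \<Sum>(y, k)\<leftarrow>lc H M n. \<Sum>(z, p)\<leftarrow>lc H M (ad x v). pure ms [ad (z * y) w, p, k])"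
    proof (rule sum_list_cong2)
      fix x n assume n: "(x, n) \<in> set (lc H M u)"
      have "?\<sigma>1 (\<Sum>(y, k)\<leftarrow>lc H M n. pure ms [ad x v, ad y w, k]) = (\<Sum>(y, k)\<leftarrow>lc H M n. ?\<sigma>1 (pure ms [ad x v, ad y w, k]))"
        by (rule S1) (intro T3 adV uvw, erule lcV[OF lcV[OF uvw(1) n]])
      also have "\<dots> = (\<Sum>(y, k)\<leftarrow>lc H M n. \<Sum>(z, p)\<leftarrow>lc H M (ad x v). pure ms [ad z (ad y w), p, k])"
        by (intro sum_list_cong2 s1 adV uvw) (erule lcV[OF lcV[OF uvw(1) n]])
      finally show "?\<sigma>1 (\<Sum>(y, k)\<leftarrow>lc H M n. pure ms [ad x v, ad y w, k])
        = (\<Sum>(y, k)\<leftarrow>lc H M n. \<Sum>(z, p)\<leftarrow>lc H M (ad x v). pure ms [ad (z * y) w, p, k])" by (simp add: ad_mult)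
    qed
    also have "\<dots> = (\<Sum>(x, n)\<leftarrow>lc H M u. \<Sum>(a, b)\<leftarrow>cop H x. \<Sum>(z, p)\<leftarrow>lc H M (ad a v). pure ms [ad (z * b) w, p, n])"
      by (rule lc_coassoc[symmetric]; intro lin_intros)
    \<comment> \<open>Here the leg z is the coaction of the element a . v; the Yetter-Drinfel'd
      condition replaces it by the coaction of v itself.\<close>
    also have "\<dots> = (\<Sum>(x, n)\<leftarrow>lc H M u. \<Sum>(a, b)\<leftarrow>cop H x. \<Sum>(y, q)\<leftarrow>lc H M v. pure ms [ad (a * y) w, ad b q, n])"
      by (rule sum_list_cong2) (rule yetter_drinfeld; intro lin_intros)
    also have "\<dots> = (\<Sum>(x, n)\<leftarrow>lc H M u. \<Sum>(z, k)\<leftarrow>lc H M n. \<Sum>(y, q)\<leftarrow>lc H M v. pure ms [ad (x * y) w, ad z q, k])"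
      by (rule lc_coassoc; intro lin_intros)
    finally have 1: "?\<sigma>1 (?\<sigma>2 (?\<sigma>1 (pure ms [u, v, w]))) = \<dots>" .
    have "?\<sigma>1 (?\<sigma>2 (pure ms [u, v, w])) = (\<Sum>(y, q)\<leftarrow>lc H M v. ?\<sigma>1 (pure ms [u, ad y w, q]))"
      unfolding s2[OF uvw] by (rule S1) (intro T3 adV uvw lcV[OF uvw(2)])
    also have "\<dots> = (\<Sum>(y, q)\<leftarrow>lc H M v. \<Sum>(x, n)\<leftarrow>lc H M u. pure ms [ad x (ad y w), n, q])"
      by (intro sum_list_cong2 s1 adV uvw lcV[OF uvw(2)])
    finally have "?\<sigma>2 (?\<sigma>1 (?\<sigma>2 (pure ms [u, v, w]))) = (\<Sum>(y, q)\<leftarrow>lc H M v. ?\<sigma>2 (\<Sum>(x, n)\<leftarrow>lc H M u. pure ms [ad x (ad y w), n, q]))"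
      by (simp only:) (rule S2, rule subspace_sum_list2[OF tpow_subspace], intro T3 adV uvw, erule lcV[OF uvw(1)], erule lcV[OF uvw(2)])
    also have "\<dots> = (\<Sum>(y, q)\<leftarrow>lc H M v. \<Sum>(x, n)\<leftarrow>lc H M u. \<Sum>(z, k)\<leftarrow>lc H M n. pure ms [ad (x * y) w, ad z q, k])"
    proof (rule sum_list_cong2)
      fix y q assume q: "(y, q) \<in> set (lc H M v)"
      have "?\<sigma>2 (\<Sum>(x, n)\<leftarrow>lc H M u. pure ms [ad x (ad y w), n, q]) = (\<Sum>(x, n)\<leftarrow>lc H M u. ?\<sigma>2 (pure ms [ad x (ad y w), n, q]))"
        by (rule S2) (intro T3 adV uvw lcV[OF uvw(2) q], erule lcV[OF uvw(1)])
      also have "\<dots> = (\<Sum>(x, n)\<leftarrow>lc H M u. \<Sum>(z, k)\<leftarrow>lc H M n. pure ms [ad x (ad y w), ad z q, k])"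
        by (intro sum_list_cong2 s2 adV uvw lcV[OF uvw(2) q]) (erule lcV[OF uvw(1)])
      finally show "?\<sigma>2 (\<Sum>(x, n)\<leftarrow>lc H M u. pure ms [ad x (ad y w), n, q])
        = (\<Sum>(x, n)\<leftarrow>lc H M u. \<Sum>(z, k)\<leftarrow>lc H M n. pure ms [ad (x * y) w, ad z q, k])" by (simp add: ad_mult)
    qed
    also have "\<dots> = (\<Sum>(x, n)\<leftarrow>lc H M u. \<Sum>(y, q)\<leftarrow>lc H M v. \<Sum>(z, k)\<leftarrow>lc H M n. pure ms [ad (x * y) w, ad z q, k])"
      by (rule sum_list_swap)
    also have "\<dots> = (\<Sum>(x, n)\<leftarrow>lc H M u. \<Sum>(z, k)\<leftarrow>lc H M n. \<Sum>(y, q)\<leftarrow>lc H M v. pure ms [ad (x * y) w, ad z q, k])"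
      by (rule sum_list_cong2) (rule sum_list_swap)
    finally show ?thesis using 1 by simp
  qed
  have "?\<sigma>1 (?\<sigma>2 (?\<sigma>1 t)) = ?\<sigma>2 (?\<sigma>1 (?\<sigma>2 t))" if "t \<in> T 3" for t
  proof (rule tpow_eqI[OF that vector_space_tscale, of "\<lambda>t. ?\<sigma>1 (?\<sigma>2 (?\<sigma>1 t))" "\<lambda>t. ?\<sigma>2 (?\<sigma>1 (?\<sigma>2 t))"])
    show "linear_on tscale tscale (T 3) (\<lambda>t. ?\<sigma>1 (?\<sigma>2 (?\<sigma>1 t)))" "linear_on tscale tscale (T 3) (\<lambda>t. ?\<sigma>2 (?\<sigma>1 (?\<sigma>2 t)))"
      using LM_linear[OF LM_comp[OF L1 LM_comp[OF L2 L1]]] LM_linear[OF LM_comp[OF L2 LM_comp[OF L1 L2]]]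
      by (simp_all add: comp_def)
  qed (use word in \<open>auto simp: length_Suc_conv numeral_3_eq_3\<close>)
  then show ?thesis
    using vs_m V_subspace LM_sig by (auto simp: braided_vector_space_def Let_def LM_def)
qed

text \<open>The inverse braiding is \<open>w \<otimes> v \<mapsto> v(0) \<otimes> S\<inverse>(v(-1)).w\<close>.\<close>

lemma sig_bij:
  assumes "bij S" shows "bij_betw \<sigma> (T 2) (T 2)"
proof -
  define Si where "Si = inv S"
  have SSi: "S (Si x) = x" and SiS: "Si (S x) = x" for x
    using assms by (simp_all add: Si_def bij_is_surj surj_f_inv_f bij_is_inj inv_f_f)
  have inj: "Si x = y \<longleftrightarrow> x = S y" for x y using SSi SiS by metis
  have lSi: "lin hs hs Si"
    using lin_add[OF lin_S] lin_scale[OF lin_S] by (simp add: linear_on_def inj SSi)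
  note [lin_intros] = lin_comp[OF lSi]
  \<comment> \<open>Applying the inverse of S, which reverses products as S does, to the antipode
    identities gives the identities for the inverse with the factors exchanged.\<close>
  have a1: "(\<Sum>(a, b)\<leftarrow>cop H x. F (b * Si a)) = tscale (\<epsilon> x) (F 1)" if F: "lin hs tscale F" for x and F :: "'h \<Rightarrow> ('k, 'm) tensor"
  proof -
    have "b * Si a = Si (a * S b)" for a b using inj[of "a * S b" "b * Si a"] by (simp add: S_mult SSi)
    moreover have "(\<Sum>(a, b)\<leftarrow>cop H x. F (Si (a * S b))) = tscale (\<epsilon> x) (F (Si 1))"
      by (rule cop_antipode_r) (intro lin_comp[OF F] lin_intros)
    moreover have "Si 1 = 1" using inj[of 1 1] by (simp add: S_1)
    ultimately show ?thesis by simp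
  qed
  have a2: "(\<Sum>(a, b)\<leftarrow>cop H x. F (Si b * a)) = tscale (\<epsilon> x) (F 1)" if F: "lin hs tscale F" for x and F :: "'h \<Rightarrow> ('k, 'm) tensor"
  proof -
    have "Si b * a = Si (S a * b)" for a b using inj[of "S a * b" "Si b * a"] by (simp add: S_mult SSi)
    moreover have "(\<Sum>(a, b)\<leftarrow>cop H x. F (Si (S a * b))) = tscale (\<epsilon> x) (F (Si 1))"
      by (rule cop_antipode_l) (intro lin_comp[OF F] lin_intros)
    moreover have "Si 1 = 1" using inj[of 1 1] by (simp add: S_1)
    ultimately show ?thesis by simp
  qed
  define G where "G = (\<lambda>u. case u of [w, v] \<Rightarrow> \<Sum>(x, n)\<leftarrow>lc H M v. pure ms [n, ad (Si x) w] | _ \<Rightarrow> 0)"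
  have mG: "mlin ms G" unfolding G_def by (rule mlin_case2; intro lin_intros)
  define \<tau> where "\<tau> t = tbind t G" for t
  have \<tau>_pure: "\<tau> (pure ms [w, v]) = (\<Sum>(x, n)\<leftarrow>lc H M v. pure ms [n, ad (Si x) w])" for w v
    unfolding \<tau>_def tbind_pure_mlin[OF mG] by (simp add: G_def)
  have l\<tau>: "lin tscale tscale \<tau>" unfolding \<tau>_def by (intro lin_intros)
  have l\<sigma>: "lin tscale tscale \<sigma>" unfolding sig_tbind by (intro lin_intros)
  have \<tau>T: "\<tau> t \<in> T 2" if t: "t \<in> T 2" for t
    unfolding \<tau>_def
  proof (rule tpow_tbind[OF mG _ tpow_subspace t])
    fix w assume "length w = 2" "set w \<subseteq> V"
    then obtain u v where w: "w = [u, v]" "u \<in> V" "v \<in> V" by (auto simp: length_Suc_conv numeral_2_eq_2)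
    have "pure ms [n, ad (Si x) u] \<in> T 2" if "(x, n) \<in> set (lc H M v)" for x n
      using w ad_coinvariant lc_coinvariantD[OF w(3) that] by (intro tpow_pure) auto
    then show "G w \<in> T 2"
      unfolding w(1) G_def by (simp add: subspace_sum_list2[OF tpow_subspace])
  qed
  have 1: "\<sigma> (\<tau> (pure ms [w, v])) = pure ms [w, v]" for w v
  proof -
    have "\<sigma> (\<tau> (pure ms [w, v])) = (\<Sum>(x, n)\<leftarrow>lc H M v. \<Sum>(y, k)\<leftarrow>lc H M n. pure ms [ad (y * Si x) w, k])"
      by (simp add: \<tau>_pure lin_sum_list2[OF l\<sigma>] sig_pure ad_mult)
    also have "\<dots> = (\<Sum>(x, n)\<leftarrow>lc H M v. \<Sum>(a, b)\<leftarrow>cop H x. pure ms [ad (b * Si a) w, n])"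
      by (rule lc_coassoc[symmetric]; intro lin_intros)
    also have "\<dots> = (\<Sum>(x, n)\<leftarrow>lc H M v. tscale (\<epsilon> x) (pure ms [ad 1 w, n]))"
      by (rule sum_list_cong2) (rule a1, intro lin_intros)
    also have "\<dots> = pure ms [ad 1 w, v]" by (rule lc_counit) (intro lin_intros)
    finally show ?thesis by (simp add: ad_1)
  qed
  have 2: "\<tau> (\<sigma> (pure ms [v, w])) = pure ms [v, w]" for v w
  proof -
    have "\<tau> (\<sigma> (pure ms [v, w])) = (\<Sum>(x, n)\<leftarrow>lc H M v. \<Sum>(y, k)\<leftarrow>lc H M n. pure ms [k, ad (Si y * x) w])"
      by (simp add: \<tau>_pure lin_sum_list2[OF l\<tau>] sig_pure ad_mult)
    also have "\<dots> = (\<Sum>(x, n)\<leftarrow>lc H M v. \<Sum>(a, b)\<leftarrow>cop H x. pure ms [n, ad (Si b * a) w])"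
      by (rule lc_coassoc[symmetric]; intro lin_intros)
    also have "\<dots> = (\<Sum>(x, n)\<leftarrow>lc H M v. tscale (\<epsilon> x) (pure ms [n, ad 1 w]))"
      by (rule sum_list_cong2) (rule a2, intro lin_intros)
    also have "\<dots> = pure ms [v, ad 1 w]" by (rule lc_counit) (intro lin_intros)
    finally show ?thesis by (simp add: ad_1)
  qed
  have "\<sigma> (\<tau> t) = t" if "t \<in> T 2" for t
    by (rule tpow_eqI[OF that vector_space_tscale, of "\<lambda>t. \<sigma> (\<tau> t)" "\<lambda>t. t"])
      (auto simp: 1 length_Suc_conv numeral_2_eq_2 intro!: lin_intros linear_on_mono[OF lin_comp[OF l\<sigma> l\<tau>]])
  moreover have "\<tau> (\<sigma> t) = t" if "t \<in> T 2" for t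
    by (rule tpow_eqI[OF that vector_space_tscale, of "\<lambda>t. \<tau> (\<sigma> t)" "\<lambda>t. t"])
      (auto simp: 2 length_Suc_conv numeral_2_eq_2 intro!: lin_intros linear_on_mono[OF lin_comp[OF l\<tau> l\<sigma>]])
  ultimately show ?thesis
    using \<tau>T LM_mem[OF LM_sig] by (intro bij_betw_byWitness[where f' = \<tau>]) auto
qed

subsection \<open>The twisted coproduct\<close>

abbreviation tc where "tc \<equiv> twisted_coprod ms V \<sigma>"

lemma twisted_LM: "LM (tprod ms (T (p + p')) (T (q + q'))) (tprod ms (tprod ms (T p) (T q)) (tprod ms (T p') (T q'))) (tc p q p' q')"
proof -
  have "LM (T (p + (p' + q + q'))) (T (p + (p' + q + q'))) (tc p q p' q')"
    unfolding twisted_coprod_def by (intro T_map(1) LM_id block_LM)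
  then show ?thesis by (simp add: tprod_tpow add.assoc add.left_commute)
qed

lemma twisted_pure:
  assumes "set s1 \<subseteq> V" "set s2 \<subseteq> V" "set t1 \<subseteq> V" "set t2 \<subseteq> V"
    and "length s1 = p" "length s2 = p'" "length t1 = q" "length t2 = q'"
  shows "tc p q p' q' (pure ms ((s1 @ s2) @ (t1 @ t2)))
    = (\<Sum>(x, u)\<leftarrow>dc s2. tmult ms (tmult ms (pure ms s1) (AD.da t1 x)) (pure ms (u @ t2)))"
proof -
  have t: "pure ms s1 \<in> T p" "pure ms (s2 @ t1) \<in> T (p' + q)" "pure ms t2 \<in> T q'"
    "pure ms (s2 @ t1 @ t2) \<in> T (p' + q + q')"
    using assms by (auto intro!: tpow_pure)
  have "tc p q p' q' (tmult ms (pure ms s1) (pure ms (s2 @ t1 @ t2)))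
    = tmult ms (pure ms s1) (tensor_map ms ms (T (p' + q)) (\<beta> p' q) (T q') id (tmult ms (pure ms (s2 @ t1)) (pure ms t2)))"
    unfolding twisted_coprod_def T_map(2)[OF LM_id(1) T_map(1)[OF block_LM LM_id(1)] t(1,4)]
    by (simp add: tmult_pure)
  also have "\<dots> = (\<Sum>(x, u)\<leftarrow>dc s2. tmult ms (tmult ms (pure ms s1) (AD.da t1 x)) (pure ms (u @ t2)))"
    unfolding T_map(2)[OF block_LM LM_id(1) t(2,3)] block_pure[OF assms(2,3,6,7)]
    by (simp add: tmult_sum_list2_left tmult_sum_list2_right TT_intros tmult_assoc tmult_pure)
  finally show ?thesis by (simp add: tmult_pure)
qed

end

section \<open>Rearranging blocks\<close>

text \<open>The common shape of \<open>flip_blocks\<close> and of the rearrangements in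
  \<open>dsq_lco\<close> and \<open>dsq_rco\<close>: a map of four consecutive blocks, the last of
  any length. Multilinearity is obtained for all of them at once by splitting off one block at a
  time.\<close>

definition blocks4 :: "nat \<Rightarrow> nat \<Rightarrow> nat \<Rightarrow> ('e list \<Rightarrow> 'e list \<Rightarrow> 'e list \<Rightarrow> 'e list \<Rightarrow> ('k::field, 'e) tensor)
    \<Rightarrow> 'e list \<Rightarrow> ('k, 'e) tensor" where
  "blocks4 a b c B w = (if a + b + c \<le> length w
     then B (take a w) (take b (drop a w)) (take c (drop (a + b) w)) (drop (a + b + c) w) else 0)"

lemma mlin_blocks4:
  fixes s :: "'k::field \<Rightarrow> 'e::ab_group_add \<Rightarrow> 'e"
  assumes B: "\<And>v w z. mlin s (\<lambda>u. B u v w z)" "\<And>u w z. mlin s (\<lambda>v. B u v w z)"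
    "\<And>u v z. mlin s (\<lambda>w. B u v w z)" "\<And>u v w. mlin s (\<lambda>z. B u v w z)"
  shows "mlin s (blocks4 a b c B)"
proof -
  define B3 where "B3 u v r = (if c \<le> length r then B u v (take c r) (drop c r) else 0)" for u v r
  define B2 where "B2 u r = (if b \<le> length r then B3 u (take b r) (drop b r) else 0)" for u r
  have 3: "mlin s (B3 u v)" for u v unfolding B3_def by (rule mlin_split[OF B(3,4)])
  have b3: "mlin s (\<lambda>v. B3 u v r)" "mlin s (\<lambda>u. B3 u v r)" for u v r
    unfolding B3_def using B(1,2) by - (cases "c \<le> length r"; simp add: mlin_0)+
  have 2: "mlin s (B2 u)" for u unfolding B2_def by (rule mlin_split[OF b3(1) 3])
  have b2: "mlin s (\<lambda>u. B2 u r)" for r unfolding B2_def using b3(2) by (cases "b \<le> length r") (simp_all add: mlin_0)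
  have 1: "mlin s (\<lambda>w. if a \<le> length w then B2 (take a w) (drop a w) else 0)"
    by (rule mlin_split[OF b2 2])
  have "blocks4 a b c B w = (if a \<le> length w then B2 (take a w) (drop a w) else 0)" for w
    by (auto simp: blocks4_def B2_def B3_def add.commute add.left_commute)
  then have "blocks4 a b c B = (\<lambda>w. if a \<le> length w then B2 (take a w) (drop a w) else 0)" by (rule ext)
  then show ?thesis using 1 by simp
qed

lemma tbind_blocks4:
  fixes s :: "'k::field \<Rightarrow> 'e::ab_group_add \<Rightarrow> 'e"
  assumes B: "mlin s (blocks4 a b c B)"
    and t: "t1 \<in> tpow s UNIV a" "t2 \<in> tpow s UNIV b" "t3 \<in> tpow s UNIV c" "t4 \<in> tpow s UNIV d"
    and G: "\<And>u v w z. length u = a \<Longrightarrow> length v = b \<Longrightarrow> length w = c \<Longrightarrow> length z = d \<Longrightarrow>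
        G (pure s u) (pure s v) (pure s w) (pure s z) = B u v w z"
    and G1: "linear_on tscale tscale (tpow s UNIV a) (\<lambda>t1. G t1 t2 t3 t4)"
    and G2: "\<And>u. linear_on tscale tscale (tpow s UNIV b) (\<lambda>t2. G (pure s u) t2 t3 t4)"
    and G3: "\<And>u v. linear_on tscale tscale (tpow s UNIV c) (\<lambda>t3. G (pure s u) (pure s v) t3 t4)"
    and G4: "\<And>u v w. linear_on tscale tscale (tpow s UNIV d) (\<lambda>t4. G (pure s u) (pure s v) (pure s w) t4)"
  shows "tbind (tmult s (tmult s t1 t2) (tmult s t3 t4)) (blocks4 a b c B) = G t1 t2 t3 t4"
proof (rule tpow_eqI[OF t(1) vector_space_tscale, of "\<lambda>t1. tbind (tmult s (tmult s t1 t2) (tmult s t3 t4)) (blocks4 a b c B)" "\<lambda>t1. G t1 t2 t3 t4"])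
  fix u :: "'e list" assume u: "length u = a"
  show "tbind (tmult s (tmult s (pure s u) t2) (tmult s t3 t4)) (blocks4 a b c B) = G (pure s u) t2 t3 t4"
  proof (rule tpow_eqI[OF t(2) vector_space_tscale, of "\<lambda>t2. tbind (tmult s (tmult s (pure s u) t2) (tmult s t3 t4)) (blocks4 a b c B)" "\<lambda>t2. G (pure s u) t2 t3 t4"])
    fix v :: "'e list" assume v: "length v = b"
    show "tbind (tmult s (tmult s (pure s u) (pure s v)) (tmult s t3 t4)) (blocks4 a b c B) = G (pure s u) (pure s v) t3 t4"
    proof (rule tpow_eqI[OF t(3) vector_space_tscale, of "\<lambda>t3. tbind (tmult s (tmult s (pure s u) (pure s v)) (tmult s t3 t4)) (blocks4 a b c B)" "\<lambda>t3. G (pure s u) (pure s v) t3 t4"])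
      fix w :: "'e list" assume w: "length w = c"
      show "tbind (tmult s (tmult s (pure s u) (pure s v)) (tmult s (pure s w) t4)) (blocks4 a b c B) = G (pure s u) (pure s v) (pure s w) t4"
      proof (rule tpow_eqI[OF t(4) vector_space_tscale, of "\<lambda>t4. tbind (tmult s (tmult s (pure s u) (pure s v)) (tmult s (pure s w) t4)) (blocks4 a b c B)" "\<lambda>t4. G (pure s u) (pure s v) (pure s w) t4"])
        fix z :: "'e list" assume z: "length z = d"
        show "tbind (tmult s (tmult s (pure s u) (pure s v)) (tmult s (pure s w) (pure s z))) (blocks4 a b c B) = G (pure s u) (pure s v) (pure s w) (pure s z)"
          using G[OF u v w z] u v w z by (simp add: tmult_pure tbind_pure_mlin[OF B] blocks4_def)
      qed (auto intro!: lin_intros TT_intros G4 simp: tpow_TTD[OF t(4)] tpow_TTD)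
    qed (auto intro!: lin_intros TT_intros G3 simp: tpow_TTD[OF t(4)] tpow_TTD)
  qed (auto intro!: lin_intros TT_intros G2 simp: tpow_TTD[OF t(3)] tpow_TTD[OF t(4)] tpow_TTD)
qed (auto intro!: lin_intros TT_intros G1)

lemma mlin_pure_app:
  fixes s :: "'k::field \<Rightarrow> 'e::ab_group_add \<Rightarrow> 'e"
  shows "mlin s (\<lambda>x. pure s (p @ x @ q))"
proof -
  have "lin s tscale (\<lambda>x. pure s (p @ (u @ x # v) @ q))" for u v
    using mlinD[OF mlin_pure, of s "p @ u" "v @ q"] by simp
  then show ?thesis by (simp add: mlin_def)
qed

lemma flip_blocks_tmult:
  fixes s :: "'k::field \<Rightarrow> 'e::ab_group_add \<Rightarrow> 'e"
  assumes t: "t1 \<in> tpow s UNIV a" "t2 \<in> tpow s UNIV b" "t3 \<in> tpow s UNIV c" "t4 \<in> tpow s UNIV d"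
  shows "flip_blocks s a b c (tmult s (tmult s t1 t2) (tmult s t3 t4)) = tmult s (tmult s t1 t3) (tmult s t2 t4)"
proof -
  let ?B = "\<lambda>u v w z. pure s (u @ w @ v @ z)"
  have "mlin s (blocks4 a b c ?B)"
  proof (rule mlin_blocks4)
    show "mlin s (\<lambda>u. pure s (u @ w @ v @ z))" "mlin s (\<lambda>v. pure s (u @ w @ v @ z))"
      "mlin s (\<lambda>w. pure s (u @ w @ v @ z))" "mlin s (\<lambda>z. pure s (u @ w @ v @ z))" for u v w z
      using mlin_pure_app[of s "[]" "w @ v @ z"] mlin_pure_app[of s "u @ w" z]
        mlin_pure_app[of s u "v @ z"] mlin_pure_app[of s "u @ w @ v" "[]"] by simp_all
  qed
  then have "tbind (tmult s (tmult s t1 t2) (tmult s t3 t4)) (blocks4 a b c ?B) = tmult s (tmult s t1 t3) (tmult s t2 t4)"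
    by (rule tbind_blocks4[OF _ t, where G = "\<lambda>t1 t2 t3 t4. tmult s (tmult s t1 t3) (tmult s t2 t4)"])
      (auto simp: tmult_pure tpow_TTD[OF t(3)] tpow_TTD[OF t(4)] tpow_TTD intro!: lin_intros TT_intros)
  then show ?thesis by (simp add: flip_blocks_def blocks4_def[abs_def])
qed

lemma lin_flip_blocks [lin_intros]: "linear_on s1 tscale X A \<Longrightarrow> linear_on s1 tscale X (\<lambda>x. flip_blocks s a b c (A x))"
  unfolding flip_blocks_def by (rule lin_tbind)

section \<open>The tensor square of the cotensor coalgebra\<close>

context hopf_bimod
begin

abbreviation D where "D \<equiv> dsq H M"

lemma hsub_D: "hsub es (max 1 p + max 1 q) (D p q)"
  unfolding dsq_def by (intro hsub_tprod hsub_cotensor)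

lemma D_subspace: "tens.subspace (D p q)"
  by (rule hsub_subspace[OF hsub_D])

lemma D_tmult: "x \<in> C p \<Longrightarrow> y \<in> C q \<Longrightarrow> tmult es x y \<in> D p q"
  unfolding dsq_def by (rule tprod_tmult)

lemma C_sub_TT: "C p \<subseteq> TT es" using C_TT by auto
lemma D_sub_TT: "D p q \<subseteq> TT es" using hsub_TT[OF hsub_D] by auto

abbreviation dec where "dec \<equiv> deconc H M"

lemma lin_dec: "lin tscale tscale (dec a b)"
  by (auto simp: deconc_def cotensor_lco_def cotensor_rco_def id_def intro!: lin_intros)

lemma dec_R: "t \<in> TT es \<Longrightarrow> dec a b (R h t) = R h (dec a b t)"
  by (simp add: deconc_def cotensor_lco_def cotensor_rco_def apply_lco_R apply_rco_R)

lemma R_kap_Nil: "R x (\<kappa> []) = pure es [(x, 0)]"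
  by (simp add: kap_Nil R_single del: ER.dT_pure)

text \<open>In the boundary cases \<open>deconc\<close> is a coaction. They fit the same formula
  because \<kappa> of the empty word is 1 in \<open>H\<close>: for \<open>a = 0\<close> the factor x
  becomes the \<open>H\<close>-entry, and for \<open>b = 0\<close> the \<open>H\<close>-entry is
  1.\<close>

lemma dec_kap:
  assumes "set s1 \<subseteq> V" "set s2 \<subseteq> V" "length s1 = a" "length s2 = b"
  shows "dec a b (\<kappa> (s1 @ s2)) = (\<Sum>(x, u)\<leftarrow>dc s2. tmult es (R x (\<kappa> s1)) (\<kappa> u))"
proof -
  consider "a = 0" | "a \<noteq> 0" "b = 0" | "a \<noteq> 0" "b \<noteq> 0" by blast
  then show ?thesis
  proof cases
    case 1
    then show ?thesis using assms by (simp add: deconc_def cotensor_lco_def lco_kap R_kap_Nil)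
  next
    case 2
    then show ?thesis using assms rco_kap[OF assms(1)]
      by (simp add: deconc_def cotensor_rco_def R_1 kap_Nil)
  next
    case 3
    then have ne: "s1 \<noteq> []" "s2 \<noteq> []" using assms by auto
    have "kw (s1 @ s2) = (\<Sum>(x, u)\<leftarrow>dc s2. tmult es (R x (kw s1)) (kw u))" by (rule kk_append)
    also have "\<dots> = (\<Sum>(x, u)\<leftarrow>dc s2. tmult es (R x (\<kappa> s1)) (\<kappa> u))"
    proof (rule sum_list_cong2)
      fix x u assume "(x, u) \<in> set (dc s2)"
      then have "u \<noteq> []" using dco_length ne by fastforce
      then show "tmult es (R x (kw s1)) (kw u) = tmult es (R x (\<kappa> s1)) (\<kappa> u)" using ne by (simp add: kap_kk)
    qed
    finally show ?thesis using 3 ne by (simp add: deconc_def kap_kk)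
  qed
qed

text \<open>For positive \<open>a\<close> and \<open>b\<close> the map is the identity, and the
  lemma says that \<open>C (a + b)\<close> lies in the tensor product of \<open>C a\<close> and
  \<open>C b\<close>. The recursion defining \<open>cotensor\<close> splits off only one last
  factor; the generators from \<open>cotensor_list\<close> give the general splitting.\<close>

lemma dec_LM: "LM (C (a + b)) (tprod es (C a) (C b)) (dec a b)"
proof (rule lin_LM[OF lin_dec])
  fix t assume "t \<in> C (a + b)"
  then obtain ps where ps: "\<And>h w. (h, w) \<in> set ps \<Longrightarrow> length w = a + b \<and> set w \<subseteq> V" "t = (\<Sum>(h, w)\<leftarrow>ps. R h (\<kappa> w))"
    using cotensor_list by blast
  have "dec a b (R h (\<kappa> w)) \<in> tprod es (C a) (C b)" if "(h, w) \<in> set ps" for h w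
  proof -
    define s1 s2 where "s1 = take a w" "s2 = drop a w"
    have w: "w = s1 @ s2" "length s1 = a" "length s2 = b" "set s1 \<subseteq> V" "set s2 \<subseteq> V"
      using ps(1)[OF that] unfolding s1_s2_def by (auto dest: in_set_takeD in_set_dropD)
    have "tmult es (R c (R x (\<kappa> s1))) (R d (\<kappa> u)) \<in> tprod es (C a) (C b)" if "(x, u) \<in> set (dc s2)" for c d x u
      using that w dco_V[OF that w(5)] dco_length[OF that] by (intro tprod_tmult R_cotensor R_kap_cotensor) auto
    then show ?thesis
      unfolding w(1) dec_R[OF kap_TT] dec_kap[OF w(4,5,2,3)]
      by (auto simp: dactT_sum_list2 ER.dT_tmult TT_intros intro!: subspace_sum_list2[OF tprod_subspace])
  qed
  then show "dec a b t \<in> tprod es (C a) (C b)"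
    unfolding ps(2) lin_sum_list2[OF lin_dec] by (rule subspace_sum_list2[OF tprod_subspace])
qed

abbreviation dcp where "dcp \<equiv> dsq_coprod H M"

lemma dcp_LM: "LM (D (p + p') (q + q')) (tprod es (D p q) (D p' q')) (dcp p q p' q')"
proof -
  let ?fl = "flip_blocks es (max 1 p) (max 1 p') (max 1 q)"
  have TT: "tprod es (C a) (C b) \<subseteq> TT es" for a b using D_sub_TT[of a b] by (simp add: dsq_def)
  have "LM (D (p + p') (q + q')) (tprod es (tprod es (C p) (C p')) (tprod es (C q) (C q')))
     (tensor_map es es (C (p + p')) (dec p p') (C (q + q')) (dec q q'))"
    unfolding dsq_def by (rule tensor_map_LM(1)[OF hsub_cotensor hsub_cotensor dec_LM dec_LM TT TT])
  moreover have "LM (tprod es (tprod es (C p) (C p')) (tprod es (C q) (C q'))) (tprod es (D p q) (D p' q')) ?fl"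
  proof (rule lin_LM)
    show "lin tscale tscale ?fl" by (intro lin_intros)
    have "?fl (tmult es x y) \<in> tprod es (D p q) (D p' q')" if xy: "x \<in> tprod es (C p) (C p')" "y \<in> tprod es (C q) (C q')" for x y
    proof -
      obtain xs where xs: "set xs \<subseteq> C p \<times> C p'" "x = (\<Sum>(a, b)\<leftarrow>xs. tmult es a b)" using tprod_list[OF xy(1) C_subspace] by blast
      obtain ys where ys: "set ys \<subseteq> C q \<times> C q'" "y = (\<Sum>(a, b)\<leftarrow>ys. tmult es a b)" using tprod_list[OF xy(2) C_subspace] by blast
      have "?fl (tmult es (tmult es a b) (tmult es c d)) \<in> tprod es (D p q) (D p' q')"
        if "(a, b) \<in> set xs" "(c, d) \<in> set ys" for a b c d
      proof -
        have m: "a \<in> C p" "b \<in> C p'" "c \<in> C q" "d \<in> C q'" using that xs(1) ys(1) by auto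
        show ?thesis
          unfolding flip_blocks_tmult[OF m(1)[THEN C_tpow] m(2)[THEN C_tpow] m(3)[THEN C_tpow] m(4)[THEN C_tpow]]
          by (intro tprod_tmult D_tmult m)
      qed
      moreover have "tmult es (tmult es a b) y = (\<Sum>(c, d)\<leftarrow>ys. tmult es (tmult es a b) (tmult es c d))" if "(a, b) \<in> set xs" for a b
        unfolding ys(2) using that xs(1) ys(1) C_TT by (intro tmult_sum_list2_right TT_tmult) blast+
      ultimately show ?thesis
        unfolding xs(2) tmult_sum_list2_left lin_sum_list2[OF lin_flip_blocks[OF lin_id]]
        by (intro subspace_sum_list2[OF tprod_subspace]) (simp add: lin_sum_list2[OF lin_flip_blocks[OF lin_id]] subspace_sum_list2[OF tprod_subspace])
    qed
    then have "tprod es (tprod es (C p) (C p')) (tprod es (C q) (C q')) \<subseteq> {t. ?fl t \<in> tprod es (D p q) (D p' q')}"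
      using tprod_subspace[of es "D p q" "D p' q'"]
      by (intro tprod_minimal) (auto simp: tens.subspace_def flip_blocks_def tbind_simps)
    then show "t \<in> tprod es (tprod es (C p) (C p')) (tprod es (C q) (C q')) \<Longrightarrow> ?fl t \<in> tprod es (D p q) (D p' q')" for t
      by auto
  qed
  ultimately show ?thesis unfolding dsq_coprod_def by (intro LM_comp)
qed

lemma dcp_tmult:
  assumes x: "x \<in> C (p + p')" "dec p p' x = (\<Sum>(a, b)\<leftarrow>xs. tmult es a b)" "set xs \<subseteq> C p \<times> C p'"
    and y: "y \<in> C (q + q')" "dec q q' y = (\<Sum>(a, b)\<leftarrow>ys. tmult es a b)" "set ys \<subseteq> C q \<times> C q'"
  shows "dcp p q p' q' (tmult es x y) = (\<Sum>(a, b)\<leftarrow>xs. \<Sum>(c, d)\<leftarrow>ys. tmult es (tmult es a c) (tmult es b d))"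
proof -
  have TT: "tprod es (C a) (C b) \<subseteq> TT es" for a b using D_sub_TT[of a b] by (simp add: dsq_def)
  have "dcp p q p' q' (tmult es x y) = flip_blocks es (max 1 p) (max 1 p') (max 1 q) (tmult es (dec p p' x) (dec q q' y))"
    unfolding dsq_coprod_def comp_apply
    using tensor_map_tmult[OF hsub_cotensor hsub_cotensor dec_LM dec_LM TT TT x(1) y(1)] by simp
  also have "tmult es (dec p p' x) (dec q q' y) = (\<Sum>(a, b)\<leftarrow>xs. \<Sum>(c, d)\<leftarrow>ys. tmult es (tmult es a b) (tmult es c d))"
    unfolding x(2) y(2) tmult_sum_list2_left using x(3) y(3) C_TT
    by (intro sum_list_cong2 tmult_sum_list2_right TT_tmult) blast+
  also have "flip_blocks es (max 1 p) (max 1 p') (max 1 q) \<dots> = (\<Sum>(a, b)\<leftarrow>xs. \<Sum>(c, d)\<leftarrow>ys.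
      flip_blocks es (max 1 p) (max 1 p') (max 1 q) (tmult es (tmult es a b) (tmult es c d)))"
    by (simp add: lin_sum_list2[OF lin_flip_blocks[OF lin_id]])
  also have "\<dots> = (\<Sum>(a, b)\<leftarrow>xs. \<Sum>(c, d)\<leftarrow>ys. tmult es (tmult es a c) (tmult es b d))"
    using x(3) y(3) C_tpow by (intro sum_list_cong2 flip_blocks_tmult) blast+
  finally show ?thesis .
qed

lemma dec_list:
  assumes "x \<in> C (a + b)"
  obtains xs where "set xs \<subseteq> C a \<times> C b" "dec a b x = (\<Sum>(a, b)\<leftarrow>xs. tmult es a b)"
  using tprod_list[OF LM_mem[OF dec_LM assms] C_subspace] by blast

end

section \<open>Pairs of multi-brace type\<close>

locale brace = hopf_bimod H M for H :: "('k::field, 'h::ring_1) hopf_data" and M :: "('k, 'h, 'm::ab_group_add) bimodule_data" +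
  fixes f :: "('k, 'h \<times> 'm, 'm) bigraded_map" and g :: "('k, 'h \<times> 'm, 'h) bigraded_map"
  assumes mb: "multi_brace_pair H M f g"
begin

abbreviation f1 where "f1 \<equiv> mval H M f"
abbreviation g1 where "g1 \<equiv> hval H M g"
abbreviation F where "F \<equiv> conv_power es D dcp f1"

lemma f_linear: "linear_on tscale ms (D p q) (f p q)"
  and g_linear: "linear_on tscale hs (D p q) (g p q)"
  and g_zero: "(p, q) \<noteq> (0, 0) \<Longrightarrow> t \<in> D p q \<Longrightarrow> g p q t = 0"
  and f_01: "f 0 1 (pure es [(x, 0), (0, m)]) = la x m" and f_10: "f 1 0 (pure es [(0, m), (x, 0)]) = ra m x"
  and f_0n: "n \<noteq> 1 \<Longrightarrow> t \<in> D 0 n \<Longrightarrow> f 0 n t = 0" and f_n0: "n \<noteq> 1 \<Longrightarrow> t \<in> D n 0 \<Longrightarrow> f n 0 t = 0"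
  and f_lact: "t \<in> D p q \<Longrightarrow> f p q (dsq_lact H M p q x t) = la x (f p q t)"
  and f_ract: "t \<in> D p q \<Longrightarrow> f p q (dsq_ract H M p q t x) = ra (f p q t) x"
  and f_lco: "t \<in> D p q \<Longrightarrow> lcoact M (f p q t) = tensor_map es es (hpart H M) id (D p q) (f1 p q) (dsq_lco H M p q t)"
  and f_rco: "t \<in> D p q \<Longrightarrow> rcoact M (f p q t) = tensor_map es es (D p q) (f1 p q) (hpart H M) id (dsq_rco H M p q t)"
  and MB: "t \<in> tprod es (D i j) (C k) \<Longrightarrow>
      f 0 k (tensor_map es es (D i j) (g1 i j) (C k) id t)
          + (\<Sum>n=1..i + j. f n k (tensor_map es es (D i j) (F n i j) (C k) id t)) =
        f i 0 (tensor_map es es (C i) id (D j k) (g1 j k) t)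
          + (\<Sum>n=1..j + k. f i n (tensor_map es es (C i) id (D j k) (F n j k) t))"
  using mb unfolding multi_brace_pair_def property_MB_def Let_def coalgebra_morphism_def hopf_bimodule_morphism_def
  by auto

lemma f_0 [simp]: "f p q 0 = 0"
proof -
  have "f p q (tscale 0 0) = ms 0 (f p q 0)"
    using f_linear[of p q] tens.subspace_0[OF D_subspace[of p q]] unfolding linear_on_def by blast
  then show ?thesis by simp
qed

lemma pure_0 [simp]: "pure es [0] = 0" "pure es [(0, 0)] = 0"
  using lin_zero[OF lin_pure1[OF lin_id, of es]] by (simp_all add: zero_prod_def)

lemma lin_f [lin_intros]:
  assumes "linear_on s1 tscale X A" "\<And>x. x \<in> X \<Longrightarrow> A x \<in> D p q"
  shows "linear_on s1 ms X (\<lambda>x. f p q (A x))"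
  using assms f_linear[of p q] by (auto simp: linear_on_def)

lemma f1_LM1: "LM (D p q) (tpow es UNIV 1) (f1 p q)"
proof -
  have "linear_on tscale tscale (D p q) (f1 p q)"
    unfolding mval_def by (intro lin_intros) auto
  then show ?thesis by (auto simp: LM_def mval_def intro!: tpow_pure)
qed

lemma g1_LM: "LM (D p q) (hpart H M) (g1 p q)"
proof -
  have "linear_on tscale tscale (D p q) (g1 p q)"
    unfolding hval_def by (intro lin_intros g_linear)
  then show ?thesis by (auto simp: LM_def hval_def hpart_iff)
qed

sublocale HD: bigraded_coalgebra es D dcp f1 "\<lambda>p q. max 1 p + max 1 q"
  by unfold_locales (rule hsub_D dcp_LM f1_LM1)+

lemma F_LM: "n \<ge> 1 \<Longrightarrow> LM (D i j) (tpow es UNIV n) (F n i j)"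
  by (rule HD.conv_power_LM)

lemma F_1: "t \<in> D i j \<Longrightarrow> F (Suc 0) i j t = pure es [(0, f i j t)]"
  by (simp add: HD.conv_power_1 mval_def)

lemma F_Suc:
  assumes n: "n \<ge> 1" and x: "x \<in> C i" and y: "y \<in> C j"
    and xs: "\<And>p. p \<le> i \<Longrightarrow> dec p (i - p) x = (\<Sum>(a, b)\<leftarrow>xs p. tmult es a b) \<and> set (xs p) \<subseteq> C p \<times> C (i - p)"
    and ys: "\<And>q. q \<le> j \<Longrightarrow> dec q (j - q) y = (\<Sum>(a, b)\<leftarrow>ys q. tmult es a b) \<and> set (ys q) \<subseteq> C q \<times> C (j - q)"
  shows "F (Suc n) i j (tmult es x y) = (\<Sum>p\<le>i. \<Sum>q\<le>j. \<Sum>(a, b)\<leftarrow>xs p. \<Sum>(c, d)\<leftarrow>ys q.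
    tmult es (pure es [(0, f p q (tmult es a c))]) (F n (i - p) (j - q) (tmult es b d)))"
  unfolding HD.conv_power_Suc[OF n D_tmult[OF x y]]
proof (intro sum.cong refl)
  fix p q assume "p \<in> {..i}" "q \<in> {..j}"
  then have pq: "p \<le> i" "q \<le> j" by auto
  note X = xs[OF pq(1)] and Y = ys[OF pq(2)]
  let ?T = "tensor_map es es (D p q) (f1 p q) (D (i - p) (j - q)) (F n (i - p) (j - q))"
  note T = tensor_map_LM[OF hsub_D hsub_D f1_LM1 F_LM[OF n] tpow_TT tpow_TT]
  have xy: "x \<in> C (p + (i - p))" "y \<in> C (q + (j - q))" using x y pq by simp_all
  have d: "dcp p q (i - p) (j - q) (tmult es x y) = (\<Sum>(a, b)\<leftarrow>xs p. \<Sum>(c, d)\<leftarrow>ys q. tmult es (tmult es a c) (tmult es b d))"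
    using X Y by (intro dcp_tmult xy) auto
  have m: "tmult es a c \<in> D p q" "tmult es b d \<in> D (i - p) (j - q)" if "(a, b) \<in> set (xs p)" "(c, d) \<in> set (ys q)" for a b c d
    using that X Y by (auto intro!: D_tmult)
  have "?T (dcp p q (i - p) (j - q) (tmult es x y))
    = (\<Sum>(a, b)\<leftarrow>xs p. ?T (\<Sum>(c, d)\<leftarrow>ys q. tmult es (tmult es a c) (tmult es b d)))"
    unfolding d by (rule LM_sum_list2[OF T(1) tprod_subspace]) (rule subspace_sum_list2[OF tprod_subspace], rule tprod_tmult, (erule m, assumption)+)
  also have "\<dots> = (\<Sum>(a, b)\<leftarrow>xs p. \<Sum>(c, d)\<leftarrow>ys q. ?T (tmult es (tmult es a c) (tmult es b d)))"
    by (rule sum_list_cong2, rule LM_sum_list2[OF T(1) tprod_subspace], rule tprod_tmult, (erule m, assumption)+)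
  also have "\<dots> = (\<Sum>(a, b)\<leftarrow>xs p. \<Sum>(c, d)\<leftarrow>ys q.
    tmult es (pure es [(0, f p q (tmult es a c))]) (F n (i - p) (j - q) (tmult es b d)))"
    by (intro sum_list_cong2) (simp add: T(2) m mval_def)
  finally show "?T (dcp p q (i - p) (j - q) (tmult es x y)) = (\<Sum>(a, b)\<leftarrow>xs p. \<Sum>(c, d)\<leftarrow>ys q.
    tmult es (pure es [(0, f p q (tmult es a c))]) (F n (i - p) (j - q) (tmult es b d)))" .
qed

lemma hC: "pure es [(h, 0)] \<in> C 0"
  by (auto simp: hpart_iff)

lemma dec_h: "dec 0 0 (pure es [(h, 0)]) = (\<Sum>(a, b)\<leftarrow>map (\<lambda>(a, b). (pure es [(a, 0)], pure es [(b, 0)])) (cop H h). tmult es a b)"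
  by (simp add: deconc_def cotensor_lco_def LC.apply_at_single lco_h comp_def case_prod_beta' tmult_pure)

lemma f1_10:
  assumes "a \<in> C 1" shows "pure es [(0, f 1 0 (tmult es a (pure es [(c, 0)])))] = R c a"
proof -
  obtain m where "a = pure es [(0, m)]" using assms by (auto simp: mpart_iff)
  then show ?thesis using f_10[of m c] by (simp add: tmult_pure R_single del: ER.dT_pure)
qed

lemma f1_01:
  assumes "a \<in> C 1" shows "pure es [(0, f 0 1 (tmult es (pure es [(c, 0)]) a))] = L c a"
proof -
  obtain m where "a = pure es [(0, m)]" using assms by (auto simp: mpart_iff)
  then show ?thesis using f_01[of c m] by (simp add: tmult_pure L_single del: EL.dT_pure)
qed

text \<open>As \<open>f p 0\<close> vanishes for p other than 1, each of the \<open>n\<close>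
  factors must take exactly one tensor factor of \<open>x\<close>, so \<open>n = i\<close>. On
  degree one \<open>f\<close> is the right action, and the legs of \<open>h\<close> acting factor by
  factor form the diagonal action.\<close>

lemma F_right:
  "n \<ge> 1 \<Longrightarrow> x \<in> C i \<Longrightarrow> F n i 0 (tmult es x (pure es [(h, 0)])) = (if n = i then R h x else 0)"
proof (induction n arbitrary: i x h rule: dec_induct)
  case base
  have m: "tmult es x (pure es [(h, 0)]) \<in> D i 0" by (rule D_tmult[OF base hC])
  show ?case
  proof (cases "i = 1")
    case True
    then show ?thesis using F_1[OF m] f1_10[of x h] base by simp
  next
    case False
    then show ?thesis using F_1[OF m] f_n0[OF False m] by simp
  qed
next
  case (step n)
  have "\<exists>xs. dec p (i - p) x = (\<Sum>(a, b)\<leftarrow>xs. tmult es a b) \<and> set xs \<subseteq> C p \<times> C (i - p)" if "p \<le> i" for p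
    using dec_list[of x p "i - p"] step.prems that by auto
  then obtain xs where xs: "\<And>p. p \<le> i \<Longrightarrow> dec p (i - p) x = (\<Sum>(a, b)\<leftarrow>xs p. tmult es a b) \<and> set (xs p) \<subseteq> C p \<times> C (i - p)"
    by metis
  let ?t = "\<lambda>p a b c d. tmult es (pure es [(0, f p 0 (tmult es a (pure es [(c, 0)])))]) (F n (i - p) 0 (tmult es b (pure es [(d, 0)])))"
  have "F (Suc n) i 0 (tmult es x (pure es [(h, 0)])) = (\<Sum>p\<le>i. \<Sum>q\<le>0. \<Sum>(a, b)\<leftarrow>xs p.
      \<Sum>(c, d)\<leftarrow>map (\<lambda>(a, b). (pure es [(a, 0)], pure es [(b, 0)])) (cop H h).
      tmult es (pure es [(0, f p q (tmult es a c))]) (F n (i - p) (0 - q) (tmult es b d)))"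
    by (rule F_Suc[OF step.hyps(1) step.prems hC xs]) (use hC dec_h in auto)
  also have "\<dots> = (\<Sum>p\<le>i. \<Sum>(a, b)\<leftarrow>xs p. \<Sum>(c, d)\<leftarrow>cop H h. ?t p a b c d)"
    by (simp add: comp_def case_prod_beta')
  \<comment> \<open>The equation \<open>n = i - 1\<close> excludes \<open>i = 0\<close> because
    \<open>n \<ge> 1\<close>, so the truncated difference is harmless.\<close>
  also have "\<dots> = (\<Sum>p\<le>i. if p = 1 \<and> n = i - 1 then R h x else 0)"
  proof (rule sum.cong[OF refl])
    fix p assume "p \<in> {..i}" then have p: "p \<le> i" by simp
    note X = xs[OF p]
    have "?t p a b c d = (if p = 1 \<and> n = i - 1 then tmult es (R c a) (R d b) else 0)" if "(a, b) \<in> set (xs p)" for a b c d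
    proof -
      have m: "a \<in> C p" "b \<in> C (i - p)" using that X by auto
      have "f p 0 (tmult es a (pure es [(c, 0)])) = 0" if "p \<noteq> 1" using f_n0[OF that D_tmult[OF m(1) hC]] .
      moreover have "pure es [(0, f p 0 (tmult es a (pure es [(c, 0)])))] = R c a" if "p = 1" using f1_10 m that by simp
      ultimately show ?thesis using step.IH[OF m(2), of d] C_TT[OF R_cotensor[OF m(1), of c]]
        by (auto simp: tmult_TT_zero_right)
    qed
    then have "(\<Sum>(a, b)\<leftarrow>xs p. \<Sum>(c, d)\<leftarrow>cop H h. ?t p a b c d)
      = (\<Sum>(a, b)\<leftarrow>xs p. \<Sum>(c, d)\<leftarrow>cop H h. if p = 1 \<and> n = i - 1 then tmult es (R c a) (R d b) else 0)"
      by (intro sum_list_cong2)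
    also have "\<dots> = (if p = 1 \<and> n = i - 1 then R h x else 0)"
    proof (cases "p = 1 \<and> n = i - 1")
      case True
      have "(\<Sum>(a, b)\<leftarrow>xs p. \<Sum>(c, d)\<leftarrow>cop H h. tmult es (R c a) (R d b)) = (\<Sum>(a, b)\<leftarrow>xs p. R h (tmult es a b))"
        using X C_TT by (intro sum_list_cong2 ER.dT_tmult[symmetric]) blast+
      also have "\<dots> = R h (dec p (i - p) x)" using X by (simp add: dactT_sum_list2)
      also have "\<dots> = R h x" using True step.hyps(1) by (auto simp: deconc_def)
      finally show ?thesis using True by simp
    next
      case False
      show ?thesis unfolding if_not_P[OF False] by (simp add: case_prod_beta')
    qed
    finally show "(\<Sum>(a, b)\<leftarrow>xs p. \<Sum>(c, d)\<leftarrow>cop H h. ?t p a b c d) = (if p = 1 \<and> n = i - 1 then R h x else 0)" .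
  qed
  also have "\<dots> = (if Suc n = i then R h x else 0)"
  proof (cases "Suc n = i")
    case True
    then have "(\<Sum>p\<le>i. if p = 1 \<and> n = i - 1 then R h x else 0) = (\<Sum>p\<le>i. if p = 1 then R h x else 0)" by auto
    then show ?thesis using True step.hyps(1) by (simp add: sum.delta)
  next
    case False
    then have "n \<noteq> i - 1" using step.hyps(1) by auto
    then show ?thesis using False by simp
  qed
  finally show ?case .
qed

text \<open>The mirror image of \<open>F_right\<close>: \<open>f 0 q\<close> vanishes for q other
  than 1, and on degree one \<open>f\<close> is the left action.\<close>

lemma F_left:
  "n \<ge> 1 \<Longrightarrow> y \<in> C k \<Longrightarrow> F n 0 k (tmult es (pure es [(h, 0)]) y) = (if n = k then L h y else 0)"
proof (induction n arbitrary: k y h rule: dec_induct)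
  case base
  have m: "tmult es (pure es [(h, 0)]) y \<in> D 0 k" by (rule D_tmult[OF hC base])
  show ?case
  proof (cases "k = 1")
    case True
    then show ?thesis using F_1[OF m] f1_01[of y h] base by simp
  next
    case False
    then show ?thesis using F_1[OF m] f_0n[OF False m] by simp
  qed
next
  case (step n)
  have "\<exists>ys. dec q (k - q) y = (\<Sum>(a, b)\<leftarrow>ys. tmult es a b) \<and> set ys \<subseteq> C q \<times> C (k - q)" if "q \<le> k" for q
    using dec_list[of y q "k - q"] step.prems that by auto
  then obtain ys where ys: "\<And>q. q \<le> k \<Longrightarrow> dec q (k - q) y = (\<Sum>(a, b)\<leftarrow>ys q. tmult es a b) \<and> set (ys q) \<subseteq> C q \<times> C (k - q)"
    by metis
  let ?t = "\<lambda>q a b c d. tmult es (pure es [(0, f 0 q (tmult es (pure es [(a, 0)]) c))]) (F n 0 (k - q) (tmult es (pure es [(b, 0)]) d))"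
  have "F (Suc n) 0 k (tmult es (pure es [(h, 0)]) y) = (\<Sum>p\<le>0. \<Sum>q\<le>k.
      \<Sum>(a, b)\<leftarrow>map (\<lambda>(a, b). (pure es [(a, 0)], pure es [(b, 0)])) (cop H h). \<Sum>(c, d)\<leftarrow>ys q.
      tmult es (pure es [(0, f p q (tmult es a c))]) (F n (0 - p) (k - q) (tmult es b d)))"
    by (rule F_Suc[OF step.hyps(1) hC step.prems _ ys]) (use hC dec_h in auto)
  also have "\<dots> = (\<Sum>q\<le>k. \<Sum>(a, b)\<leftarrow>cop H h. \<Sum>(c, d)\<leftarrow>ys q. ?t q a b c d)"
    by (simp add: comp_def case_prod_beta')
  also have "\<dots> = (\<Sum>q\<le>k. if q = 1 \<and> n = k - 1 then L h y else 0)"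
  proof (rule sum.cong[OF refl])
    fix q assume "q \<in> {..k}" then have q: "q \<le> k" by simp
    note Y = ys[OF q]
    have "?t q a b c d = (if q = 1 \<and> n = k - 1 then tmult es (L a c) (L b d) else 0)" if "(c, d) \<in> set (ys q)" for a b c d
    proof -
      have m: "c \<in> C q" "d \<in> C (k - q)" using that Y by auto
      have "f 0 q (tmult es (pure es [(a, 0)]) c) = 0" if "q \<noteq> 1" using f_0n[OF that D_tmult[OF hC m(1)]] .
      moreover have "pure es [(0, f 0 q (tmult es (pure es [(a, 0)]) c))] = L a c" if "q = 1" using f1_01 m that by simp
      ultimately show ?thesis using step.IH[OF m(2), of b] C_TT[OF L_cotensor[OF m(1), of a]]
        by (auto simp: tmult_TT_zero_right)
    qed
    then have "(\<Sum>(a, b)\<leftarrow>cop H h. \<Sum>(c, d)\<leftarrow>ys q. ?t q a b c d)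
      = (\<Sum>(a, b)\<leftarrow>cop H h. \<Sum>(c, d)\<leftarrow>ys q. if q = 1 \<and> n = k - 1 then tmult es (L a c) (L b d) else 0)"
      by (intro sum_list_cong2)
    also have "\<dots> = (if q = 1 \<and> n = k - 1 then L h y else 0)"
    proof (cases "q = 1 \<and> n = k - 1")
      case True
      have "(\<Sum>(a, b)\<leftarrow>cop H h. \<Sum>(c, d)\<leftarrow>ys q. tmult es (L a c) (L b d)) = (\<Sum>(c, d)\<leftarrow>ys q. \<Sum>(a, b)\<leftarrow>cop H h. tmult es (L a c) (L b d))"
        by (rule sum_list_swap)
      also have "\<dots> = (\<Sum>(c, d)\<leftarrow>ys q. L h (tmult es c d))"
        using Y C_TT by (intro sum_list_cong2 EL.dT_tmult[symmetric]) blast+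
      also have "\<dots> = L h (dec q (k - q) y)" using Y by (simp add: dactT_sum_list2)
      also have "\<dots> = L h y" using True step.hyps(1) by (auto simp: deconc_def)
      finally show ?thesis using True by simp
    next
      case False
      show ?thesis unfolding if_not_P[OF False] by (simp add: case_prod_beta')
    qed
    finally show "(\<Sum>(a, b)\<leftarrow>cop H h. \<Sum>(c, d)\<leftarrow>ys q. ?t q a b c d) = (if q = 1 \<and> n = k - 1 then L h y else 0)" .
  qed
  also have "\<dots> = (if Suc n = k then L h y else 0)"
  proof (cases "Suc n = k")
    case True
    then have "(\<Sum>q\<le>k. if q = 1 \<and> n = k - 1 then L h y else 0) = (\<Sum>q\<le>k. if q = 1 then L h y else 0)" by auto
    then show ?thesis using True step.hyps(1) by (simp add: sum.delta)
  next
    case False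
    then have "n \<noteq> k - 1" using step.hyps(1) by auto
    then show ?thesis using False by simp
  qed
  finally show ?case .
qed

text \<open>This is (MB) on \<open>C i \<otimes> H \<otimes> C k\<close>: by the two lemmas above only the terms \<open>n = i\<close> and \<open>m = k\<close> survive.\<close>

lemma f_balanced:
  assumes x: "x \<in> C i" and y: "y \<in> C k"
  shows "f i k (tmult es (R h x) y) = f i k (tmult es x (L h y))"
proof -
  \<comment> \<open>For \<open>i = 0\<close> or \<open>k = 0\<close> a term of (MB) with
    \<open>g 0 0\<close>, the multiplication of \<open>H\<close>, can survive. These cases follow
    directly from the given values of \<open>f 0 k\<close> and \<open>f i 0\<close> and the module
    axioms.\<close>
  consider "i = 0" "k \<noteq> 1" | "i = 0" "k = 1" | "k = 0" "i \<noteq> 1" | "k = 0" "i = 1" | "i \<ge> 1" "k \<ge> 1" by linarith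
  then show ?thesis
  proof cases
    case 1
    then show ?thesis using f_0n D_tmult x y R_cotensor[OF x] L_cotensor[OF y] by metis
  next
    case 2
    then obtain a m where "x = pure es [(a, 0)]" "y = pure es [(0, m)]" using x y by (auto simp: hpart_iff mpart_iff)
    then show ?thesis using 2 f_01 by (simp add: R_single L_single tmult_pure la_mult del: ER.dT_pure EL.dT_pure)
  next
    case 3
    then show ?thesis using f_n0 D_tmult x y R_cotensor[OF x] L_cotensor[OF y] by metis
  next
    case 4
    then obtain a m where "y = pure es [(a, 0)]" "x = pure es [(0, m)]" using x y by (auto simp: hpart_iff mpart_iff)
    then show ?thesis using 4 f_10 by (simp add: R_single L_single tmult_pure ra_mult del: ER.dT_pure EL.dT_pure)
  next
    case 5
    let ?h = "pure es [(h, 0)]"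
    have xh: "tmult es x ?h \<in> D i 0" and hy: "tmult es ?h y \<in> D 0 k" by (intro D_tmult hC x y)+
    define t where "t = tmult es (tmult es x ?h) y"
    have t2: "t = tmult es x (tmult es ?h y)" unfolding t_def by (rule tmult_assoc[OF C_TT[OF y]])
    have t: "t \<in> tprod es (D i 0) (C k)" unfolding t_def by (intro tprod_tmult xh y)
    have l: "tensor_map es es (D i 0) G (C k) id t = tmult es (G (tmult es x ?h)) y" if "LM (D i 0) Z G" "Z \<subseteq> TT es" for G Z
      unfolding t_def using tensor_map_tmult[OF hsub_D hsub_cotensor that(1) LM_id(1) that(2) C_sub_TT xh y] by simp
    have r: "tensor_map es es (C i) id (D 0 k) G t = tmult es x (G (tmult es ?h y))" if "LM (D 0 k) Z G" "Z \<subseteq> TT es" for G Z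
      unfolding t2 using tensor_map_tmult[OF hsub_cotensor hsub_D LM_id(1) that(1) C_sub_TT that(2) x hy] by simp
    have hTT: "hpart H M \<subseteq> TT es" using C_sub_TT[of 0] by simp
    have gl: "g1 i 0 (tmult es x ?h) = 0" "g1 0 k (tmult es ?h y) = 0"
      using g_zero[OF _ xh] g_zero[OF _ hy] 5 by (simp_all add: hval_def)
    have "f 0 k (tensor_map es es (D i 0) (g1 i 0) (C k) id t) = 0"
      unfolding l[OF g1_LM hTT] gl by simp
    moreover have "f i 0 (tensor_map es es (C i) id (D 0 k) (g1 0 k) t) = 0"
      unfolding r[OF g1_LM hTT] gl by (simp add: C_TT[OF x])
    moreover have "(\<Sum>n=1..i + 0. f n k (tensor_map es es (D i 0) (F n i 0) (C k) id t))
      = (\<Sum>n=1..i. if n = i then f i k (tmult es (R h x) y) else 0)"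
    proof (rule sum.cong)
      fix n assume "n \<in> {1..i}"
      then have n: "n \<ge> 1" by simp
      show "f n k (tensor_map es es (D i 0) (F n i 0) (C k) id t) = (if n = i then f i k (tmult es (R h x) y) else 0)"
        unfolding l[OF F_LM[OF n] tpow_TT] F_right[OF n x] by simp
    qed simp
    moreover have "(\<Sum>m=1..0 + k. f i m (tensor_map es es (C i) id (D 0 k) (F m 0 k) t))
      = (\<Sum>n=1..k. if n = k then f i k (tmult es x (L h y)) else 0)"
    proof (rule sum.cong)
      fix n assume "n \<in> {1..k}"
      then have n: "n \<ge> 1" by simp
      show "f i n (tensor_map es es (C i) id (D 0 k) (F n 0 k) t) = (if n = k then f i k (tmult es x (L h y)) else 0)"
        unfolding r[OF F_LM[OF n] tpow_TT] F_left[OF n y] by (simp add: C_TT[OF x])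
    qed simp
    ultimately show ?thesis using MB[OF t] 5 by (simp add: sum.delta)
  qed
qed

end

section \<open>The coactions of the tensor square\<close>

lemma mlin_length_if: "mlin s F \<Longrightarrow> mlin s (\<lambda>w. if length w = n then F w else 0)"
  unfolding mlin_def
proof (intro allI)
  fix u v assume F: "\<forall>u v. lin s tscale (\<lambda>x. F (u @ x # v))"
  show "lin s tscale (\<lambda>x. if length (u @ x # v) = n then F (u @ x # v) else 0)"
    using F by (cases "length u + Suc (length v) = n") (simp_all add: lin_0)
qed

context hopf_bimod
begin

definition lco_merge :: "nat \<Rightarrow> nat \<Rightarrow> ('h \<times> 'm) list \<Rightarrow> ('k, 'h \<times> 'm) tensor" where
  "lco_merge a b w = (if length w = a + b + 2
         then pure es ((fst (w ! 0) * fst (w ! (a + 1)), 0) # take a (drop 1 w) @ drop (a + 2) w) else 0)"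

definition rco_merge :: "nat \<Rightarrow> nat \<Rightarrow> ('h \<times> 'm) list \<Rightarrow> ('k, 'h \<times> 'm) tensor" where
  "rco_merge a b w = (if length w = a + b + 2
         then pure es (take a w @ take b (drop (a + 1) w) @ [(fst (w ! a) * fst (w ! (a + b + 1)), 0)]) else 0)"

lemma mlin_lco_merge: "mlin es (lco_merge a b)"
proof -
  \<comment> \<open>The blocks are the \<open>H\<close>-entry of the first factor, its
    \<open>a\<close> letters, the \<open>H\<close>-entry of the second factor and its letters.
    \<open>blocks4\<close> leaves the length of the last block open, so \<open>length z = b\<close>
    is built in.\<close>
  define B where "B u v w z = (case u of [e] \<Rightarrow> (case w of [e'] \<Rightarrow>
     (if length z = b then pure es ((fst e * fst e', 0) # v @ z) else 0) | _ \<Rightarrow> 0) | _ \<Rightarrow> 0)" for u v w z :: "('h \<times> 'm) list"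
  have 1: "lin es tscale (\<lambda>e. if length z = b then pure es ((fst e * h, 0) # v @ z) else 0)"
    "lin es tscale (\<lambda>e. if length z = b then pure es ((h * fst e, 0) # v @ z) else 0)" for h v z
  proof -
    have "lin es tscale (\<lambda>e. pure es ([] @ (fst e * h, 0) # v @ z))" "lin es tscale (\<lambda>e. pure es ([] @ (h * fst e, 0) # v @ z))"
      by - (rule lin_pure, intro lin_intros)+
    then show "lin es tscale (\<lambda>e. if length z = b then pure es ((fst e * h, 0) # v @ z) else 0)"
      "lin es tscale (\<lambda>e. if length z = b then pure es ((h * fst e, 0) # v @ z) else 0)"
      by (cases "length z = b"; simp add: lin_0)+
  qed
  have "mlin es (\<lambda>u. B u v w z)" for v w z
  proof -
    have "lin es tscale (\<lambda>e. case w of [e'] \<Rightarrow> (if length z = b then pure es ((fst e * fst e', 0) # v @ z) else 0) | _ \<Rightarrow> 0)"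
      using 1(1) by (cases w; cases "tl w") (auto simp: lin_0)
    then show ?thesis unfolding B_def by (rule mlin_case1)
  qed
  moreover have "mlin es (\<lambda>v. B u v w z)" for u w z
  proof -
    have "mlin es (\<lambda>v. if length z = b then pure es (e # v @ z) else 0)" for e
      using mlin_pure_app[of es "[e]" z] by (cases "length z = b") (auto simp: mlin_0)
    then show ?thesis unfolding B_def by (cases u; cases "tl u"; cases w; cases "tl w") (auto simp: mlin_0)
  qed
  moreover have "mlin es (\<lambda>w. B u v w z)" for u v z
  proof -
    have "mlin es (\<lambda>w. case w of [e'] \<Rightarrow> (if length z = b then pure es ((fst e * fst e', 0) # v @ z) else 0) | _ \<Rightarrow> 0)" for e :: "'h \<times> 'm"
      by (rule mlin_case1[OF 1(2)])
    then show ?thesis unfolding B_def by (cases u; cases "tl u") (auto simp: mlin_0)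
  qed
  moreover have "mlin es (\<lambda>z. B u v w z)" for u v w
  proof -
    have "mlin es (\<lambda>z. if length z = b then pure es (e # v @ z) else 0)" for e
      using mlin_pure_app[of es "e # v" "[]"] by (intro mlin_length_if) simp
    then show ?thesis unfolding B_def by (cases u; cases "tl u"; cases w; cases "tl w") (auto simp: mlin_0)
  qed
  ultimately have "mlin es (blocks4 1 a 1 B)" by (rule mlin_blocks4)
  moreover have "blocks4 1 a 1 B w = lco_merge a b w" for w
  proof (cases "a + 2 \<le> length w")
    case True
    have h: "take 1 xs = [xs ! 0]" if "xs \<noteq> []" for xs :: "('h \<times> 'm) list" using that by (cases xs) auto
    have "w \<noteq> []" "drop (1 + a) w \<noteq> []" using True by auto
    from this[THEN h] have "take 1 w = [w ! 0]" "take 1 (drop (1 + a) w) = [w ! (a + 1)]" using True by auto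
    then show ?thesis using True by (auto simp: blocks4_def lco_merge_def B_def)
  qed (simp add: blocks4_def lco_merge_def)
  ultimately show ?thesis by (simp add: mlin_def)
qed

lemma mlin_rco_merge: "mlin es (rco_merge a b)"
proof -
  \<comment> \<open>The blocks are the \<open>a\<close> letters of the first factor, its
    \<open>H\<close>-entry, the \<open>b\<close> letters of the second factor and its
    \<open>H\<close>-entry. The case on \<open>z\<close> is zero unless exactly one letter remains,
    which enforces the total length.\<close>
  define B where "B u w v z = (case w of [e] \<Rightarrow> (case z of [e'] \<Rightarrow> pure es (u @ v @ [(fst e * fst e', 0)]) | _ \<Rightarrow> 0) | _ \<Rightarrow> 0)"
    for u v w z :: "('h \<times> 'm) list"
  have 1: "lin es tscale (\<lambda>e. pure es (u @ v @ [(fst e * h, 0)]))"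
    "lin es tscale (\<lambda>e. pure es (u @ v @ [(h * fst e, 0)]))" for h u v
  proof -
    have "lin es tscale (\<lambda>e. pure es ((u @ v) @ (fst e * h, 0) # []))" "lin es tscale (\<lambda>e. pure es ((u @ v) @ (h * fst e, 0) # []))"
      by - (rule lin_pure, intro lin_intros)+
    then show "lin es tscale (\<lambda>e. pure es (u @ v @ [(fst e * h, 0)]))" "lin es tscale (\<lambda>e. pure es (u @ v @ [(h * fst e, 0)]))"
      by simp_all
  qed
  have "mlin es (\<lambda>u. B u w v z)" for v w z
    using mlin_pure_app[of es "[]"] unfolding B_def by (cases z; cases "tl z"; cases w; cases "tl w") (auto simp: mlin_0)
  moreover have "mlin es (\<lambda>w. B u w v z)" for u v z
  proof -
    have "lin es tscale (\<lambda>e. case z of [e'] \<Rightarrow> pure es (u @ v @ [(fst e * fst e', 0)]) | _ \<Rightarrow> 0)"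
      using 1(1) by (cases z; cases "tl z") (auto simp: lin_0)
    then show ?thesis unfolding B_def by (rule mlin_case1)
  qed
  moreover have "mlin es (\<lambda>v. B u w v z)" for u w z
    using mlin_pure_app[of es u] unfolding B_def by (cases z; cases "tl z"; cases w; cases "tl w") (auto simp: mlin_0)
  moreover have "mlin es (\<lambda>z. B u w v z)" for u v w
  proof -
    have "mlin es (\<lambda>z. case z of [e'] \<Rightarrow> pure es (u @ v @ [(fst e * fst e', 0)]) | _ \<Rightarrow> 0)" for e :: "'h \<times> 'm"
      by (rule mlin_case1[OF 1(2)])
    then show ?thesis unfolding B_def by (cases w; cases "tl w") (auto simp: mlin_0)
  qed
  ultimately have "mlin es (blocks4 a 1 b B)" by (rule mlin_blocks4)
  moreover have "blocks4 a 1 b B w = rco_merge a b w" for w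
  proof (cases "a + b + 1 \<le> length w")
    case True
    have h: "take 1 xs = [xs ! 0]" if "xs \<noteq> []" for xs :: "('h \<times> 'm) list" using that by (cases xs) auto
    have t: "take 1 (drop a w) = [w ! a]" using True h[of "drop a w"] by auto
    show ?thesis
    proof (cases "length w = a + b + 2")
      case l: True
      have "drop (a + 1 + b) w = [w ! (a + b + 1)]"
        using l h[of "drop (a + 1 + b) w"] take_all[of "drop (a + 1 + b) w" 1] by (auto simp: add.commute)
      then show ?thesis using True l t by (auto simp: blocks4_def rco_merge_def B_def)
    next
      case False
      then have "length (drop (a + 1 + b) w) \<noteq> 1" using True by auto
      moreover have "length z \<noteq> 1 \<Longrightarrow> B u x v z = 0" for u x v z
        unfolding B_def by (auto split: list.split)
      ultimately have "B u x v (drop (a + 1 + b) w) = 0" for u x v by simp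
      then show ?thesis using True False by (auto simp: blocks4_def rco_merge_def)
    qed
  qed (simp add: blocks4_def rco_merge_def)
  ultimately show ?thesis by (simp add: mlin_def)
qed

lemma tbind_lco_merge:
  assumes y: "y \<in> tpow es UNIV a" and z: "z \<in> tpow es UNIV b"
  shows "tbind (tmult es (tmult es (pure es [(g, 0)]) y) (tmult es (pure es [(h, 0)]) z)) (lco_merge a b)
    = tmult es (pure es [(g * h, 0)]) (tmult es y z)"
proof (rule tpow_eqI[OF y vector_space_tscale, of "\<lambda>y. tbind (tmult es (tmult es (pure es [(g, 0)]) y) (tmult es (pure es [(h, 0)]) z)) (lco_merge a b)"
    "\<lambda>y. tmult es (pure es [(g * h, 0)]) (tmult es y z)"])
  fix v :: "('h \<times> 'm) list" assume v: "length v = a"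
  show "tbind (tmult es (tmult es (pure es [(g, 0)]) (pure es v)) (tmult es (pure es [(h, 0)]) z)) (lco_merge a b)
    = tmult es (pure es [(g * h, 0)]) (tmult es (pure es v) z)"
    by (rule tpow_eqI[OF z vector_space_tscale, of "\<lambda>z. tbind (tmult es (tmult es (pure es [(g, 0)]) (pure es v)) (tmult es (pure es [(h, 0)]) z)) (lco_merge a b)"
    "\<lambda>z. tmult es (pure es [(g * h, 0)]) (tmult es (pure es v) z)"])
      (use v in \<open>auto simp: tmult_pure tbind_pure_mlin[OF mlin_lco_merge] lco_merge_def nth_append tpow_TTD intro!: lin_intros TT_intros\<close>)
qed (auto simp: tpow_TTD[OF z] tpow_TTD intro!: lin_intros TT_intros)

lemma tbind_rco_merge:
  assumes y: "y \<in> tpow es UNIV a" and z: "z \<in> tpow es UNIV b"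
  shows "tbind (tmult es (tmult es y (pure es [(g, 0)])) (tmult es z (pure es [(h, 0)]))) (rco_merge a b)
    = tmult es (tmult es y z) (pure es [(g * h, 0)])"
proof (rule tpow_eqI[OF y vector_space_tscale, of "\<lambda>y. tbind (tmult es (tmult es y (pure es [(g, 0)])) (tmult es z (pure es [(h, 0)]))) (rco_merge a b)"
    "\<lambda>y. tmult es (tmult es y z) (pure es [(g * h, 0)])"])
  fix v :: "('h \<times> 'm) list" assume v: "length v = a"
  show "tbind (tmult es (tmult es (pure es v) (pure es [(g, 0)])) (tmult es z (pure es [(h, 0)]))) (rco_merge a b)
    = tmult es (tmult es (pure es v) z) (pure es [(g * h, 0)])"
    by (rule tpow_eqI[OF z vector_space_tscale, of "\<lambda>z. tbind (tmult es (tmult es (pure es v) (pure es [(g, 0)])) (tmult es z (pure es [(h, 0)]))) (rco_merge a b)"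
    "\<lambda>z. tmult es (tmult es (pure es v) z) (pure es [(g * h, 0)])"])
      (use v in \<open>auto simp: tmult_pure tbind_pure_mlin[OF mlin_rco_merge] rco_merge_def nth_append tpow_TTD intro!: lin_intros TT_intros\<close>)
qed (auto simp: tpow_TTD[OF z] tpow_TTD intro!: lin_intros TT_intros)

abbreviation \<delta> where "\<delta> \<equiv> apply_at es 0 (lco H M)"

lemma dec_0: "dec 0 p = \<delta>"
  by (auto simp: deconc_def cotensor_lco_def)

lemma TT_CC: "tprod es (C a) (C b) \<subseteq> TT es"
  using D_sub_TT[of a b] by (simp add: dsq_def)

text \<open>In degree zero both coactions are the coproduct of \<open>H\<close>, so the left one
  covers that case; in positive degree the right coaction is a component of deconcatenation.\<close>

lemma cotensor_rco_LM: "LM (C p) (tprod es (C p) (C 0)) (cotensor_rco H M p)"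
proof (cases "p = 0")
  case True
  have "dec 0 0 x = cotensor_rco H M 0 x" if "x \<in> C 0" for x
    using that by (auto simp: hpart_iff deconc_def cotensor_lco_def cotensor_rco_def LC.apply_at_single RC.apply_at_single lco_h rco_h)
  then show ?thesis using LM_cong[OF dec_LM[of 0 0], of "cotensor_rco H M 0"] C_subspace[of 0] True by simp
next
  case False
  then show ?thesis using dec_LM[of p 0] by (simp add: deconc_def)
qed

lemma dsq_lco_tmult:
  assumes y: "y \<in> C p" "\<delta> y = (\<Sum>(a, y')\<leftarrow>A. tmult es (pure es [(a, 0)]) y')" "snd ` set A \<subseteq> C p"
    and z: "z \<in> C q" "\<delta> z = (\<Sum>(b, z')\<leftarrow>B. tmult es (pure es [(b, 0)]) z')" "snd ` set B \<subseteq> C q"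
  shows "dsq_lco H M p q (tmult es y z) = (\<Sum>(a, y')\<leftarrow>A. \<Sum>(b, z')\<leftarrow>B. tmult es (pure es [(a * b, 0)]) (tmult es y' z'))"
proof -
  have yC: "y' \<in> C p" if "(a, y') \<in> set A" for a y' using that y(3) by force
  have zC: "z' \<in> C q" if "(b, z') \<in> set B" for b z' using that z(3) by force
  have m: "(\<lambda>w. if length w = max 1 p + max 1 q + 2
         then pure es ((fst (w ! 0) * fst (w ! (max 1 p + 1)), 0) # take (max 1 p) (drop 1 w) @ drop (max 1 p + 2) w) else 0)
     = lco_merge (max 1 p) (max 1 q)" by (simp add: lco_merge_def fun_eq_iff)
  have c: "cotensor_lco H M = \<delta>" by (simp add: cotensor_lco_def)
  have d: "LM (C n) (tprod es (C 0) (C n)) \<delta>" for n using dec_LM[of 0 n] by (simp add: dec_0)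
  have "tensor_map es es (C p) \<delta> (C q) \<delta> (tmult es y z) = tmult es (\<delta> y) (\<delta> z)"
    by (rule tensor_map_tmult[OF hsub_cotensor hsub_cotensor d d TT_CC TT_CC y(1) z(1)])
  also have "\<dots> = (\<Sum>(a, y')\<leftarrow>A. \<Sum>(b, z')\<leftarrow>B. tmult es (tmult es (pure es [(a, 0)]) y') (tmult es (pure es [(b, 0)]) z'))"
    unfolding y(2) z(2) tmult_sum_list2_left
    by (intro sum_list_cong2 tmult_sum_list2_right TT_tmult TT_pure) (erule yC[THEN C_TT] zC[THEN C_TT])+
  finally show ?thesis
    unfolding dsq_lco_def Let_def m c
    by (simp only: tbind_sum_list2) (intro sum_list_cong2 tbind_lco_merge; erule yC[THEN C_tpow] zC[THEN C_tpow])
qed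

end

section \<open>Module and comodule properties of f and of its restriction\<close>

context brace
begin

lemma f_la:
  assumes y: "y \<in> C p" and z: "z \<in> C q"
  shows "la x (f p q (tmult es y z)) = f p q (tmult es (L x y) z)"
proof -
  have e: "tlact H M x = L x" by (rule ext) (rule tlact_L)
  have "LM (C p) (C p) (L x)" by (intro lin_LM lin_intros L_cotensor)
  from tensor_map_tmult[OF hsub_cotensor hsub_cotensor this LM_id(1) C_sub_TT C_sub_TT y z]
  show ?thesis using f_lact[OF D_tmult[OF y z], of x] by (simp add: dsq_lact_def e)
qed

lemma f_ra:
  assumes y: "y \<in> C p" and z: "z \<in> C q"
  shows "ra (f p q (tmult es y z)) x = f p q (tmult es y (R x z))"
proof -
  have e: "(\<lambda>u. tract H M u x) = R x" by (rule ext) (rule tract_R)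
  have "LM (C q) (C q) (R x)" by (intro lin_LM lin_intros R_cotensor)
  from tensor_map_tmult[OF hsub_cotensor hsub_cotensor LM_id(1) this C_sub_TT C_sub_TT y z]
  show ?thesis using f_ract[OF D_tmult[OF y z], of x] by (simp add: dsq_ract_def e)
qed

lemma f_colinear:
  assumes y: "y \<in> C p" "\<delta> y = (\<Sum>(a, y')\<leftarrow>A. tmult es (pure es [(a, 0)]) y')" "snd ` set A \<subseteq> C p"
    and z: "z \<in> C q" "\<delta> z = (\<Sum>(b, z')\<leftarrow>B. tmult es (pure es [(b, 0)]) z')" "snd ` set B \<subseteq> C q"
  shows "lcoact M (f p q (tmult es y z)) = (\<Sum>(a, y')\<leftarrow>A. \<Sum>(b, z')\<leftarrow>B. pure es [(a * b, 0), (0, f p q (tmult es y' z'))])"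
proof -
  have yC: "y' \<in> C p" if "(a, y') \<in> set A" for a y' using that y(3) by force
  have zC: "z' \<in> C q" if "(b, z') \<in> set B" for b z' using that z(3) by force
  note T = tensor_map_LM[OF hsub_hpart hsub_D LM_id(1) f1_LM1 C_sub_TT[of 0, simplified] tpow_TT]
  have m: "tmult es (pure es [(a * b, 0)]) (tmult es y' z') \<in> tprod es (hpart H M) (D p q)" if "(a, y') \<in> set A" "(b, z') \<in> set B" for a b y' z'
    using hC yC[OF that(1)] zC[OF that(2)] by (auto intro!: tprod_tmult D_tmult)
  have "lcoact M (f p q (tmult es y z)) = tensor_map es es (hpart H M) id (D p q) (f1 p q)
      (\<Sum>(a, y')\<leftarrow>A. \<Sum>(b, z')\<leftarrow>B. tmult es (pure es [(a * b, 0)]) (tmult es y' z'))"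
    unfolding f_lco[OF D_tmult[OF y(1) z(1)]] dsq_lco_tmult[OF y z] ..
  also have "\<dots> = (\<Sum>(a, y')\<leftarrow>A. tensor_map es es (hpart H M) id (D p q) (f1 p q) (\<Sum>(b, z')\<leftarrow>B. tmult es (pure es [(a * b, 0)]) (tmult es y' z')))"
    by (rule LM_sum_list2[OF T(1) tprod_subspace], rule subspace_sum_list2[OF tprod_subspace]) (rule m)
  also have "\<dots> = (\<Sum>(a, y')\<leftarrow>A. \<Sum>(b, z')\<leftarrow>B. tensor_map es es (hpart H M) id (D p q) (f1 p q) (tmult es (pure es [(a * b, 0)]) (tmult es y' z')))"
    by (rule sum_list_cong2, rule LM_sum_list2[OF T(1) tprod_subspace]) (rule m)
  also have "\<dots> = (\<Sum>(a, y')\<leftarrow>A. \<Sum>(b, z')\<leftarrow>B. pure es [(a * b, 0), (0, f p q (tmult es y' z'))])"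
  proof (intro sum_list_cong2)
    fix a y' b z' assume "(a, y') \<in> set A" "(b, z') \<in> set B"
    then have "tmult es y' z' \<in> D p q" "pure es [(a * b, 0)] \<in> hpart H M" using yC zC hC by (auto intro!: D_tmult)
    then show "tensor_map es es (hpart H M) id (D p q) (f1 p q) (tmult es (pure es [(a * b, 0)]) (tmult es y' z'))
      = pure es [(a * b, 0), (0, f p q (tmult es y' z'))]"
      using T(2) by (simp add: mval_def tmult_pure)
  qed
  finally show ?thesis .
qed

text \<open>Both embedded words are coinvariant, so the coaction of the tensor square contributes 1
  * 1 in \<open>H\<close>, and right colinearity of \<open>f\<close> carries this over to the
  value.\<close>

lemma f_coinvariant:
  assumes "set s \<subseteq> V" "set t \<subseteq> V" "length s = p" "length t = q"
  shows "f p q (tmult es (\<kappa> s) (\<kappa> t)) \<in> V"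
proof -
  have y: "\<kappa> s \<in> C p" and z: "\<kappa> t \<in> C q" using assms kap_cotensor by auto
  have m: "(\<lambda>w. if length w = max 1 p + max 1 q + 2
         then pure es (take (max 1 p) w @ take (max 1 q) (drop (max 1 p + 1) w) @ [(fst (w ! max 1 p) * fst (w ! (max 1 p + max 1 q + 1)), 0)]) else 0)
     = rco_merge (max 1 p) (max 1 q)" by (simp add: rco_merge_def fun_eq_iff)
  have r: "cotensor_rco H M p (\<kappa> s) = tmult es (\<kappa> s) (pure es [(1, 0)])" "cotensor_rco H M q (\<kappa> t) = tmult es (\<kappa> t) (pure es [(1, 0)])"
    using rco_kap[OF assms(1)] rco_kap[OF assms(2)] assms(3,4) by (simp_all add: cotensor_rco_def)
  have "tensor_map es es (C p) (cotensor_rco H M p) (C q) (cotensor_rco H M q) (tmult es (\<kappa> s) (\<kappa> t))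
    = tmult es (tmult es (\<kappa> s) (pure es [(1, 0)])) (tmult es (\<kappa> t) (pure es [(1, 0)]))"
    using tensor_map_tmult[OF hsub_cotensor hsub_cotensor cotensor_rco_LM cotensor_rco_LM TT_CC TT_CC y z] by (simp add: r)
  then have "dsq_rco H M p q (tmult es (\<kappa> s) (\<kappa> t)) = tmult es (tmult es (\<kappa> s) (\<kappa> t)) (pure es [(1 * 1, 0)])"
    unfolding dsq_rco_def Let_def m using tbind_rco_merge[OF C_tpow[OF y] C_tpow[OF z]] by (simp only:)
  moreover note T = tensor_map_LM(2)[OF hsub_D hsub_hpart f1_LM1 LM_id(1) tpow_TT C_sub_TT[of 0, simplified] D_tmult[OF y z]]
  have "pure es [(1, 0)] \<in> hpart H M" using hC by simp
  ultimately have "rcoact M (f p q (tmult es (\<kappa> s) (\<kappa> t))) = pure es [(0, f p q (tmult es (\<kappa> s) (\<kappa> t))), (1, 0)]"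
    using f_rco[OF D_tmult[OF y z]] T by (simp add: mval_def tmult_pure)
  then show ?thesis by (simp add: coinvariants_def)
qed

subsection \<open>The restricted maps\<close>

abbreviation rb where "rb \<equiv> restricted_brace H M f"

lemma coinv_embed_LM: "LM (T p) (C p) (coinv_embed H M p)"
proof -
  have "LM (T p) (C p) (\<lambda>t. K t)" by (intro lin_LM lin_intros K_cotensor)
  then show ?thesis by (rule LM_cong[OF _ tpow_subspace]) (simp add: coinv_embed_K)
qed

lemma rb_tmult:
  assumes "t \<in> T p" "u \<in> T q"
  shows "rb p q (tmult ms t u) = f p q (tmult es (K t) (K u))"
  using tensor_map_tmult[OF hsub_tpow hsub_tpow coinv_embed_LM coinv_embed_LM C_sub_TT C_sub_TT assms] assms
  by (simp add: restricted_brace_def coinv_embed_K)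

lemma rb_linear: "linear_on tscale ms (T (p + q)) (rb p q)"
proof -
  have "LM (T (p + q)) (D p q) (tensor_map ms es (T p) (coinv_embed H M p) (T q) (coinv_embed H M q))"
    using tensor_map_LM(1)[OF hsub_tpow hsub_tpow coinv_embed_LM coinv_embed_LM C_sub_TT C_sub_TT] by (simp add: tprod_tpow dsq_def)
  then show ?thesis using f_linear[of p q] unfolding restricted_brace_def LM_def linear_on_def by simp
qed

lemma lin_rb [lin_intros]:
  assumes "linear_on s1 tscale X A" "\<And>x. x \<in> X \<Longrightarrow> A x \<in> T (p + q)"
  shows "linear_on s1 ms X (\<lambda>x. rb p q (A x))"
  using assms rb_linear[of p q] by (auto simp: linear_on_def)

lemma rb_pure:
  assumes "set s \<subseteq> V" "set t \<subseteq> V" "length s = p" "length t = q"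
  shows "rb p q (pure ms (s @ t)) = f p q (tmult es (\<kappa> s) (\<kappa> t))"
  using rb_tmult[of "pure ms s" p "pure ms t" q] assms by (simp add: tmult_pure K_pure tpow_pure)

lemma split_word:
  assumes "set w \<subseteq> V" "length w = p + q"
  obtains s t where "w = s @ t" "set s \<subseteq> V" "set t \<subseteq> V" "length s = p" "length t = q"
proof (rule that[of "take p w" "drop p w"])
qed (use assms in \<open>auto dest: in_set_takeD in_set_dropD\<close>)

text \<open>Membership in the coinvariants is expressed by the equation P(x) = x, which is linear
  and can be checked on words.\<close>

lemma rb_V:
  assumes t: "t \<in> T (p + q)" shows "rb p q t \<in> V"
proof -
  have "P (rb p q t) = rb p q t"
  proof (rule tpow_eqI[OF t vs_m, of "\<lambda>t. P (rb p q t)" "rb p q"])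
    fix w assume "length w = p + q" "set w \<subseteq> V"
    then obtain s t where st: "w = s @ t" "set s \<subseteq> V" "set t \<subseteq> V" "length s = p" "length t = q"
      using split_word by blast
    show "P (rb p q (pure ms w)) = rb p q (pure ms w)"
      unfolding st(1) rb_pure[OF st(2-5)] by (intro P_id f_coinvariant st(2-5))
  qed (auto intro!: lin_intros)
  then show ?thesis using P_coinvariant[of "rb p q t"] by simp
qed

text \<open>Left colinearity of \<open>f\<close> on embedded words, whose coaction is the diagonal
  one by \<open>lco_kap\<close>.\<close>

lemma rb_colinear:
  assumes w: "set w \<subseteq> V" "length w = p + q"
    and Q: "\<And>n. lin hs tscale (\<lambda>x. Q x n)" "\<And>x. lin ms tscale (\<lambda>n. Q x n)"
  shows "(\<Sum>(x, n)\<leftarrow>lc H M (rb p q (pure ms w)). Q x n) = (\<Sum>(x, w')\<leftarrow>dc w. Q x (rb p q (pure ms w')))"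
proof -
  obtain s t where st: "w = s @ t" "set s \<subseteq> V" "set t \<subseteq> V" "length s = p" "length t = q" using split_word[OF w] .
  have d: "\<delta> (\<kappa> s) = (\<Sum>(x, y)\<leftarrow>map (\<lambda>(x, u). (x, \<kappa> u)) (dc s). tmult es (pure es [(x, 0)]) y)" for s
    by (simp add: lco_kap comp_def case_prod_beta')
  have c: "snd ` set (map (\<lambda>(x, u). (x, \<kappa> u)) (dc s)) \<subseteq> C (length s)" if "set s \<subseteq> V" for s
    using that kap_cotensor by (fastforce dest: dco_V dco_length)
  have "lcoact M (rb p q (pure ms w)) = (\<Sum>(x, u)\<leftarrow>dc s. \<Sum>(y, v)\<leftarrow>dc t. pure es [(x * y, 0), (0, f p q (tmult es (\<kappa> u) (\<kappa> v)))])"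
    using f_colinear[OF kap_cotensor[OF st(2)] d c[OF st(2)] kap_cotensor[OF st(3)] d c[OF st(3)]] st
    by (simp add: rb_pure comp_def case_prod_beta')
  also have "\<dots> = (\<Sum>(x, w')\<leftarrow>dc w. pure es [(x, 0), (0, rb p q (pure ms w'))])"
    unfolding st(1) dco_append
  proof (intro sum_list_cong2)
    fix x u y v assume "(x, u) \<in> set (dc s)" "(y, v) \<in> set (dc t)"
    then have "set u \<subseteq> V" "set v \<subseteq> V" "length u = p" "length v = q" using st dco_V dco_length by blast+
    then show "pure es [(x * y, 0), (0, f p q (tmult es (\<kappa> u) (\<kappa> v)))] = pure es [(x * y, 0), (0, rb p q (pure ms (u @ v)))]"
      by (simp add: rb_pure)
  qed
  finally show ?thesis
    unfolding tbind_lcoact[OF Q, symmetric]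
    using tbind_pure2[OF Q lin_fst[OF lin_id] lin_snd[OF lin_id]] by (simp add: tbind_sum_list2)
qed

text \<open>Balancedness moves x to the second factor, where \<open>L_kap\<close> splits it into an
  adjoint action of x1 on t and a right factor x2. Right linearity of \<open>f\<close> then takes
  the right factor x2 y outside.\<close>

lemma f_RR:
  assumes s: "set s \<subseteq> V" "length s = p" and t: "set t \<subseteq> V" "length t = q" and G: "lin ms tscale G"
  shows "G (f p q (tmult es (R x (\<kappa> s)) (R y (\<kappa> t))))
    = (\<Sum>(a, b)\<leftarrow>cop H x. G (ra (rb p q (tmult ms (pure ms s) (AD.da t a))) (b * y)))"
proof -
  have \<kappa>: "\<kappa> s \<in> C p" "\<kappa> t \<in> C q" using s t kap_cotensor by auto
  have KC: "K (AD.da t a) \<in> C q" for a by (rule K_cotensor[OF da_T[OF t]])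
  have sT: "pure ms s \<in> T p" using s by (auto intro!: tpow_pure)
  have "f p q (tmult es (R x (\<kappa> s)) (R y (\<kappa> t))) = f p q (tmult es (\<kappa> s) (R y (L x (\<kappa> t))))"
    using f_balanced[OF \<kappa>(1) R_cotensor[OF \<kappa>(2)]] L_R[OF kap_TT] by simp
  also have "R y (L x (\<kappa> t)) = (\<Sum>(a, b)\<leftarrow>cop H x. R (b * y) (K (AD.da t a)))"
    by (simp add: L_kap dactT_sum_list2 R_mult C_TT[OF KC])
  also have "tmult es (\<kappa> s) \<dots> = (\<Sum>(a, b)\<leftarrow>cop H x. tmult es (\<kappa> s) (R (b * y) (K (AD.da t a))))"
    by (intro tmult_sum_list2_right kap_TT C_TT[OF R_cotensor[OF KC]])
  also have "f p q \<dots> = (\<Sum>(a, b)\<leftarrow>cop H x. f p q (tmult es (\<kappa> s) (R (b * y) (K (AD.da t a)))))"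
    by (intro linear_on_sum_list2[OF f_linear D_subspace vs_m] D_tmult \<kappa> R_cotensor KC)
  also have "\<dots> = (\<Sum>(a, b)\<leftarrow>cop H x. ra (rb p q (tmult ms (pure ms s) (AD.da t a))) (b * y))"
    by (simp add: f_ra[OF \<kappa>(1) KC] rb_tmult[OF sT da_T[OF t]] K_pure)
  finally show ?thesis by (simp add: lin_sum_list2[OF G])
qed

text \<open>Let x1 f(s \<otimes> t) S(x2) stand for the adjoint action on the value. The left factor
  enters s as an adjoint action followed by a right factor; balancedness moves that factor to t,
  where it splits in the same way. This gives x1 . s and (x2 . t) x3, and x3 cancels against
  S(x4).\<close>

lemma rb_ad:
  assumes w: "set w \<subseteq> V" "length w = p + q"
  shows "ad x (rb p q (pure ms w)) = rb p q (AD.da w x)"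
proof -
  obtain s t where st: "w = s @ t" "set s \<subseteq> V" "set t \<subseteq> V" "length s = p" "length t = q" using split_word[OF w] .
  note s = st(2,4) and t = st(3,5)
  have \<kappa>: "\<kappa> s \<in> C p" "\<kappa> t \<in> C q" using s t kap_cotensor by auto
  have KC: "K (AD.da t a) \<in> C q" "K (AD.da s a) \<in> C p" for a
    by (rule K_cotensor[OF da_T[OF t]], rule K_cotensor[OF da_T[OF s]])
  have KT: "K (AD.da t a) \<in> TT es" "K (AD.da s a) \<in> TT es" for a using C_TT[OF KC(1)] C_TT[OF KC(2)] by auto
  define Q where "Q c d e = pure ms [f p q (tmult es (K (AD.da s c)) (R e (K (AD.da t d))))]" for c d e
  have m: "tmult es (K (AD.da s c)) (R e (K (AD.da t d))) \<in> D p q" for c d e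
    by (intro D_tmult KC R_cotensor)
  have lQ: "lin hs tscale (\<lambda>c. Q c d e)" "lin hs tscale (\<lambda>d. Q c d e)" "lin hs tscale (\<lambda>e. Q c d e)" for c d e
    unfolding Q_def by (intro lin_intros m KT TT_intros)+
  note [lin_intros] = lin_comp[OF lQ(1)] lin_comp[OF lQ(2)] lin_comp[OF lQ(3)]
  have G: "pure ms [ra (la a (rb p q (pure ms w))) h] = (\<Sum>(c, d)\<leftarrow>cop H a. \<Sum>(d1, d2)\<leftarrow>cop H d. Q c d1 (d2 * h))" for a h
  proof -
    have "ra (la a (rb p q (pure ms w))) h = f p q (tmult es (L a (\<kappa> s)) (R h (\<kappa> t)))"
      using st \<kappa> by (simp add: rb_pure f_la f_ra L_cotensor)
    also have "\<dots> = f p q (\<Sum>(c, d)\<leftarrow>cop H a. tmult es (R d (K (AD.da s c))) (R h (\<kappa> t)))"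
      by (simp add: L_kap tmult_sum_list2_left)
    also have "\<dots> = (\<Sum>(c, d)\<leftarrow>cop H a. f p q (tmult es (R d (K (AD.da s c))) (R h (\<kappa> t))))"
      by (intro linear_on_sum_list2[OF f_linear D_subspace vs_m] D_tmult \<kappa> R_cotensor KC)
    also have "\<dots> = (\<Sum>(c, d)\<leftarrow>cop H a. f p q (\<Sum>(d1, d2)\<leftarrow>cop H d. tmult es (K (AD.da s c)) (R (d2 * h) (K (AD.da t d1)))))"
    proof (rule sum_list_cong2)
      fix c d
      have "L d (R h (\<kappa> t)) = (\<Sum>(d1, d2)\<leftarrow>cop H d. R (d2 * h) (K (AD.da t d1)))"
        by (simp add: L_R[OF kap_TT] L_kap dactT_sum_list2 R_mult KT)
      then have "tmult es (K (AD.da s c)) (L d (R h (\<kappa> t))) = (\<Sum>(d1, d2)\<leftarrow>cop H d. tmult es (K (AD.da s c)) (R (d2 * h) (K (AD.da t d1))))"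
        by (simp only:) (intro tmult_sum_list2_right KT C_TT[OF R_cotensor[OF KC(1)]])
      then show "f p q (tmult es (R d (K (AD.da s c))) (R h (\<kappa> t))) = f p q (\<Sum>(d1, d2)\<leftarrow>cop H d. tmult es (K (AD.da s c)) (R (d2 * h) (K (AD.da t d1))))"
        using f_balanced[OF KC(2) R_cotensor[OF \<kappa>(2)]] by simp
    qed
    also have "\<dots> = (\<Sum>(c, d)\<leftarrow>cop H a. \<Sum>(d1, d2)\<leftarrow>cop H d. f p q (tmult es (K (AD.da s c)) (R (d2 * h) (K (AD.da t d1)))))"
      by (intro sum_list_cong2[OF linear_on_sum_list2[OF f_linear D_subspace vs_m]] m)
    finally show ?thesis unfolding Q_def by (simp add: lin_sum_list2[OF lin_pure1[OF lin_id]])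
  qed
  have "pure ms [ad x (rb p q (pure ms w))] = (\<Sum>(a, b)\<leftarrow>cop H x. pure ms [ra (la a (rb p q (pure ms w))) (S b)])"
    by (rule ad_F) (intro lin_intros)
  also have "\<dots> = (\<Sum>(a, b)\<leftarrow>cop H x. \<Sum>(c, d)\<leftarrow>cop H a. \<Sum>(d1, d2)\<leftarrow>cop H d. Q c d1 (d2 * S b))"
    by (simp only: G)
  also have "\<dots> = (\<Sum>(c, r)\<leftarrow>cop H x. \<Sum>(d, b)\<leftarrow>cop H r. \<Sum>(d1, d2)\<leftarrow>cop H d. Q c d1 (d2 * S b))"
    by (rule cop_coassoc; intro lin_intros)
  also have "\<dots> = (\<Sum>(c, r)\<leftarrow>cop H x. \<Sum>(d1, z)\<leftarrow>cop H r. \<Sum>(d2, b)\<leftarrow>cop H z. Q c d1 (d2 * S b))"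
    by (rule sum_list_cong2, rule cop_coassoc; intro lin_intros)
  also have "\<dots> = (\<Sum>(c, r)\<leftarrow>cop H x. \<Sum>(d1, z)\<leftarrow>cop H r. tscale (\<epsilon> z) (Q c d1 1))"
    by (intro sum_list_cong2 cop_antipode_r lin_intros)
  also have "\<dots> = (\<Sum>(c, r)\<leftarrow>cop H x. Q c r 1)"
    by (intro sum_list_cong2 cop_counit_r lin_intros)
  also have "\<dots> = (\<Sum>(c, r)\<leftarrow>cop H x. pure ms [rb p q (tmult ms (AD.da s c) (AD.da t r))])"
    using rb_tmult[OF da_T[OF s] da_T[OF t]] KC by (simp add: Q_def R_1 KT)
  also have "\<dots> = pure ms [rb p q (AD.da w x)]"
  proof -
    have "rb p q (AD.da w x) = (\<Sum>(c, r)\<leftarrow>cop H x. rb p q (tmult ms (AD.da s c) (AD.da t r)))"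
      unfolding st(1) AD.da_append
      by (rule linear_on_sum_list2[OF rb_linear tpow_subspace vs_m]) (intro tpow_tmult da_T[OF s] da_T[OF t])
    then show ?thesis by (simp add: lin_sum_list2[OF lin_pure1[OF lin_id]])
  qed
  finally show ?thesis by (simp add: pure_single_inject[OF vs_m])
qed

section \<open>Convolution powers of f on embedded words and their left coaction\<close>

lemma F_Suc_kap:
  assumes n: "n \<ge> 1" and s: "set s \<subseteq> V" "length s = i" and t: "set t \<subseteq> V" "length t = j"
  shows "F (Suc n) i j (tmult es (\<kappa> s) (\<kappa> t)) = (\<Sum>p\<le>i. \<Sum>q\<le>j. \<Sum>(x, u)\<leftarrow>dc (drop p s). \<Sum>(y, v)\<leftarrow>dc (drop q t).
    tmult es (pure es [(0, f p q (tmult es (R x (\<kappa> (take p s))) (R y (\<kappa> (take q t)))))]) (F n (i - p) (j - q) (tmult es (\<kappa> u) (\<kappa> v))))"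
proof -
  let ?A = "\<lambda>s p. map (\<lambda>(x, u). (R x (\<kappa> (take p s)), \<kappa> u)) (dc (drop p s))"
  have d: "dec p (length s - p) (\<kappa> s) = (\<Sum>(a, b)\<leftarrow>?A s p. tmult es a b) \<and> set (?A s p) \<subseteq> C p \<times> C (length s - p)"
    if s: "set s \<subseteq> V" and p: "p \<le> length s" for s p
  proof
    have V: "set (take p s) \<subseteq> V" "set (drop p s) \<subseteq> V" using s by (auto dest: in_set_takeD in_set_dropD)
    show "dec p (length s - p) (\<kappa> s) = (\<Sum>(a, b)\<leftarrow>?A s p. tmult es a b)"
      using dec_kap[OF V, of p "length s - p"] p by (simp add: comp_def case_prod_beta')
    have "R x (\<kappa> (take p s)) \<in> C p \<and> \<kappa> u \<in> C (length s - p)" if "(x, u) \<in> set (dc (drop p s))" for x u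
      using R_cotensor[OF kap_cotensor[OF V(1)]] kap_cotensor[OF dco_V[OF that V(2)]] dco_length[OF that] p by simp
    then show "set (?A s p) \<subseteq> C p \<times> C (length s - p)" by auto
  qed
  have "F (Suc n) i j (tmult es (\<kappa> s) (\<kappa> t)) = (\<Sum>p\<le>i. \<Sum>q\<le>j. \<Sum>(a, b)\<leftarrow>?A s p. \<Sum>(c, d)\<leftarrow>?A t q.
    tmult es (pure es [(0, f p q (tmult es a c))]) (F n (i - p) (j - q) (tmult es b d)))"
  proof (rule F_Suc[OF n])
    show "\<kappa> s \<in> C i" "\<kappa> t \<in> C j" using kap_cotensor s t by auto
  qed (use d[OF s(1)] d[OF t(1)] s(2) t(2) in blast)+
  then show ?thesis by (simp add: comp_def case_prod_beta')
qed

text \<open>\<open>dco_coassoc\<close> asks for functions multilinear on all words, whereas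
  \<open>F n i j\<close> is linear on \<open>D i j\<close> only, which is known to contain the
  embedded words over the coinvariants. Composing with a linear projection onto \<open>D i j\<close>
  gives a total multilinear function with the right values there.\<close>

lemma F_extension:
  assumes n: "n \<ge> 1"
  obtains N where "\<And>v. mlin ms (\<lambda>u. N u v)" "\<And>u. mlin ms (N u)" "\<And>u v. N u v \<in> TT es"
    "\<And>u v. set u \<subseteq> V \<Longrightarrow> length u = i \<Longrightarrow> set v \<subseteq> V \<Longrightarrow> length v = j \<Longrightarrow> F n i j (tmult es (\<kappa> u) (\<kappa> v)) = N u v"
proof -
  obtain \<pi> where \<pi>: "lin tscale tscale \<pi>" "\<And>t. \<pi> t \<in> D i j" "\<And>t. t \<in> D i j \<Longrightarrow> \<pi> t = t"
    by (rule subspace_projection[OF D_subspace[of i j]]) (rule that)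
  note FL = F_LM[OF n, of i j]
  have l: "lin tscale tscale (\<lambda>t. F n i j (\<pi> t))"
    using LM_linear[OF FL] \<pi>(1,2) by (simp add: linear_on_def)
  define N where "N u v = F n i j (\<pi> (tmult es (\<kappa> u) (\<kappa> v)))" for u v
  show ?thesis
  proof (rule that[of N])
    show "mlin ms (\<lambda>u. N u v)" for v
      unfolding N_def mlin_def by (intro allI lin_comp[OF l] lin_intros mlinD[OF mlin_kap])
    show "mlin ms (N u)" for u
      unfolding N_def mlin_def by (intro allI lin_comp[OF l] lin_intros mlinD[OF mlin_kap] TT_intros)
    show "N u v \<in> TT es" for u v
      unfolding N_def by (rule tpow_TTD[OF LM_mem[OF FL \<pi>(2)]])
    show "F n i j (tmult es (\<kappa> u) (\<kappa> v)) = N u v" if "set u \<subseteq> V" "length u = i" "set v \<subseteq> V" "length v = j" for u v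
      using \<pi>(3)[of "tmult es (\<kappa> u) (\<kappa> v)"] D_tmult[OF kap_cotensor[OF that(1)] kap_cotensor[OF that(3)]] that by (simp add: N_def)
  qed
qed

lemma f_RR_colinear:
  assumes s: "set s \<subseteq> V" "length s = p" and t: "set t \<subseteq> V" "length t = q"
    and Q: "\<And>n. lin hs tscale (\<lambda>h. Q h n)" "\<And>h. lin ms tscale (\<lambda>n. Q h n)"
  shows "(\<Sum>(h, m)\<leftarrow>lc H M (f p q (tmult es (R x (\<kappa> s)) (R y (\<kappa> t)))). Q h m)
    = (\<Sum>(z, w)\<leftarrow>dc s. \<Sum>(a, b)\<leftarrow>cop H x. \<Sum>(z', w')\<leftarrow>dc t. \<Sum>(a', b')\<leftarrow>cop H y.
        Q (z * a * (z' * a')) (f p q (tmult es (R b (\<kappa> w)) (R b' (\<kappa> w')))))"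
proof -
  define A where "A s x = concat (map (\<lambda>(z, w). map (\<lambda>(a, b). (z * a, R b (\<kappa> w))) (cop H x)) (dc s))" for s x
  have A: "(\<Sum>(h, y)\<leftarrow>A s x. G h y) = (\<Sum>(z, w)\<leftarrow>dc s. \<Sum>(a, b)\<leftarrow>cop H x. G (z * a) (R b (\<kappa> w)))"
    for s x and G :: "'h \<Rightarrow> ('k, 'h \<times> 'm) tensor \<Rightarrow> ('k, 'h \<times> 'm) tensor"
    unfolding A_def by (simp add: map_concat sum_list_concat comp_def case_prod_beta')
  have C: "snd ` set (A s x) \<subseteq> C (length s)" if s: "set s \<subseteq> V" for s x
  proof -
    have "R b (\<kappa> w) \<in> C (length s)" if "(z, w) \<in> set (dc s)" for z w b
      using R_cotensor[OF kap_cotensor[OF dco_V[OF that s]]] dco_length[OF that] by simp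
    then show ?thesis unfolding A_def by auto
  qed
  have d: "\<delta> (R x (\<kappa> s)) = (\<Sum>(h, y)\<leftarrow>A s x. tmult es (pure es [(h, 0)]) y)" for s x
    unfolding A apply_lco_R[OF kap_TT] lco_kap
    by (simp add: dactT_sum_list2 ER.dT_tmult R_single del: ER.dT_pure)
  have "lcoact M (f p q (tmult es (R x (\<kappa> s)) (R y (\<kappa> t))))
    = (\<Sum>(h, u)\<leftarrow>A s x. \<Sum>(h', v)\<leftarrow>A t y. pure es [(h * h', 0), (0, f p q (tmult es u v))])"
    using f_colinear[OF R_cotensor[OF kap_cotensor[OF s(1)]] d C[OF s(1)] R_cotensor[OF kap_cotensor[OF t(1)]] d C[OF t(1)]] s t
    by simp
  then show ?thesis
    unfolding tbind_lcoact[OF Q, symmetric] A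
    using tbind_pure2[OF Q lin_fst[OF lin_id] lin_snd[OF lin_id]] by (simp add: tbind_sum_list2)
qed

lemma coaction_cons:
  assumes "y \<in> TT es"
  shows "\<delta> (tmult es (pure es [(0, m)]) y) = (\<Sum>(h, n)\<leftarrow>lc H M m. tmult es (pure es [(h, 0)]) (tmult es (pure es [(0, n)]) y))"
proof -
  have "tmult es (pure es [(h, 0), (0, n)]) y = tmult es (pure es [(h, 0)]) (tmult es (pure es [(0, n)]) y)" for h n
    using tmult_assoc[OF assms, of "pure es [(h, 0)]" "pure es [(0, n)]"] by (simp add: tmult_pure)
  moreover have "pure es [(0, m)] \<in> tpow es UNIV 1" by (auto intro!: tpow_pure)
  ultimately show ?thesis
    using LC.apply_at_left[of "pure es [(0, m)]" 1 y 0] assms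
    by (simp add: LC.apply_at_single lco_m tmult_sum_list2_left)
qed

text \<open>One bidegree of the recursion for convolution powers. By \<open>coaction_cons\<close>
  the coaction of the product is that of its first factor, and through the right factors x and y it
  also involves the coactions of s2 and t2. Coassociativity, applied to t2 and to s2, separates the
  legs that go to \<open>H\<close> from those that stay as right factors; the other steps
  interchange sums.\<close>

lemma coaction_step:
  assumes s: "set s1 \<subseteq> V" "length s1 = p" and t: "set t1 \<subseteq> V" "length t1 = q"
    and N: "\<And>v. mlin ms (\<lambda>u. N u v)" "\<And>u. mlin ms (N u)" "\<And>u v. N u v \<in> TT es"
  shows "(\<Sum>(x, u)\<leftarrow>dc s2. \<Sum>(y, v)\<leftarrow>dc t2. \<delta> (tmult es (pure es [(0, f p q (tmult es (R x (\<kappa> s1)) (R y (\<kappa> t1))))]) (N u v)))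
    = (\<Sum>(z, w)\<leftarrow>dc s1. \<Sum>(c, r)\<leftarrow>dc s2. \<Sum>(z', w')\<leftarrow>dc t1. \<Sum>(c', r')\<leftarrow>dc t2. \<Sum>(x, u)\<leftarrow>dc r. \<Sum>(y, v)\<leftarrow>dc r'.
        tmult es (pure es [(z * c * (z' * c'), 0)]) (tmult es (pure es [(0, f p q (tmult es (R x (\<kappa> w)) (R y (\<kappa> w'))))]) (N u v)))"
proof -
  define E where "E z w z' w' a b u a' b' v =
    tmult es (pure es [(z * a * (z' * a'), 0)]) (tmult es (pure es [(0, f p q (tmult es (R b (\<kappa> w)) (R b' (\<kappa> w'))))]) (N u v))"
    for z w z' w' a b u a' b' v
  have NT: "lin hs tscale G \<Longrightarrow> lin hs tscale (\<lambda>x. tmult es (G x) (N u v))" for G u v by (intro lin_intros)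
  have lE: "lin hs tscale (\<lambda>a. E z w z' w' a b u a' b' v)" "lin hs tscale (\<lambda>b. E z w z' w' a b u a' b' v)"
    "lin hs tscale (\<lambda>a'. E z w z' w' a b u a' b' v)" "lin hs tscale (\<lambda>b'. E z w z' w' a b u a' b' v)"
    "mlin ms (\<lambda>u. E z w z' w' a b u a' b' v)" "mlin ms (\<lambda>v. E z w z' w' a b u a' b' v)"
    if w: "(z, w) \<in> set (dc s1)" "(z', w') \<in> set (dc t1)" for z w z' w' a b u a' b' v
  proof -
    have m: "tmult es (R b (\<kappa> w)) (R b' (\<kappa> w')) \<in> D p q" for b b'
      using R_kap_cotensor dco_V[OF w(1) s(1)] dco_V[OF w(2) t(1)] dco_length[OF w(1)] dco_length[OF w(2)] s(2) t(2)
      by (intro D_tmult) auto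
    show "lin hs tscale (\<lambda>a. E z w z' w' a b u a' b' v)" "lin hs tscale (\<lambda>b. E z w z' w' a b u a' b' v)"
      "lin hs tscale (\<lambda>a'. E z w z' w' a b u a' b' v)" "lin hs tscale (\<lambda>b'. E z w z' w' a b u a' b' v)"
      unfolding E_def by (intro lin_intros m TT_intros N(3))+
    show "mlin ms (\<lambda>u. E z w z' w' a b u a' b' v)" "mlin ms (\<lambda>v. E z w z' w' a b u a' b' v)"
      unfolding E_def mlin_def by (intro allI lin_intros mlinD[OF N(1)] mlinD[OF N(2)] TT_intros N(3))+
  qed
  have "(\<Sum>(x, u)\<leftarrow>dc s2. \<Sum>(y, v)\<leftarrow>dc t2. \<delta> (tmult es (pure es [(0, f p q (tmult es (R x (\<kappa> s1)) (R y (\<kappa> t1))))]) (N u v)))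
    = (\<Sum>(x, u)\<leftarrow>dc s2. \<Sum>(y, v)\<leftarrow>dc t2. \<Sum>(z, w)\<leftarrow>dc s1. \<Sum>(a, b)\<leftarrow>cop H x. \<Sum>(z', w')\<leftarrow>dc t1. \<Sum>(a', b')\<leftarrow>cop H y. E z w z' w' a b u a' b' v)"
    unfolding E_def coaction_cons[OF N(3)]
    by (rule sum_list_cong2, rule sum_list_cong2, rule f_RR_colinear[OF s t]; intro lin_intros TT_intros N(3))
  also have "\<dots> = (\<Sum>(x, u)\<leftarrow>dc s2. \<Sum>(z, w)\<leftarrow>dc s1. \<Sum>(y, v)\<leftarrow>dc t2. \<Sum>(a, b)\<leftarrow>cop H x. \<Sum>(z', w')\<leftarrow>dc t1. \<Sum>(a', b')\<leftarrow>cop H y. E z w z' w' a b u a' b' v)"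
    by (rule sum_list_cong2, rule sum_list_swap)
  also have "\<dots> = (\<Sum>(z, w)\<leftarrow>dc s1. \<Sum>(x, u)\<leftarrow>dc s2. \<Sum>(y, v)\<leftarrow>dc t2. \<Sum>(a, b)\<leftarrow>cop H x. \<Sum>(z', w')\<leftarrow>dc t1. \<Sum>(a', b')\<leftarrow>cop H y. E z w z' w' a b u a' b' v)"
    by (rule sum_list_swap)
  also have "\<dots> = (\<Sum>(z, w)\<leftarrow>dc s1. \<Sum>(x, u)\<leftarrow>dc s2. \<Sum>(a, b)\<leftarrow>cop H x. \<Sum>(y, v)\<leftarrow>dc t2. \<Sum>(z', w')\<leftarrow>dc t1. \<Sum>(a', b')\<leftarrow>cop H y. E z w z' w' a b u a' b' v)"
    by (rule sum_list_cong2, rule sum_list_cong2, rule sum_list_swap)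
  also have "\<dots> = (\<Sum>(z, w)\<leftarrow>dc s1. \<Sum>(x, u)\<leftarrow>dc s2. \<Sum>(a, b)\<leftarrow>cop H x. \<Sum>(z', w')\<leftarrow>dc t1. \<Sum>(y, v)\<leftarrow>dc t2. \<Sum>(a', b')\<leftarrow>cop H y. E z w z' w' a b u a' b' v)"
    by (rule sum_list_cong2, rule sum_list_cong2, rule sum_list_cong2, rule sum_list_swap)
  also have "\<dots> = (\<Sum>(z, w)\<leftarrow>dc s1. \<Sum>(x, u)\<leftarrow>dc s2. \<Sum>(a, b)\<leftarrow>cop H x. \<Sum>(z', w')\<leftarrow>dc t1. \<Sum>(c', r')\<leftarrow>dc t2. \<Sum>(y, v)\<leftarrow>dc r'. E z w z' w' a b u c' y v)"
    by (rule sum_list_cong2, rule sum_list_cong2, rule sum_list_cong2, rule sum_list_cong2) (rule dco_coassoc; rule lE)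
  also have "\<dots> = (\<Sum>(z, w)\<leftarrow>dc s1. \<Sum>(c, r)\<leftarrow>dc s2. \<Sum>(x, u)\<leftarrow>dc r. \<Sum>(z', w')\<leftarrow>dc t1. \<Sum>(c', r')\<leftarrow>dc t2. \<Sum>(y, v)\<leftarrow>dc r'. E z w z' w' c x u c' y v)"
    by (rule sum_list_cong2, rule dco_coassoc; (unfold mlin_def)?; intro allI lin_tscale_sum_list; clarsimp;
        intro lin_tscale_sum_list; clarsimp; intro lin_tscale_sum_list; clarsimp; intro lE mlinD[OF lE(5)])
  also have "\<dots> = (\<Sum>(z, w)\<leftarrow>dc s1. \<Sum>(c, r)\<leftarrow>dc s2. \<Sum>(z', w')\<leftarrow>dc t1. \<Sum>(x, u)\<leftarrow>dc r. \<Sum>(c', r')\<leftarrow>dc t2. \<Sum>(y, v)\<leftarrow>dc r'. E z w z' w' c x u c' y v)"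
    by (rule sum_list_cong2, rule sum_list_cong2, rule sum_list_swap)
  also have "\<dots> = (\<Sum>(z, w)\<leftarrow>dc s1. \<Sum>(c, r)\<leftarrow>dc s2. \<Sum>(z', w')\<leftarrow>dc t1. \<Sum>(c', r')\<leftarrow>dc t2. \<Sum>(x, u)\<leftarrow>dc r. \<Sum>(y, v)\<leftarrow>dc r'. E z w z' w' c x u c' y v)"
    by (rule sum_list_cong2, rule sum_list_cong2, rule sum_list_cong2, rule sum_list_swap)
  finally show ?thesis unfolding E_def .
qed

end

lemma lin_sum: "lin s1 s2 F \<Longrightarrow> F (\<Sum>i\<in>I. G i) = (\<Sum>i\<in>I. F (G i))"
  by (induction I rule: infinite_finite_induct) (simp_all add: lin_zero lin_add)

lemma linear_on_sum:
  assumes "vector_space s2" "\<And>i. i \<in> I \<Longrightarrow> linear_on s1 s2 X (F i)"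
  shows "linear_on s1 s2 X (\<lambda>x. \<Sum>i\<in>I. F i x)"
proof -
  interpret s2: vector_space s2 by fact
  show ?thesis using assms(2) by (simp add: linear_on_def sum.distrib s2.scale_sum_right)
qed

lemma linear_on_tpow_mem:
  assumes F: "linear_on tscale tscale (tpow s V n) F" "\<And>w. length w = n \<Longrightarrow> set w \<subseteq> V \<Longrightarrow> F (pure s w) \<in> Y"
    and Y: "tens.subspace Y" and t: "t \<in> tpow s V n"
  shows "F t \<in> Y"
proof -
  have "F (tscale 0 0) = tscale 0 (F 0)"
    using F(1) tens.subspace_0[OF tpow_subspace[of s V n]] unfolding linear_on_def by blast
  then have "tpow s V n \<subseteq> {t \<in> tpow s V n. F t \<in> Y}"
    using F Y tpow_subspace[of s V n] by (intro tpow_minimal) (auto simp: tens.subspace_def linear_on_def intro: tpow_pure)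
  then show ?thesis using t by blast
qed

context brace
begin

text \<open>Left colinearity of the convolution powers on embedded words. \<open>F_kap_W\<close>
  needs it where a letter is prepended by \<open>K_cons\<close>, since this uses the coaction of the
  rest. With more than one factor, \<open>coaction_step\<close> treats each bidegree and
  \<open>dco_append\<close> puts the split words together again.\<close>

lemma F_coaction:
  assumes n: "n \<ge> 1" and s: "set s \<subseteq> V" "length s = i" and t: "set t \<subseteq> V" "length t = j"
  shows "\<delta> (F n i j (tmult es (\<kappa> s) (\<kappa> t)))
    = (\<Sum>(x, u)\<leftarrow>dc s. \<Sum>(y, v)\<leftarrow>dc t. tmult es (pure es [(x * y, 0)]) (F n i j (tmult es (\<kappa> u) (\<kappa> v))))"
proof -
  have word: "set u \<subseteq> V" "length u = length w" if "(x, u) \<in> set (dc w)" "set w \<subseteq> V" for x u w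
    using dco_V[OF that] dco_length[OF that(1)] by auto
  consider "n = 1" | m where "n = Suc m" "m \<ge> 1" using n by (cases n; cases "n - 1") auto
  then show ?thesis
  proof cases
    case 1
    have Dm: "tmult es (\<kappa> u) (\<kappa> v) \<in> D i j" if "set u \<subseteq> V" "length u = i" "set v \<subseteq> V" "length v = j" for u v
      using D_tmult[OF kap_cotensor[OF that(1)] kap_cotensor[OF that(3)]] that by simp
    have d: "\<delta> (\<kappa> s) = (\<Sum>(x, y)\<leftarrow>map (\<lambda>(x, u). (x, \<kappa> u)) (dc s). tmult es (pure es [(x, 0)]) y)" for s
      by (simp add: lco_kap comp_def case_prod_beta')
    have c: "snd ` set (map (\<lambda>(x, u). (x, \<kappa> u)) (dc s)) \<subseteq> C (length s)" if "set s \<subseteq> V" for s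
      using that kap_cotensor by (fastforce dest: dco_V dco_length)
    have "\<delta> (F n i j (tmult es (\<kappa> s) (\<kappa> t))) = lcoact M (f i j (tmult es (\<kappa> s) (\<kappa> t)))"
      using 1 F_1[OF Dm[OF s t]] by (simp add: LC.apply_at_single lco_m lc)
    also have "\<dots> = (\<Sum>(x, u)\<leftarrow>dc s. \<Sum>(y, v)\<leftarrow>dc t. pure es [(x * y, 0), (0, f i j (tmult es (\<kappa> u) (\<kappa> v)))])"
      using f_colinear[OF kap_cotensor[OF s(1)] d c[OF s(1)] kap_cotensor[OF t(1)] d c[OF t(1)]] s t
      by (simp add: comp_def case_prod_beta')
    also have "\<dots> = (\<Sum>(x, u)\<leftarrow>dc s. \<Sum>(y, v)\<leftarrow>dc t. tmult es (pure es [(x * y, 0)]) (F n i j (tmult es (\<kappa> u) (\<kappa> v))))"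
    proof (rule sum_list_cong2, rule sum_list_cong2)
      fix x u y v assume "(x, u) \<in> set (dc s)" "(y, v) \<in> set (dc t)"
      then have "tmult es (\<kappa> u) (\<kappa> v) \<in> D i j" using word s t by (intro Dm) auto
      then show "pure es [(x * y, 0), (0, f i j (tmult es (\<kappa> u) (\<kappa> v)))]
        = tmult es (pure es [(x * y, 0)]) (F n i j (tmult es (\<kappa> u) (\<kappa> v)))"
        using 1 F_1 by (simp add: tmult_pure)
    qed
    finally show ?thesis .
  next
    case (2 m)
    define B where "B p q s t = (\<Sum>(x, u)\<leftarrow>dc (drop p s). \<Sum>(y, v)\<leftarrow>dc (drop q t).
      tmult es (pure es [(0, f p q (tmult es (R x (\<kappa> (take p s))) (R y (\<kappa> (take q t)))))]) (F m (i - p) (j - q) (tmult es (\<kappa> u) (\<kappa> v))))"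
      for p q s t
    have FB: "F n i j (tmult es (\<kappa> u) (\<kappa> v)) = (\<Sum>p\<le>i. \<Sum>q\<le>j. B p q u v)"
      if "set u \<subseteq> V" "length u = i" "set v \<subseteq> V" "length v = j" for u v
      unfolding 2(1) B_def by (rule F_Suc_kap[OF 2(2) that])
    have pq: "\<delta> (B p q s t) = (\<Sum>(x, u)\<leftarrow>dc s. \<Sum>(y, v)\<leftarrow>dc t. tmult es (pure es [(x * y, 0)]) (B p q u v))
       \<and> (\<forall>(x, u)\<in>set (dc s). \<forall>(y, v)\<in>set (dc t). B p q u v \<in> TT es)"
      if pq: "p \<le> i" "q \<le> j" for p q
    proof -
      obtain N where N: "\<And>v. mlin ms (\<lambda>u. N u v)" "\<And>u. mlin ms (N u)" "\<And>u v. N u v \<in> TT es"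
        "\<And>u v. set u \<subseteq> V \<Longrightarrow> length u = i - p \<Longrightarrow> set v \<subseteq> V \<Longrightarrow> length v = j - q \<Longrightarrow> F m (i - p) (j - q) (tmult es (\<kappa> u) (\<kappa> v)) = N u v"
        by (rule F_extension[OF 2(2), of "i - p" "j - q"]) (rule that)
      define s1 s2 t1 t2 where st: "s1 = take p s" "s2 = drop p s" "t1 = take q t" "t2 = drop q t"
      have V: "set s1 \<subseteq> V" "set s2 \<subseteq> V" "set t1 \<subseteq> V" "set t2 \<subseteq> V"
        using s(1) t(1) unfolding st by (auto dest: in_set_takeD in_set_dropD)
      have len: "length s1 = p" "length s2 = i - p" "length t1 = q" "length t2 = j - q" using pq s(2) t(2) by (auto simp: st)
      have app: "s = s1 @ s2" "t = t1 @ t2" by (simp_all add: st)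
      have BN: "B p q (w @ r) (w' @ r') = (\<Sum>(x, u)\<leftarrow>dc r. \<Sum>(y, v)\<leftarrow>dc r'.
          tmult es (pure es [(0, f p q (tmult es (R x (\<kappa> w)) (R y (\<kappa> w'))))]) (N u v))"
        if "set r \<subseteq> V" "length r = i - p" "set r' \<subseteq> V" "length r' = j - q" "length w = p" "length w' = q" for w r w' r'
      proof -
        have "F m (i - p) (j - q) (tmult es (\<kappa> u) (\<kappa> v)) = N u v" if "(x, u) \<in> set (dc r)" "(y, v) \<in> set (dc r')" for x u y v
          using word[OF that(1)] word[OF that(2)] \<open>set r \<subseteq> V\<close> \<open>set r' \<subseteq> V\<close> \<open>length r = i - p\<close> \<open>length r' = j - q\<close>
          by (intro N(4)) auto
        then show ?thesis
          unfolding B_def using that(5,6) by (auto intro!: sum_list_cong2)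
      qed
      have "\<delta> (B p q s t) = (\<Sum>(x, u)\<leftarrow>dc s2. \<Sum>(y, v)\<leftarrow>dc t2. \<delta> (tmult es (pure es [(0, f p q (tmult es (R x (\<kappa> s1)) (R y (\<kappa> t1))))]) (N u v)))"
        unfolding app BN[OF V(2) len(2) V(4) len(4) len(1) len(3)] by (simp add: lin_sum_list2[OF lin_apply_at[OF lin_id]])
      also note coaction_step[OF V(1) len(1) V(3) len(3) N(1-3)]
      also have "(\<Sum>(z, w)\<leftarrow>dc s1. \<Sum>(c, r)\<leftarrow>dc s2. \<Sum>(z', w')\<leftarrow>dc t1. \<Sum>(c', r')\<leftarrow>dc t2. \<Sum>(x, u)\<leftarrow>dc r. \<Sum>(y, v)\<leftarrow>dc r'.
          tmult es (pure es [(z * c * (z' * c'), 0)]) (tmult es (pure es [(0, f p q (tmult es (R x (\<kappa> w)) (R y (\<kappa> w'))))]) (N u v)))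
        = (\<Sum>(z, w)\<leftarrow>dc s1. \<Sum>(c, r)\<leftarrow>dc s2. \<Sum>(z', w')\<leftarrow>dc t1. \<Sum>(c', r')\<leftarrow>dc t2.
          tmult es (pure es [(z * c * (z' * c'), 0)]) (B p q (w @ r) (w' @ r')))"
      proof (rule sum_list_cong2, rule sum_list_cong2, rule sum_list_cong2, rule sum_list_cong2)
        fix z w c r z' w' c' r'
        assume *: "(z, w) \<in> set (dc s1)" "(c, r) \<in> set (dc s2)" "(z', w') \<in> set (dc t1)" "(c', r') \<in> set (dc t2)"
        have "B p q (w @ r) (w' @ r') = (\<Sum>(x, u)\<leftarrow>dc r. \<Sum>(y, v)\<leftarrow>dc r'.
          tmult es (pure es [(0, f p q (tmult es (R x (\<kappa> w)) (R y (\<kappa> w'))))]) (N u v))"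
          using word[OF *(1) V(1)] word[OF *(2) V(2)] word[OF *(3) V(3)] word[OF *(4) V(4)] len by (intro BN) auto
        then show "(\<Sum>(x, u)\<leftarrow>dc r. \<Sum>(y, v)\<leftarrow>dc r'.
          tmult es (pure es [(z * c * (z' * c'), 0)]) (tmult es (pure es [(0, f p q (tmult es (R x (\<kappa> w)) (R y (\<kappa> w'))))]) (N u v)))
          = tmult es (pure es [(z * c * (z' * c'), 0)]) (B p q (w @ r) (w' @ r'))"
          by (simp add: tmult_sum_list2_right TT_intros N(3))
      qed
      also have "\<dots> = (\<Sum>(x, u)\<leftarrow>dc s. \<Sum>(y, v)\<leftarrow>dc t. tmult es (pure es [(x * y, 0)]) (B p q u v))"
        unfolding app by (simp only: dco_append)
      finally have "\<delta> (B p q s t) = (\<Sum>(x, u)\<leftarrow>dc s. \<Sum>(y, v)\<leftarrow>dc t. tmult es (pure es [(x * y, 0)]) (B p q u v))" .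
      moreover have "B p q u v \<in> TT es" if "(x, u) \<in> set (dc s)" "(y, v) \<in> set (dc t)" for x u y v
      proof -
        have "B p q (take p u @ drop p u) (take q v @ drop q v) \<in> TT es"
          using word[OF that(1) s(1)] word[OF that(2) t(1)] s t pq
          by (subst BN) (auto intro!: TT_intros N(3) dest: in_set_dropD)
        then show ?thesis by simp
      qed
      ultimately show ?thesis by blast
    qed
    have "\<delta> (F n i j (tmult es (\<kappa> s) (\<kappa> t))) = (\<Sum>p\<le>i. \<Sum>q\<le>j. \<delta> (B p q s t))"
      unfolding FB[OF s t] by (simp add: apply_at_def lin_sum[OF lin_tbind[OF lin_id]])
    also have "\<dots> = (\<Sum>p\<le>i. \<Sum>q\<le>j. \<Sum>(x, u)\<leftarrow>dc s. \<Sum>(y, v)\<leftarrow>dc t. tmult es (pure es [(x * y, 0)]) (B p q u v))"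
      using pq by (intro sum.cong refl) auto
    also have "\<dots> = (\<Sum>(x, u)\<leftarrow>dc s. \<Sum>(y, v)\<leftarrow>dc t. \<Sum>p\<le>i. \<Sum>q\<le>j. tmult es (pure es [(x * y, 0)]) (B p q u v))"
      by (simp only: sum_list_sum_swap)
    also have "\<dots> = (\<Sum>(x, u)\<leftarrow>dc s. \<Sum>(y, v)\<leftarrow>dc t. tmult es (pure es [(x * y, 0)]) (F n i j (tmult es (\<kappa> u) (\<kappa> v))))"
    proof (rule sum_list_cong2, rule sum_list_cong2)
      fix x u y v assume *: "(x, u) \<in> set (dc s)" "(y, v) \<in> set (dc t)"
      have TT: "B p q u v \<in> TT es" if "p \<le> i" "q \<le> j" for p q using pq[OF that] * by blast
      have "tmult es (pure es [(x * y, 0)]) (F n i j (tmult es (\<kappa> u) (\<kappa> v)))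
        = tmult es (pure es [(x * y, 0)]) (\<Sum>p\<le>i. \<Sum>q\<le>j. B p q u v)"
        using FB[of u v] word[OF *(1) s(1)] word[OF *(2) t(1)] s(2) t(2) by simp
      also have "\<dots> = (\<Sum>p\<le>i. tmult es (pure es [(x * y, 0)]) (\<Sum>q\<le>j. B p q u v))"
        by (rule tmult_sum_right) (auto intro!: TT_tensor_like TT_intros TT)
      also have "\<dots> = (\<Sum>p\<le>i. \<Sum>q\<le>j. tmult es (pure es [(x * y, 0)]) (B p q u v))"
        by (intro sum.cong refl tmult_sum_right) (auto intro!: TT_tensor_like TT_intros TT)
      finally show "(\<Sum>p\<le>i. \<Sum>q\<le>j. tmult es (pure es [(x * y, 0)]) (B p q u v))
        = tmult es (pure es [(x * y, 0)]) (F n i j (tmult es (\<kappa> u) (\<kappa> v)))" by simp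
    qed
    finally show ?thesis .
  qed
qed

text \<open>The map x \<otimes> y \<mapsto> m x \<otimes> y, by which the letter m takes up the leg
  in \<open>H\<close> of a left coaction.\<close>

definition absorb :: "'m \<Rightarrow> ('h \<times> 'm) list \<Rightarrow> ('k, 'h \<times> 'm) tensor" where
  "absorb m w = (case w of [] \<Rightarrow> 0 | e # u \<Rightarrow> pure es ((0, ra m (fst e)) # u))"

lemma mlin_absorb: "mlin es (absorb m)"
  unfolding mlin_def
proof (intro allI)
  fix u v
  have "lin es tscale (\<lambda>e. pure es ([] @ (0, ra m (fst e)) # v))" by (rule lin_pure) (intro lin_intros)
  moreover have "lin es tscale (\<lambda>e. pure es (((0, ra m (fst a)) # u') @ e # v))" for a u' by (rule lin_pure) (intro lin_intros)
  ultimately show "lin es tscale (\<lambda>e. absorb m (u @ e # v))" by (cases u) (simp_all add: absorb_def)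
qed

lemma tbind_absorb:
  assumes "y \<in> TT es"
  shows "tbind (tmult es (pure es [(x, 0)]) y) (absorb m) = tmult es (pure es [(0, ra m x)]) y"
  by (rule TT_eqI[OF assms, of "\<lambda>y. tbind (tmult es (pure es [(x, 0)]) y) (absorb m)" "\<lambda>y. tmult es (pure es [(0, ra m x)]) y"])
    (auto simp: tmult_pure tbind_pure_mlin[OF mlin_absorb] absorb_def intro!: lin_intros TT_intros)

text \<open>This is \<kappa>(m w) = m w(-1) \<otimes> w(0). The degree of \<open>w\<close> must be
  positive: \<kappa> of the empty word is the entry 1 in \<open>H\<close>, which would remain as an
  additional factor on the right-hand side.\<close>

lemma K_cons:
  assumes w: "w \<in> tpow ms UNIV n" and n: "n \<ge> 1"
  shows "K (tmult ms (pure ms [m]) w) = tbind (\<delta> (K w)) (absorb m)"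
proof (rule tpow_eqI[OF w vector_space_tscale, of "\<lambda>w. K (tmult ms (pure ms [m]) w)" "\<lambda>w. tbind (\<delta> (K w)) (absorb m)"])
  fix l :: "'m list" assume l: "length l = n"
  have "K (tmult ms (pure ms [m]) (pure ms l)) = (\<Sum>(x, v)\<leftarrow>dc l. tmult es (pure es [(0, ra m x)]) (kw v))"
    using kk_Cons[of m l] by (simp add: tmult_pure K_pure kap_kk)
  also have "\<dots> = (\<Sum>(x, v)\<leftarrow>dc l. tmult es (pure es [(0, ra m x)]) (\<kappa> v))"
  proof (rule sum_list_cong2)
    fix x v assume "(x, v) \<in> set (dc l)"
    then have "v \<noteq> []" using dco_length l n by fastforce
    then show "tmult es (pure es [(0, ra m x)]) (kw v) = tmult es (pure es [(0, ra m x)]) (\<kappa> v)" by (simp add: kap_kk)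
  qed
  also have "\<dots> = tbind (\<delta> (K (pure ms l))) (absorb m)"
    by (simp add: K_pure lco_kap tbind_sum_list2 tbind_absorb)
  finally show "K (tmult ms (pure ms [m]) (pure ms l)) = tbind (\<delta> (K (pure ms l))) (absorb m)" .
qed (auto intro!: lin_intros TT_intros simp: tpow_TTD)

subsection \<open>Convolution powers of the restricted maps\<close>

abbreviation W where "W \<equiv> conv_power ms (\<lambda>p q. tprod ms (T p) (T q)) tc (\<lambda>p q t. pure ms [rb p q t])"

lemma rb_LM: "LM (T (p + q)) (T 1) (\<lambda>t. pure ms [rb p q t])"
  using rb_V lin_pure1[OF rb_linear] by (auto simp: LM_def intro!: tpow_pure)

sublocale HW: bigraded_coalgebra ms "\<lambda>p q. tprod ms (T p) (T q)" tc "\<lambda>p q t. pure ms [rb p q t]" "\<lambda>p q. p + q"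
proof unfold_locales
  show "hsub ms (p + q) (tprod ms (T p) (T q))" for p q by (intro hsub_tprod hsub_tpow)
  show "LM (tprod ms (T (p + p')) (T (q + q'))) (tprod ms (tprod ms (T p) (T q)) (tprod ms (T p') (T q'))) (tc p q p' q')" for p q p' q'
    by (rule twisted_LM)
  show "LM (tprod ms (T p) (T q)) (tpow ms UNIV 1) (\<lambda>t. pure ms [rb p q t])" for p q
    using LM_linear[OF rb_LM[of p q]] by (auto simp: tprod_tpow LM_def intro: tpow_pure)
qed

lemma W_1: "t \<in> T (i + j) \<Longrightarrow> W (Suc 0) i j t = pure ms [rb i j t]"
  using HW.conv_power_1[of t i j] by (simp add: tprod_tpow)

text \<open>Compared with \<open>F_Suc_kap\<close>, only the rest of s coacts here, through the
  braiding. The coaction of the rest of t occurring there comes from \<kappa> itself.\<close>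

lemma W_Suc:
  assumes n: "n \<ge> 1" and s: "set s \<subseteq> V" "length s = i" and t: "set t \<subseteq> V" "length t = j"
  shows "W (Suc n) i j (pure ms (s @ t)) = (\<Sum>p\<le>i. \<Sum>q\<le>j. \<Sum>(x, r)\<leftarrow>dc (drop p s).
    tmult ms (pure ms [rb p q (tmult ms (pure ms (take p s)) (AD.da (take q t) x))]) (W n (i - p) (j - q) (pure ms (r @ drop q t))))"
proof -
  have m: "pure ms (s @ t) \<in> tprod ms (T i) (T j)" using s t by (auto simp: tprod_tpow intro!: tpow_pure)
  show ?thesis
    unfolding HW.conv_power_Suc[OF n m]
  proof (intro sum.cong refl)
    fix p q assume "p \<in> {..i}" "q \<in> {..j}"
    define s1 s2 t1 t2 where st: "s1 = take p s" "s2 = drop p s" "t1 = take q t" "t2 = drop q t"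
    have V: "set s1 \<subseteq> V" "set s2 \<subseteq> V" "set t1 \<subseteq> V" "set t2 \<subseteq> V"
      using s(1) t(1) unfolding st by (auto dest: in_set_takeD in_set_dropD)
    have len: "length s1 = p" "length s2 = i - p" "length t1 = q" "length t2 = j - q"
      using \<open>p \<in> {..i}\<close> \<open>q \<in> {..j}\<close> s(2) t(2) by (auto simp: st)
    let ?T = "tensor_map ms ms (tprod ms (T p) (T q)) (\<lambda>t. pure ms [rb p q t]) (tprod ms (T (i - p)) (T (j - q))) (W n (i - p) (j - q))"
    note TM = tensor_map_LM[OF HW.D HW.D HW.F HW.conv_power_LM[OF n] tpow_TT tpow_TT]
    have m1: "tmult ms (pure ms s1) (AD.da t1 x) \<in> tprod ms (T p) (T q)" for x
      using V len by (intro tprod_tmult tpow_pure da_T)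
    have m2: "pure ms (r @ t2) \<in> tprod ms (T (i - p)) (T (j - q))" if "(x, r) \<in> set (dc s2)" for x r
      using dco_V[OF that V(2)] dco_length[OF that] V len by (auto simp: tprod_tpow intro!: tpow_pure)
    have "?T (tc p q (i - p) (j - q) (pure ms (s @ t)))
      = ?T (\<Sum>(x, r)\<leftarrow>dc s2. tmult ms (tmult ms (pure ms s1) (AD.da t1 x)) (pure ms (r @ t2)))"
      using twisted_pure[OF V len] by (simp add: st)
    also have "\<dots> = (\<Sum>(x, r)\<leftarrow>dc s2. ?T (tmult ms (tmult ms (pure ms s1) (AD.da t1 x)) (pure ms (r @ t2))))"
      by (rule LM_sum_list2[OF TM(1) tprod_subspace]) (intro tprod_tmult m1 m2)
    also have "\<dots> = (\<Sum>(x, r)\<leftarrow>dc s2. tmult ms (pure ms [rb p q (tmult ms (pure ms s1) (AD.da t1 x))]) (W n (i - p) (j - q) (pure ms (r @ t2))))"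
      by (rule sum_list_cong2) (rule TM(2)[OF m1 m2])
    finally show "?T (tc p q (i - p) (j - q) (pure ms (s @ t))) = (\<Sum>(x, r)\<leftarrow>dc (drop p s).
      tmult ms (pure ms [rb p q (tmult ms (pure ms (take p s)) (AD.da (take q t) x))]) (W n (i - p) (j - q) (pure ms (r @ drop q t))))"
      by (simp only: st)
  qed
qed

lemma W_linear: "n \<ge> 1 \<Longrightarrow> linear_on tscale tscale (T (i + j)) (W n i j)"
  using LM_linear[OF HW.conv_power_LM[of n i j]] by (simp add: tprod_tpow)

text \<open>The values have to stay over the coinvariants, because the restricted maps and the
  embedding are controlled only there.\<close>

lemma W_LM: "n \<ge> 1 \<Longrightarrow> LM (T (i + j)) (T n) (W n i j)"
proof (induction n arbitrary: i j rule: dec_induct)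
  case base
  show ?case using LM_cong[OF rb_LM tpow_subspace, of i j "W (Suc 0) i j"] W_1 by simp
next
  case (step n)
  have "W (Suc n) i j t \<in> T (Suc n)" if "t \<in> T (i + j)" for t
  proof (rule linear_on_tpow_mem[OF W_linear _ tpow_subspace that])
    fix w assume "length w = i + j" "set w \<subseteq> V"
    then obtain s t where st: "w = s @ t" "set s \<subseteq> V" "set t \<subseteq> V" "length s = i" "length t = j"
      using split_word by blast
    have "tmult ms (pure ms [rb p q (tmult ms (pure ms (take p s)) (AD.da (take q t) x))]) (W n (i - p) (j - q) (pure ms (r @ drop q t))) \<in> T (Suc n)"
      if "p \<le> i" "q \<le> j" "(x, r) \<in> set (dc (drop p s))" for p q x r
    proof -
      have V: "set (take p s) \<subseteq> V" "set (drop p s) \<subseteq> V" "set (take q t) \<subseteq> V" "set (drop q t) \<subseteq> V"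
        using st by (auto dest: in_set_takeD in_set_dropD)
      have "pure ms (r @ drop q t) \<in> T ((i - p) + (j - q))"
        using dco_V[OF that(3) V(2)] dco_length[OF that(3)] V st that(1,2) by (auto intro!: tpow_pure)
      then have "W n (i - p) (j - q) (pure ms (r @ drop q t)) \<in> T n" using LM_mem[OF step.IH] by blast
      moreover have "pure ms (take p s) \<in> T p" "AD.da (take q t) x \<in> T q"
        using V st that(1,2) by (auto intro!: tpow_pure da_T)
      then have "pure ms [rb p q (tmult ms (pure ms (take p s)) (AD.da (take q t) x))] \<in> T 1"
        by (intro LM_mem[OF rb_LM] tpow_tmult)
      ultimately show ?thesis using tpow_tmult[of _ ms V 1 _ n] by simp
    qed
    then show "W (Suc n) i j (pure ms w) \<in> T (Suc n)"
      unfolding st(1) W_Suc[OF step.hyps(1) st(2,4,3,5)]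
      by (intro tens.subspace_sum[OF tpow_subspace] subspace_sum_list2[OF tpow_subspace]) auto
  qed simp
  then show ?case using W_linear[of "Suc n" i j] by (simp add: LM_def)
qed

text \<open>Induction on the number of factors, comparing \<open>F_Suc_kap\<close> with
  \<open>W_Suc\<close> in each bidegree. \<open>f_RR\<close> turns the coaction of the rest of s
  into an adjoint action on the passed part of t and a right factor. The right factors that remain
  are the coaction of the remaining product, by \<open>F_coaction\<close>, and this is what \<kappa>
  adds when a letter is prepended.\<close>

lemma F_kap_W:
  "n \<ge> 1 \<Longrightarrow> set s \<subseteq> V \<Longrightarrow> length s = i \<Longrightarrow> set t \<subseteq> V \<Longrightarrow> length t = j \<Longrightarrow>
    F n i j (tmult es (\<kappa> s) (\<kappa> t)) = K (W n i j (pure ms (s @ t)))"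
proof (induction n arbitrary: i j s t rule: dec_induct)
  case base
  then have "tmult es (\<kappa> s) (\<kappa> t) \<in> D i j" "pure ms (s @ t) \<in> T (i + j)"
    using D_tmult[OF kap_cotensor kap_cotensor, of s t] by (auto intro!: tpow_pure)
  then show ?case using base by (simp add: F_1 W_1 rb_pure K_pure kap_kk kk_single)
next
  case (step n)
  note s = step.prems(1,2) and t = step.prems(3,4)
  have "K (W (Suc n) i j (pure ms (s @ t))) = (\<Sum>p\<le>i. \<Sum>q\<le>j. \<Sum>(x, r)\<leftarrow>dc (drop p s).
    K (tmult ms (pure ms [rb p q (tmult ms (pure ms (take p s)) (AD.da (take q t) x))]) (W n (i - p) (j - q) (pure ms (r @ drop q t)))))"
    unfolding W_Suc[OF step.hyps(1) s t] by (simp only: lin_sum[OF lin_tbind[OF lin_id]] tbind_sum_list2)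
  also have "\<dots> = (\<Sum>p\<le>i. \<Sum>q\<le>j. \<Sum>(x, u)\<leftarrow>dc (drop p s). \<Sum>(y, v)\<leftarrow>dc (drop q t).
    tmult es (pure es [(0, f p q (tmult es (R x (\<kappa> (take p s))) (R y (\<kappa> (take q t)))))]) (F n (i - p) (j - q) (tmult es (\<kappa> u) (\<kappa> v))))"
  proof (intro sum.cong refl)
    fix p q assume "p \<in> {..i}" "q \<in> {..j}"
    define s1 s2 t1 t2 where st: "s1 = take p s" "s2 = drop p s" "t1 = take q t" "t2 = drop q t"
    have V: "set s1 \<subseteq> V" "set s2 \<subseteq> V" "set t1 \<subseteq> V" "set t2 \<subseteq> V"
      using s(1) t(1) unfolding st by (auto dest: in_set_takeD in_set_dropD)
    have len: "length s1 = p" "length s2 = i - p" "length t1 = q" "length t2 = j - q"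
      using \<open>p \<in> {..i}\<close> \<open>q \<in> {..j}\<close> s(2) t(2) by (auto simp: st)
    obtain N where N: "\<And>v. mlin ms (\<lambda>u. N u v)" "\<And>u. mlin ms (N u)" "\<And>u v. N u v \<in> TT es"
      "\<And>u v. set u \<subseteq> V \<Longrightarrow> length u = i - p \<Longrightarrow> set v \<subseteq> V \<Longrightarrow> length v = j - q \<Longrightarrow> F n (i - p) (j - q) (tmult es (\<kappa> u) (\<kappa> v)) = N u v"
      by (rule F_extension[OF step.hyps(1), of "i - p" "j - q"]) (rule that)
    define m where "m x = rb p q (tmult ms (pure ms s1) (AD.da t1 x))" for x
    have mT: "tmult ms (pure ms s1) (AD.da t1 x) \<in> T (p + q)" for x
      using V len by (intro tpow_tmult tpow_pure da_T)
    have NF: "F n (i - p) (j - q) (tmult es (\<kappa> u) (\<kappa> v)) = N u v"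
      if "(x, u) \<in> set (dc r)" "set r \<subseteq> V" "length r = i - p" "(y, v) \<in> set (dc t2)" for x u r y v
      using dco_V[OF that(1,2)] dco_length[OF that(1)] dco_V[OF that(4) V(4)] dco_length[OF that(4)] that(3) len by (intro N(4)) auto
    have "(\<Sum>(x, u)\<leftarrow>dc s2. \<Sum>(y, v)\<leftarrow>dc t2.
        tmult es (pure es [(0, f p q (tmult es (R x (\<kappa> s1)) (R y (\<kappa> t1))))]) (F n (i - p) (j - q) (tmult es (\<kappa> u) (\<kappa> v))))
      = (\<Sum>(x, u)\<leftarrow>dc s2. \<Sum>(y, v)\<leftarrow>dc t2. \<Sum>(a, b)\<leftarrow>cop H x. tmult es (pure es [(0, ra (m a) (b * y))]) (N u v))"
    proof (rule sum_list_cong2, rule sum_list_cong2)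
      fix x u y v assume "(x, u) \<in> set (dc s2)" "(y, v) \<in> set (dc t2)"
      moreover have "lin ms tscale (\<lambda>m. tmult es (pure es [(0, m)]) (N u v))" by (intro lin_intros)
      ultimately show "tmult es (pure es [(0, f p q (tmult es (R x (\<kappa> s1)) (R y (\<kappa> t1))))]) (F n (i - p) (j - q) (tmult es (\<kappa> u) (\<kappa> v)))
        = (\<Sum>(a, b)\<leftarrow>cop H x. tmult es (pure es [(0, ra (m a) (b * y))]) (N u v))"
        using f_RR[OF V(1) len(1) V(3) len(3), of "\<lambda>m. tmult es (pure es [(0, m)]) (N u v)" x y] NF V(2) len(2)
        by (simp add: m_def)
    qed
    also have "\<dots> = (\<Sum>(x, u)\<leftarrow>dc s2. \<Sum>(a, b)\<leftarrow>cop H x. \<Sum>(y, v)\<leftarrow>dc t2. tmult es (pure es [(0, ra (m a) (b * y))]) (N u v))"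
      by (rule sum_list_cong2, rule sum_list_swap)
    \<comment> \<open>Coassociativity turns the two legs of the coaction of s2 into an iterated
      coaction: x acts on t1 as in the twisted coproduct, and z stays as a right factor, now as the
      coaction of r.\<close>
    also have "\<dots> = (\<Sum>(x, r)\<leftarrow>dc s2. \<Sum>(z, u)\<leftarrow>dc r. \<Sum>(y, v)\<leftarrow>dc t2. tmult es (pure es [(0, ra (m x) (z * y))]) (N u v))"
    proof (rule dco_coassoc)
      show "lin hs tscale (\<lambda>a. \<Sum>(y, v)\<leftarrow>dc t2. tmult es (pure es [(0, ra (m a) (b * y))]) (N u v))"
        "lin hs tscale (\<lambda>b. \<Sum>(y, v)\<leftarrow>dc t2. tmult es (pure es [(0, ra (m a) (b * y))]) (N u v))" for a b u
        unfolding m_def by (intro lin_intros mT TT_intros; clarsimp; intro lin_intros mT TT_intros)+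
      show "mlin ms (\<lambda>u. \<Sum>(y, v)\<leftarrow>dc t2. tmult es (pure es [(0, ra (m a) (b * y))]) (N u v))" for a b
        unfolding mlin_def
        by (intro allI lin_intros; clarsimp; intro lin_intros mlinD[OF N(1)] TT_intros N(3))
    qed
    also have "\<dots> = (\<Sum>(x, r)\<leftarrow>dc s2. K (tmult ms (pure ms [m x]) (W n (i - p) (j - q) (pure ms (r @ t2)))))"
    proof (rule sum_list_cong2)
      fix x r assume r: "(x, r) \<in> set (dc s2)"
      have rV: "set r \<subseteq> V" "length r = i - p" using dco_V[OF r V(2)] dco_length[OF r] len by auto
      have w: "pure ms (r @ t2) \<in> T ((i - p) + (j - q))" using rV V len by (auto intro!: tpow_pure)
      have "W n (i - p) (j - q) (pure ms (r @ t2)) \<in> tpow ms UNIV n"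
        using LM_mem[OF HW.conv_power_LM[OF step.hyps(1)], of "pure ms (r @ t2)" "i - p" "j - q"] w by (simp add: tprod_tpow)
      \<comment> \<open>Prepending the letter m x amounts to absorbing the left coaction of the
        image of the rest, which by induction is a convolution power of \<open>f\<close> on embedded
        words.\<close>
      then have "K (tmult ms (pure ms [m x]) (W n (i - p) (j - q) (pure ms (r @ t2))))
        = tbind (\<delta> (F n (i - p) (j - q) (tmult es (\<kappa> r) (\<kappa> t2)))) (absorb (m x))"
        using K_cons step.hyps(1) step.IH[OF rV V(4) len(4)] by simp
      also have "\<dots> = (\<Sum>(z, u)\<leftarrow>dc r. \<Sum>(y, v)\<leftarrow>dc t2.
          tbind (tmult es (pure es [(z * y, 0)]) (F n (i - p) (j - q) (tmult es (\<kappa> u) (\<kappa> v)))) (absorb (m x)))"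
        unfolding F_coaction[OF step.hyps(1) rV V(4) len(4)] by (simp only: tbind_sum_list2)
      also have "\<dots> = (\<Sum>(z, u)\<leftarrow>dc r. \<Sum>(y, v)\<leftarrow>dc t2. tmult es (pure es [(0, ra (m x) (z * y))]) (N u v))"
        by (rule sum_list_cong2, rule sum_list_cong2) (simp add: NF[OF _ rV] tbind_absorb N(3))
      finally show "(\<Sum>(z, u)\<leftarrow>dc r. \<Sum>(y, v)\<leftarrow>dc t2. tmult es (pure es [(0, ra (m x) (z * y))]) (N u v))
        = K (tmult ms (pure ms [m x]) (W n (i - p) (j - q) (pure ms (r @ t2))))" by simp
    qed
    finally show "(\<Sum>(x, r)\<leftarrow>dc (drop p s).
      K (tmult ms (pure ms [rb p q (tmult ms (pure ms (take p s)) (AD.da (take q t) x))]) (W n (i - p) (j - q) (pure ms (r @ drop q t)))))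
      = (\<Sum>(x, u)\<leftarrow>dc (drop p s). \<Sum>(y, v)\<leftarrow>dc (drop q t).
    tmult es (pure es [(0, f p q (tmult es (R x (\<kappa> (take p s))) (R y (\<kappa> (take q t)))))]) (F n (i - p) (j - q) (tmult es (\<kappa> u) (\<kappa> v))))"
      by (simp only: m_def st)
  qed
  also have "\<dots> = F (Suc n) i j (tmult es (\<kappa> s) (\<kappa> t))"
    by (rule F_Suc_kap[OF step.hyps(1) s t, symmetric])
  finally show ?case by simp
qed

section \<open>The axioms of a quantum multi-brace algebra\<close>

lemma rb_zero:
  assumes "n \<noteq> 1" "t \<in> T n" shows "rb n 0 t = 0" "rb 0 n t = 0"
proof -
  have e: "pure ms [] \<in> T 0" by (auto intro!: tpow_pure)
  have K: "K t \<in> C n" "K (pure ms []) \<in> C 0" by (rule K_cotensor, fact)+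
  show "rb n 0 t = 0"
    using rb_tmult[OF assms(2) e] f_n0[OF assms(1) D_tmult[OF K]] T_TT[OF assms(2)] by simp
  show "rb 0 n t = 0"
    using rb_tmult[OF e assms(2)] f_0n[OF assms(1) D_tmult[OF K(2,1)]] T_TT[OF assms(2)] by simp
qed

lemma rb_unit:
  assumes "v \<in> V" shows "rb 1 0 (pure ms [v]) = v" "rb 0 1 (pure ms [v]) = v"
  using rb_pure[of "[v]" "[]" 1 0] rb_pure[of "[]" "[v]" 0 1] f_10[of v 1] f_01[of 1 v] assms
  by (simp_all add: kap_Nil kap_kk kk_single tmult_pure ra_1 la_1)

text \<open>A value of the restricted map crosses the last \<open>k\<close> factors through its left
  coaction, which by \<open>rb_colinear\<close> is the diagonal coaction of the arguments. This is
  how the arguments cross as a block.\<close>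

lemma rb_braided_left:
  assumes t: "t \<in> T (i + j + k)"
  shows "\<beta> 1 k (tensor_map ms ms (T (i + j)) (\<lambda>t. pure ms [rb i j t]) (T k) id t)
    = tensor_map ms ms (T k) id (T (i + j)) (\<lambda>t. pure ms [rb i j t]) (\<beta> (i + j) k t)"
proof -
  let ?l = "tensor_map ms ms (T (i + j)) (\<lambda>t. pure ms [rb i j t]) (T k) id"
  let ?r = "tensor_map ms ms (T k) id (T (i + j)) (\<lambda>t. pure ms [rb i j t])"
  note l = T_map[OF rb_LM[of i j] LM_id(1)[of "T k"]] and r = T_map[OF LM_id(1)[of "T k"] rb_LM[of i j]]
  have r': "LM (T (i + j + k)) (T (k + 1)) ?r" using r(1) by (simp add: ac_simps)
  show ?thesis
  proof (rule tpow_eqI[OF t vector_space_tscale, of "\<lambda>t. \<beta> 1 k (?l t)" "\<lambda>t. ?r (\<beta> (i + j) k t)"])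
    show "linear_on tscale tscale (T (i + j + k)) (\<lambda>t. \<beta> 1 k (?l t))"
      "linear_on tscale tscale (T (i + j + k)) (\<lambda>t. ?r (\<beta> (i + j) k t))"
      using LM_linear[OF LM_comp[OF block_LM l(1)]] LM_linear[OF LM_comp[OF r' block_LM]] by (simp_all add: comp_def)
    fix v assume "length v = i + j + k" "set v \<subseteq> V"
    then obtain w c where v: "v = w @ c" "set w \<subseteq> V" "set c \<subseteq> V" "length w = i + j" "length c = k"
      using split_word by blast
    have m: "pure ms w \<in> T (i + j)" "pure ms c \<in> T k" using v by (auto intro!: tpow_pure)
    have dcw: "pure ms w' \<in> T (i + j)" if "(x, w') \<in> set (dc w)" for x w'
      using dco_V[OF that v(2)] dco_length[OF that] v(4) by (auto intro!: tpow_pure)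
    have "?l (pure ms v) = pure ms ([rb i j (pure ms w)] @ c)"
      using l(2)[OF m] v(1) by (simp add: tmult_pure)
    then have "\<beta> 1 k (?l (pure ms v)) = (\<Sum>(x, u)\<leftarrow>dc [rb i j (pure ms w)]. tmult ms (AD.da c x) (pure ms u))"
      using block_pure[of "[rb i j (pure ms w)]" c 1 k] v rb_V[OF m(1)] by simp
    also have "\<dots> = (\<Sum>(x, n)\<leftarrow>lc H M (rb i j (pure ms w)). tmult ms (AD.da c x) (pure ms [n]))"
      by (rule dco_single)
    also have "\<dots> = (\<Sum>(x, w')\<leftarrow>dc w. tmult ms (AD.da c x) (pure ms [rb i j (pure ms w')]))"
      by (rule rb_colinear[OF v(2,4)]; intro lin_intros TT_intros)
    also have "\<dots> = (\<Sum>(x, w')\<leftarrow>dc w. ?r (tmult ms (AD.da c x) (pure ms w')))"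
      by (rule sum_list_cong2) (simp add: r(2) dcw da_T[OF v(3,5)])
    also have "\<dots> = ?r (\<Sum>(x, w')\<leftarrow>dc w. tmult ms (AD.da c x) (pure ms w'))"
      by (rule LM_sum_list2[OF r(1) tpow_subspace, symmetric]) (intro tpow_tmult da_T[OF v(3,5)] dcw)
    also have "\<dots> = ?r (\<beta> (i + j) k (pure ms v))"
      using block_pure[OF v(2-5)] v(1) by simp
    finally show "\<beta> 1 k (?l (pure ms v)) = ?r (\<beta> (i + j) k (pure ms v))" .
  qed
qed

text \<open>The block crossing from the left acts on the value by the adjoint action;
  \<open>rb_ad\<close> moves this action to the arguments.\<close>

lemma rb_braided_right:
  assumes t: "t \<in> T (i + j + k)"
  shows "\<beta> i 1 (tensor_map ms ms (T i) id (T (j + k)) (\<lambda>t. pure ms [rb j k t]) t)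
    = tensor_map ms ms (T (j + k)) (\<lambda>t. pure ms [rb j k t]) (T i) id (\<beta> i (j + k) t)"
proof -
  let ?l = "tensor_map ms ms (T i) id (T (j + k)) (\<lambda>t. pure ms [rb j k t])"
  let ?r = "tensor_map ms ms (T (j + k)) (\<lambda>t. pure ms [rb j k t]) (T i) id"
  have t': "t \<in> T (i + (j + k))" using t by (simp add: add.assoc)
  note l = T_map[OF LM_id(1)[of "T i"] rb_LM[of j k]] and r = T_map[OF rb_LM[of j k] LM_id(1)[of "T i"]]
  have r': "LM (T (i + (j + k))) (T (1 + i)) ?r" using r(1) by (simp add: ac_simps)
  show ?thesis
  proof (rule tpow_eqI[OF t' vector_space_tscale, of "\<lambda>t. \<beta> i 1 (?l t)" "\<lambda>t. ?r (\<beta> i (j + k) t)"])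
    show "linear_on tscale tscale (T (i + (j + k))) (\<lambda>t. \<beta> i 1 (?l t))"
      "linear_on tscale tscale (T (i + (j + k))) (\<lambda>t. ?r (\<beta> i (j + k) t))"
      using LM_linear[OF LM_comp[OF block_LM l(1)]] LM_linear[OF LM_comp[OF r' block_LM]] by (simp_all add: comp_def)
    fix v assume "length v = i + (j + k)" "set v \<subseteq> V"
    then obtain a w where v: "v = a @ w" "set a \<subseteq> V" "set w \<subseteq> V" "length a = i" "length w = j + k"
      using split_word by blast
    have m: "pure ms a \<in> T i" "pure ms w \<in> T (j + k)" using v by (auto intro!: tpow_pure)
    have dca: "pure ms u \<in> T i" if "(x, u) \<in> set (dc a)" for x u
      using dco_V[OF that v(2)] dco_length[OF that] v(4) by (auto intro!: tpow_pure)
    have "?l (pure ms v) = pure ms (a @ [rb j k (pure ms w)])"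
      using l(2)[OF m] v(1) by (simp add: tmult_pure)
    then have "\<beta> i 1 (?l (pure ms v)) = (\<Sum>(x, u)\<leftarrow>dc a. tmult ms (AD.da [rb j k (pure ms w)] x) (pure ms u))"
      using block_pure[of a "[rb j k (pure ms w)]" i 1] v rb_V[OF m(2)] by simp
    also have "\<dots> = (\<Sum>(x, u)\<leftarrow>dc a. ?r (tmult ms (AD.da w x) (pure ms u)))"
    proof (rule sum_list_cong2)
      fix x u assume u: "(x, u) \<in> set (dc a)"
      show "tmult ms (AD.da [rb j k (pure ms w)] x) (pure ms u) = ?r (tmult ms (AD.da w x) (pure ms u))"
        unfolding r(2)[OF da_T[OF v(3,5)] dca[OF u]] AD.da_single rb_ad[OF v(3,5)] by simp
    qed
    also have "\<dots> = ?r (\<Sum>(x, u)\<leftarrow>dc a. tmult ms (AD.da w x) (pure ms u))"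
      by (rule LM_sum_list2[OF r(1) tpow_subspace, symmetric]) (intro tpow_tmult da_T[OF v(3,5)] dca)
    also have "\<dots> = ?r (\<beta> i (j + k) (pure ms v))"
      using block_pure[OF v(2-5)] v(1) by simp
    finally show "\<beta> i 1 (?l (pure ms v)) = ?r (\<beta> i (j + k) (pure ms v))" .
  qed
qed

text \<open>Evaluate (MB) on the embedded words a, b, c. The indices are positive, so the terms with
  \<open>g\<close> vanish, and \<open>F_kap_W\<close> replaces the convolution powers of
  \<open>f\<close> by those of the restricted map.\<close>

lemma rb_associative:
  assumes ijk: "i \<ge> 1" "j \<ge> 1" "k \<ge> 1" and t: "t \<in> T (i + j + k)"
  shows "(\<Sum>r=1..i + j. rb r k (tensor_map ms ms (T (i + j)) (W r i j) (T k) id t))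
    = (\<Sum>l=1..j + k. rb i l (tensor_map ms ms (T i) id (T (j + k)) (W l j k) t))"
proof (rule tpow_eqI[OF t vs_m, of "\<lambda>t. \<Sum>r=1..i + j. rb r k (tensor_map ms ms (T (i + j)) (W r i j) (T k) id t)"
    "\<lambda>t. \<Sum>l=1..j + k. rb i l (tensor_map ms ms (T i) id (T (j + k)) (W l j k) t)"])
  have l: "LM (T (i + j + k)) (T (r + k)) (tensor_map ms ms (T (i + j)) (W r i j) (T k) id)" if "r \<ge> 1" for r
    by (rule T_map(1)[OF W_LM[OF that] LM_id(1)])
  have r: "LM (T (i + j + k)) (T (i + l)) (tensor_map ms ms (T i) id (T (j + k)) (W l j k))" if "l \<ge> 1" for l
    using T_map(1)[OF LM_id(1)[of "T i"] W_LM[OF that, of j k]] by (simp add: add.assoc)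
  show "linear_on tscale ms (T (i + j + k)) (\<lambda>t. \<Sum>r=1..i + j. rb r k (tensor_map ms ms (T (i + j)) (W r i j) (T k) id t))"
    by (intro linear_on_sum[OF vs_m] lin_rb LM_linear[OF l] LM_mem[OF l]) auto
  show "linear_on tscale ms (T (i + j + k)) (\<lambda>t. \<Sum>l=1..j + k. rb i l (tensor_map ms ms (T i) id (T (j + k)) (W l j k) t))"
    by (intro linear_on_sum[OF vs_m] lin_rb LM_linear[OF r] LM_mem[OF r]) auto
  fix w assume "length w = i + j + k" "set w \<subseteq> V"
  then obtain ab c where w: "w = ab @ c" "set ab \<subseteq> V" "set c \<subseteq> V" "length ab = i + j" "length c = k"
    using split_word by blast
  obtain a b where ab: "ab = a @ b" "set a \<subseteq> V" "set b \<subseteq> V" "length a = i" "length b = j"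
    by (rule split_word[OF w(2,4)]) (rule that)
  have \<kappa>: "\<kappa> a \<in> C i" "\<kappa> b \<in> C j" "\<kappa> c \<in> C k" using w ab kap_cotensor by auto
  have D: "tmult es (\<kappa> a) (\<kappa> b) \<in> D i j" "tmult es (\<kappa> b) (\<kappa> c) \<in> D j k" by (intro D_tmult \<kappa>)+
  let ?t = "tmult es (tmult es (\<kappa> a) (\<kappa> b)) (\<kappa> c)"
  have t2: "?t = tmult es (\<kappa> a) (tmult es (\<kappa> b) (\<kappa> c))" by (rule tmult_assoc[OF kap_TT])
  have mem: "?t \<in> tprod es (D i j) (C k)" by (intro tprod_tmult D \<kappa>)
  have tl: "tensor_map es es (D i j) G (C k) id ?t = tmult es (G (tmult es (\<kappa> a) (\<kappa> b))) (\<kappa> c)"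
    if "LM (D i j) Z G" "Z \<subseteq> TT es" for G Z
    using tensor_map_tmult[OF hsub_D hsub_cotensor that(1) LM_id(1) that(2) C_sub_TT D(1) \<kappa>(3)] by simp
  have tr: "tensor_map es es (C i) id (D j k) G ?t = tmult es (\<kappa> a) (G (tmult es (\<kappa> b) (\<kappa> c)))"
    if "LM (D j k) Z G" "Z \<subseteq> TT es" for G Z
    unfolding t2 using tensor_map_tmult[OF hsub_cotensor hsub_D LM_id(1) that(1) C_sub_TT that(2) \<kappa>(1) D(2)] by simp
  have hTT: "hpart H M \<subseteq> TT es" using C_sub_TT[of 0] by simp
  have g0: "g1 i j (tmult es (\<kappa> a) (\<kappa> b)) = 0" "g1 j k (tmult es (\<kappa> b) (\<kappa> c)) = 0"
    using g_zero[OF _ D(1)] g_zero[OF _ D(2)] ijk by (simp_all add: hval_def)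
  have p: "pure ms ab \<in> T (i + j)" "pure ms a \<in> T i" "pure ms c \<in> T k" "pure ms (b @ c) \<in> T (j + k)"
    using w ab by (auto intro!: tpow_pure)
  have L: "rb r k (tensor_map ms ms (T (i + j)) (W r i j) (T k) id (pure ms w)) = f r k (tensor_map es es (D i j) (F r i j) (C k) id ?t)"
    if n: "r \<ge> 1" for r
  proof -
    have "tensor_map ms ms (T (i + j)) (W r i j) (T k) id (pure ms w) = tmult ms (W r i j (pure ms ab)) (pure ms c)"
      using T_map(2)[OF W_LM[OF n] LM_id(1) p(1,3)] w(1) by (simp add: tmult_pure)
    then have "rb r k (tensor_map ms ms (T (i + j)) (W r i j) (T k) id (pure ms w)) = f r k (tmult es (K (W r i j (pure ms ab))) (\<kappa> c))"
      using rb_tmult[OF LM_mem[OF W_LM[OF n] p(1)] p(3)] by (simp add: K_pure)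
    then show ?thesis
      using F_kap_W[OF n ab(2,4,3,5)] ab(1) tl[OF F_LM[OF n] tpow_TT] by simp
  qed
  have R: "rb i l (tensor_map ms ms (T i) id (T (j + k)) (W l j k) (pure ms w)) = f i l (tensor_map es es (C i) id (D j k) (F l j k) ?t)"
    if n: "l \<ge> 1" for l
  proof -
    have "tensor_map ms ms (T i) id (T (j + k)) (W l j k) (pure ms w) = tmult ms (pure ms a) (W l j k (pure ms (b @ c)))"
      using T_map(2)[OF LM_id(1) W_LM[OF n] p(2,4)] w(1) ab(1) by (simp add: tmult_pure)
    then have "rb i l (tensor_map ms ms (T i) id (T (j + k)) (W l j k) (pure ms w)) = f i l (tmult es (\<kappa> a) (K (W l j k (pure ms (b @ c)))))"
      using rb_tmult[OF p(2) LM_mem[OF W_LM[OF n] p(4)]] by (simp add: K_pure)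
    then show ?thesis
      using F_kap_W[OF n ab(3,5) w(3,5)] tr[OF F_LM[OF n] tpow_TT] by simp
  qed
  show "(\<Sum>r=1..i + j. rb r k (tensor_map ms ms (T (i + j)) (W r i j) (T k) id (pure ms w)))
    = (\<Sum>l=1..j + k. rb i l (tensor_map ms ms (T i) id (T (j + k)) (W l j k) (pure ms w)))"
    using MB[OF mem] tl[OF g1_LM hTT] tr[OF g1_LM hTT] by (simp add: L R g0)
qed

lemma quantum: "quantum_multi_brace_algebra ms V rb \<sigma>"
  unfolding quantum_multi_brace_algebra_def Let_def
  using braided rb_linear rb_V rb_zero rb_unit rb_braided_left rb_braided_right rb_associative
  by (auto simp: tprod_tpow)

end

theorem theorem2:
  fixes H :: "('k::field_char_0, 'h::ring_1) hopf_data"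
    and M :: "('k, 'h, 'm::ab_group_add) bimodule_data"
    and f :: "('k, 'h \<times> 'm, 'm) bigraded_map"
    and g :: "('k, 'h \<times> 'm, 'h) bigraded_map"
  assumes "hopf_algebra H"
    and "hopf_bimodule H M"
    and "multi_brace_pair H M f g"
  shows "quantum_multi_brace_algebra
           (mscale M) (coinvariants H M) (restricted_brace H M f) (yd_braiding H M) \<and>
         (bij (antipode H) \<longrightarrow>
           bij_betw (yd_braiding H M)
             (tpow (mscale M) (coinvariants H M) 2) (tpow (mscale M) (coinvariants H M) 2))"
proof -
  interpret brace H M f g
    using assms by unfold_locales
  show ?thesis using quantum sig_bij by blast
qed

end
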